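(* Let $(u,\psi)\in L^{6}(\mathbb{R}^3)\times L^{3}(\mathbb{R}^3;\mathbb{C}^4)$, with $u$ real-valued, be a solution in the sense of distributions of the system $$-c_3\Delta u=|\psi|^2u,\qquad \mathcal{D}\psi=|u|^2\psi\qquad\text{on }\mathbb{R}^3,\qquad c_3=6 .$$ Then $u\in C^\infty(\mathbb{R}^3)$ and $\psi\in C^\infty(\mathbb{R}^3;\mathbb{C}^4)$. Moreover, the following complete asymptotic expansions hold. (1) There exist $z_\alpha\in\mathbb{R}$, $\alpha\in\mathbb{N}_0^3$, such that for any $M\in\mathbb{N}$ there is $C_M<\infty$ with $$\left|u(x)-|x|^{-1}\sum_{|\alpha|_1\le M}\frac{x^\alpha}{|x|^{2|\alpha|_1}}z_\alpha\right|\le C_M|x|^{-2-M}\qquad\text{for all }|x|\ge 1 .$$ (2) There exist $\zeta_\alpha\in\mathbb{C}^4$, $\alpha\in\mathbb{N}_0^3$, such that for any $M\in\mathbb{N}$ there is $C_M<\infty$ with $$\left|\psi(x)-|x|^{-2}\,\mathcal{U}(x)\sum_{|\alpha|_1\le M}\frac{x^\alpha}{|x|^{2|\alpha|_1}}\zeta_\alpha\right|\le C_M|x|^{-3-M}\qquad\text{for all }|x|\ge 1 .$$ If in addition $(u,\psi)$ is non-trivial (not identically $(0,0)$), then at least one $z_{\overline\alpha}$ and at least one $\zeta_{\overline\alpha}$ is non-zero.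
   Context: Scalar functions are real-valued. The spinor bundle $\Sigma\mathbb{R}^3$ is identified with the trivial bundle $\mathbb{R}^3\times\mathbb{C}^4$, so spinors are functions $\mathbb{R}^3\to\mathbb{C}^4$, and $|\psi|$ is the pointwise Hermitian norm. Let $\sigma_1,\sigma_2,\sigma_3$ be $2\times2$ Hermitian matrices with $\sigma_j\sigma_k+\sigma_k\sigma_j=2\delta_{j,k}$, and set $\alpha_j=\begin{pmatrix}0&\sigma_j\\ \sigma_j&0\end{pmatrix}$. The Dirac operator is $\mathcal{D}=-i\sum_{j=1}^3\alpha_j\partial_{x_j}$. Put $\boldsymbol\sigma=(\sigma_1,\sigma_2,\sigma_3)$, $x\cdot\boldsymbol\sigma=\sum_j x_j\sigma_j$, and $$\mathcal{U}(x)=\begin{pmatrix}0&-i\frac{x}{|x|}\cdot\boldsymbol\sigma\\ i\frac{x}{|x|}\cdot\boldsymbol\sigma&0\end{pmatrix},\qquad x\in\mathbb{R}^3\setminus\{0\}.$$ For a multi-index $\alpha\in\mathbb{N}_0^3$: $x^\alpha=x_1^{\alpha_1}x_2^{\alpha_2}x_3^{\alpha_3}$ and $|\alpha|_1=|\alpha_1|+|\alpha_2|+|\alpha_3|$. *)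

theory Defs
  imports "HOL-Analysis.Analysis"
begin

subsection \<open>Smooth functions and test functions\<close>

definition partial_deriv ::
    "'n::finite \<Rightarrow> (real^'n \<Rightarrow> 'b::real_normed_vector) \<Rightarrow> real^'n \<Rightarrow> 'b"
  where "partial_deriv j f x = frechet_derivative f (at x) (axis j 1)"

primrec C_k :: "nat \<Rightarrow> (real^'n::finite \<Rightarrow> 'b::real_normed_vector) \<Rightarrow> bool" where
  "C_k 0 f \<longleftrightarrow> continuous_on UNIV f"
| "C_k (Suc k) f \<longleftrightarrow> (\<forall>x. f differentiable (at x)) \<and> (\<forall>j. C_k k (partial_deriv j f))"

definition smooth :: "(real^'n::finite \<Rightarrow> 'b::real_normed_vector) \<Rightarrow> bool"
  where "smooth f \<longleftrightarrow> (\<forall>k. C_k k f)"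

definition test_function :: "(real^'n::finite \<Rightarrow> real) \<Rightarrow> bool"
  where "test_function \<phi> \<longleftrightarrow> smooth \<phi> \<and> compact (closure {x. \<phi> x \<noteq> 0})"

subsection \<open>Lebesgue spaces and distributions\<close>

text \<open>Elements of \<open>L\<^sup>p\<close> are represented by functions; equality in \<open>L\<^sup>p\<close> is equality almost everywhere.\<close>

definition in_Lp :: "nat \<Rightarrow> (real^'n::finite \<Rightarrow> 'b::euclidean_space) \<Rightarrow> bool"
  where "in_Lp p f \<longleftrightarrow>
    f \<in> borel_measurable lebesgue \<and> integrable lebesgue (\<lambda>x. norm (f x) ^ p)"

text \<open>A distribution with values in \<open>'b\<close> is represented by its action on real-valued test
  functions; for complex \<open>'b\<close> this determines its complex-linear extension to complex-valued
  test functions. The values on functions that are not test functions are irrelevant.\<close>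

type_synonym ('n, 'b) distr = "(real^'n \<Rightarrow> real) \<Rightarrow> 'b"

definition regular_distr ::
    "(real^'n::finite \<Rightarrow> 'b::euclidean_space) \<Rightarrow> ('n, 'b) distr"
  where "regular_distr f \<phi> = (LINT x|lebesgue. \<phi> x *\<^sub>R f x)"

definition distr_deriv :: "'n::finite \<Rightarrow> ('n, 'b::real_normed_vector) distr \<Rightarrow> ('n, 'b) distr"
  where "distr_deriv j T \<phi> = - T (partial_deriv j \<phi>)"

definition distr_laplacian :: "('n::finite, 'b::real_normed_vector) distr \<Rightarrow> ('n, 'b) distr"
  where "distr_laplacian T \<phi> = (\<Sum>j\<in>UNIV. distr_deriv j (distr_deriv j T) \<phi>)"

subsection \<open>Dirac matrices\<close>

definition hermitian :: "complex^'n^'n::finite \<Rightarrow> bool"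
  where "hermitian A \<longleftrightarrow> (\<forall>a b. A $ a $ b = cnj (A $ b $ a))"

definition pauli_system :: "(3 \<Rightarrow> complex^2^2) \<Rightarrow> bool"
  where "pauli_system \<sigma> \<longleftrightarrow> (\<forall>j. hermitian (\<sigma> j)) \<and>
    (\<forall>j k. \<sigma> j ** \<sigma> k + \<sigma> k ** \<sigma> j = mat (if j = k then 2 else 0))"

definition off_diag_blocks :: "complex^2^2 \<Rightarrow> complex^2^2 \<Rightarrow> complex^4^4"
  where "off_diag_blocks A B = vector
    [vector [0, 0, A$1$1, A$1$2],
     vector [0, 0, A$2$1, A$2$2],
     vector [B$1$1, B$1$2, 0, 0],
     vector [B$2$1, B$2$2, 0, 0]]"

definition dirac_alpha :: "(3 \<Rightarrow> complex^2^2) \<Rightarrow> 3 \<Rightarrow> complex^4^4"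
  where "dirac_alpha \<sigma> j = off_diag_blocks (\<sigma> j) (\<sigma> j)"

definition distr_dirac :: "(3 \<Rightarrow> complex^2^2) \<Rightarrow> (3, complex^4) distr \<Rightarrow> (3, complex^4) distr"
  where "distr_dirac \<sigma> T \<phi> = - \<i> *s (\<Sum>j\<in>UNIV. dirac_alpha \<sigma> j *v distr_deriv j T \<phi>)"

definition dot_sigma :: "(3 \<Rightarrow> complex^2^2) \<Rightarrow> real^3 \<Rightarrow> complex^2^2"
  where "dot_sigma \<sigma> x = (\<Sum>j\<in>UNIV. (x $ j) *\<^sub>R \<sigma> j)"

definition U_matrix :: "(3 \<Rightarrow> complex^2^2) \<Rightarrow> real^3 \<Rightarrow> complex^4^4"
  where "U_matrix \<sigma> x =
    (let S = dot_sigma \<sigma> (x /\<^sub>R norm x)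
     in off_diag_blocks (\<chi> a b. - \<i> * S $ a $ b) (\<chi> a b. \<i> * S $ a $ b))"

subsection \<open>The coupled system\<close>

definition c3 :: real
  where "c3 = 6"

text \<open>For \<open>u \<in> L\<^sup>6\<close> and \<open>\<psi> \<in> L\<^sup>3\<close>, Hoelder's inequality makes both right-hand sides locally
  integrable, so all the regular distributions below are given by convergent integrals.\<close>

definition distributional_solution ::
    "(3 \<Rightarrow> complex^2^2) \<Rightarrow> (real^3 \<Rightarrow> real) \<Rightarrow> (real^3 \<Rightarrow> complex^4) \<Rightarrow> bool"
  where "distributional_solution \<sigma> u \<psi> \<longleftrightarrow> (\<forall>\<phi>. test_function \<phi> \<longrightarrow>
    - c3 * distr_laplacian (regular_distr u) \<phi>
      = regular_distr (\<lambda>x. (norm (\<psi> x))\<^sup>2 * u x) \<phi> \<and>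
    distr_dirac \<sigma> (regular_distr \<psi>) \<phi>
      = regular_distr (\<lambda>x. \<bar>u x\<bar>\<^sup>2 *\<^sub>R \<psi> x) \<phi>)"

subsection \<open>Multi-indices\<close>

definition mi_order :: "nat^3 \<Rightarrow> nat"
  where "mi_order \<alpha> = (\<Sum>j\<in>UNIV. \<alpha> $ j)"

definition mi_power :: "real^3 \<Rightarrow> nat^3 \<Rightarrow> real"
  where "mi_power x \<alpha> = (\<Prod>j\<in>UNIV. (x $ j) ^ (\<alpha> $ j))"

end

theory Submission
  imports Defs
begin

text \<open>Testing the system with truncated regularised potentials and removing first the truncation, then
the regularisation, turns it into the integral equations \<open>u = c |x|\<^sup>-\<^sup>1 * (|\<psi>|\<^sup>2 u)\<close> and
\<open>\<psi> = c' (\<i> \<alpha> \<cdot> x) |x|\<^sup>-\<^sup>3 * (u\<^sup>2 \<psi>)\<close> almost everywhere. By the Hardy-Littlewood-Sobolev inequality the cubic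
right-hand sides are contractions in \<open>L\<^sup>6 \<times> L\<^sup>3\<close> once the unknown is only varied on a small ball.

Solutions are real analytic, without any bootstrap: move the ball by \<open>\<Phi>\<^sub>t(y) = y + \<theta>(y) t\<close> with a tent function
\<open>\<theta>\<close>. The moved solution solves the moved equations, whose kernels are absolutely convergent power
series in \<open>t\<close>, that is, elements of a commutative Banach algebra. The same contraction argument with values in
this algebra yields a power series whose value at each small \<open>t\<close> is \<open>(u, \<psi>) \<circ> \<Phi>\<^sub>t\<close>; by Fubini,
\<open>t \<mapsto> (u, \<psi>)(x + \<theta>(x) t)\<close> is a power series for almost every \<open>x\<close>.

The Kelvin transform \<open>u(x/|x|\<^sup>2)/|x|\<close>, \<open>|x|\<^sup>-\<^sup>2 U(x) \<psi>(x/|x|\<^sup>2)\<close> preserves the integral equations. Hence the transformed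
pair is analytic at \<open>0\<close>, and its Taylor expansion there is the asserted expansion at infinity. If all
coefficients of one component vanish, so does this component by unique continuation, and then the
other one by its integral equation.\<close>

section \<open>The Hardy-Littlewood-Sobolev inequality at the critical exponents\<close>

text \<open>The exponents are scale invariant: inserting the integral equations into each other
  gains no integrability, and the norms of \<open>u\<close> and \<open>\<psi>\<close> do not shrink
  under scaling. The only smallness available is absolute continuity of the integral, which is why
  the contraction is confined to a ball. The flow therefore has to map this ball onto itself and
  must leave the data outside independent of the parameter. The slope of the tent is at most 2 on
  every ball, so moved and original distances are comparable with absolute constants: the
  singularities of the kernels keep their orders, and the admissible range of parameters does not
  depend on the radius. To make sense in an algebra of power series the nonlinearities must be
  polynomial; hence spinors are written in real coordinates, where the squared norm is a sum of
  squares. Contraction constants are arranged to agree for the scalar, the algebra-valued and the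
  moved system, so that one choice of the small size \<open>\<epsilon>\<close> serves all three.
  Convergence is taken almost everywhere with geometric rates, so that iterates and their limits can
  be evaluated point by point.\<close>

abbreviation borel_fun :: "('a::topological_space \<Rightarrow> 'b::topological_space) set"
 where "borel_fun \<equiv> borel_measurable borel"

abbreviation sqd :: "real^3 \<Rightarrow> real^3 \<Rightarrow> real"
 where "sqd a x \<equiv> (x - a) \<bullet> (x - a)"

text \<open>Wherever \<open>f\<close> is non-zero it lies below one of the step functions of height
  \<open>a n\<close> on the ball of radius \<open>r n\<close>, hence below their sum. Ball volumes
  grow like the cube of the radius, which gives the summability condition. Growing radii treat decay
  at infinity, shrinking radii a singularity at 0.\<close>

lemma nn_integral_dyadic_finite:
 fixes a :: "nat \<Rightarrow> real" and r :: "nat \<Rightarrow> real"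
 assumes "\<And>n. 0 \<le> a n" "\<And>n. 0 \<le> r n" "summable (\<lambda>n. a n * r n ^ 3)"
  and le: "\<And>x::real^3. x \<noteq> 0 \<Longrightarrow> f x \<noteq> 0 \<Longrightarrow> \<exists>n. norm x \<le> r n \<and> f x \<le> ennreal (a n)"
 shows "(\<integral>\<^sup>+x. f x \<partial>lborel) < \<infinity>"
proof -
 have "(\<integral>\<^sup>+x. f x \<partial>lborel) \<le> (\<integral>\<^sup>+x. (\<Sum>n. ennreal (a n) * indicator (cball (0::real^3) (r n)) x) \<partial>lborel)"
 proof (rule nn_integral_mono_AE)
  have "AE x in lborel. x \<noteq> (0::real^3)"
   by (rule AE_lborel_singleton)
  then show "AE x in lborel. f x \<le> (\<Sum>n. ennreal (a n) * indicator (cball (0::real^3) (r n)) x)"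
  proof eventually_elim
   case (elim x)
   show ?case
   proof (cases "f x = 0")
    case False
    then obtain n where n: "norm x \<le> r n" "f x \<le> ennreal (a n)"
     using le elim by blast
    have "f x \<le> ennreal (a n) * indicator (cball (0::real^3) (r n)) x"
     using n by (simp add: indicator_def)
    also have "\<dots> = (\<Sum>k\<in>{n}. ennreal (a k) * indicator (cball (0::real^3) (r k)) x)"
     by (simp only: sum.insert finite.emptyI empty_iff not_False_eq_True sum.empty add_0_right)
    also have "\<dots> \<le> (\<Sum>n. ennreal (a n) * indicator (cball (0::real^3) (r n)) x)"
     by (rule sum_le_suminf) auto
    finally show ?thesis .
   qed simp
  qed
 qed
 also have "\<dots> = (\<Sum>n. \<integral>\<^sup>+x. ennreal (a n) * indicator (cball (0::real^3) (r n)) x \<partial>lborel)"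
  by (intro nn_integral_suminf borel_measurable_times_ennreal borel_measurable_indicator) auto
 also have "\<dots> = (\<Sum>n. ennreal (unit_ball_vol 3 * (a n * r n ^ 3)))"
  using assms
  by (intro suminf_cong)
    (simp add: nn_integral_cmult_indicator emeasure_cball ennreal_mult[symmetric] mult_ac)
 also have "\<dots> < \<infinity>"
  using assms by (subst suminf_ennreal2) (auto intro!: summable_mult mult_nonneg_nonneg)
 finally show ?thesis .
qed

section \<open>Integrability of powers of the distance\<close>

lemma powr_neg_eq_inverse_power: "0 < a \<Longrightarrow> a powr (- real k) = inverse (a ^ k)"
 by (simp add: powr_minus powr_realpow)

text \<open>On the shell \<open>2^n \<le> 1 + norm x < 2^(n+1)\<close> the integrand is at most
  \<open>(2 powr (- p))^n\<close>, while the volume is of order \<open>8^n\<close>. The resulting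
  series is geometric with ratio \<open>2 powr (3 - p)\<close>, below 1.\<close>

lemma nn_integral_decay_finite:
 fixes p :: real
 assumes "p > 3"
 shows "(\<integral>\<^sup>+(x::real^3). ennreal ((1 + norm x) powr (- p)) \<partial>lborel) < \<infinity>"
proof (rule nn_integral_dyadic_finite[where a = "\<lambda>n. (2 powr (- p)) ^ n" and r = "\<lambda>n. 2 ^ (n + 1)"])
 have *: "(2 powr (- p)) ^ n * (2 ^ (n + 1)) ^ 3 = 8 * (2 powr (3 - p)) ^ n" for n :: nat
 proof -
  have "(2::real) powr (3 - p) = 2 powr (- p) * 8"
   by (simp add: powr_diff powr_minus field_simps)
  then have "(2 powr (3 - p)) ^ n = (2 powr (- p)) ^ n * (8::real) ^ n"
   by (simp add: power_mult_distrib)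
  moreover have "((2::real) ^ (n + 1)) ^ 3 = 8 * 8 ^ n"
   by (simp add: power_mult_distrib flip: power_mult) (simp add: power_mult mult.commute[of n])
  ultimately show ?thesis by simp
 qed
 have "2 powr (3 - p) < (1::real)"
  using assms by (simp add: powr_less_one)
 then show "summable (\<lambda>n. (2 powr (- p)) ^ n * ((2::real) ^ (n + 1)) ^ 3)"
  unfolding * by (intro summable_mult summable_geometric) simp
next
 fix x :: "real^3"
 define n where "n = nat \<lfloor>log 2 (1 + norm x)\<rfloor>"
 have l0: "0 \<le> log 2 (1 + norm x)" by (subst zero_le_log_cancel_iff) (auto intro: add_pos_nonneg)
 have n1: "real n \<le> log 2 (1 + norm x)" and n2: "log 2 (1 + norm x) < real n + 1"
  using l0 unfolding n_def by linarith+
 have "1 + norm x < 2 powr (real n + 1)"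
  using n2 by (subst (asm) log_less_iff) (auto intro: add_pos_nonneg)
 then have 1: "1 + norm x < 2 ^ (n + 1)"
  using powr_realpow[of 2 "n+1"] by (simp add: add.commute)
 have 2: "2 powr real n \<le> 1 + norm x"
  using n1 by (subst (asm) le_log_iff) (auto intro: add_pos_nonneg)
 have "(1 + norm x) powr (- p) \<le> (2 powr real n) powr (- p)"
  using 2 assms by (intro powr_mono2') auto
 also have "\<dots> = (2 powr (- p)) ^ n"
  by (simp add: powr_powr mult.commute powr_realpow[symmetric])
 finally show "\<exists>n. norm x \<le> 2 ^ (n + 1) \<and> ennreal ((1 + norm x) powr (- p)) \<le> ennreal ((2 powr (- p)) ^ n)"
  using 1 by (intro exI[of _ n] conjI ennreal_leI) auto
qed auto

lemma nn_integral_singular_finite: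
 assumes "l < 3"
 shows "(\<integral>\<^sup>+(x::real^3). ennreal (indicator (cball 0 1) x / norm x ^ l) \<partial>lborel) < \<infinity>"
proof (rule nn_integral_dyadic_finite[where a = "\<lambda>n. 2 ^ (l * (n + 1))" and r = "\<lambda>n. 1 / 2 ^ n"])
 have *: "2 ^ (l * (n + 1)) * (1 / 2 ^ n) ^ 3 = (2::real) ^ l * (2 ^ l / 8) ^ n" for n :: nat
 proof -
  have "((2::real) ^ n) ^ 3 = 8 ^ n"
   by (subst power_mult[symmetric], subst mult.commute, subst power_mult) simp
  then show ?thesis
   by (simp add: power_divide power_add power_mult)
 qed
 have "(2::real) ^ l < 2 ^ 3"
  by (rule power_strict_increasing) (use assms in auto)
 then show "summable (\<lambda>n. 2 ^ (l * (n + 1)) * (1 / (2::real) ^ n) ^ 3)"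
  unfolding * by (intro summable_mult summable_geometric) simp
next
 fix x :: "real^3" assume x: "x \<noteq> 0" and nz: "ennreal (indicator (cball 0 1) x / norm x ^ l) \<noteq> 0"
 then have x1: "norm x \<le> 1" by (auto simp: indicator_def split: if_splits)
 define n where "n = nat \<lfloor>log 2 (1 / norm x)\<rfloor>"
 have l0: "0 \<le> log 2 (1 / norm x)" using x x1 by simp
 have n1: "real n \<le> log 2 (1 / norm x)" and n2: "log 2 (1 / norm x) < real n + 1"
  using l0 unfolding n_def by linarith+
 have "1 / norm x < 2 powr (real n + 1)"
  using n2 x by (subst (asm) log_less_iff) auto
 then have 1: "1 / norm x \<le> 2 ^ (n + 1)"
  using powr_realpow[of 2 "n+1"] by (simp add: add.commute)
 have "2 powr real n \<le> 1 / norm x"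
  using n1 x by (subst (asm) le_log_iff) auto
 then have 2: "norm x \<le> 1 / 2 ^ n"
  using x by (simp add: powr_realpow field_simps)
 have "indicator (cball 0 1) x / norm x ^ l \<le> (1 / norm x) ^ l"
  by (simp add: indicator_def power_divide)
 also have "\<dots> \<le> (2 ^ (n + 1)) ^ l"
  using 1 by (intro power_mono) auto
 also have "\<dots> = 2 ^ (l * (n + 1))"
  by (simp add: power_add mult.commute flip: power_mult)
 finally show "\<exists>n. norm x \<le> 1 / 2 ^ n \<and> ennreal (indicator (cball 0 1) x / norm x ^ l) \<le> ennreal (2 ^ (l * (n + 1)))"
  using 2 by (intro exI[of _ n] conjI ennreal_leI) auto
qed auto

lemma nn_integral_lborel_affine:
 fixes f :: "'a::euclidean_space \<Rightarrow> ennreal"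
 assumes [measurable]: "f \<in> borel_fun" and "c \<noteq> 0"
 shows "(\<integral>\<^sup>+x. f x \<partial>lborel) = ennreal (\<bar>c\<bar> ^ DIM('a)) * (\<integral>\<^sup>+x. f (t + c *\<^sub>R x) \<partial>lborel)"
 by (subst lborel_affine[OF assms(2), of t])
   (simp add: nn_integral_density nn_integral_distr nn_integral_cmult)

text \<open>This is \<open>hls_near l 1\<close> as a function of position, the shape to which every
  \<open>hls_near l a\<close> is reduced by the substitution \<open>y = x + z / a^2\<close>. It
  behaves like \<open>|z|^-l\<close> near 0 and like \<open>|z|^-6\<close> at infinity.\<close>

definition hls_kernel :: "nat \<Rightarrow> real^3 \<Rightarrow> real"
 where "hls_kernel l z = (min 1 (1 / norm z)) ^ (6 - l) / norm z ^ l"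

definition hls_const :: "nat \<Rightarrow> real"
 where "hls_const l = enn2real (\<integral>\<^sup>+z. ennreal (hls_kernel l z) \<partial>lborel)"

lemma hls_kernel_measurable [measurable]: "hls_kernel l \<in> borel_fun"
 unfolding hls_kernel_def by measurable

lemma hls_kernel_nonneg [simp]: "0 \<le> hls_kernel l z"
 unfolding hls_kernel_def by (intro divide_nonneg_nonneg zero_le_power) auto

lemma hls_const:
 assumes "l < 3"
 shows "(\<integral>\<^sup>+z. ennreal (hls_kernel l z) \<partial>lborel) = ennreal (hls_const l)"
proof -
 have "(\<integral>\<^sup>+z. ennreal (hls_kernel l z) \<partial>lborel) \<le>
   (\<integral>\<^sup>+(z::real^3). ennreal (indicator (cball 0 1) z / norm z ^ l) + ennreal (64 * (1 + norm z) powr (- real 6)) \<partial>lborel)"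
 proof (rule nn_integral_mono)
  fix z :: "real^3"
  have "hls_kernel l z \<le> indicator (cball 0 1) z / norm z ^ l + 64 * (1 + norm z) powr (- real 6)"
  proof (cases "norm z \<le> 1")
   case True
   have "(min 1 (1 / norm z)) ^ (6 - l) \<le> 1"
    by (intro power_le_one) auto
   then have "hls_kernel l z \<le> 1 / norm z ^ l"
    unfolding hls_kernel_def by (intro divide_right_mono) auto
   then show ?thesis using True by (simp add: indicator_def add_increasing2)
  next
   case False
   have "min 1 (1 / norm z) = 1 / norm z"
    using False by (intro min_absorb2) (auto simp: divide_simps)
   then have "hls_kernel l z = (1 / norm z) ^ (6 - l) / norm z ^ l"
    by (simp only: hls_kernel_def)
   also have "\<dots> = 1 / (norm z ^ (6 - l) * norm z ^ l)"
    by (simp add: power_divide)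
   also have "norm z ^ (6 - l) * norm z ^ l = norm z ^ 6"
    using assms by (simp flip: power_add)
   \<comment> \<open>Outside the unit ball \<open>1 + norm z \<le> 2 * norm z\<close>, hence the
     factor \<open>2^6 = 64\<close>.\<close>
   also have "1 / norm z ^ 6 = 64 * inverse ((2 * norm z) ^ 6)"
    by (simp add: power_mult_distrib field_simps)
   also have "\<dots> \<le> 64 * inverse ((1 + norm z) ^ 6)"
   proof -
    have "inverse ((2 * norm z) ^ 6) \<le> inverse ((1 + norm z) ^ 6)"
     using False by (intro le_imp_inverse_le power_mono zero_less_power) linarith+
    then show ?thesis by linarith
   qed
   also have "\<dots> = 64 * (1 + norm z) powr (- real 6)"
    by (subst powr_neg_eq_inverse_power) (auto intro: add_pos_nonneg)
   finally show ?thesis using False by (simp add: indicator_def)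
  qed
  then show "ennreal (hls_kernel l z) \<le> ennreal (indicator (cball 0 1) z / norm z ^ l) + ennreal (64 * (1 + norm z) powr (- real 6))"
   by (subst ennreal_plus[symmetric]) (auto intro!: ennreal_leI simp del: ennreal_plus)
 qed
 also have "\<dots> = (\<integral>\<^sup>+z. ennreal (indicator (cball 0 1) (z::real^3) / norm z ^ l) \<partial>lborel)
   + ennreal 64 * (\<integral>\<^sup>+(z::real^3). ennreal ((1 + norm z) powr (- real 6)) \<partial>lborel)"
  by (subst nn_integral_add)
    (auto simp: ennreal_mult nn_integral_cmult intro!: measurable_compose[OF _ measurable_ennreal] borel_measurable_divide borel_measurable_indicator)
 also have "\<dots> < \<infinity>"
  using nn_integral_singular_finite[OF assms] nn_integral_decay_finite[of "real 6"]
  by (simp add: ennreal_mult_less_top)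
 finally show ?thesis
  unfolding hls_const_def by (simp add: less_top)
qed

lemma hls_const_nonneg [simp]: "0 \<le> hls_const l"
 by (simp add: hls_const_def)

text \<open>Bound for the kernel with values \<open>a \<ge> b\<close> at distance \<open>d\<close>
  in the region \<open>d * a * b < 1\<close>: there \<open>b\<close> is at most both
  \<open>a\<close> and \<open>1 / (a * d)\<close>, so that only the larger value is left.\<close>

definition hls_near :: "nat \<Rightarrow> real \<Rightarrow> real \<Rightarrow> real"
 where "hls_near l a d = a ^ (6 - l) * (min a (1 / (a * d))) ^ (6 - l) / d ^ l"

lemma hls_near_nonneg: "0 \<le> a \<Longrightarrow> 0 \<le> d \<Longrightarrow> 0 \<le> hls_near l a d"
 unfolding hls_near_def by (intro divide_nonneg_nonneg mult_nonneg_nonneg zero_le_power) auto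

text \<open>The splitting behind the inequality. If \<open>d * a * b \<ge> 1\<close>, then
  \<open>1 / d^l\<close> is at most \<open>(a * b)^l\<close> and the variables separate. Otherwise
  the smaller value is controlled by the larger one and the distance.\<close>

lemma hls_pointwise:
 fixes a b d :: real
 assumes "0 \<le> a" "0 \<le> b" "0 \<le> d" "1 \<le> l" "l \<le> 6"
 shows "a ^ (6 - l) * b ^ (6 - l) / d ^ l \<le> a ^ 6 * b ^ 6 + hls_near l a d + hls_near l b d"
proof -
 have near: "a ^ (6 - l) * b ^ (6 - l) / d ^ l \<le> hls_near l a d"
  if "b \<le> a" "d * a * b < 1" "0 \<le> a" "0 \<le> b" "0 < d" for a b
 proof (cases "a = 0")
  case True
  then show ?thesis using that hls_near_nonneg[of 0 d l] by (cases "6 - l") (auto simp: hls_near_def)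
 next
  case False
  with that have "b \<le> min a (1 / (a * d))"
   by (simp add: field_simps)
  then show ?thesis
   unfolding hls_near_def using that
   by (intro divide_right_mono mult_left_mono power_mono) auto
 qed
 have n: "0 \<le> hls_near l a d" "0 \<le> hls_near l b d"
  using assms by (auto intro: hls_near_nonneg)
 consider "d = 0" | "d > 0" "d * a * b \<ge> 1" | "d > 0" "d * a * b < 1"
  using assms by linarith
 then show ?thesis
 proof cases
  case 1
  then show ?thesis using assms n by (auto simp: power_0_left)
 next
  case 2
  have "1 / d \<le> a * b" using 2 by (simp add: field_simps)
  then have "(1 / d) ^ l \<le> (a * b) ^ l" using 2 by (intro power_mono) auto
  then have "a ^ (6 - l) * b ^ (6 - l) * (1 / d) ^ l \<le> a ^ (6 - l) * b ^ (6 - l) * (a * b) ^ l"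
   using assms by (intro mult_left_mono) auto
  also have "\<dots> = (a ^ (6 - l) * a ^ l) * (b ^ (6 - l) * b ^ l)"
   by (simp add: power_mult_distrib)
  also have "\<dots> = a ^ 6 * b ^ 6"
   using assms by (simp flip: power_add)
  finally show ?thesis using n by (simp add: power_divide)
 next
  case 3
  show ?thesis
  proof (cases "b \<le> a")
   case True
   then show ?thesis using near[of b a] 3 assms n
    by (smt (verit) mult_nonneg_nonneg zero_le_power)
  next
   case False
   then show ?thesis using near[of a b] 3 assms n
    by (smt (verit) mult_nonneg_nonneg zero_le_power mult.commute mult.left_commute)
  qed
 qed
qed

text \<open>Scaling by \<open>a^2\<close> takes \<open>a^12\<close> out of the integrand and
  \<open>a^-6\<close> out of the volume. What remains is proportional to \<open>a^6\<close>, which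
  is integrable when \<open>a\<close> is a value of a function in \<open>L^6\<close>.\<close>

lemma nn_integral_hls_near:
 fixes x :: "real^3"
 assumes "0 \<le> a" "l < 3" "1 \<le> l"
 shows "(\<integral>\<^sup>+y. ennreal (hls_near l a (dist x y)) \<partial>lborel) = ennreal (hls_const l * a ^ 6)"
proof (cases "a = 0")
 case True
 then show ?thesis using assms by (simp add: hls_near_def power_0_left)
next
 case False
 then have a: "a > 0" using assms by simp
 have [measurable]: "(\<lambda>y::real^3. ennreal (hls_near l a (dist x y))) \<in> borel_fun"
  unfolding hls_near_def by measurable
 have *: "hls_near l a (norm z / a\<^sup>2) = a ^ 12 * hls_kernel l z" for z :: "real^3"
 proof -
  have "min a (1 / (a * (norm z / a\<^sup>2))) = a * min 1 (1 / norm z)"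
  proof -
   have "1 / (a * (norm z / a\<^sup>2)) = a * (1 / norm z)"
    using a by (simp add: power2_eq_square)
   then show ?thesis
    using a by (simp only: min_mult_distrib_left) simp
  qed
  then have "hls_near l a (norm z / a\<^sup>2) =
    (a ^ (6 - l) * a ^ (6 - l) * (a\<^sup>2) ^ l) * hls_kernel l z"
   by (simp add: hls_near_def hls_kernel_def power_mult_distrib power_divide)
  also have "a ^ (6 - l) * a ^ (6 - l) * (a\<^sup>2) ^ l = a ^ 12"
   using assms by (simp flip: power_add power_mult)
  finally show ?thesis .
 qed
 have "(\<integral>\<^sup>+y. ennreal (hls_near l a (dist x y)) \<partial>lborel) =
   ennreal (\<bar>1 / a\<^sup>2\<bar> ^ 3) * (\<integral>\<^sup>+z. ennreal (hls_near l a (dist x (x + (1 / a\<^sup>2) *\<^sub>R z))) \<partial>lborel)"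
  using a by (subst nn_integral_lborel_affine[where c = "1 / a\<^sup>2" and t = x]) auto
 also have "(\<lambda>z. hls_near l a (dist x (x + (1 / a\<^sup>2) *\<^sub>R z))) = (\<lambda>z. a ^ 12 * hls_kernel l z)"
  by (simp add: dist_norm flip: *)
 also have "(\<integral>\<^sup>+z. ennreal (a ^ 12 * hls_kernel l z) \<partial>lborel) = ennreal (a ^ 12 * hls_const l)"
  using a assms by (simp add: ennreal_mult nn_integral_cmult hls_const)
 also have "ennreal (\<bar>1 / a\<^sup>2\<bar> ^ 3) * ennreal (a ^ 12 * hls_const l) = ennreal (hls_const l * a ^ 6)"
 proof -
  have "\<bar>1 / a\<^sup>2\<bar> ^ 3 * (a ^ 12 * hls_const l) = hls_const l * a ^ 6"
   using a by (simp add: power_divide field_simps flip: power_mult power_add)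
  then show ?thesis using a by (subst ennreal_mult[symmetric]) auto
 qed
 finally show ?thesis .
qed

text \<open>The diagonal case of the inequality, both functions being the power \<open>6 - l\<close>
  of one function in \<open>L^6\<close>. The bound is not homogeneous in \<open>B\<close>;
  \<open>riesz_bound\<close> restores homogeneity by normalising first.\<close>

lemma hls_diagonal:
 fixes s :: "real^3 \<Rightarrow> real"
 assumes [measurable]: "s \<in> borel_fun" and s: "\<And>x. 0 \<le> s x"
  and B: "(\<integral>\<^sup>+x. ennreal (s x ^ 6) \<partial>lborel) \<le> ennreal B" "0 \<le> B" and l: "1 \<le> l" "l < 3"
 shows "(\<integral>\<^sup>+x. \<integral>\<^sup>+y. ennreal (s x ^ (6 - l) * s y ^ (6 - l) / dist x y ^ l) \<partial>lborel \<partial>lborel)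
  \<le> ennreal (B\<^sup>2 + 2 * hls_const l * B)"
proof -
 define I where "I = (\<integral>\<^sup>+x. ennreal (s x ^ 6) \<partial>lborel)"
 have [measurable]: "(\<lambda>(x, y). ennreal (hls_near l (s x) (dist x y))) \<in> borel_measurable (borel \<Otimes>\<^sub>M borel)"
  "(\<lambda>(x, y). ennreal (hls_near l (s y) (dist x y))) \<in> borel_measurable (borel \<Otimes>\<^sub>M borel)"
  unfolding hls_near_def by measurable
 have "(\<integral>\<^sup>+x. \<integral>\<^sup>+y. ennreal (s x ^ (6 - l) * s y ^ (6 - l) / dist x y ^ l) \<partial>lborel \<partial>lborel)
   \<le> (\<integral>\<^sup>+x. \<integral>\<^sup>+y. ennreal (s x ^ 6) * ennreal (s y ^ 6) + (ennreal (hls_near l (s x) (dist x y))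
     + ennreal (hls_near l (s y) (dist x y))) \<partial>lborel \<partial>lborel)"
  using hls_pointwise[OF s s zero_le_dist, of l] l s
  by (intro nn_integral_mono)
    (auto simp: ennreal_mult[symmetric] ennreal_plus[symmetric] hls_near_nonneg add.assoc
       intro!: ennreal_leI simp del: ennreal_plus)
 also have "\<dots> = (\<integral>\<^sup>+x. \<integral>\<^sup>+y. ennreal (s x ^ 6) * ennreal (s y ^ 6) \<partial>lborel \<partial>lborel)
   + ((\<integral>\<^sup>+x. \<integral>\<^sup>+y. ennreal (hls_near l (s x) (dist x y)) \<partial>lborel \<partial>lborel)
    + (\<integral>\<^sup>+x. \<integral>\<^sup>+y. ennreal (hls_near l (s y) (dist x y)) \<partial>lborel \<partial>lborel))"
  by (simp add: nn_integral_add)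
 also have "(\<integral>\<^sup>+x. \<integral>\<^sup>+y. ennreal (s x ^ 6) * ennreal (s y ^ 6) \<partial>lborel \<partial>lborel) = I * I"
  by (simp add: nn_integral_cmult nn_integral_multc I_def)
 also have "(\<integral>\<^sup>+x. \<integral>\<^sup>+y. ennreal (hls_near l (s x) (dist x y)) \<partial>lborel \<partial>lborel) = ennreal (hls_const l) * I"
  using s l by (simp add: nn_integral_hls_near ennreal_mult nn_integral_cmult I_def)
 also have "(\<integral>\<^sup>+x. \<integral>\<^sup>+y. ennreal (hls_near l (s y) (dist x y)) \<partial>lborel \<partial>lborel) = ennreal (hls_const l) * I"
  using s l by (subst lborel_pair.Fubini') 
   (simp_all add: dist_commute[of _ y for y] nn_integral_hls_near ennreal_mult nn_integral_cmult I_def)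
 also have "I * I + (ennreal (hls_const l) * I + ennreal (hls_const l) * I) \<le>
   ennreal B * ennreal B + (ennreal (hls_const l) * ennreal B + ennreal (hls_const l) * ennreal B)"
  using B(1) unfolding I_def by (intro add_mono mult_mono) auto
 also have "\<dots> = ennreal (B\<^sup>2 + 2 * hls_const l * B)"
  using B(2) by (simp add: ennreal_mult[symmetric] ennreal_plus[symmetric] power2_eq_square del: ennreal_plus)
 finally show ?thesis .
qed

section \<open>Riesz potentials at the critical exponents\<close>

declare borel_closed[OF closed_cball, measurable]

definition riesz :: "nat \<Rightarrow> (real^3 \<Rightarrow> ennreal) \<Rightarrow> real^3 \<Rightarrow> ennreal"
 where "riesz l f x = (\<integral>\<^sup>+y. f y * ennreal (1 / dist x y ^ l) \<partial>lborel)"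

lemma riesz_measurable [measurable]:
 assumes [measurable]: "f \<in> borel_fun"
 shows "riesz l f \<in> borel_fun"
 unfolding riesz_def by measurable

lemma nn_integral_bounded_support_finite:
 fixes f :: "real^3 \<Rightarrow> real"
 assumes "\<And>x. f x \<le> B * indicator (cball 0 r) x" "0 \<le> B"
 shows "(\<integral>\<^sup>+x. ennreal (f x) \<partial>lborel) < \<infinity>"
proof -
 have "(\<integral>\<^sup>+x. ennreal (f x) \<partial>lborel) \<le> (\<integral>\<^sup>+x. ennreal B * indicator (cball (0::real^3) r) x \<partial>lborel)"
 proof (rule nn_integral_mono)
  fix x
  show "ennreal (f x) \<le> ennreal B * indicator (cball 0 r) x"
   using assms(1)[of x] by (cases "x \<in> cball 0 r") (auto simp: ennreal_leI ennreal_neg)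
 qed
 also have "\<dots> = ennreal B * emeasure lborel (cball (0::real^3) r)"
  by (rule nn_integral_cmult_indicator) simp
 also have "\<dots> < \<infinity>"
  using emeasure_lborel_cball_finite[of "0::real^3" r] by (simp add: ennreal_mult_less_top)
 finally show ?thesis .
qed

text \<open>The bound is dual to \<open>hls_diagonal\<close>: pair \<open>riesz l f\<close> with the power \<open>6 - l\<close> of
 (a truncation of) its own \<open>l\<close>-th root.\<close>

lemma riesz_bound:
 fixes s :: "real^3 \<Rightarrow> real" and f :: "real^3 \<Rightarrow> ennreal"
 assumes [measurable]: "s \<in> borel_fun" "f \<in> borel_fun"
  and s: "\<And>x. 0 \<le> s x" "(\<integral>\<^sup>+x. ennreal (s x ^ 6) \<partial>lborel) \<le> 4"
  and f: "\<And>x. f x \<le> ennreal (s x ^ (6 - l))" and l: "1 \<le> l" "l < 3" and m: "m * l = 6"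
 shows "(\<integral>\<^sup>+x. riesz l f x ^ m \<partial>lborel) \<le> ennreal ((25 + 10 * hls_const l) ^ m)"
proof -
 define C where "C = 25 + 10 * hls_const l"
 have C: "C > 0" by (simp add: C_def add_pos_nonneg)
 have m0: "m > 0" using m by (cases m) auto
 \<comment> \<open>Truncation in height and in space makes the integral of \<open>g n ^ m\<close>
   finite, so that one may divide by it. The bound obtained is uniform in \<open>n\<close> and
   survives monotone convergence.\<close>
 define g where "g n x = enn2real (min (riesz l f x) (ennreal (real n))) * indicator (cball 0 (real n)) x" for n and x :: "real^3"
 have [measurable]: "g n \<in> borel_fun" for n
  unfolding g_def by measurable
 have g0: "0 \<le> g n x" for n x by (simp add: g_def)
 have gle: "ennreal (g n x) \<le> riesz l f x" for n x
 proof -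
  have "ennreal (g n x) \<le> ennreal (enn2real (min (riesz l f x) (ennreal (real n))))"
   by (auto simp: g_def indicator_def intro!: ennreal_leI)
  also have "\<dots> = min (riesz l f x) (ennreal (real n))"
   by (intro ennreal_enn2real) (simp add: min_less_iff_disj)
  finally show ?thesis by simp
 qed
 have gn: "g n x \<le> real n * indicator (cball 0 (real n)) x" for n x
 proof -
  have "enn2real (min (riesz l f x) (ennreal (real n))) \<le> real n"
   by (rule enn2real_leI) auto
  then show ?thesis by (auto simp: g_def indicator_def)
 qed
 have main: "(\<integral>\<^sup>+x. ennreal (g n x ^ m) \<partial>lborel) \<le> ennreal (C ^ m)" for n
 proof -
  have "g n x ^ m \<le> real n ^ m * indicator (cball 0 (real n)) x" for x
   using power_mono[OF gn g0, of n x m] m0 by (auto simp: indicator_def power_0_left split: if_splits)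
  then have fin: "(\<integral>\<^sup>+x. ennreal (g n x ^ m) \<partial>lborel) < \<infinity>"
   by (intro nn_integral_bounded_support_finite[of _ "real n ^ m" "real n"]) auto
  define N where "N = enn2real (\<integral>\<^sup>+x. ennreal (g n x ^ m) \<partial>lborel)"
  have N: "(\<integral>\<^sup>+x. ennreal (g n x ^ m) \<partial>lborel) = ennreal N"
   using fin by (simp add: N_def less_top)
  have N0: "0 \<le> N" by (simp add: N_def)
  show ?thesis
  proof (cases "N = 0")
   case True then show ?thesis by (simp add: N)
  next
   case False
   then have Np: "N > 0" using N0 by simp
   \<comment> \<open>Normalisation: the sixth power of \<open>h / c\<close> has integral 1.\<close>
   define c where "c = root 6 N"
   have c: "c > 0" "c ^ 6 = N" using Np by (auto simp: c_def real_root_pow_pos)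
   define h where "h x = root l (g n x)" for x
   have h0: "0 \<le> h x" for x by (simp add: h_def g0 real_root_ge_zero)
   have hl: "h x ^ l = g n x" for x using l g0 by (simp add: h_def real_root_pow_pos2)
   have h6: "h x ^ 6 = g n x ^ m" for x
    unfolding hl[symmetric] using m by (simp flip: power_mult add: mult.commute)
   have [measurable]: "h \<in> borel_fun" unfolding h_def by measurable
   \<comment> \<open>One function dominates both sides of the pairing, as the diagonal estimate
     requires. Its sixth power has integral at most \<open>4 + 1 = 5\<close>, and
     \<open>5^2 + 2 * hls_const l * 5\<close> is the constant
     \<open>25 + 10 * hls_const l\<close>.\<close>
   define r where "r x = max (s x) (h x / c)" for x
   have [measurable]: "r \<in> borel_fun" unfolding r_def by measurable
   have r0: "0 \<le> r x" for x using s(1)[of x] by (simp add: r_def)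
   have "(\<integral>\<^sup>+x. ennreal (r x ^ 6) \<partial>lborel) \<le> (\<integral>\<^sup>+x. ennreal (s x ^ 6) + ennreal (1 / N) * ennreal (g n x ^ m) \<partial>lborel)"
   proof (rule nn_integral_mono)
    fix x
    have "r x ^ 6 \<le> s x ^ 6 + (h x / c) ^ 6"
     by (auto simp: r_def max_def)
    also have "(h x / c) ^ 6 = 1 / N * g n x ^ m"
     by (simp add: power_divide h6 c)
    finally show "ennreal (r x ^ 6) \<le> ennreal (s x ^ 6) + ennreal (1 / N) * ennreal (g n x ^ m)"
     using s(1)[of x] g0[of n x] Np
     by (subst ennreal_mult[symmetric], simp, simp, subst ennreal_plus[symmetric]) (auto intro!: ennreal_leI simp del: ennreal_plus)
   qed
   also have "\<dots> = (\<integral>\<^sup>+x. ennreal (s x ^ 6) \<partial>lborel) + ennreal (1 / N) * ennreal N"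
    by (simp add: nn_integral_add nn_integral_cmult N)
   also have "\<dots> \<le> 4 + 1"
    using s(2) Np by (intro add_mono) (simp_all flip: ennreal_mult)
   finally have r6: "(\<integral>\<^sup>+x. ennreal (r x ^ 6) \<partial>lborel) \<le> ennreal 5"
    by simp
   have "ennreal N = (\<integral>\<^sup>+x. ennreal (g n x) * ennreal (h x ^ (6 - l)) \<partial>lborel)"
    unfolding N[symmetric] h6[symmetric] using l
    by (intro nn_integral_cong) (simp add: g0 h0 hl[symmetric] flip: ennreal_mult power_add)
   also have "\<dots> \<le> (\<integral>\<^sup>+x. riesz l f x * ennreal (h x ^ (6 - l)) \<partial>lborel)"
    using gle by (intro nn_integral_mono mult_right_mono) auto
   also have "\<dots> = (\<integral>\<^sup>+x. \<integral>\<^sup>+y. f y * ennreal (1 / dist x y ^ l) * ennreal (h x ^ (6 - l)) \<partial>lborel \<partial>lborel)"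
    unfolding riesz_def by (simp add: nn_integral_multc)
   also have "\<dots> \<le> (\<integral>\<^sup>+x. \<integral>\<^sup>+y. ennreal (c ^ (6 - l)) * ennreal (r x ^ (6 - l) * r y ^ (6 - l) / dist x y ^ l) \<partial>lborel \<partial>lborel)"
   proof (intro nn_integral_mono)
    fix x y
    have "f y * ennreal (1 / dist x y ^ l) * ennreal (h x ^ (6 - l))
     \<le> ennreal (r y ^ (6 - l)) * ennreal (1 / dist x y ^ l) * ennreal ((c * r x) ^ (6 - l))"
    proof (intro mult_mono)
     have "s y ^ (6 - l) \<le> r y ^ (6 - l)" using s by (intro power_mono) (auto simp: r_def)
     then show "f y \<le> ennreal (r y ^ (6 - l))" using f[of y] by (meson ennreal_leI order_trans)
     have "h x \<le> c * r x" using c(1) by (auto simp: r_def max_def field_simps)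
     then show "ennreal (h x ^ (6 - l)) \<le> ennreal ((c * r x) ^ (6 - l))"
      using h0 by (intro ennreal_leI power_mono) auto
    qed auto
    also have "\<dots> = ennreal (c ^ (6 - l)) * ennreal (r x ^ (6 - l) * r y ^ (6 - l) / dist x y ^ l)"
     using r0 c(1) by (simp add: power_mult_distrib flip: ennreal_mult)
    finally show "f y * ennreal (1 / dist x y ^ l) * ennreal (h x ^ (6 - l)) \<le> \<dots>" .
   qed
   also have "\<dots> = ennreal (c ^ (6 - l)) * (\<integral>\<^sup>+x. \<integral>\<^sup>+y. ennreal (r x ^ (6 - l) * r y ^ (6 - l) / dist x y ^ l) \<partial>lborel \<partial>lborel)"
    by (simp add: nn_integral_cmult)
   also have "\<dots> \<le> ennreal (c ^ (6 - l)) * ennreal (5\<^sup>2 + 2 * hls_const l * 5)"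
    using l r0 r6 by (intro mult_left_mono hls_diagonal) auto
   also have "\<dots> = ennreal (c ^ (6 - l) * C)"
    using c(1) C by (subst ennreal_mult[symmetric]) (auto simp: C_def)
   finally have "N \<le> c ^ (6 - l) * C"
    using c(1) C by (subst (asm) ennreal_le_iff) auto
   moreover have "N = c ^ (6 - l) * c ^ l"
    using c(2) l by (simp flip: power_add)
   ultimately have "c ^ l \<le> C" using c(1) by simp
   then have "(c ^ l) ^ m \<le> C ^ m" using c(1) by (intro power_mono) auto
   moreover have "(c ^ l) ^ m = N" using c(2) m by (simp flip: power_mult add: mult.commute)
   ultimately show ?thesis unfolding N by (simp add: ennreal_leI)
  qed
 qed
 have inc: "incseq (\<lambda>n x. ennreal (g n x ^ m))"
 proof (intro incseq_SucI le_funI ennreal_leI power_mono g0)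
  fix n x
  show "g n x \<le> g (Suc n) x"
   unfolding g_def
   by (intro mult_mono enn2real_mono min.mono)
     (auto simp: indicator_def min_less_iff_disj ennreal_leI simp del: of_nat_Suc)
 qed
 have sup: "(SUP n. ennreal (g n x ^ m)) \<ge> riesz l f x ^ m" for x
 proof -
  obtain n0 :: nat where n0: "norm x \<le> real n0" using real_arch_simple by blast
  have g: "g n x = enn2real (min (riesz l f x) (ennreal (real n)))" if "n0 \<le> n" for n
   using n0 that by (simp add: g_def indicator_def)
  show ?thesis
  proof (cases "riesz l f x = top")
   case True
   have "(SUP n. ennreal (g n x ^ m)) = top"
   proof (rule ennreal_SUP_eq_top)
    fix n :: nat
    have "real n \<le> real (max n (max 1 n0))" by simp
    also have "\<dots> \<le> real (max n (max 1 n0)) ^ m" using m0 by (intro self_le_power) auto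
    also have "\<dots> = g (max n (max 1 n0)) x ^ m" by (subst g) (simp_all add: True)
    finally have "ennreal (real n) \<le> ennreal (g (max n (max 1 n0)) x ^ m)" by (rule ennreal_leI)
    then show "\<exists>i\<in>UNIV. of_nat n \<le> ennreal (g i x ^ m)"
     by (auto simp: ennreal_of_nat_eq_real_of_nat)
   qed
   then show ?thesis by (simp only: top_greatest)
  next
   case False
   then obtain t where t: "riesz l f x = ennreal t" "0 \<le> t" by (cases "riesz l f x") auto
   obtain n1 :: nat where n1: "t \<le> real n1" using real_arch_simple by blast
   have "g (max n0 n1) x = t"
    using t n1 by (subst g) (simp_all add: min_absorb1 ennreal_leI)
   then have "riesz l f x ^ m = ennreal (g (max n0 n1) x ^ m)"
    using t by (simp add: ennreal_power)
   then show ?thesis by (metis SUP_upper UNIV_I)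
  qed
 qed
 have "(\<integral>\<^sup>+x. riesz l f x ^ m \<partial>lborel) \<le> (\<integral>\<^sup>+x. (SUP n. ennreal (g n x ^ m)) \<partial>lborel)"
  using sup by (intro nn_integral_mono)
 also have "\<dots> = (SUP n. \<integral>\<^sup>+x. ennreal (g n x ^ m) \<partial>lborel)"
  using inc by (intro nn_integral_monotone_convergence_SUP) auto
 also have "\<dots> \<le> ennreal (C ^ m)"
  by (intro SUP_least main)
 finally show ?thesis by (simp add: C_def)
qed

section \<open>Bounds in \<open>L^6 \<times> L^3\<close> and the trilinear estimates\<close>

definition pair_le :: "real \<Rightarrow> (real^3 \<Rightarrow> real) \<Rightarrow> (real^3 \<Rightarrow> real) \<Rightarrow> bool"
 where "pair_le \<eta> p q \<longleftrightarrow> p \<in> borel_fun \<and> q \<in> borel_fun \<and>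
  (\<forall>x. 0 \<le> p x) \<and> (\<forall>x. 0 \<le> q x) \<and>
  (\<integral>\<^sup>+x. ennreal (p x ^ 6) \<partial>lborel) \<le> ennreal (\<eta> ^ 6) \<and>
  (\<integral>\<^sup>+x. ennreal (q x ^ 3) \<partial>lborel) \<le> ennreal (\<eta> ^ 3)"

text \<open>Convexity of the \<open>n\<close>-th power at the combination of \<open>x / a\<close>
  and \<open>y / b\<close> with weights \<open>a / (a + b)\<close> and \<open>b / (a + b)\<close>.
  With \<open>a\<close> and \<open>b\<close> the norms of two functions, integration turns this into
  Minkowski's inequality.\<close>

lemma convex_power_sum:
 fixes a b :: real
 assumes "0 \<le> x" "0 \<le> y" "0 < a" "0 < b"
 shows "(x + y) ^ n \<le> (a + b) ^ n * (a / (a + b) * (x / a) ^ n + b / (a + b) * (y / b) ^ n)"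
proof -
 have "(x + y) / (a + b) = a / (a + b) * (x / a) + b / (a + b) * (y / b)"
  using assms by (simp add: add_divide_distrib)
 moreover have "(a / (a + b) * (x / a) + b / (a + b) * (y / b)) ^ n \<le> a / (a + b) * (x / a) ^ n + b / (a + b) * (y / b) ^ n"
 proof (induction n)
  case 0 then show ?case using assms by (simp flip: add_divide_distrib)
 next
  case (Suc n)
  define l m X Y where "l = a / (a + b)" and "m = b / (a + b)" and "X = x / a" and "Y = y / b"
  have p: "0 \<le> l" "0 \<le> m" "l + m = 1" "0 \<le> X" "0 \<le> Y"
   using assms by (auto simp: l_def m_def X_def Y_def simp flip: add_divide_distrib)
  \<comment> \<open>Both factors have the same sign (Chebyshev), so the product of the two means is
    at most the mean of the products.\<close>
  have "0 \<le> (X - Y) * (X ^ n - Y ^ n)"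
   using power_mono[of X Y n] power_mono[of Y X n] p
   by (cases "X \<le> Y") (auto simp: zero_le_mult_iff)
  then have "0 \<le> l * m * ((X - Y) * (X ^ n - Y ^ n))" using p by (metis mult_nonneg_nonneg)
  moreover have "l * X ^ Suc n + m * Y ^ Suc n - (l * X + m * Y) * (l * X ^ n + m * Y ^ n) = l * m * ((X - Y) * (X ^ n - Y ^ n))"
  proof -
   have m: "m = 1 - l" using p by simp
   show ?thesis unfolding m by (simp add: algebra_simps)
  qed
  moreover have "(l * X + m * Y) ^ Suc n \<le> (l * X + m * Y) * (l * X ^ n + m * Y ^ n)"
   using Suc.IH p unfolding l_def[symmetric] m_def[symmetric] X_def[symmetric] Y_def[symmetric]
   by (auto intro!: mult_left_mono)
  ultimately show ?case unfolding l_def[symmetric] m_def[symmetric] X_def[symmetric] Y_def[symmetric] by linarith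
 qed
 ultimately have "((x + y) / (a + b)) ^ n \<le> a / (a + b) * (x / a) ^ n + b / (a + b) * (y / b) ^ n"
  by simp
 then have "(a + b) ^ n * ((x + y) / (a + b)) ^ n \<le> (a + b) ^ n * (a / (a + b) * (x / a) ^ n + b / (a + b) * (y / b) ^ n)"
  using assms by (intro mult_left_mono) auto
 moreover have "(a + b) ^ n * ((x + y) / (a + b)) ^ n = (x + y) ^ n"
  using assms by (simp add: power_divide)
 ultimately show ?thesis by simp
qed

lemma nn_integral_power_sum_le:
 fixes f g :: "'a \<Rightarrow> real"
 assumes [measurable]: "f \<in> borel_measurable M" "g \<in> borel_measurable M"
  and nn: "\<And>x. 0 \<le> f x" "\<And>x. 0 \<le> g x" and ab: "0 < a" "0 < b"
  and f: "(\<integral>\<^sup>+x. ennreal (f x ^ n) \<partial>M) \<le> ennreal (a ^ n)"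
  and g: "(\<integral>\<^sup>+x. ennreal (g x ^ n) \<partial>M) \<le> ennreal (b ^ n)"
 shows "(\<integral>\<^sup>+x. ennreal ((f x + g x) ^ n) \<partial>M) \<le> ennreal ((a + b) ^ n)"
proof -
 define c d where "c = (a + b) ^ n * (a / (a + b)) / a ^ n" and "d = (a + b) ^ n * (b / (a + b)) / b ^ n"
 have cd: "0 \<le> c" "0 \<le> d" using ab by (auto simp: c_def d_def)
 have sum: "c * a ^ n + d * b ^ n = (a + b) ^ n"
 proof -
  have "c * a ^ n + d * b ^ n = (a + b) ^ n * (a / (a + b) + b / (a + b))"
   using ab unfolding c_def d_def by (simp only: distrib_left) simp
  also have "a / (a + b) + b / (a + b) = 1"
   using ab by (simp flip: add_divide_distrib)
  finally show ?thesis by simp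
 qed
 have "(\<integral>\<^sup>+x. ennreal ((f x + g x) ^ n) \<partial>M)
   \<le> (\<integral>\<^sup>+x. ennreal c * ennreal (f x ^ n) + ennreal d * ennreal (g x ^ n) \<partial>M)"
 proof (rule nn_integral_mono)
  fix x
  have "(f x + g x) ^ n \<le> c * f x ^ n + d * g x ^ n"
   using convex_power_sum[OF nn(1)[of x] nn(2)[of x] ab, of n]
   by (simp add: c_def d_def power_divide distrib_left mult_ac)
  then show "ennreal ((f x + g x) ^ n) \<le> ennreal c * ennreal (f x ^ n) + ennreal d * ennreal (g x ^ n)"
   using nn cd by (simp add: ennreal_leI flip: ennreal_mult ennreal_plus)
 qed
 also have "\<dots> = ennreal c * (\<integral>\<^sup>+x. ennreal (f x ^ n) \<partial>M) + ennreal d * (\<integral>\<^sup>+x. ennreal (g x ^ n) \<partial>M)"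
  by (simp add: nn_integral_add nn_integral_cmult)
 also have "\<dots> \<le> ennreal c * ennreal (a ^ n) + ennreal d * ennreal (b ^ n)"
  using f g by (intro add_mono mult_left_mono) auto
 also have "\<dots> = ennreal ((a + b) ^ n)"
  using cd ab by (simp add: sum flip: ennreal_mult ennreal_plus)
 finally show ?thesis .
qed

lemma pair_le_add:
 assumes "pair_le a p q" "pair_le b p' q'" "0 < a" "0 < b"
 shows "pair_le (a + b) (\<lambda>x. p x + p' x) (\<lambda>x. q x + q' x)"
 using assms unfolding pair_le_def
 by (auto intro!: nn_integral_power_sum_le)

lemma pair_le_mono:
 assumes "pair_le a p q" "0 \<le> a" "a \<le> b"
  and "p' \<in> borel_fun" "q' \<in> borel_fun"
  and "\<And>x. 0 \<le> p' x" "\<And>x. p' x \<le> p x" "\<And>x. 0 \<le> q' x" "\<And>x. q' x \<le> q x"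
 shows "pair_le b p' q'"
proof -
 have "(\<integral>\<^sup>+x. ennreal (p' x ^ 6) \<partial>lborel) \<le> ennreal (b ^ 6)"
  if "(\<integral>\<^sup>+x. ennreal (p x ^ 6) \<partial>lborel) \<le> ennreal (a ^ 6)"
  by (rule order_trans[OF nn_integral_mono order_trans[OF that]])
    (use assms in \<open>auto intro!: ennreal_leI power_mono\<close>)
 moreover have "(\<integral>\<^sup>+x. ennreal (q' x ^ 3) \<partial>lborel) \<le> ennreal (b ^ 3)"
  if "(\<integral>\<^sup>+x. ennreal (q x ^ 3) \<partial>lborel) \<le> ennreal (a ^ 3)"
  by (rule order_trans[OF nn_integral_mono order_trans[OF that]])
    (use assms in \<open>auto intro!: ennreal_leI power_mono\<close>)
 ultimately show ?thesis
  using assms unfolding pair_le_def by auto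
qed

text \<open>The constant of \<open>riesz_bound\<close> with both kernels added, to serve for either,
  times 2 for the two terms of each linearised cubic.\<close>

definition pair_const :: real
 where "pair_const = 2 * (25 + 10 * (hls_const 1 + hls_const 2))"

lemma pair_const_pos: "pair_const > 0"
 unfolding pair_const_def by (intro mult_pos_pos add_pos_nonneg) auto

lemma riesz_cmult:
 assumes [measurable]: "f \<in> borel_fun"
 shows "riesz l (\<lambda>y. c * f y) x = c * riesz l f x"
 unfolding riesz_def by (simp add: nn_integral_cmult mult.assoc)

text \<open>Each summand has one factor from the pair of size \<open>\<eta>\<close> and two from the
  pair of size \<open>S\<close>. If \<open>p\<close> counts as one power and \<open>q\<close> as two
  powers of a common function \<open>s\<close>, the products have degrees 5 and 4, which is
  \<open>6 - l\<close> for the kernels \<open>l = 1\<close> and \<open>l = 2\<close>.\<close>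

lemma pair_le_riesz:
 assumes pq: "pair_le \<eta> p q" and pq': "pair_le S p' q'" and pos: "0 < \<eta>" "0 < S"
 shows "(\<integral>\<^sup>+x. riesz 1 (\<lambda>y. ennreal (p y * (q' y)\<^sup>2 + p' y * q' y * q y)) x ^ 6 \<partial>lborel)
   \<le> ennreal ((pair_const * S\<^sup>2 * \<eta>) ^ 6)" (is ?A)
  and "(\<integral>\<^sup>+x. riesz 2 (\<lambda>y. ennreal (p y * p' y * q' y + (p' y)\<^sup>2 * q y)) x ^ 3 \<partial>lborel)
   \<le> ennreal ((pair_const * S\<^sup>2 * \<eta>) ^ 3)" (is ?B)
proof -
 have [measurable]: "p \<in> borel_fun" "q \<in> borel_fun"
   "p' \<in> borel_fun" "q' \<in> borel_fun"
  and nn: "0 \<le> p x" "0 \<le> q x" "0 \<le> p' x" "0 \<le> q' x" for x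
  using pq pq' by (auto simp: pair_le_def)
 \<comment> \<open>Each of the four normalised entries contributes at most 1 to the integral of
   \<open>s^6\<close>, hence the bound 4.\<close>
 define s where "s x = max (max (p x / \<eta>) (p' x / S)) (max (sqrt (q x / \<eta>)) (sqrt (q' x / S)))" for x
 have [measurable]: "s \<in> borel_fun" unfolding s_def by measurable
 have s0: "0 \<le> s x" for x using nn[of x] pos by (simp add: s_def le_max_iff_disj)
 have le: "p x \<le> \<eta> * s x" "p' x \<le> S * s x" "q x \<le> \<eta> * (s x)\<^sup>2" "q' x \<le> S * (s x)\<^sup>2" for x
 proof -
  have "p x / \<eta> \<le> s x" "p' x / S \<le> s x" "sqrt (q x / \<eta>) \<le> s x" "sqrt (q' x / S) \<le> s x"
   by (simp_all add: s_def)
  moreover from this(3,4) have "q x / \<eta> \<le> (s x)\<^sup>2" "q' x / S \<le> (s x)\<^sup>2"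
   using nn[of x] pos by (simp_all add: sqrt_le_D)
  ultimately show "p x \<le> \<eta> * s x" "p' x \<le> S * s x" "q x \<le> \<eta> * (s x)\<^sup>2" "q' x \<le> S * (s x)\<^sup>2"
   using pos by (simp_all add: field_simps)
 qed
 have s6: "(\<integral>\<^sup>+x. ennreal (s x ^ 6) \<partial>lborel) \<le> 4"
 proof -
  have sq6: "sqrt t ^ 6 = t ^ 3" if "0 \<le> t" for t :: real
  proof -
   have "sqrt t ^ 6 = ((sqrt t)\<^sup>2) ^ 3" by (simp flip: power_mult)
   then show ?thesis using that by simp
  qed
  have "(\<integral>\<^sup>+x. ennreal (s x ^ 6) \<partial>lborel) \<le> (\<integral>\<^sup>+x. (ennreal (1 / \<eta> ^ 6) * ennreal (p x ^ 6) + ennreal (1 / S ^ 6) * ennreal (p' x ^ 6))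
    + (ennreal (1 / \<eta> ^ 3) * ennreal (q x ^ 3) + ennreal (1 / S ^ 3) * ennreal (q' x ^ 3)) \<partial>lborel)"
  proof (rule nn_integral_mono)
   fix x
   have "s x ^ 6 \<le> ((p x / \<eta>) ^ 6 + (p' x / S) ^ 6) + (sqrt (q x / \<eta>) ^ 6 + sqrt (q' x / S) ^ 6)"
    using nn[of x] pos unfolding s_def max_def by auto
   also have "\<dots> = (1 / \<eta> ^ 6 * p x ^ 6 + 1 / S ^ 6 * p' x ^ 6) + (1 / \<eta> ^ 3 * q x ^ 3 + 1 / S ^ 3 * q' x ^ 3)"
    using nn[of x] pos by (simp add: sq6 power_divide)
   finally show "ennreal (s x ^ 6) \<le> (ennreal (1 / \<eta> ^ 6) * ennreal (p x ^ 6) + ennreal (1 / S ^ 6) * ennreal (p' x ^ 6))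
    + (ennreal (1 / \<eta> ^ 3) * ennreal (q x ^ 3) + ennreal (1 / S ^ 3) * ennreal (q' x ^ 3))"
    using nn[of x] pos by (simp add: ennreal_leI flip: ennreal_mult ennreal_plus)
  qed
  also have "\<dots> = (ennreal (1 / \<eta> ^ 6) * (\<integral>\<^sup>+x. ennreal (p x ^ 6) \<partial>lborel) + ennreal (1 / S ^ 6) * (\<integral>\<^sup>+x. ennreal (p' x ^ 6) \<partial>lborel))
    + (ennreal (1 / \<eta> ^ 3) * (\<integral>\<^sup>+x. ennreal (q x ^ 3) \<partial>lborel) + ennreal (1 / S ^ 3) * (\<integral>\<^sup>+x. ennreal (q' x ^ 3) \<partial>lborel))"
   by (simp add: nn_integral_add nn_integral_cmult)
  also have "\<dots> \<le> (ennreal (1 / \<eta> ^ 6) * ennreal (\<eta> ^ 6) + ennreal (1 / S ^ 6) * ennreal (S ^ 6))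
    + (ennreal (1 / \<eta> ^ 3) * ennreal (\<eta> ^ 3) + ennreal (1 / S ^ 3) * ennreal (S ^ 3))"
   using pq pq' by (intro add_mono mult_left_mono) (auto simp: pair_le_def)
  also have "\<dots> = ennreal 4"
   using pos by (simp flip: ennreal_mult ennreal_plus)
  finally show ?thesis by simp
 qed
 have bound: "(\<integral>\<^sup>+x. riesz l f x ^ m \<partial>lborel) \<le> ennreal ((pair_const * S\<^sup>2 * \<eta>) ^ m)"
  if [measurable]: "f \<in> borel_fun" and f: "\<And>x. f x \<le> ennreal (2 * S\<^sup>2 * \<eta> * s x ^ (6 - l))"
   and l: "1 \<le> l" "l < 3" "m * l = 6" for f l m
 proof -
  define c where "c = 2 * S\<^sup>2 * \<eta>"
  have c: "c > 0" using pos by (simp add: c_def)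
  define g where "g y = ennreal (s y ^ (6 - l))" for y
  have [measurable]: "g \<in> borel_fun" unfolding g_def by measurable
  have "riesz l f x \<le> ennreal c * riesz l g x" for x
  proof -
   have "f y \<le> ennreal c * g y" for y
    using f[of y] s0[of y] c unfolding c_def g_def by (simp flip: ennreal_mult)
   then have "riesz l f x \<le> riesz l (\<lambda>y. ennreal c * g y) x"
    unfolding riesz_def by (intro nn_integral_mono mult_right_mono) auto
   then show ?thesis by (simp add: riesz_cmult)
  qed
  then have "(\<integral>\<^sup>+x. riesz l f x ^ m \<partial>lborel) \<le> (\<integral>\<^sup>+x. ennreal (c ^ m) * riesz l g x ^ m \<partial>lborel)"
   using c by (intro nn_integral_mono) (metis ennreal_power less_imp_le power_mono power_mult_distrib zero_le)
  also have "\<dots> = ennreal (c ^ m) * (\<integral>\<^sup>+x. riesz l g x ^ m \<partial>lborel)"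
   by (simp add: nn_integral_cmult)
  also have "\<dots> \<le> ennreal (c ^ m) * ennreal ((25 + 10 * hls_const l) ^ m)"
   using l s0 s6 by (intro mult_left_mono riesz_bound[where s = s]) (auto simp: g_def)
  also have "\<dots> = ennreal ((c * (25 + 10 * hls_const l)) ^ m)"
   using c by (subst ennreal_mult[symmetric]) (auto simp: power_mult_distrib add_nonneg_nonneg)
  also have "\<dots> \<le> ennreal ((pair_const * S\<^sup>2 * \<eta>) ^ m)"
  proof (intro ennreal_leI power_mono)
   have "l = 1 \<or> l = 2" using l by auto
   then have "25 + 10 * hls_const l \<le> 25 + 10 * (hls_const 1 + hls_const 2)" by auto
   then have "c * (25 + 10 * hls_const l) \<le> c * (25 + 10 * (hls_const 1 + hls_const 2))"
    using c by (intro mult_left_mono) auto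
   also have "\<dots> = pair_const * S\<^sup>2 * \<eta>" by (simp add: c_def pair_const_def)
   finally show "c * (25 + 10 * hls_const l) \<le> pair_const * S\<^sup>2 * \<eta>" .
  qed (use c in \<open>auto intro!: mult_nonneg_nonneg add_nonneg_nonneg\<close>)
  finally show ?thesis .
 qed
 show ?A
 proof (rule bound)
  fix x
  have "p x * (q' x)\<^sup>2 \<le> (\<eta> * s x) * (S * (s x)\<^sup>2)\<^sup>2"
   using nn le s0 pos by (intro mult_mono power_mono) auto
  moreover have "p' x * q' x * q x \<le> (S * s x) * (S * (s x)\<^sup>2) * (\<eta> * (s x)\<^sup>2)"
   using nn le s0 pos by (intro mult_mono) auto
  ultimately have "p x * (q' x)\<^sup>2 + p' x * q' x * q x \<le> 2 * S\<^sup>2 * \<eta> * s x ^ (6 - 1)"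
   by (simp add: power_numeral_reduce algebra_simps)
  then show "ennreal (p x * (q' x)\<^sup>2 + p' x * q' x * q x) \<le> ennreal (2 * S\<^sup>2 * \<eta> * s x ^ (6 - 1))"
   by (rule ennreal_leI)
 qed auto
 show ?B
 proof (rule bound)
  fix x
  have "p x * p' x * q' x \<le> (\<eta> * s x) * (S * s x) * (S * (s x)\<^sup>2)"
   using nn le s0 pos by (intro mult_mono) auto
  moreover have "(p' x)\<^sup>2 * q x \<le> (S * s x)\<^sup>2 * (\<eta> * (s x)\<^sup>2)"
   using nn le s0 pos by (intro mult_mono power_mono) auto
  ultimately have "p x * p' x * q' x + (p' x)\<^sup>2 * q x \<le> 2 * S\<^sup>2 * \<eta> * s x ^ (6 - 2)"
   by (simp add: power_numeral_reduce algebra_simps)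
  then show "ennreal (p x * p' x * q' x + (p' x)\<^sup>2 * q x) \<le> ennreal (2 * S\<^sup>2 * \<eta> * s x ^ (6 - 2))"
   by (rule ennreal_leI)
 qed auto
qed

section \<open>The Banach algebra of absolutely convergent power series\<close>

no_notation Infinite_Set_Sum.abs_summable_on (infix \<open>abs'_summable'_on\<close> 50)

text \<open>Real power series in three variables that converge absolutely on the closed unit polydisc,
 with the sum of the absolute values of the coefficients as norm.\<close>

typedef mps = "{f :: nat^3 \<Rightarrow> real. f abs_summable_on UNIV}"
 morphisms coef Abs_mps
 by (rule exI[of _ "\<lambda>_. 0"]) simp

setup_lifting type_definition_mps

lemma coef_abs_summable: "coef f abs_summable_on UNIV"
 using coef[of f] by simp

lemma coef_abs_summable' [simp]: "(\<lambda>\<alpha>. \<bar>coef f \<alpha>\<bar>) summable_on UNIV"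
 using coef_abs_summable[of f] by simp

lemma mps_eqI: "(\<And>\<alpha>. coef f \<alpha> = coef g \<alpha>) \<Longrightarrow> f = g"
 by (metis coef_inject ext)

instantiation mps :: real_normed_vector
begin

lift_definition zero_mps :: mps is "\<lambda>_. 0" by simp

lift_definition plus_mps :: "mps \<Rightarrow> mps \<Rightarrow> mps" is "\<lambda>f g \<alpha>. f \<alpha> + g \<alpha>"
proof -
 fix f g :: "nat^3 \<Rightarrow> real"
 assume "f abs_summable_on UNIV" "g abs_summable_on UNIV"
 then have "(\<lambda>x. norm (f x) + norm (g x)) summable_on UNIV" by (rule summable_on_add)
 then show "(\<lambda>\<alpha>. f \<alpha> + g \<alpha>) abs_summable_on UNIV"
  by (rule summable_on_comparison_test) (auto intro: abs_triangle_ineq)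
qed

lift_definition uminus_mps :: "mps \<Rightarrow> mps" is "\<lambda>f \<alpha>. - f \<alpha>" by simp

definition minus_mps :: "mps \<Rightarrow> mps \<Rightarrow> mps" where "minus_mps f g = f + - g"

lift_definition scaleR_mps :: "real \<Rightarrow> mps \<Rightarrow> mps" is "\<lambda>c f \<alpha>. c * f \<alpha>"
 by (simp add: abs_mult summable_on_cmult_right)

definition norm_mps :: "mps \<Rightarrow> real" where "norm_mps f = (\<Sum>\<^sub>\<infinity>\<alpha>. \<bar>coef f \<alpha>\<bar>)"
definition dist_mps :: "mps \<Rightarrow> mps \<Rightarrow> real" where "dist_mps f g = norm (f - g)"
definition sgn_mps :: "mps \<Rightarrow> mps" where "sgn_mps f = scaleR (inverse (norm f)) f"
definition uniformity_mps :: "(mps \<times> mps) filter"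
 where "uniformity_mps = (INF e\<in>{0<..}. principal {(x, y). dist x y < e})"
definition open_mps :: "mps set \<Rightarrow> bool"
 where "open_mps U \<longleftrightarrow> (\<forall>x\<in>U. \<forall>\<^sub>F (x', y) in uniformity. x' = x \<longrightarrow> y \<in> U)"

lemma coef_zero [simp]: "coef 0 \<alpha> = 0" by transfer simp
lemma coef_add [simp]: "coef (f + g) \<alpha> = coef f \<alpha> + coef g \<alpha>" by transfer simp
lemma coef_uminus [simp]: "coef (- f) \<alpha> = - coef f \<alpha>" by transfer simp
lemma coef_scaleR [simp]: "coef (c *\<^sub>R f) \<alpha> = c * coef f \<alpha>" by transfer simp
lemma coef_diff [simp]: "coef (f - g) \<alpha> = coef f \<alpha> - coef g \<alpha>" by (simp add: minus_mps_def)

lemma coef_le_norm: "\<bar>coef f \<alpha>\<bar> \<le> norm f"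
proof -
 have "(\<Sum>\<alpha>\<in>{\<alpha>}. \<bar>coef f \<alpha>\<bar>) \<le> (\<Sum>\<^sub>\<infinity>\<alpha>. \<bar>coef f \<alpha>\<bar>)"
  by (rule finite_sum_le_infsum) auto
 then show ?thesis by (simp add: norm_mps_def)
qed

instance
proof
 fix f g h :: mps and a b :: real
 show "norm f = 0 \<longleftrightarrow> f = 0"
  using coef_le_norm[of f] by (auto simp: norm_mps_def intro!: mps_eqI) 
 show "norm (f + g) \<le> norm f + norm g"
 proof -
  have "(\<Sum>\<^sub>\<infinity>\<alpha>. \<bar>coef (f + g) \<alpha>\<bar>) \<le> (\<Sum>\<^sub>\<infinity>\<alpha>. \<bar>coef f \<alpha>\<bar> + \<bar>coef g \<alpha>\<bar>)"
   by (rule infsum_mono) (auto intro: summable_on_add simp del: coef_add, simp add: abs_triangle_ineq)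
  then show ?thesis by (simp add: norm_mps_def infsum_add)
 qed
 show "norm (a *\<^sub>R f) = \<bar>a\<bar> * norm f"
  by (simp add: norm_mps_def abs_mult infsum_cmult_right)
qed (auto simp: minus_mps_def dist_mps_def sgn_mps_def uniformity_mps_def open_mps_def algebra_simps
    intro!: mps_eqI)

end

lemma sum_abs_coef_le_norm: "finite F \<Longrightarrow> (\<Sum>\<alpha>\<in>F. \<bar>coef f \<alpha>\<bar>) \<le> norm f"
 unfolding norm_mps_def by (rule finite_sum_le_infsum) auto

lemma bounded_linear_coef: "bounded_linear (\<lambda>f. coef f \<alpha>)"
 by (rule bounded_linear_intro[of _ 1]) (auto simp: coef_le_norm)

lemma mps_norm_leI:
 assumes "\<And>F. finite F \<Longrightarrow> (\<Sum>\<alpha>\<in>F. \<bar>f \<alpha>\<bar>) \<le> B"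
 shows "f abs_summable_on UNIV" "norm (Abs_mps f) \<le> B"
proof -
 show *: "f abs_summable_on UNIV"
  unfolding abs_summable_iff_bdd_above using assms by (intro bdd_aboveI2[of _ _ B]) auto
 have "(\<Sum>\<^sub>\<infinity>\<alpha>. \<bar>f \<alpha>\<bar>) \<le> B"
  by (rule infsum_le_finite_sums) (use * assms in auto)
 then show "norm (Abs_mps f) \<le> B"
  using * by (simp add: norm_mps_def Abs_mps_inverse)
qed

instance mps :: banach
proof
 fix X :: "nat \<Rightarrow> mps" assume X: "Cauchy X"
 have "convergent (\<lambda>n. coef (X n) \<alpha>)" for \<alpha>
  using bounded_linear.Cauchy[OF bounded_linear_coef X] by (simp add: Cauchy_convergent_iff)
 then obtain g where g: "\<And>\<alpha>. (\<lambda>n. coef (X n) \<alpha>) \<longlonglongrightarrow> g \<alpha>"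
  unfolding convergent_def by metis
 \<comment> \<open>Finite partial sums pass to the coefficientwise limit; this turns the Cauchy
   estimate into a bound for the distance to the limit in norm.\<close>
 have fin: "(\<Sum>\<alpha>\<in>F. \<bar>g \<alpha> - coef (X n) \<alpha>\<bar>) \<le> e"
  if "\<And>m. m \<ge> N \<Longrightarrow> norm (X m - X n) \<le> e" "finite F" for F N n e
 proof (rule LIMSEQ_le_const2)
  show "(\<lambda>m. \<Sum>\<alpha>\<in>F. \<bar>coef (X m) \<alpha> - coef (X n) \<alpha>\<bar>) \<longlonglongrightarrow> (\<Sum>\<alpha>\<in>F. \<bar>g \<alpha> - coef (X n) \<alpha>\<bar>)"
   by (intro tendsto_intros g)
  have "(\<Sum>\<alpha>\<in>F. \<bar>coef (X m) \<alpha> - coef (X n) \<alpha>\<bar>) \<le> e" if "m \<ge> N" for m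
   using sum_abs_coef_le_norm[OF \<open>finite F\<close>, of "X m - X n"] \<open>\<And>m. m \<ge> N \<Longrightarrow> norm (X m - X n) \<le> e\<close>[OF that] by simp
  then show "\<exists>N. \<forall>m\<ge>N. (\<Sum>\<alpha>\<in>F. \<bar>coef (X m) \<alpha> - coef (X n) \<alpha>\<bar>) \<le> e" by blast
 qed
 have C: "\<exists>N. \<forall>m\<ge>N. \<forall>n\<ge>N. norm (X m - X n) \<le> e" if "e > 0" for e
  using CauchyD[OF X that] by (meson less_imp_le)
 obtain N where N: "\<And>m n. m \<ge> N \<Longrightarrow> n \<ge> N \<Longrightarrow> norm (X m - X n) \<le> 1"
  using C[of 1] by auto
 have "(\<lambda>\<alpha>. g \<alpha> - coef (X N) \<alpha>) abs_summable_on UNIV"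
  using fin[of N N 1] N by (intro mps_norm_leI(1)[of _ 1]) auto
 then have "(\<lambda>\<alpha>. \<bar>g \<alpha> - coef (X N) \<alpha>\<bar> + \<bar>coef (X N) \<alpha>\<bar>) summable_on UNIV"
  by (intro summable_on_add) auto
 then have gs: "g abs_summable_on UNIV"
  by (rule summable_on_comparison_test) auto
 define G where "G = Abs_mps g"
 have cG: "coef G = g" using gs by (simp add: G_def Abs_mps_inverse)
 have "X \<longlonglongrightarrow> G"
 proof (rule LIMSEQ_I)
  fix r :: real assume "r > 0"
  then obtain N where N: "\<And>m n. m \<ge> N \<Longrightarrow> n \<ge> N \<Longrightarrow> norm (X m - X n) \<le> r / 2"
   using C[of "r / 2"] by auto
  have "norm (X n - G) < r" if "n \<ge> N" for n
  proof -
   have "norm (G - X n) = norm (Abs_mps (coef (G - X n)))" by (simp add: coef_inverse)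
   also have "\<dots> \<le> r / 2"
    using fin[of N n "r / 2"] N that by (intro mps_norm_leI(2)) (auto simp: cG)
   finally show ?thesis using \<open>r > 0\<close> by (simp add: norm_minus_commute)
  qed
  then show "\<exists>N. \<forall>n\<ge>N. norm (X n - G) < r" by blast
 qed
 then show "convergent X" by (rule convergentI)
qed

text \<open>\<open>mpair f w\<close> pairs \<open>f\<close> with a bounded family; evaluation, substitution and the coefficients
 are all of this form.\<close>

definition mpair :: "mps \<Rightarrow> (nat^3 \<Rightarrow> 'b::banach) \<Rightarrow> 'b"
 where "mpair f w = (\<Sum>\<^sub>\<infinity>\<alpha>. coef f \<alpha> *\<^sub>R w \<alpha>)"

lemma mpair_abs_summable:
 assumes "\<And>\<alpha>. norm (w \<alpha>) \<le> W"
 shows "(\<lambda>\<alpha>. coef f \<alpha> *\<^sub>R w \<alpha>) abs_summable_on UNIV"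
proof -
 have "(\<lambda>\<alpha>. \<bar>coef f \<alpha>\<bar> * W) summable_on UNIV" by (intro summable_on_cmult_left) simp
 then show ?thesis
  by (rule summable_on_comparison_test) (auto intro: mult_left_mono assms)
qed

lemma mpair_summable:
 fixes w :: "nat^3 \<Rightarrow> 'b::banach"
 assumes "\<And>\<alpha>. norm (w \<alpha>) \<le> W"
 shows "(\<lambda>\<alpha>. coef f \<alpha> *\<^sub>R w \<alpha>) summable_on UNIV"
 using mpair_abs_summable[OF assms] by (rule abs_summable_summable)

lemma norm_mpair_le:
 fixes w :: "nat^3 \<Rightarrow> 'b::banach"
 assumes "\<And>\<alpha>. norm (w \<alpha>) \<le> W"
 shows "norm (mpair f w) \<le> norm f * W"
proof -
 have "norm (mpair f w) \<le> (\<Sum>\<^sub>\<infinity>\<alpha>. norm (coef f \<alpha> *\<^sub>R w \<alpha>))"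
  unfolding mpair_def by (rule norm_infsum_bound[OF mpair_abs_summable[OF assms]])
 also have "\<dots> \<le> (\<Sum>\<^sub>\<infinity>\<alpha>. \<bar>coef f \<alpha>\<bar> * W)"
  by (rule infsum_mono[OF mpair_abs_summable[OF assms]])
    (auto intro: summable_on_cmult_left mult_left_mono assms)
 also have "\<dots> = norm f * W"
  by (simp add: norm_mps_def infsum_cmult_left)
 finally show ?thesis .
qed

lemma mpair_linear:
 fixes w :: "nat^3 \<Rightarrow> 'b::banach"
 assumes "\<And>\<alpha>. norm (w \<alpha>) \<le> W"
 shows "bounded_linear (\<lambda>f. mpair f w)"
proof (rule bounded_linear_intro[of _ W])
 fix f g :: mps and r :: real
 show "mpair (f + g) w = mpair f w + mpair g w"
  unfolding mpair_def by (simp add: scaleR_left_distrib infsum_add mpair_summable[OF assms])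
 show "mpair (r *\<^sub>R f) w = r *\<^sub>R mpair f w"
  unfolding mpair_def by (simp add: infsum_scaleR_right flip: scaleR_scaleR)
 show "norm (mpair f w) \<le> norm f * W" by (rule norm_mpair_le[OF assms])
qed

lemma mpair_indicator [simp]: "mpair f (indicator {\<alpha>} :: _ \<Rightarrow> real) = coef f \<alpha>"
proof -
 have "mpair f (indicator {\<alpha>} :: _ \<Rightarrow> real) = (\<Sum>\<^sub>\<infinity>\<beta>\<in>{\<alpha>}. coef f \<beta>)"
  unfolding mpair_def by (rule infsum_cong_neutral) (auto simp: indicator_def)
 then show ?thesis by simp
qed

subsection \<open>Fibre sums and multiplication\<close>

lemma fibre_bij: "bij_betw snd (SIGMA i:UNIV. {x. h x = i}) UNIV"
 by (rule bij_betwI[of _ _ _ "\<lambda>x. (h x, x)"]) auto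

lemma infsum_fibres:
 fixes F :: "'x \<Rightarrow> 'b::banach"
 assumes "F summable_on UNIV"
 shows "(\<lambda>i. \<Sum>\<^sub>\<infinity>x\<in>{x. h x = i}. F x) summable_on UNIV"
  and "(\<Sum>\<^sub>\<infinity>i. \<Sum>\<^sub>\<infinity>x\<in>{x. h x = i}. F x) = (\<Sum>\<^sub>\<infinity>x. F x)"
proof -
 have s: "(\<lambda>(i, x). F x) summable_on (SIGMA i:UNIV. {x. h x = i})"
  using assms summable_on_reindex_bij_betw[OF fibre_bij, of F h]
  by (simp add: case_prod_beta' )
 show "(\<lambda>i. \<Sum>\<^sub>\<infinity>x\<in>{x. h x = i}. F x) summable_on UNIV"
  by (rule summable_on_Sigma_banach[OF s])
 show "(\<Sum>\<^sub>\<infinity>i. \<Sum>\<^sub>\<infinity>x\<in>{x. h x = i}. F x) = (\<Sum>\<^sub>\<infinity>x. F x)"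
  using infsum_Sigma'_banach[OF s] infsum_reindex_bij_betw[OF fibre_bij, of F h]
  by (simp add: case_prod_beta')
qed

lemma infsum_prod_abs_summable:
 fixes f g :: "nat^3 \<Rightarrow> real"
 assumes "f abs_summable_on UNIV" "g abs_summable_on UNIV"
 shows "(\<lambda>p. f (fst p) * g (snd p)) abs_summable_on UNIV"
proof -
 have "(\<lambda>(a, b). norm (f a) * norm (g b)) summable_on (UNIV \<times> UNIV)"
  by (rule summable_on_SigmaI[where g = "\<lambda>a. norm (f a) * (\<Sum>\<^sub>\<infinity>b. norm (g b))"])
    (use assms in \<open>auto intro!: has_sum_cmult_right summable_on_cmult_left has_sum_infsum simp: mult_ac\<close>)
 then show ?thesis by (simp add: case_prod_beta' abs_mult)
qed

instantiation mps :: comm_ring_1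
begin

lift_definition one_mps :: mps is "\<lambda>\<alpha>. if \<alpha> = 0 then 1 else 0"
proof -
 have "(\<lambda>\<alpha>::nat^3. if \<alpha> = 0 then 1 else 0 :: real) summable_on {0}" by simp
 then show "(\<lambda>\<alpha>::nat^3. if \<alpha> = 0 then 1 else 0 :: real) abs_summable_on UNIV"
  by (subst summable_on_cong_neutral[where T = "{0}" and g = "\<lambda>\<alpha>. if \<alpha> = 0 then 1 else 0"]) auto
qed

lift_definition times_mps :: "mps \<Rightarrow> mps \<Rightarrow> mps"
 is "\<lambda>f g \<gamma>. \<Sum>\<^sub>\<infinity>p\<in>{p. fst p + snd p = \<gamma>}. f (fst p) * g (snd p)"
proof -
 fix f g :: "nat^3 \<Rightarrow> real"
 assume fg: "f abs_summable_on UNIV" "g abs_summable_on UNIV"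
 have s: "(\<lambda>p. \<bar>f (fst p) * g (snd p)\<bar>) summable_on UNIV"
  using infsum_prod_abs_summable[OF fg] by simp
 show "(\<lambda>\<gamma>. \<Sum>\<^sub>\<infinity>p\<in>{p. fst p + snd p = \<gamma>}. f (fst p) * g (snd p)) abs_summable_on UNIV"
 proof (rule summable_on_comparison_test[OF infsum_fibres(1)[OF s, of "\<lambda>p. fst p + snd p"]])
  fix \<gamma> :: "nat^3"
  have "(\<lambda>p. norm (f (fst p) * g (snd p))) summable_on {p. fst p + snd p = \<gamma>}"
   by (rule summable_on_subset_banach[of _ UNIV]) (use s in auto)
  then show "norm (\<Sum>\<^sub>\<infinity>p\<in>{p. fst p + snd p = \<gamma>}. f (fst p) * g (snd p)) \<le> (\<Sum>\<^sub>\<infinity>p\<in>{p. fst p + snd p = \<gamma>}. \<bar>f (fst p) * g (snd p)\<bar>)"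
   using norm_infsum_bound[of "\<lambda>p. f (fst p) * g (snd p)" "{p. fst p + snd p = \<gamma>}"] by simp
 qed auto
qed

text \<open>Pairing with a product is an iterated pairing with shifted weights, by summation along
  the fibres \<open>a + b = \<gamma>\<close>. Pairings separate elements, so associativity,
  distributivity, the norm inequality and multiplicativity of substitution all reduce to this
  formula.\<close>

lemma mpair_times:
 fixes w :: "nat^3 \<Rightarrow> 'b::banach"
 assumes "\<And>\<alpha>. norm (w \<alpha>) \<le> W"
 shows "mpair (f * g) w = mpair f (\<lambda>a. mpair g (\<lambda>b. w (a + b)))"
proof -
 define P where "P p = coef f (fst p) * coef g (snd p)" for p
 have P: "P abs_summable_on UNIV"
  unfolding P_def by (rule infsum_prod_abs_summable[OF coef_abs_summable coef_abs_summable])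
 have "(\<lambda>p. \<bar>P p\<bar> * W) summable_on UNIV" using P by (intro summable_on_cmult_left) simp
 then have Fa: "(\<lambda>p. P p *\<^sub>R w (fst p + snd p)) abs_summable_on UNIV"
  by (rule summable_on_comparison_test) (auto intro: mult_left_mono assms)
 then have F: "(\<lambda>p. P p *\<^sub>R w (fst p + snd p)) summable_on UNIV" by (rule abs_summable_summable)
 have "mpair (f * g) w = (\<Sum>\<^sub>\<infinity>\<gamma>. (\<Sum>\<^sub>\<infinity>p\<in>{p. fst p + snd p = \<gamma>}. P p) *\<^sub>R w \<gamma>)"
  by (simp add: mpair_def times_mps.rep_eq P_def)
 also have "\<dots> = (\<Sum>\<^sub>\<infinity>\<gamma>. \<Sum>\<^sub>\<infinity>p\<in>{p. fst p + snd p = \<gamma>}. P p *\<^sub>R w (fst p + snd p))"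
 proof (rule infsum_cong)
  fix \<gamma> :: "nat^3"
  have "P summable_on {p. fst p + snd p = \<gamma>}"
   using abs_summable_summable[OF P] by (rule summable_on_subset_banach) auto
  then have "(\<Sum>\<^sub>\<infinity>p\<in>{p. fst p + snd p = \<gamma>}. P p) *\<^sub>R w \<gamma> = (\<Sum>\<^sub>\<infinity>p\<in>{p. fst p + snd p = \<gamma>}. P p *\<^sub>R w \<gamma>)"
   by (simp add: infsum_scaleR_left)
  also have "\<dots> = (\<Sum>\<^sub>\<infinity>p\<in>{p. fst p + snd p = \<gamma>}. P p *\<^sub>R w (fst p + snd p))"
   by (rule infsum_cong) auto
  finally show "(\<Sum>\<^sub>\<infinity>p\<in>{p. fst p + snd p = \<gamma>}. P p) *\<^sub>R w \<gamma> = \<dots>" .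
 qed
 also have "\<dots> = (\<Sum>\<^sub>\<infinity>p. P p *\<^sub>R w (fst p + snd p))"
  by (rule infsum_fibres(2)[OF F])
 also have "\<dots> = (\<Sum>\<^sub>\<infinity>a. \<Sum>\<^sub>\<infinity>b. P (a, b) *\<^sub>R w (a + b))"
  using infsum_Sigma_banach[of "\<lambda>p. P p *\<^sub>R w (fst p + snd p)" UNIV "\<lambda>_. UNIV"] F by simp
 also have "\<dots> = (\<Sum>\<^sub>\<infinity>a. coef f a *\<^sub>R mpair g (\<lambda>b. w (a + b)))"
  by (simp add: P_def mpair_def infsum_scaleR_right flip: scaleR_scaleR)
 finally show ?thesis by (simp add: mpair_def)
qed

lemma mps_eq_mpairI:
 assumes "\<And>w :: nat^3 \<Rightarrow> real. (\<And>\<alpha>. norm (w \<alpha>) \<le> 1) \<Longrightarrow> mpair f w = mpair g w"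
 shows "f = g"
proof (rule mps_eqI)
 fix \<alpha>
 have "mpair f (indicator {\<alpha>} :: _ \<Rightarrow> real) = mpair g (indicator {\<alpha>})"
  by (rule assms) (auto simp: indicator_def)
 then show "coef f \<alpha> = coef g \<alpha>" by simp
qed

lemma mpair_one [simp]: "mpair 1 w = w 0"
proof -
 have "mpair 1 w = (\<Sum>\<^sub>\<infinity>\<beta>\<in>{0}. w \<beta>)"
  unfolding mpair_def by (rule infsum_cong_neutral) (auto simp: one_mps.rep_eq)
 then show ?thesis by simp
qed

instance
proof
 fix f g h :: mps
 have b: "norm (mpair f (\<lambda>b. w (a + b))) \<le> norm f" if "\<And>\<alpha>. norm (w \<alpha>) \<le> 1" for w :: "nat^3 \<Rightarrow> real" and f a
  using norm_mpair_le[of "\<lambda>b. w (a + b)" 1 f] that by simp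
 show "f * g * h = f * (g * h)"
 proof (rule mps_eq_mpairI)
  fix w :: "nat^3 \<Rightarrow> real" assume w: "\<And>\<alpha>. norm (w \<alpha>) \<le> 1"
  have "mpair (f * g * h) w = mpair (f * g) (\<lambda>a. mpair h (\<lambda>b. w (a + b)))"
   by (rule mpair_times[OF w])
  also have "\<dots> = mpair f (\<lambda>a. mpair g (\<lambda>c. mpair h (\<lambda>b. w (a + c + b))))"
   by (rule mpair_times[OF b[OF w]])
  also have "\<dots> = mpair f (\<lambda>a. mpair (g * h) (\<lambda>c. w (a + c)))"
   using w by (simp add: mpair_times[of _ 1] add.assoc)
  also have "\<dots> = mpair (f * (g * h)) w"
   by (rule mpair_times[OF w, symmetric])
  finally show "mpair (f * g * h) w = mpair (f * (g * h)) w" .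
 qed
 show "f * g = g * f"
 proof (rule mps_eqI)
  fix \<gamma>
  have "bij_betw prod.swap {p::(nat^3)\<times>(nat^3). fst p + snd p = \<gamma>} {p. fst p + snd p = \<gamma>}"
   by (rule bij_betwI[of _ _ _ prod.swap]) (auto simp: add.commute)
  from infsum_reindex_bij_betw[OF this, of "\<lambda>p. coef g (fst p) * coef f (snd p)"]
  show "coef (f * g) \<gamma> = coef (g * f) \<gamma>" by (simp add: times_mps.rep_eq mult.commute)
 qed
 show "1 * f = f"
 proof (rule mps_eq_mpairI)
  fix w :: "nat^3 \<Rightarrow> real" assume "\<And>\<alpha>. norm (w \<alpha>) \<le> 1"
  then show "mpair (1 * f) w = mpair f w" by (simp add: mpair_times[of _ 1])
 qed
 show "(f + g) * h = f * h + g * h"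
 proof (rule mps_eq_mpairI)
  fix w :: "nat^3 \<Rightarrow> real" assume w: "\<And>\<alpha>. norm (w \<alpha>) \<le> 1"
  interpret bounded_linear "\<lambda>f. mpair f w" by (rule mpair_linear[OF w])
  interpret b: bounded_linear "\<lambda>f. mpair f (\<lambda>a. mpair h (\<lambda>b. w (a + b)))" by (rule mpair_linear[OF b[OF w]])
  show "mpair ((f + g) * h) w = mpair (f * h + g * h) w"
   using w by (simp add: mpair_times[of _ 1] add b.add)
 qed
 show "(0::mps) \<noteq> 1"
  by (metis coef_zero one_mps.rep_eq zero_neq_one)
qed

end

instance mps :: real_normed_algebra_1
proof
 fix f g h :: mps and c :: real
 have l: "(c *\<^sub>R f) * g = c *\<^sub>R (f * g)" for f g :: mps and c :: real
 proof (rule mps_eqI)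
  fix \<gamma>
  show "coef ((c *\<^sub>R f) * g) \<gamma> = coef (c *\<^sub>R (f * g)) \<gamma>"
   by (simp add: times_mps.rep_eq mult.assoc infsum_cmult_right')
 qed
 show "(c *\<^sub>R f) * g = c *\<^sub>R (f * g)" by (rule l)
 show "f * (c *\<^sub>R g) = c *\<^sub>R (f * g)" using l[of c g f] by (simp add: mult.commute)
 show "norm (f * g) \<le> norm f * norm g"
 proof -
  \<comment> \<open>With the signs of the coefficients as weights, the pairing is the norm.\<close>
  define w where "w \<alpha> = sgn (coef (f * g) \<alpha>)" for \<alpha>
  have w: "norm (w \<alpha>) \<le> 1" for \<alpha> by (simp add: w_def abs_sgn_eq)
  have "norm (f * g) = mpair (f * g) w"
   by (simp add: norm_mps_def mpair_def w_def flip: abs_sgn)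
  also have "\<dots> = mpair f (\<lambda>a. mpair g (\<lambda>b. w (a + b)))"
   by (rule mpair_times[OF w])
  also have "\<dots> \<le> norm f * norm g"
  proof -
   have "norm (mpair g (\<lambda>b. w (a + b))) \<le> norm g" for a
    using norm_mpair_le[of "\<lambda>b. w (a + b)" 1 g] w by simp
   from norm_mpair_le[of "\<lambda>a. mpair g (\<lambda>b. w (a + b))", OF this, of f] show ?thesis by simp
  qed
  finally show ?thesis .
 qed
 have "norm (1::mps) = (\<Sum>\<^sub>\<infinity>\<alpha>\<in>{0::nat^3}. 1)"
  unfolding norm_mps_def by (rule infsum_cong_neutral) (auto simp: one_mps.rep_eq)
 then show "norm (1::mps) = 1" by simp
qed

subsection \<open>Polynomials are dense; second countability\<close>

lift_definition mon :: "nat^3 \<Rightarrow> mps" is "\<lambda>\<alpha> \<beta>. if \<beta> = \<alpha> then 1 else 0"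
proof -
 fix \<alpha> :: "nat^3"
 have "(\<lambda>\<beta>::nat^3. if \<beta> = \<alpha> then 1 else 0 :: real) summable_on {\<alpha>}" by simp
 then show "(\<lambda>\<beta>::nat^3. if \<beta> = \<alpha> then 1 else 0 :: real) abs_summable_on UNIV"
  by (subst summable_on_cong_neutral[where T = "{\<alpha>}" and g = "\<lambda>\<beta>. if \<beta> = \<alpha> then 1 else 0"]) auto
qed

lemma coef_sum [simp]: "coef (sum f F) \<alpha> = (\<Sum>i\<in>F. coef (f i) \<alpha>)"
 by (induction F rule: infinite_finite_induct) auto

lemma coef_mon: "coef (mon \<alpha>) \<beta> = (if \<beta> = \<alpha> then 1 else 0)"
 by (simp add: mon.rep_eq)

lemma mpair_mon [simp]: "mpair (mon \<alpha>) w = w \<alpha>"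
proof -
 have "mpair (mon \<alpha>) w = (\<Sum>\<^sub>\<infinity>\<beta>\<in>{\<alpha>}. w \<beta>)"
  unfolding mpair_def by (rule infsum_cong_neutral) (auto simp: coef_mon)
 then show ?thesis by simp
qed

lemma norm_mon [simp]: "norm (mon \<alpha>) = 1"
proof -
 have "norm (mon \<alpha>) = (\<Sum>\<^sub>\<infinity>\<beta>\<in>{\<alpha>}. 1)"
  unfolding norm_mps_def by (rule infsum_cong_neutral) (auto simp: coef_mon)
 then show ?thesis by simp
qed

lemma mps_approx:
 assumes "e > 0"
 obtains F where "finite F" "norm (f - (\<Sum>\<alpha>\<in>F. coef f \<alpha> *\<^sub>R mon \<alpha>)) < e"
proof -
 have "\<exists>F. finite F \<and> F \<subseteq> UNIV \<and> dist (\<Sum>\<alpha>\<in>F. \<bar>coef f \<alpha>\<bar>) (\<Sum>\<^sub>\<infinity>\<alpha>. \<bar>coef f \<alpha>\<bar>) \<le> e / 2"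
  by (rule infsum_finite_approximation) (use assms in auto)
 then obtain F where F: "finite F" "dist (\<Sum>\<alpha>\<in>F. \<bar>coef f \<alpha>\<bar>) (norm f) \<le> e / 2"
  unfolding norm_mps_def by blast
 define g where "g = f - (\<Sum>\<alpha>\<in>F. coef f \<alpha> *\<^sub>R mon \<alpha>)"
 have cg: "coef g \<alpha> = (if \<alpha> \<in> F then 0 else coef f \<alpha>)" for \<alpha>
  using F(1) by (auto simp: g_def coef_mon if_distrib sum.delta cong: if_cong)
 have "(\<Sum>\<alpha>\<in>G. \<bar>coef g \<alpha>\<bar>) \<le> e / 2" if "finite G" for G
 proof -
  have "(\<Sum>\<alpha>\<in>G. \<bar>coef g \<alpha>\<bar>) = (\<Sum>\<alpha>\<in>G - F. \<bar>coef f \<alpha>\<bar>)"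
   using that by (intro sum.mono_neutral_cong_right) (auto simp: cg)
  also have "\<dots> + (\<Sum>\<alpha>\<in>F. \<bar>coef f \<alpha>\<bar>) = (\<Sum>\<alpha>\<in>(G - F) \<union> F. \<bar>coef f \<alpha>\<bar>)"
   using that F by (intro sum.union_disjoint[symmetric]) auto
  then have "(\<Sum>\<alpha>\<in>G - F. \<bar>coef f \<alpha>\<bar>) = (\<Sum>\<alpha>\<in>(G - F) \<union> F. \<bar>coef f \<alpha>\<bar>) - (\<Sum>\<alpha>\<in>F. \<bar>coef f \<alpha>\<bar>)" by simp
  also have "\<dots> \<le> norm f - (norm f - e / 2)"
   using that F(1) F(2)[unfolded dist_real_def] by (intro diff_mono sum_abs_coef_le_norm) (simp, linarith)
  finally show ?thesis by simp
 qed
 from mps_norm_leI(2)[OF this] have "norm g \<le> e / 2" by (simp add: coef_inverse)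
 then show thesis using assms F(1) that by (force simp: g_def)
qed

text \<open>Polynomials with rational coefficients. Lists form a countable type, so this is a
  countable dense set. The resulting second countability is what Borel measurability of sums and
  products, and the Bochner integral, rest on for \<open>mps\<close>-valued functions.\<close>

definition mps_of_list :: "((nat^3) \<times> rat) list \<Rightarrow> mps"
 where "mps_of_list xs = (\<Sum>(\<alpha>, q)\<leftarrow>xs. of_rat q *\<^sub>R mon \<alpha>)"

lemma mps_of_list_dense:
 assumes "e > 0"
 shows "\<exists>xs. norm (f - mps_of_list xs) < e"
proof -
 obtain F where F: "finite F" "norm (f - (\<Sum>\<alpha>\<in>F. coef f \<alpha> *\<^sub>R mon \<alpha>)) < e / 2"
  using mps_approx[of "e / 2" f] assms by auto
 define d where "d = e / 2 / (real (card F) + 1)"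
 have d: "d > 0" using assms by (simp add: d_def)
 have "\<exists>q. \<bar>coef f \<alpha> - of_rat q\<bar> < d" for \<alpha>
 proof -
  obtain q where "coef f \<alpha> - d < of_rat q" "of_rat q < coef f \<alpha> + d"
   using of_rat_dense[of "coef f \<alpha> - d" "coef f \<alpha> + d"] d by auto
  then have "\<bar>coef f \<alpha> - of_rat q\<bar> < d" by linarith
  then show ?thesis ..
 qed
 then obtain q where q: "\<And>\<alpha>. \<bar>coef f \<alpha> - of_rat (q \<alpha>)\<bar> < d" by metis
 obtain as where as: "set as = F" "distinct as" using F(1) finite_distinct_list by blast
 have "mps_of_list (map (\<lambda>\<alpha>. (\<alpha>, q \<alpha>)) as) = (\<Sum>\<alpha>\<in>F. of_rat (q \<alpha>) *\<^sub>R mon \<alpha>)"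
  using as by (simp add: mps_of_list_def sum_list_distinct_conv_sum_set o_def flip: as(1))
 moreover have "norm ((\<Sum>\<alpha>\<in>F. coef f \<alpha> *\<^sub>R mon \<alpha>) - (\<Sum>\<alpha>\<in>F. of_rat (q \<alpha>) *\<^sub>R mon \<alpha>)) \<le> e / 2"
 proof -
  have "norm ((\<Sum>\<alpha>\<in>F. coef f \<alpha> *\<^sub>R mon \<alpha>) - (\<Sum>\<alpha>\<in>F. of_rat (q \<alpha>) *\<^sub>R mon \<alpha>)) = norm (\<Sum>\<alpha>\<in>F. (coef f \<alpha> - of_rat (q \<alpha>)) *\<^sub>R mon \<alpha>)"
   by (simp add: scaleR_left_diff_distrib sum_subtractf)
  also have "\<dots> \<le> (\<Sum>\<alpha>\<in>F. d)"
   using q by (intro sum_norm_le) (auto intro: less_imp_le)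
  also have "\<dots> \<le> (real (card F) + 1) * d" using d by (simp add: distrib_right)
  also have "\<dots> = e / 2"
  proof -
   have "real (card F) + 1 \<noteq> 0" by linarith
   then show ?thesis unfolding d_def by (metis nonzero_mult_div_cancel_left times_divide_eq_right)
  qed
  finally show ?thesis .
 qed
 ultimately have "norm (f - mps_of_list (map (\<lambda>\<alpha>. (\<alpha>, q \<alpha>)) as)) < e"
  using F(2) norm_triangle_ineq[of "f - (\<Sum>\<alpha>\<in>F. coef f \<alpha> *\<^sub>R mon \<alpha>)" "(\<Sum>\<alpha>\<in>F. coef f \<alpha> *\<^sub>R mon \<alpha>) - (\<Sum>\<alpha>\<in>F. of_rat (q \<alpha>) *\<^sub>R mon \<alpha>)"]
  by simp
 then show ?thesis by blast
qed

instance mps :: second_countable_topology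
proof
 define B where "B = (\<lambda>(xs, n). ball (mps_of_list xs) (1 / real (Suc n))) ` UNIV"
 have "countable B" unfolding B_def by (rule countable_image) simp
 moreover have "topological_basis B"
 proof (rule topological_basisI)
  fix U and f :: mps assume U: "open U" "f \<in> U"
  then obtain e where e: "e > 0" "ball f e \<subseteq> U" using open_contains_ball by blast
  obtain n where n: "1 / real (Suc n) < e / 2" using e nat_approx_posE[of "e / 2"] by auto
  obtain xs where xs: "norm (f - mps_of_list xs) < 1 / real (Suc n)"
   using mps_of_list_dense[of "1 / real (Suc n)" f] by auto
  have "ball (mps_of_list xs) (1 / real (Suc n)) \<subseteq> ball f e"
  proof
   fix g assume "g \<in> ball (mps_of_list xs) (1 / real (Suc n))"
   then have "dist f g < 1 / real (Suc n) + 1 / real (Suc n)"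
    using xs dist_triangle[of f g "mps_of_list xs"] by (simp add: dist_norm)
   then show "g \<in> ball f e" using n by simp
  qed
  moreover have "f \<in> ball (mps_of_list xs) (1 / real (Suc n))"
   using xs by (simp add: dist_norm norm_minus_commute)
  ultimately show "\<exists>B'\<in>B. f \<in> B' \<and> B' \<subseteq> U"
   using e(2) unfolding B_def by (intro bexI[of _ "ball (mps_of_list xs) (1 / real (Suc n))"]) auto
 qed (auto simp: B_def)
 ultimately show "\<exists>B::mps set set. countable B \<and> open = generate_topology B"
  using topological_basis_imp_subbasis by blast
qed

subsection \<open>Substitution\<close>

definition mono_pow :: "('b::comm_ring_1)^3 \<Rightarrow> nat^3 \<Rightarrow> 'b"
 where "mono_pow T \<alpha> = (\<Prod>j\<in>UNIV. (T $ j) ^ (\<alpha> $ j))"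

text \<open>For real \<open>T\<close> this is the value of the series at \<open>T\<close>, for
  \<open>T\<close> in \<open>mps\<close> the composition of series. As long as the components of
  \<open>T\<close> have norm at most 1, both are norm-decreasing homomorphisms for the same
  reason.\<close>

definition msub :: "('b::{comm_ring_1,real_normed_algebra_1,banach})^3 \<Rightarrow> mps \<Rightarrow> 'b"
 where "msub T f = mpair f (mono_pow T)"

definition mX :: "3 \<Rightarrow> mps"
 where "mX j = mon (axis j 1)"

context
 fixes T :: "('b::{comm_ring_1,real_normed_algebra_1,banach})^3"
 assumes T: "\<And>j. norm (T $ j) \<le> 1"
begin

lemma norm_mono_pow_le: "norm (mono_pow T \<alpha>) \<le> 1"
proof -
 have "norm (mono_pow T \<alpha>) \<le> (\<Prod>j\<in>UNIV. norm ((T $ j) ^ (\<alpha> $ j)))"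
  unfolding mono_pow_def by (rule norm_prod_le)
 also have "\<dots> \<le> 1"
 proof (rule prod_le_1)
  fix j :: 3
  have "norm ((T $ j) ^ (\<alpha> $ j)) \<le> norm (T $ j) ^ (\<alpha> $ j)" by (rule norm_power_ineq)
  also have "\<dots> \<le> 1" using T by (simp add: power_le_one)
  finally show "0 \<le> norm ((T $ j) ^ (\<alpha> $ j)) \<and> norm ((T $ j) ^ (\<alpha> $ j)) \<le> 1" by simp
 qed
 finally show ?thesis .
qed

lemma bounded_linear_msub: "bounded_linear (msub T)"
 using mpair_linear[OF norm_mono_pow_le] unfolding msub_def .

lemma norm_msub_le: "norm (msub T f) \<le> norm f"
 using norm_mpair_le[OF norm_mono_pow_le] unfolding msub_def by simp

lemma msub_add: "msub T (f + g) = msub T f + msub T g"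
 using bounded_linear.linear[OF bounded_linear_msub] by (rule linear_add)

lemma msub_scaleR: "msub T (c *\<^sub>R f) = c *\<^sub>R msub T f"
 using bounded_linear.linear[OF bounded_linear_msub] by (rule linear_cmul)

lemma msub_sum: "msub T (sum f A) = (\<Sum>i\<in>A. msub T (f i))"
 using bounded_linear.linear[OF bounded_linear_msub] by (rule linear_sum)

lemma msub_times: "msub T (f * g) = msub T f * msub T g"
proof -
 have "msub T (f * g) = mpair f (\<lambda>a. mpair g (\<lambda>b. mono_pow T (a + b)))"
  unfolding msub_def by (rule mpair_times[OF norm_mono_pow_le])
 also have "\<dots> = mpair f (\<lambda>a. mono_pow T a * msub T g)"
 proof -
  have "mpair g (\<lambda>b. mono_pow T (a + b)) = mono_pow T a * msub T g" for a
  proof -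
   have "mpair g (\<lambda>b. mono_pow T (a + b)) = (\<Sum>\<^sub>\<infinity>b. mono_pow T a * (coef g b *\<^sub>R mono_pow T b))"
    by (simp add: mpair_def mono_pow_def power_add prod.distrib)
   also have "\<dots> = mono_pow T a * msub T g"
    unfolding msub_def mpair_def
    by (rule infsum_cmult_right) (rule mpair_summable[OF norm_mono_pow_le])
   finally show ?thesis .
  qed
  then show ?thesis by simp
 qed
 also have "\<dots> = (\<Sum>\<^sub>\<infinity>a. (coef f a *\<^sub>R mono_pow T a) * msub T g)"
  by (simp add: mpair_def)
 also have "\<dots> = msub T f * msub T g"
  unfolding msub_def mpair_def
  by (rule infsum_cmult_left) (rule mpair_summable[OF norm_mono_pow_le])
 finally show ?thesis .
qed

lemma msub_one [simp]: "msub T 1 = 1"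
 by (simp add: msub_def mono_pow_def)

lemma msub_power: "msub T (f ^ n) = msub T f ^ n"
 by (induction n) (auto simp: msub_times)

lemma msub_prod: "msub T (prod f A) = (\<Prod>i\<in>A. msub T (f i))"
 by (induction A rule: infinite_finite_induct) (auto simp: msub_times)

lemma msub_mX [simp]: "msub T (mX i) = T $ i"
proof -
 have "msub T (mX i) = (\<Prod>j\<in>UNIV. if i = j then T $ j else 1)"
  unfolding msub_def mX_def mpair_mon mono_pow_def
  by (intro prod.cong) (auto simp: axis_def)
 also have "\<dots> = T $ i" by (subst prod.delta') auto
 finally show ?thesis .
qed

end

lemma norm_mX [simp]: "norm (mX j) = 1"
 by (simp add: mX_def)

section \<open>Real analytic functions of three variables\<close>

declare One_nat_def [simp del]

lemma component_le_one: "norm (t::real^3) \<le> 1 \<Longrightarrow> norm (t $ j) \<le> 1"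
 using component_le_norm_cart[of t j] by simp

lemma finite_mi_order_le [simp]: "finite {\<alpha>. mi_order \<alpha> \<le> M}"
proof -
 have "{\<alpha>. mi_order \<alpha> \<le> M} \<subseteq> (\<lambda>f. \<chi> j. f j) ` (PiE UNIV (\<lambda>_::3. {..M}))"
 proof
  fix \<alpha> :: "nat^3" assume "\<alpha> \<in> {\<alpha>. mi_order \<alpha> \<le> M}"
  then have "\<alpha> $ j \<le> M" for j
   using member_le_sum[of j UNIV "\<lambda>j. \<alpha> $ j"] by (force simp: mi_order_def)
  then show "\<alpha> \<in> (\<lambda>f. \<chi> j. f j) ` (PiE UNIV (\<lambda>_::3. {..M}))"
   by (intro image_eqI[of _ _ "\<lambda>j. \<alpha> $ j"]) auto
 qed
 moreover have "finite \<dots>" by (intro finite_imageI finite_PiE) auto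
 ultimately show ?thesis by (rule finite_subset)
qed

lemma mono_pow_real: "mono_pow t = mi_power t"
 by (simp add: fun_eq_iff mono_pow_def mi_power_def)

lemma abs_mi_power_le: "\<bar>mi_power t \<alpha>\<bar> \<le> norm t ^ mi_order \<alpha>"
proof -
 have "\<bar>mi_power t \<alpha>\<bar> = (\<Prod>j\<in>UNIV. \<bar>t $ j\<bar> ^ (\<alpha> $ j))"
  by (simp add: mi_power_def abs_prod power_abs)
 also have "\<dots> \<le> (\<Prod>j\<in>UNIV. norm t ^ (\<alpha> $ j))"
  by (intro prod_mono conjI power_mono component_le_norm_cart) auto
 also have "\<dots> = norm t ^ mi_order \<alpha>" by (simp add: mi_order_def power_sum)
 finally show ?thesis .
qed

lemma mi_power_scaleR: "mi_power (c *\<^sub>R t) \<alpha> = c ^ mi_order \<alpha> * mi_power t \<alpha>"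
 by (simp add: mi_power_def mi_order_def power_mult_distrib prod.distrib power_sum)

text \<open>The tail is again a pairing, whose weights are monomials of degree above
  \<open>M\<close> and hence at most \<open>norm t ^ Suc M\<close> in the unit ball. The norm of the
  series therefore serves as the constant for every \<open>M\<close>.\<close>

lemma msub_taylor:
 fixes t :: "real^3"
 assumes "norm t \<le> 1"
 shows "\<bar>msub t c - (\<Sum>\<alpha> | mi_order \<alpha> \<le> M. coef c \<alpha> * mi_power t \<alpha>)\<bar> \<le> norm c * norm t ^ Suc M"
proof -
 define w where "w \<alpha> = (if mi_order \<alpha> \<le> M then 0 else mi_power t \<alpha>)" for \<alpha>
 have w: "norm (w \<alpha>) \<le> norm t ^ Suc M" for \<alpha>
 proof (cases "mi_order \<alpha> \<le> M")
  case False
  then have "norm t ^ mi_order \<alpha> \<le> norm t ^ Suc M" using assms by (intro power_decreasing) auto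
  then show ?thesis using False abs_mi_power_le[of t \<alpha>] by (simp add: w_def)
 qed (simp add: w_def)
 define w' where "w' \<alpha> = (if mi_order \<alpha> \<le> M then mi_power t \<alpha> else 0)" for \<alpha>
 have w': "norm (w' \<alpha>) \<le> 1" for \<alpha>
  using abs_mi_power_le[of t \<alpha>] power_le_one[of "norm t" "mi_order \<alpha>"] assms by (simp add: w'_def)
 have "msub t c = (\<Sum>\<^sub>\<infinity>\<alpha>. coef c \<alpha> *\<^sub>R w \<alpha> + coef c \<alpha> *\<^sub>R w' \<alpha>)"
  unfolding msub_def mpair_def mono_pow_real by (intro infsum_cong) (simp add: w_def w'_def)
 also have "\<dots> = mpair c w + mpair c w'"
  unfolding mpair_def by (rule infsum_add[OF mpair_summable[OF w] mpair_summable[OF w']])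
 also have "mpair c w' = (\<Sum>\<^sub>\<infinity>\<alpha>\<in>{\<alpha>. mi_order \<alpha> \<le> M}. coef c \<alpha> * mi_power t \<alpha>)"
  unfolding mpair_def by (rule infsum_cong_neutral) (auto simp: w'_def)
 finally have "msub t c - (\<Sum>\<alpha> | mi_order \<alpha> \<le> M. coef c \<alpha> * mi_power t \<alpha>) = mpair c w" by simp
 then show ?thesis using norm_mpair_le[OF w, of c] by simp
qed

lemma infsum_bounded_linear:
 assumes "bounded_linear h" "f summable_on A"
 shows "infsum (\<lambda>x. h (f x)) A = h (infsum f A)"
 by (rule infsumI[OF has_sum_bounded_linear[OF assms(1) has_sum_infsum[OF assms(2)]]])

lemma msub_msub:
 fixes T :: "mps^3" and t :: "real^3"
 assumes T: "\<And>j. norm (T $ j) \<le> 1" and t: "\<And>j. norm (t $ j) \<le> 1"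
 shows "msub t (msub T c) = msub (\<chi> j. msub t (T $ j)) c"
proof -
 have "msub t (msub T c) = (\<Sum>\<^sub>\<infinity>\<alpha>. msub t (coef c \<alpha> *\<^sub>R mono_pow T \<alpha>))"
  unfolding msub_def[of T] mpair_def
  using infsum_bounded_linear[OF bounded_linear_msub[OF t], OF mpair_summable[OF norm_mono_pow_le[OF T]], of c]
  by (simp add: o_def)
 also have "\<dots> = msub (\<chi> j. msub t (T $ j)) c"
  unfolding msub_def[of "\<chi> j. msub t (T $ j)"] mpair_def
  by (intro infsum_cong) (simp add: msub_scaleR[OF t] mono_pow_def msub_prod[OF t] msub_power[OF t])
 finally show ?thesis .
qed

text \<open>The substitution of \<open>s + X / 2\<close> for \<open>X\<close>, which recentres a
  series at \<open>s\<close>. For \<open>norm s \<le> 1 / 2\<close> its components have norm at most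
  1: halving the radius pays for the shift.\<close>

definition shift_vec :: "real^3 \<Rightarrow> mps^3"
 where "shift_vec s = (\<chi> j. (1/2) *\<^sub>R mX j + (s $ j) *\<^sub>R 1)"

lemma norm_shift_vec: "norm s \<le> 1 / 2 \<Longrightarrow> norm (shift_vec s $ j) \<le> 1"
 using component_le_norm_cart[of s j] norm_triangle_ineq[of "(1/2) *\<^sub>R mX j" "(s $ j) *\<^sub>R 1"]
 by (simp add: shift_vec_def)

lemma msub_shift_vec:
 fixes t :: "real^3"
 assumes s: "norm s \<le> 1 / 2" and t: "norm t \<le> 1"
 shows "msub t (msub (shift_vec s) c) = msub (s + (1/2) *\<^sub>R t) c"
proof -
 have "(\<chi> j. msub t (shift_vec s $ j)) = s + (1/2) *\<^sub>R t"
  unfolding vec_eq_iff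
  using component_le_one[OF t] by (simp add: shift_vec_def msub_add msub_scaleR)
 then show ?thesis
  using msub_msub[OF norm_shift_vec[OF s] component_le_one[OF t], of c] by simp
qed

text \<open>Rescaling the variable by \<open>r\<close> lets series with any radius live in the one
  algebra \<open>mps\<close>.\<close>

definition has_mps :: "(real^3 \<Rightarrow> real) \<Rightarrow> real^3 \<Rightarrow> real \<Rightarrow> mps \<Rightarrow> bool"
 where "has_mps f x r c \<longleftrightarrow> r > 0 \<and> (\<forall>h. norm h \<le> r \<longrightarrow> f (x + h) = msub (h /\<^sub>R r) c)"

definition analytic_pt :: "(real^3 \<Rightarrow> real) \<Rightarrow> real^3 \<Rightarrow> bool"
 where "analytic_pt f x \<longleftrightarrow> (\<exists>r c. has_mps f x r c)"

lemma has_mps_shift: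
 assumes f: "has_mps f x r c" and h: "norm h \<le> r / 2"
 shows "has_mps f (x + h) (r / 2) (msub (shift_vec (h /\<^sub>R r)) c)"
proof -
 have r: "r > 0" using f by (simp add: has_mps_def)
 have s: "norm (h /\<^sub>R r) \<le> 1 / 2" using h r by (simp add: field_simps)
 have "f (x + h + k) = msub (k /\<^sub>R (r / 2)) (msub (shift_vec (h /\<^sub>R r)) c)" if "norm k \<le> r / 2" for k
 proof -
  have "norm (h + k) \<le> r" using h that norm_triangle_ineq[of h k] by linarith
  then have "f (x + (h + k)) = msub ((h + k) /\<^sub>R r) c" using f by (simp add: has_mps_def)
  moreover have "norm (k /\<^sub>R (r / 2)) \<le> 1" using r that by (simp add: field_simps)
  moreover have "(h + k) /\<^sub>R r = h /\<^sub>R r + (1/2) *\<^sub>R (k /\<^sub>R (r / 2))"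
   using r by (simp add: scaleR_add_right inverse_eq_divide)
  ultimately show ?thesis using msub_shift_vec[OF s] by (simp add: add.assoc)
 qed
 then show ?thesis using r by (simp add: has_mps_def)
qed

lemma mi_order_zero [simp]: "mi_order 0 = 0" by (simp add: mi_order_def)

lemma mi_order_eq_0: "mi_order \<alpha> = 0 \<longleftrightarrow> \<alpha> = 0"
 by (simp add: mi_order_def vec_eq_iff)

lemma mi_power_zero [simp]: "mi_power t 0 = 1" by (simp add: mi_power_def)

lemma mi_order_axis [simp]: "mi_order (axis j 1) = 1"
 by (simp add: mi_order_def axis_def)

lemma mi_power_axis [simp]: "mi_power t (axis j 1) = t $ j"
proof -
 have "mi_power t (axis j 1) = (\<Prod>i\<in>UNIV. if j = i then t $ i else 1)"
  unfolding mi_power_def by (intro prod.cong) (auto simp: axis_def)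
 then show ?thesis by simp
qed

lemma axis_neq_0: "axis j 1 \<noteq> (0::nat^3)"
proof
 assume "axis j 1 = (0::nat^3)"
 then have "axis j (1::nat) $ j = 0" by simp
 then show False by (simp add: axis_def)
qed

lemma mi_order_le_1: "{\<alpha>. mi_order \<alpha> \<le> 1} = insert 0 (range (\<lambda>j. axis j 1))"
proof -
 have "\<alpha> = 0 \<or> (\<exists>j. \<alpha> = axis j 1)" if "mi_order \<alpha> \<le> 1" for \<alpha> :: "nat^3"
 proof (rule disjCI)
  assume "\<nexists>j. \<alpha> = axis j 1"
  then have *: "\<alpha> \<noteq> axis 1 1" "\<alpha> \<noteq> axis 2 1" "\<alpha> \<noteq> axis 3 1" by auto
  have "\<alpha> $ 1 + \<alpha> $ 2 + \<alpha> $ 3 \<le> 1" using that by (simp add: mi_order_def sum_3)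
  then show "\<alpha> = 0" using * by (auto simp: vec_eq_iff axis_def forall_3)
 qed
 moreover have "mi_order (axis j 1) \<le> 1" for j by (simp only: mi_order_axis)
 ultimately show ?thesis by fastforce
qed

lemma has_mps_has_derivative:
 assumes "has_mps f x r c"
 shows "(f has_derivative (\<lambda>h. \<Sum>j\<in>UNIV. coef c (axis j 1) * (h $ j / r))) (at x)"
proof (rule has_derivativeI_sandwich[of r])
 have r: "r > 0" and f: "\<And>h. norm h \<le> r \<Longrightarrow> f (x + h) = msub (h /\<^sub>R r) c"
  using assms by (auto simp: has_mps_def)
 show "bounded_linear (\<lambda>h. \<Sum>j\<in>UNIV. coef c (axis j 1) * (h $ j / r))"
  unfolding divide_inverse by (intro bounded_linear_intros bounded_linear_vec_nth)
 have fx: "f x = coef c 0"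
 proof -
  have "f (x + 0) = msub 0 c" using f[of 0] r by simp
  also have "\<dots> = coef c 0" using msub_taylor[of 0 c 0] by (simp add: mi_order_eq_0)
  finally show ?thesis by simp
 qed
 show "((\<lambda>y. norm c / r\<^sup>2 * norm (y - x)) \<longlongrightarrow> 0) (at x)"
  using r by (auto intro!: tendsto_eq_intros)
 show "norm (f y - f x - (\<Sum>j\<in>UNIV. coef c (axis j 1) * ((y - x) $ j / r))) / norm (y - x) \<le> norm c / r\<^sup>2 * norm (y - x)"
  if "y \<noteq> x" "dist y x < r" for y
 proof -
  define h where "h = y - x"
  have h: "norm h \<le> r" "h \<noteq> 0" using that by (auto simp: h_def dist_norm)
  define t where "t = h /\<^sub>R r"
  have t: "norm t \<le> 1" using h r by (simp add: t_def field_simps)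
  have "f y = msub t c" using f[OF h(1)] by (simp add: h_def t_def)
  moreover have "(\<Sum>\<alpha> | mi_order \<alpha> \<le> 1. coef c \<alpha> * mi_power t \<alpha>) = coef c 0 + (\<Sum>j\<in>UNIV. coef c (axis j 1) * (h $ j / r))"
  proof -
   have inj: "inj (\<lambda>j::3. axis j (1::nat))" by (auto simp: inj_def axis_eq_axis)
   have "0 \<notin> range (\<lambda>j::3. axis j (1::nat))" using axis_neq_0 by (metis imageE)
   then show ?thesis
    unfolding mi_order_le_1 by (subst sum.insert) (auto simp: sum.reindex[OF inj] t_def divide_inverse mult_ac)
  qed
  ultimately have "\<bar>f y - f x - (\<Sum>j\<in>UNIV. coef c (axis j 1) * (h $ j / r))\<bar> \<le> norm c * norm t ^ 2"
   using msub_taylor[OF t, of c 1] fx by (simp add: numeral_2_eq_2 algebra_simps)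
  also have "norm c * norm t ^ 2 = norm c / r\<^sup>2 * norm h * norm h"
   using r by (simp add: t_def power2_eq_square field_simps)
  finally show ?thesis using h(2) unfolding h_def[symmetric]
   by (simp add: divide_le_eq)
 qed
qed (use assms in \<open>auto simp: has_mps_def\<close>)

lemma analytic_pt_differentiable: "analytic_pt f x \<Longrightarrow> f differentiable (at x)"
 unfolding analytic_pt_def differentiable_def using has_mps_has_derivative by blast

lemma axis_nth_if: "axis j x $ i = (if i = j then x else 0)"
 by (simp add: axis_def)

lemma has_mps_partial_deriv:
 assumes "has_mps f x r c"
 shows "partial_deriv j f x = coef c (axis j 1) / r"
proof -
 have "frechet_derivative f (at x) = (\<lambda>h. \<Sum>j\<in>UNIV. coef c (axis j 1) * (h $ j / r))"
  using frechet_derivative_at[OF has_mps_has_derivative[OF assms]] by simp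
 then have "partial_deriv j f x = (\<Sum>i\<in>UNIV. if j = i then coef c (axis i 1) / r else 0)"
  unfolding partial_deriv_def by (simp only: axis_nth_if) (intro sum.cong refl, simp)
 then show ?thesis by simp
qed

subsection \<open>Derivatives of analytic functions are analytic\<close>

lemma plus_eq_axis_iff:
 fixes a b :: "nat^3"
 shows "a + b = axis j 1 \<longleftrightarrow> a = 0 \<and> b = axis j 1 \<or> a = axis j 1 \<and> b = 0"
proof
 assume *: "a + b = axis j 1"
 have ab: "a $ i + b $ i = (if i = j then 1 else 0)" for i
  using arg_cong[OF *, of "\<lambda>v. v $ i"] by (simp add: axis_nth_if)
 have *: "c = 0" if "\<And>i. c $ i = 0" for c :: "nat^3" using that by (simp add: vec_eq_iff)
 have **: "c = axis j 1" if "\<And>i. c $ i = (if i = j then 1 else 0)" for c :: "nat^3"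
  using that by (simp add: vec_eq_iff axis_nth_if)
 have "a $ j = 0 \<and> b $ j = 1 \<or> a $ j = 1 \<and> b $ j = 0" using ab[of j] by auto
 then show "a = 0 \<and> b = axis j 1 \<or> a = axis j 1 \<and> b = 0"
 proof
  assume "a $ j = 0 \<and> b $ j = 1"
  then have "a $ i = 0" "b $ i = (if i = j then 1 else 0)" for i
   using ab[of i] by (auto split: if_splits)
  then show ?thesis using *[of a] **[of b] by blast
 next
  assume "a $ j = 1 \<and> b $ j = 0"
  then have "b $ i = 0" "a $ i = (if i = j then 1 else 0)" for i
   using ab[of i] by (auto split: if_splits)
  then show ?thesis using *[of b] **[of a] by blast
 qed
qed auto

lemma plus_eq_zero_iff: "a + b = 0 \<longleftrightarrow> a = 0 \<and> b = (0::nat^3)"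
 by (auto simp: vec_eq_iff)

lemma coef_times_0: "coef (f * g) 0 = coef f 0 * coef g 0"
proof -
 have "{p::(nat^3)\<times>(nat^3). fst p + snd p = 0} = {(0, 0)}"
  by (auto simp: plus_eq_zero_iff)
 then show ?thesis by (simp add: times_mps.rep_eq)
qed

lemma coef_times_axis: "coef (f * g) (axis j 1) = coef f 0 * coef g (axis j 1) + coef f (axis j 1) * coef g 0"
proof -
 have "{p::(nat^3)\<times>(nat^3). fst p + snd p = axis j 1} = {(0, axis j 1), (axis j 1, 0)}"
  by (auto simp: plus_eq_axis_iff)
 then show ?thesis by (simp add: times_mps.rep_eq axis_neq_0)
qed

lemma coef_one: "coef 1 \<alpha> = (if \<alpha> = 0 then 1 else 0)"
 by (simp add: one_mps.rep_eq)

lemma coef_power_0: "coef (f ^ n) 0 = coef f 0 ^ n"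
 by (induction n) (auto simp: coef_one coef_times_0)

lemma coef_power_axis: "coef (f ^ n) (axis j 1) = real n * coef f 0 ^ (n - 1) * coef f (axis j 1)"
proof (induction n)
 case (Suc n)
 have "coef (f ^ Suc n) (axis j 1) = coef f 0 * (real n * coef f 0 ^ (n - 1) * coef f (axis j 1)) + coef f (axis j 1) * coef f 0 ^ n"
  by (simp only: power_Suc coef_times_axis Suc.IH coef_power_0)
 then show ?case by (cases n) (simp_all add: algebra_simps)
qed (simp add: coef_one axis_neq_0)

lemma coef_shift_vec:
 "coef (shift_vec s $ i) 0 = s $ i" "coef (shift_vec s $ i) (axis j 1) = (if i = j then 1 / 2 else 0)"
 using axis_neq_0[of i] axis_neq_0[of j] by (auto simp: shift_vec_def mX_def coef_mon coef_one axis_eq_axis)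

lemma prod_3: "prod f (UNIV::3 set) = f 1 * f 2 * f 3"
 unfolding UNIV_3 by (simp add: mult_ac)

text \<open>The coefficient at a unit multi-index obeys the product rule, so it acts as a derivative
  at 0. If \<open>\<alpha> $ j = 0\<close>, the truncated subtraction in the exponent is harmless
  because of the factor \<open>real (\<alpha> $ j)\<close>.\<close>

lemma coef_mono_pow_shift:
 "coef (mono_pow (shift_vec s) \<alpha>) (axis j 1) = (1/2) * real (\<alpha> $ j) * mi_power s (\<alpha> - axis j 1)"
proof -
 have z: "(\<alpha> - axis j 1) $ i = (if i = j then \<alpha> $ i - 1 else \<alpha> $ i)" for i
  by (simp add: axis_nth_if)
 have ne: "(1::3) \<noteq> 2" "(1::3) \<noteq> 3" "(2::3) \<noteq> 1" "(2::3) \<noteq> 3" "(3::3) \<noteq> 1" "(3::3) \<noteq> 2"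
  by simp_all
 define A where "A i = shift_vec s $ i ^ (\<alpha> $ i)" for i
 have A0: "coef (A i) 0 = s $ i ^ (\<alpha> $ i)" for i
  by (simp only: A_def coef_power_0 coef_shift_vec)
 have A1: "coef (A i) (axis j 1) = (if i = j then (1/2) * real (\<alpha> $ j) * s $ j ^ (\<alpha> $ j - 1) else 0)" for i
  by (simp only: A_def coef_power_axis coef_shift_vec) simp
 have m: "mi_power s (\<alpha> - axis j 1) = (s $ 1 ^ (if 1 = j then \<alpha> $ 1 - 1 else \<alpha> $ 1)) * (s $ 2 ^ (if 2 = j then \<alpha> $ 2 - 1 else \<alpha> $ 2)) * (s $ 3 ^ (if 3 = j then \<alpha> $ 3 - 1 else \<alpha> $ 3))"
  by (simp only: mi_power_def prod_3 z)
 have l: "coef (mono_pow (shift_vec s) \<alpha>) (axis j 1) = coef (A 1 * A 2 * A 3) (axis j 1)"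
  by (simp only: mono_pow_def prod_3 A_def)
 show ?thesis
  unfolding l m coef_times_axis coef_times_0 A0 A1
  using exhaust_3[of j] by (elim disjE) (simp_all only: ne if_True if_False refl simp_thms, simp_all)
qed

text \<open>Up to a constant factor, the series of the partial derivative on half the radius. The
  power of 2 compensates the factor \<open>\<beta> $ j + 1\<close> produced by differentiation,
  which preserves absolute summability.\<close>

definition mderiv :: "3 \<Rightarrow> mps \<Rightarrow> mps"
 where "mderiv j c = Abs_mps (\<lambda>\<beta>. coef c (\<beta> + axis j 1) * (real (\<beta> $ j) + 1) / 2 ^ Suc (mi_order \<beta>))"

lemma Suc_le_power_2: "real n + 1 \<le> 2 ^ n"
 by (induction n) auto

lemma coef_mderiv: "coef (mderiv j c) \<beta> = coef c (\<beta> + axis j 1) * (real (\<beta> $ j) + 1) / 2 ^ Suc (mi_order \<beta>)"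
proof -
 have "(\<lambda>\<beta>. coef c (\<beta> + axis j 1) * (real (\<beta> $ j) + 1) / 2 ^ Suc (mi_order \<beta>)) abs_summable_on UNIV"
 proof (rule summable_on_comparison_test)
  have "inj (\<lambda>\<beta>::nat^3. \<beta> + axis j 1)" by (simp add: inj_def)
  moreover have "(\<lambda>\<alpha>. \<bar>coef c \<alpha>\<bar>) summable_on range (\<lambda>\<beta>. \<beta> + axis j 1)"
   by (rule summable_on_subset_banach[of _ UNIV]) auto
  ultimately show "(\<lambda>\<beta>. \<bar>coef c (\<beta> + axis j 1)\<bar>) summable_on UNIV"
   using summable_on_reindex[of "\<lambda>\<beta>. \<beta> + axis j 1" UNIV "\<lambda>\<alpha>. \<bar>coef c \<alpha>\<bar>"] by (simp add: o_def)
  fix \<beta> :: "nat^3"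
  have "\<beta> $ j \<le> mi_order \<beta>"
   using member_le_sum[of j UNIV "\<lambda>j. \<beta> $ j"] by (simp add: mi_order_def)
  then have "real (\<beta> $ j) + 1 \<le> 2 ^ Suc (mi_order \<beta>)"
   using Suc_le_power_2[of "\<beta> $ j"] power_increasing[of "\<beta> $ j" "Suc (mi_order \<beta>)" "2::real"] by linarith
  then have "\<bar>coef c (\<beta> + axis j 1)\<bar> * (real (\<beta> $ j) + 1) \<le> \<bar>coef c (\<beta> + axis j 1)\<bar> * 2 ^ Suc (mi_order \<beta>)"
   by (intro mult_left_mono) auto
  then show "norm (coef c (\<beta> + axis j 1) * (real (\<beta> $ j) + 1) / 2 ^ Suc (mi_order \<beta>)) \<le> \<bar>coef c (\<beta> + axis j 1)\<bar>"
   by (simp add: abs_mult divide_le_eq del: power_Suc)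
 qed auto
 then show ?thesis by (simp add: mderiv_def Abs_mps_inverse)
qed

lemma coef_msub_shift:
 assumes "norm s \<le> 1 / 2"
 shows "coef (msub (shift_vec s) c) (axis j 1) = msub (2 *\<^sub>R s) (mderiv j c)"
proof -
 have "coef (msub (shift_vec s) c) (axis j 1) = (\<Sum>\<^sub>\<infinity>\<alpha>. coef c \<alpha> * ((1/2) * real (\<alpha> $ j) * mi_power s (\<alpha> - axis j 1)))"
  unfolding msub_def mpair_def
  using infsum_bounded_linear[OF bounded_linear_coef[of "axis j 1"], OF mpair_summable[OF norm_mono_pow_le[OF norm_shift_vec[OF assms]]], of c]
  by (simp add: o_def coef_mono_pow_shift)
 also have "\<dots> = (\<Sum>\<^sub>\<infinity>\<alpha>\<in>range (\<lambda>\<beta>. \<beta> + axis j 1). coef c \<alpha> * ((1/2) * real (\<alpha> $ j) * mi_power s (\<alpha> - axis j 1)))"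
 proof (rule infsum_cong_neutral)
  fix \<alpha> :: "nat^3" assume "\<alpha> \<in> UNIV - range (\<lambda>\<beta>. \<beta> + axis j 1)"
  then have "\<alpha> \<noteq> (\<alpha> - axis j 1) + axis j 1" by blast
  then have "\<alpha> $ j = 0" by (auto simp: vec_eq_iff axis_def split: if_splits)
  then show "coef c \<alpha> * ((1/2) * real (\<alpha> $ j) * mi_power s (\<alpha> - axis j 1)) = 0" by simp
 qed auto
 also have "\<dots> = (\<Sum>\<^sub>\<infinity>\<beta>. coef c (\<beta> + axis j 1) * ((1/2) * real ((\<beta> + axis j 1) $ j) * mi_power s (\<beta> + axis j 1 - axis j 1)))"
  by (subst infsum_reindex) (auto simp: inj_def o_def)
 also have "\<dots> = (\<Sum>\<^sub>\<infinity>\<beta>. coef (mderiv j c) \<beta> *\<^sub>R mono_pow (2 *\<^sub>R s) \<beta>)"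
  by (intro infsum_cong) (auto simp: coef_mderiv mono_pow_real mi_power_scaleR axis_def)
 finally show ?thesis by (simp add: msub_def mpair_def)
qed

text \<open>The derivative at \<open>x + h\<close> is the linear coefficient of the series recentred
  there, and by \<open>coef_msub_shift\<close> this coefficient is itself a power series in
  \<open>h\<close>.\<close>

lemma analytic_pt_partial_deriv:
 assumes "analytic_pt f x"
 shows "analytic_pt (partial_deriv j f) x"
proof -
 obtain r c where rc: "has_mps f x r c" using assms by (auto simp: analytic_pt_def)
 then have r: "r > 0" by (simp add: has_mps_def)
 have "partial_deriv j f (x + h) = msub (h /\<^sub>R (r / 2)) ((2 / r) *\<^sub>R mderiv j c)" if h: "norm h \<le> r / 2" for h
 proof -
  have n: "norm (h /\<^sub>R r) \<le> 1 / 2" using h r by (simp add: field_simps)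
  then have n2: "norm (h /\<^sub>R (r / 2)) \<le> 1" using r h by (simp add: field_simps)
  have "partial_deriv j f (x + h) = coef (msub (shift_vec (h /\<^sub>R r)) c) (axis j 1) / (r / 2)"
   by (rule has_mps_partial_deriv[OF has_mps_shift[OF rc h]])
  also have "\<dots> = (2 / r) * msub (2 *\<^sub>R (h /\<^sub>R r)) (mderiv j c)"
   by (simp add: coef_msub_shift[OF n])
  also have "2 *\<^sub>R (h /\<^sub>R r) = h /\<^sub>R (r / 2)" by (simp add: field_simps)
  also have "(2 / r) * msub (h /\<^sub>R (r / 2)) (mderiv j c) = msub (h /\<^sub>R (r / 2)) ((2 / r) *\<^sub>R mderiv j c)"
   by (simp only: msub_scaleR[OF component_le_one[OF n2]] real_scaleR_def)
  finally show ?thesis .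
 qed
 then have "has_mps (partial_deriv j f) x (r / 2) ((2 / r) *\<^sub>R mderiv j c)"
  using r by (simp add: has_mps_def)
 then show ?thesis by (auto simp: analytic_pt_def)
qed

lemma analytic_smooth:
 assumes "\<And>x. analytic_pt f x"
 shows "smooth f"
proof -
 have "C_k k f" if "\<And>x. analytic_pt f x" for k f
  using that
 proof (induction k arbitrary: f)
  case 0
  then show ?case
   by (auto intro!: continuous_at_imp_continuous_on differentiable_imp_continuous_within analytic_pt_differentiable)
 next
  case (Suc k)
  then show ?case by (auto intro: analytic_pt_differentiable analytic_pt_partial_deriv)
 qed
 then show ?thesis using assms by (simp add: smooth_def)
qed

subsection \<open>Unique continuation\<close>

text \<open>Split into homogeneous parts \<open>H n\<close>. If the lower parts vanish, Taylor's
  bound along the ray through \<open>s\<close> gives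
  \<open>l^n * |H n s| \<le> norm c * l^(n+1)\<close>, and letting \<open>l\<close> tend to 0 kills
  \<open>H n\<close>. The remainder estimate then kills the whole series.\<close>

lemma msub_zero_extend:
 assumes d: "d > 0" and zero: "\<And>t::real^3. norm t \<le> d \<Longrightarrow> msub t c = (0::real)"
  and s: "norm (s::real^3) < 1"
 shows "msub s c = 0"
proof -
 define H where "H n s = (\<Sum>\<alpha> | mi_order \<alpha> = n. coef c \<alpha> * mi_power s \<alpha>)" for n s
 have fin: "finite {\<alpha>. mi_order \<alpha> = n}" for n
  by (rule finite_subset[OF _ finite_mi_order_le[of n]]) auto
 have sumH: "(\<Sum>\<alpha> | mi_order \<alpha> \<le> M. coef c \<alpha> * mi_power s \<alpha>) = (\<Sum>n\<le>M. H n s)" for M s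
 proof -
  have "{\<alpha>. mi_order \<alpha> \<le> M} = (\<Union>n\<le>M. {\<alpha>. mi_order \<alpha> = n})" by auto
  then show ?thesis unfolding H_def by (simp only:) (rule sum.UNION_disjoint; use fin in auto)
 qed
 have Hsc: "H n (l *\<^sub>R s) = l ^ n * H n s" for n l s
  unfolding H_def sum_distrib_left by (intro sum.cong) (auto simp: mi_power_scaleR)
 have H0: "H n s = 0" if "norm s < 1" for n s
 proof (induction n rule: less_induct)
  case (less n)
  have le: "\<bar>H n s\<bar> \<le> norm c * l" if l: "0 < l" "l \<le> min 1 d" for l
  proof -
   have ls: "norm (l *\<^sub>R s) \<le> l" using l \<open>norm s < 1\<close> by (simp add: mult_left_le)
   have "\<bar>(\<Sum>n\<le>n. H n (l *\<^sub>R s))\<bar> \<le> norm c * norm (l *\<^sub>R s) ^ Suc n"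
    using msub_taylor[of "l *\<^sub>R s" c n] zero[of "l *\<^sub>R s"] order_trans[OF ls, of 1] order_trans[OF ls, of d] l
    by (simp add: sumH del: norm_scaleR)
   also have "(\<Sum>n\<le>n. H n (l *\<^sub>R s)) = H n (l *\<^sub>R s)"
   proof -
    have "(\<Sum>n\<le>n. H n (l *\<^sub>R s)) = (\<Sum>m<n. H m (l *\<^sub>R s)) + H n (l *\<^sub>R s)"
     by (simp flip: lessThan_Suc_atMost)
    also have "(\<Sum>m<n. H m (l *\<^sub>R s)) = 0" using less by (intro sum.neutral) (auto simp: Hsc)
    finally show ?thesis by simp
   qed
   finally have "l ^ n * \<bar>H n s\<bar> \<le> norm c * norm (l *\<^sub>R s) ^ Suc n"
    using l by (simp add: Hsc abs_mult)
   also have "\<dots> \<le> norm c * l ^ Suc n" using ls by (intro mult_left_mono power_mono) auto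
   finally show ?thesis using l by (simp add: mult.commute mult.left_commute)
  qed
  have "\<bar>H n s\<bar> \<le> 0"
  proof (rule tendsto_lowerbound)
   show "((\<lambda>l. norm c * l) \<longlongrightarrow> 0) (at_right 0)" by (auto intro!: tendsto_eq_intros)
   have "0 < min 1 d" using d by simp
   then show "\<forall>\<^sub>F l in at_right 0. \<bar>H n s\<bar> \<le> norm c * l"
    unfolding eventually_at_right[OF \<open>0 < min 1 d\<close>] using le by (intro exI[of _ "min 1 d"]) auto
  qed simp
  then show ?case by simp
 qed
 have "\<bar>msub s c\<bar> \<le> norm c * norm s ^ Suc M" for M
  using msub_taylor[of s c M] s by (simp add: sumH H0)
 moreover have "(\<lambda>M. norm c * norm s ^ Suc M) \<longlonglongrightarrow> norm c * 0"
  using s by (intro tendsto_mult tendsto_const LIMSEQ_Suc LIMSEQ_realpow_zero) auto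
 ultimately have "\<bar>msub s c\<bar> \<le> 0"
  by (intro tendsto_lowerbound[of _ _ sequentially]) auto
 then show ?thesis by simp
qed

lemma analytic_unique_continuation:
 assumes an: "\<And>x. analytic_pt f x" and "has_mps f 0 r c" "\<And>\<alpha>. coef c \<alpha> = 0"
 shows "f x = 0"
proof -
 define Z where "Z = interior {x. f x = 0}"
 have "open Z"
  unfolding Z_def by simp
 moreover have "closed Z"
  unfolding closed_sequential_limits
 proof (intro allI impI)
  fix X x assume X: "(\<forall>n. X n \<in> Z) \<and> X \<longlonglongrightarrow> x"
  obtain R d where R: "has_mps f x R d" using an[of x] by (auto simp: analytic_pt_def)
  then have Rp: "R > 0" by (simp add: has_mps_def)
  \<comment> \<open>Recentring at a point \<open>z\<close> closer to \<open>x\<close> than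
    \<open>R / 4\<close> leaves a series on radius \<open>R / 2\<close> around \<open>z\<close>;
    that ball contains the ball of radius \<open>R / 4\<close> around \<open>x\<close>.\<close>
  then obtain n where n: "dist (X n) x < R / 4"
   using X metric_LIMSEQ_D[of X x "R / 4"] by auto
  define z where "z = X n"
  have "z \<in> interior {x. f x = 0}" using X by (simp add: Z_def z_def)
  then obtain e where e0: "e > 0" "ball z e \<subseteq> {x. f x = 0}" unfolding mem_interior by blast
  then have e: "e > 0" "\<And>y. dist z y < e \<Longrightarrow> f y = 0" by auto
  have nz: "norm (z - x) < R / 4" using n by (simp add: z_def dist_norm)
  define d' where "d' = msub (shift_vec ((z - x) /\<^sub>R R)) d"
  have hz: "has_mps f z (R / 2) d'"
   using has_mps_shift[OF R, of "z - x"] nz Rp by (simp add: d'_def)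
  have fz: "f (z + h) = msub (h /\<^sub>R (R / 2)) d'" if "norm h \<le> R / 2" for h
   using hz that by (simp add: has_mps_def)
  define b where "b = min 1 (e / R)"
  have b: "b > 0" using e Rp by (simp add: b_def)
  have ze: "msub t d' = 0" if t: "norm t \<le> b" for t :: "real^3"
  proof -
   have "norm ((R / 2) *\<^sub>R t) < e" "norm ((R / 2) *\<^sub>R t) \<le> R / 2"
   proof -
    have "norm t \<le> e / R" "norm t \<le> 1" using t by (auto simp: b_def)
    then have "R * norm t \<le> e" "R * norm t \<le> R" using Rp by (auto simp: field_simps)
    moreover have "norm ((R / 2) *\<^sub>R t) = R * norm t / 2" using Rp by simp
    ultimately show "norm ((R / 2) *\<^sub>R t) < e" "norm ((R / 2) *\<^sub>R t) \<le> R / 2" using e(1) by linarith+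
   qed
   then show ?thesis
    using fz[of "(R / 2) *\<^sub>R t"] e(2)[of "z + (R / 2) *\<^sub>R t"] Rp by (simp add: dist_norm)
  qed
  have "f y = 0" if "dist x y < R / 4" for y
  proof -
   have "norm (y - z) < R / 2"
    using that nz norm_triangle_ineq[of "y - x" "x - z"] by (simp add: dist_norm norm_minus_commute)
   then have 1: "norm ((y - z) /\<^sub>R (R / 2)) < 1"
    using Rp by (simp add: divide_less_eq inverse_eq_divide)
   have "f (z + (y - z)) = msub ((y - z) /\<^sub>R (R / 2)) d'"
    using \<open>norm (y - z) < R / 2\<close> by (intro fz) simp
   also have "\<dots> = 0" by (rule msub_zero_extend[OF b ze 1])
   finally show ?thesis by simp
  qed
  then show "x \<in> Z" unfolding Z_def mem_interior using Rp by (intro exI[of _ "R / 4"]) auto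
 qed
 moreover have "0 \<in> Z"
 proof -
  have "c = 0" using assms(3) by (intro mps_eqI) simp
  have "f y = 0" if "dist 0 y < r" for y
  proof -
   have "f (0 + y) = msub (y /\<^sub>R r) c" using assms(2) that by (simp add: has_mps_def)
   then show ?thesis by (simp add: \<open>c = 0\<close> msub_def mpair_def)
  qed
  then show ?thesis using assms(2) unfolding Z_def has_mps_def mem_interior by auto
 qed
 ultimately have "Z = UNIV" using clopen[of Z] by auto
 then have "x \<in> Z" by simp
 then show ?thesis unfolding Z_def using interior_subset by blast
qed

section \<open>Cutoffs of the regularised Newton potential as test functions\<close>

text \<open>Dividing the standard flat function \<open>bumpf 0\<close> by powers of \<open>s\<close>
  gives a family whose linear span is closed under differentiation.\<close>

definition bumpf :: "nat \<Rightarrow> real \<Rightarrow> real"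
 where "bumpf n s = (if s > 0 then exp (- 1 / s) / s ^ n else 0)"

lemma bumpf_nonneg: "0 \<le> bumpf n s"
 by (simp add: bumpf_def)

text \<open>A single term of the exponential series bounds \<open>exp (1 / s)\<close> from below.
  The case \<open>k = 0\<close> bounds the functions, the case \<open>k = 2\<close> gives the
  derivative 0 at the origin.\<close>

lemma bumpf_le:
 assumes "s > 0"
 shows "bumpf n s \<le> fact (n + k) * s ^ k"
proof -
 have "(1 / s) ^ (n + k) /\<^sub>R fact (n + k) \<le> exp (1 / s)"
 proof -
  have "(\<Sum>i\<in>{n + k}. (1 / s) ^ i /\<^sub>R fact i) \<le> (\<Sum>i. (1 / s) ^ i /\<^sub>R fact i)"
   by (rule sum_le_suminf[OF summable_exp_generic]) (use assms in auto)
  then show ?thesis by (simp add: exp_def)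
 qed
 then have "fact (n + k) * ((1 / s) ^ (n + k) /\<^sub>R fact (n + k)) \<le> fact (n + k) * exp (1 / s)"
  by (intro mult_left_mono) auto
 then have "1 / s ^ (n + k) \<le> fact (n + k) * exp (1 / s)"
  by (simp add: power_divide)
 then have "exp (- 1 / s) * (1 / s ^ (n + k)) * s ^ k \<le> exp (- 1 / s) * (fact (n + k) * exp (1 / s)) * s ^ k"
  using assms by (intro mult_right_mono mult_left_mono) auto
 moreover have "exp (- 1 / s) * (fact (n + k) * exp (1 / s)) * s ^ k = fact (n + k) * s ^ k"
  by (simp add: exp_minus)
 moreover have "exp (- 1 / s) * (1 / s ^ (n + k)) * s ^ k = bumpf n s"
  using assms by (simp add: bumpf_def power_add)
 ultimately show ?thesis by linarith
qed

lemma bumpf_bound: "bumpf n s \<le> fact n"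
 using bumpf_le[of s n 0] by (cases "s > 0") (auto simp: bumpf_def)

lemma bumpf_deriv: "(bumpf n has_real_derivative bumpf (n + 2) s - real n * bumpf (n + 1) s) (at s)"
proof (cases s "0::real" rule: linorder_cases)
 case less
 have "((\<lambda>_. 0) has_real_derivative 0) (at s)" by simp
 then have "(bumpf n has_real_derivative 0) (at s)"
  by (rule has_field_derivative_transform_within_open[of _ _ _ "{..<0}"])
    (use less in \<open>auto simp: bumpf_def\<close>)
 then show ?thesis using less by (simp add: bumpf_def)
next
 case greater
 have "((\<lambda>s. exp (- 1 / s) / s ^ n) has_real_derivative bumpf (n + 2) s - real n * bumpf (n + 1) s) (at s)"
  using greater
  by (auto intro!: derivative_eq_intros simp: bumpf_def field_simps power2_eq_square)
    (cases n; simp add: field_simps power_add)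
 then show ?thesis
  by (rule has_field_derivative_transform_within_open[of _ _ _ "{0<..}"])
    (use greater in \<open>auto simp: bumpf_def\<close>)
next
 case equal
 have "(\<lambda>h. (bumpf n (0 + h) - bumpf n 0) / h) \<midarrow>0\<rightarrow> 0"
 proof (rule Lim_null_comparison)
  show "(\<lambda>h. fact (n + 2) * \<bar>h\<bar>) \<midarrow>0\<rightarrow> (0::real)" by (auto intro!: tendsto_eq_intros)
  have "norm ((bumpf n (0 + h) - bumpf n 0) / h) \<le> fact (n + 2) * \<bar>h\<bar>" for h
  proof (cases "h > 0")
   case True
   then show ?thesis using bumpf_le[of h n 2] bumpf_nonneg[of n h]
    by (simp add: bumpf_def[of n 0] divide_le_eq power2_eq_square mult.assoc)
  next
   case False
   then have "norm ((bumpf n (0 + h) - bumpf n 0) / h) = 0" by (simp add: bumpf_def)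
   also have "0 \<le> fact (n + 2) * \<bar>h\<bar>" by (intro mult_nonneg_nonneg) auto
   finally show ?thesis .
  qed
  then show "\<forall>\<^sub>F h in at 0. norm ((bumpf n (0 + h) - bumpf n 0) / h) \<le> fact (n + 2) * \<bar>h\<bar>"
   by simp
 qed
 then have "(bumpf n has_real_derivative 0) (at 0)" by (simp add: DERIV_def)
 then show ?thesis using equal by (simp add: bumpf_def)
qed

lemma bumpf_chain:
 "((\<lambda>s. bumpf n (1 - s / c)) has_real_derivative (bumpf (n + 2) (1 - s / c) + (- real n) * bumpf (n + 1) (1 - s / c)) * (- 1 / c)) (at s)"
proof -
 have "((\<lambda>s. 1 - s / c) has_real_derivative - 1 / c) (at s)"
  unfolding divide_inverse by (auto intro!: derivative_eq_intros)
 from DERIV_chain2[OF bumpf_deriv this] show ?thesis by simp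
qed

lemma bumpf_tendsto: "isCont (bumpf n) s"
 by (rule DERIV_isCont[OF bumpf_deriv])

text \<open>A class of functions that contains the regularised and truncated potentials and is closed under
 partial derivatives, which gives their smoothness.\<close>

inductive elem :: "real^3 \<Rightarrow> real \<Rightarrow> real \<Rightarrow> (real^3 \<Rightarrow> real) \<Rightarrow> bool" for x0 d R where
 const: "elem x0 d R (\<lambda>x. c)"
| coord: "elem x0 d R (\<lambda>x. x $ j)"
| bump: "elem x0 d R (\<lambda>x. bumpf n (1 - sqd x0 x / R\<^sup>2))"
| powr: "elem x0 d R (\<lambda>x. (sqd x0 x + d) powr p)"
| add: "elem x0 d R f \<Longrightarrow> elem x0 d R g \<Longrightarrow> elem x0 d R (\<lambda>x. f x + g x)"
| mult: "elem x0 d R f \<Longrightarrow> elem x0 d R g \<Longrightarrow> elem x0 d R (\<lambda>x. f x * g x)"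

definition has_grad :: "(real^3 \<Rightarrow> real) \<Rightarrow> (3 \<Rightarrow> real^3 \<Rightarrow> real) \<Rightarrow> bool"
 where "has_grad f g \<longleftrightarrow> (\<forall>x. (f has_derivative (\<lambda>h. \<Sum>j\<in>UNIV. g j x * h $ j)) (at x))"

lemma has_grad_partial_deriv: "has_grad f g \<Longrightarrow> partial_deriv j f = g j"
proof
 fix x assume "has_grad f g"
 then have "frechet_derivative f (at x) = (\<lambda>h. \<Sum>j\<in>UNIV. g j x * h $ j)"
  by (intro frechet_derivative_at[symmetric]) (simp add: has_grad_def)
 then have "partial_deriv j f x = (\<Sum>i\<in>UNIV. if j = i then g j x else 0)"
  unfolding partial_deriv_def by (simp only: axis_nth_if) (intro sum.cong refl, simp)
 then show "partial_deriv j f x = g j x" by simp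
qed

text \<open>Coordinate differences are written as \<open>x $ j + - x0 $ j\<close> so that the
  closure rules of \<open>elem\<close>, which include sums, match them syntactically.\<close>

lemma has_grad_radial:
 assumes "\<And>s. s \<ge> 0 \<Longrightarrow> (g has_real_derivative g' s) (at s)"
 shows "has_grad (\<lambda>x. g (sqd x0 x)) (\<lambda>j x. g' (sqd x0 x) * (2 * (x $ j + - x0 $ j)))"
 unfolding has_grad_def
proof
 fix x
 have "((\<lambda>x. sqd x0 x) has_derivative (\<lambda>h. 2 * ((x - x0) \<bullet> h))) (at x)"
  by (auto intro!: derivative_eq_intros simp: inner_commute)
 then have "((\<lambda>x. g (sqd x0 x)) has_derivative (\<lambda>h. g' (sqd x0 x) * (2 * ((x - x0) \<bullet> h)))) (at x)"
  using assms[of "sqd x0 x"] has_derivative_compose[of "\<lambda>x. sqd x0 x" _ x UNIV g]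
  by (auto simp: has_field_derivative_def o_def)
 moreover have "(\<lambda>h. g' (sqd x0 x) * (2 * ((x - x0) \<bullet> h))) =
   (\<lambda>h. \<Sum>j\<in>UNIV. g' (sqd x0 x) * (2 * (x $ j + - x0 $ j)) * h $ j)"
  by (simp add: fun_eq_iff inner_vec_def sum_distrib_left mult_ac)
 ultimately show "((\<lambda>x. g (sqd x0 x)) has_derivative
   (\<lambda>h. \<Sum>j\<in>UNIV. g' (sqd x0 x) * (2 * (x $ j + - x0 $ j)) * h $ j)) (at x)" by simp
qed

lemma has_grad_mult:
 assumes "has_grad f f'" "has_grad g g'"
 shows "has_grad (\<lambda>x. f x * g x) (\<lambda>j x. f x * g' j x + f' j x * g x)"
 unfolding has_grad_def
proof
 fix x
 have "((\<lambda>x. f x * g x) has_derivative (\<lambda>h. f x * (\<Sum>j\<in>UNIV. g' j x * h $ j) + (\<Sum>j\<in>UNIV. f' j x * h $ j) * g x)) (at x)"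
  using assms by (intro has_derivative_mult) (auto simp: has_grad_def)
 then show "((\<lambda>x. f x * g x) has_derivative (\<lambda>h. \<Sum>j\<in>UNIV. (f x * g' j x + f' j x * g x) * h $ j)) (at x)"
  by (simp add: sum_distrib_left sum_distrib_right sum.distrib algebra_simps)
qed

lemma elem_has_grad:
 assumes "elem x0 d R f" "d > 0"
 shows "\<exists>g. has_grad f g \<and> (\<forall>j. elem x0 d R (g j))"
 using assms(1)
proof induction
 case (const c)
 show ?case
  by (rule exI[of _ "\<lambda>_ _. 0"]) (auto simp: has_grad_def intro: elem.const)
next
 case (coord j)
 have "((\<lambda>x. x $ j) has_derivative (\<lambda>h. \<Sum>i\<in>UNIV. (if j = i then 1 else 0) * h $ i)) (at x)" for x :: "real^3"
 proof -
  have "(\<lambda>h::real^3. \<Sum>i\<in>UNIV. (if j = i then 1 else 0) * h $ i) = (\<lambda>h. h $ j)"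
   by (simp add: fun_eq_iff if_distrib[of "\<lambda>c. c * _"] cong: if_cong)
  then show ?thesis using bounded_linear_imp_has_derivative[OF bounded_linear_vec_nth] by simp
 qed
 then show ?case
  by (intro exI[of _ "\<lambda>i x. if j = i then 1 else 0"]) (auto simp: has_grad_def intro: elem.const)
next
 case (bump n)
 note hg = has_grad_radial[OF bumpf_chain[of n "R\<^sup>2"], of x0]
 show ?case by (rule exI, rule conjI, rule hg) (intro allI elem.intros)
next
 case (powr p)
 have "((\<lambda>s. (s + d) powr p) has_real_derivative p * (s + d) powr (p - 1)) (at s)" if "s \<ge> 0" for s
  using that assms(2) by (auto intro!: derivative_eq_intros)
 note hg = has_grad_radial[OF this, of x0]
 show ?case by (rule exI, rule conjI, rule hg) (assumption, intro allI elem.intros)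
next
 case (add f g)
 then obtain f' g' where fg: "has_grad f f'" "has_grad g g'" "\<And>j. elem x0 d R (f' j)" "\<And>j. elem x0 d R (g' j)" by auto
 have hg: "has_grad (\<lambda>x. f x + g x) (\<lambda>j x. f' j x + g' j x)"
  using fg(1,2) unfolding has_grad_def
  by (auto simp: distrib_right sum.distrib intro!: has_derivative_add)
 show ?case by (rule exI, rule conjI, rule hg) (intro allI elem.add fg(3,4))
next
 case (mult f g)
 then obtain f' g' where fg: "has_grad f f'" "has_grad g g'" "\<And>j. elem x0 d R (f' j)" "\<And>j. elem x0 d R (g' j)" by auto
 show ?case
  by (rule exI, rule conjI, rule has_grad_mult[OF fg(1,2)])
    (intro allI elem.add elem.mult fg(3,4) mult.hyps)
qed

lemma elem_smooth:
 assumes "elem x0 d R f" "d > 0"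
 shows "smooth f"
proof -
 have diff: "f differentiable (at x)" if "elem x0 d R f" for f x
  using elem_has_grad[OF that assms(2)] by (auto simp: has_grad_def differentiable_def)
 have "C_k k f" if "elem x0 d R f" for k f
  using that
 proof (induction k arbitrary: f)
  case 0
  then show ?case
   by (auto intro!: continuous_at_imp_continuous_on differentiable_imp_continuous_within diff)
 next
  case (Suc k)
  obtain g where "has_grad f g" "\<And>j. elem x0 d R (g j)" using elem_has_grad[OF Suc.prems assms(2)] by auto
  then show ?case using Suc by (auto intro: diff simp: has_grad_partial_deriv)
 qed
 then show ?thesis using assms(1) by (simp add: smooth_def)
qed

lemma compact_closure_support:
 fixes f :: "real^3 \<Rightarrow> real"
 assumes "\<And>x. r < norm (x - x0) \<Longrightarrow> f x = 0"
 shows "compact (closure {x. f x \<noteq> 0})"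
proof -
 have "{x. f x \<noteq> 0} \<subseteq> cball x0 r"
  using assms by (auto simp: dist_norm norm_minus_commute not_less[symmetric])
 then have "bounded {x. f x \<noteq> 0}" by (rule bounded_subset[OF bounded_cball])
 then show ?thesis by (simp add: compact_closure)
qed

context
 fixes x0 :: "real^3" and d R :: real
 assumes d: "d > 0" and R: "R \<ge> 1"
begin

text \<open>The profile as a function of the squared distance \<open>s\<close>; \<open>cg1\<close>
  and \<open>cg2\<close> are its first two derivatives in \<open>s\<close>. As \<open>R\<close>
  grows, the cutoff tends to the constant \<open>bumpf 0 1 = exp (- 1)\<close>, which later cancels
  from both sides of the limiting equations.\<close>

definition cg :: "real \<Rightarrow> real"
 where "cg s = (s + d) powr (- 1/2) * bumpf 0 (1 - s / R\<^sup>2)"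
definition cg1 :: "real \<Rightarrow> real"
 where "cg1 s = - 1/2 * (s + d) powr (- 3/2) * bumpf 0 (1 - s / R\<^sup>2) - 1 / R\<^sup>2 * (s + d) powr (- 1/2) * bumpf 2 (1 - s / R\<^sup>2)"
definition cg2 :: "real \<Rightarrow> real"
 where "cg2 s = 3/4 * (s + d) powr (- 5/2) * bumpf 0 (1 - s / R\<^sup>2) + 1 / R\<^sup>2 * (s + d) powr (- 3/2) * bumpf 2 (1 - s / R\<^sup>2)
   + 1 / R ^ 4 * (s + d) powr (- 1/2) * (bumpf 4 (1 - s / R\<^sup>2) - 2 * bumpf 3 (1 - s / R\<^sup>2))"

abbreviation qq :: "real^3 \<Rightarrow> real" where "qq x \<equiv> sqd x0 x"

definition cphi :: "real^3 \<Rightarrow> real" where "cphi x = cg (qq x)"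
definition cphi1 :: "3 \<Rightarrow> real^3 \<Rightarrow> real" where "cphi1 j x = cg1 (qq x) * (2 * (x $ j + - x0 $ j))"
definition cphi2 :: "3 \<Rightarrow> 3 \<Rightarrow> real^3 \<Rightarrow> real"
 where "cphi2 j k x = cg2 (qq x) * (2 * (x $ k + - x0 $ k)) * (2 * (x $ j + - x0 $ j)) + cg1 (qq x) * (if j = k then 2 else 0)"

lemma cg_deriv:
 assumes "s \<ge> 0"
 shows "(cg has_real_derivative cg1 s) (at s)" "(cg1 has_real_derivative cg2 s) (at s)"
proof -
 note b = bumpf_chain[of _ "R\<^sup>2"]
 have p: "((\<lambda>s. (s + d) powr p) has_real_derivative p * (s + d) powr (p - 1)) (at s)" for p
  using assms d by (auto intro!: derivative_eq_intros)
 note p1 = p[of "-1/2"] and p3 = p[of "-3/2"]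
 show "(cg has_real_derivative cg1 s) (at s)"
  unfolding cg_def[abs_def]
  by (rule DERIV_cong[OF DERIV_mult[OF p1 b]]) (simp add: cg1_def numeral_2_eq_2)
 define i where "i = 1 / R\<^sup>2"
 have e: "- 1 / R\<^sup>2 = - i" "1 / R ^ 4 = i * i" "1 / R\<^sup>2 = i"
  by (simp_all add: i_def flip: power_add)
 have n: "0 + 2 = (2::nat)" "2 + 2 = (4::nat)" "2 + 1 = (3::nat)" "- 3 / 2 - 1 = - 5 / (2::real)" "- 1 / 2 - 1 = - 3 / (2::real)"
  by simp_all
 show "(cg1 has_real_derivative cg2 s) (at s)"
  unfolding cg1_def[abs_def]
  by (rule DERIV_cong[OF DERIV_diff[OF DERIV_mult[OF DERIV_cmult[OF p3] b] DERIV_mult[OF DERIV_cmult[OF p1] b]]])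
    (unfold cg2_def e n, simp add: algebra_simps)
qed

lemma cphi_has_grad: "has_grad cphi cphi1"
 using has_grad_radial[OF cg_deriv(1), of x0] unfolding cphi_def[abs_def] cphi1_def[abs_def] .

lemma cphi1_has_grad: "has_grad (cphi1 j) (cphi2 j)"
proof -
 have "has_grad (\<lambda>x. 2 * (x $ j + - x0 $ j)) (\<lambda>i x. if j = i then 2 else 0)"
  unfolding has_grad_def
 proof
  fix x :: "real^3"
  have "(\<lambda>h::real^3. \<Sum>i\<in>UNIV. (if j = i then 2 else 0) * h $ i) = (\<lambda>h. 2 * h $ j)"
   by (simp add: fun_eq_iff if_distrib[of "\<lambda>c. c * _"] cong: if_cong)
  then show "((\<lambda>x. 2 * (x $ j + - x0 $ j)) has_derivative (\<lambda>h. \<Sum>i\<in>UNIV. (if j = i then 2 else 0) * h $ i)) (at x)"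
   by (auto intro!: derivative_eq_intros bounded_linear_imp_has_derivative bounded_linear_vec_nth)
 qed
 from has_grad_mult[OF has_grad_radial[OF cg_deriv(2), of x0] this]
 show ?thesis unfolding cphi1_def[abs_def] cphi2_def[abs_def] by (simp add: add.commute)
qed

lemma cg_zero: "R\<^sup>2 < s \<Longrightarrow> cg s = 0" "R\<^sup>2 < s \<Longrightarrow> cg1 s = 0"
 using R by (auto simp: cg_def cg1_def bumpf_def field_simps)

lemma qq_norm: "qq x = (norm (x - x0))\<^sup>2"
 by (simp add: power2_norm_eq_inner)

lemma cphi_test: "test_function cphi" "test_function (cphi1 j)"
proof -
 have e: "elem x0 d R cphi"
  unfolding cphi_def[abs_def] cg_def by (intro elem.intros)
 have zero: "cphi x = 0" "cphi1 j x = 0" if "R < norm (x - x0)" for x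
 proof -
  have "R\<^sup>2 < qq x" unfolding qq_norm using that R by (intro power_strict_mono) auto
  then show "cphi x = 0" "cphi1 j x = 0" by (auto simp: cphi_def cphi1_def cg_zero)
 qed
 show "test_function cphi"
  unfolding test_function_def by (intro conjI elem_smooth[OF e d] compact_closure_support[of R x0] zero)
 have "smooth cphi" by (rule elem_smooth[OF e d])
 then have "C_k (Suc k) cphi" for k by (simp only: smooth_def)
 then have "smooth (partial_deriv j cphi)" by (simp add: smooth_def)
 then have "smooth (cphi1 j)" by (simp add: has_grad_partial_deriv[OF cphi_has_grad])
 then show "test_function (cphi1 j)"
  unfolding test_function_def by (intro conjI compact_closure_support[of R x0] zero)
qed

lemma mult_mid_cong: "a * b = c * b \<Longrightarrow> a * p * b = c * p * (b::real)"
 by algebra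

lemma powr_shift: "0 < t \<Longrightarrow> t powr (p - real n) * t ^ n = t powr p"
 by (simp add: powr_diff powr_realpow)

text \<open>Bounds uniform in the cutoff radius: on the support, \<open>R powi (- 2)\<close> is absorbed by \<open>(s + d) powi (- 1)\<close>.\<close>

lemma cg_bounds:
 assumes s: "s \<ge> 0"
 shows "\<bar>cg s\<bar> \<le> (s + d) powr (- 1/2)"
  and "\<bar>cg1 s\<bar> \<le> 60 * (1 + d)\<^sup>2 * (s + d) powr (- 3/2)"
  and "\<bar>cg2 s\<bar> \<le> 60 * (1 + d)\<^sup>2 * (s + d) powr (- 5/2)"
proof -
 have sd: "s + d > 0" using s d by simp
 have b0: "\<bar>bumpf 0 t\<bar> \<le> 1" for t using bumpf_bound[of 0 t] bumpf_nonneg[of 0 t] by simp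
 have b2: "\<bar>bumpf 2 t\<bar> \<le> 2" for t using bumpf_bound[of 2 t] bumpf_nonneg[of 2 t] by (simp add: fact_numeral)
 \<comment> \<open>\<open>36 = 4! + 2 * 3!\<close>, since \<open>bumpf n\<close> is bounded by
   \<open>n!\<close>. This is the largest contribution to the final constant:
   \<open>3/4 + 2 + 36 < 60\<close>.\<close>
 have b3: "\<bar>bumpf 4 t - 2 * bumpf 3 t\<bar> \<le> 36" for t
  using bumpf_bound[of 4 t] bumpf_nonneg[of 4 t] bumpf_bound[of 3 t] bumpf_nonneg[of 3 t]
  by (simp add: fact_numeral)
 \<comment> \<open>The value 0 for \<open>s \<ge> R^2\<close> is legitimate because all bump factors
   vanish there; for \<open>s < R^2\<close> the bound on \<open>i\<close> uses
   \<open>R \<ge> 1\<close>.\<close>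
 define i where "i = (if s < R\<^sup>2 then 1 / R\<^sup>2 else 0)"
 have i: "0 \<le> i" "i \<le> (1 + d) / (s + d)"
 proof -
  have "s + d \<le> R\<^sup>2 * (1 + d)" if "s < R\<^sup>2"
  proof -
   have "1 \<le> R\<^sup>2" using R by (simp add: one_le_power)
   then have "d \<le> R\<^sup>2 * d" using d by simp
   then show ?thesis using that by (simp add: distrib_left)
  qed
  then show "0 \<le> i" "i \<le> (1 + d) / (s + d)"
   using R sd d by (auto simp: i_def field_simps)
 qed
 have ib: "1 / R\<^sup>2 * bumpf n (1 - s / R\<^sup>2) = i * bumpf n (1 - s / R\<^sup>2)" for n
  using R by (auto simp: i_def bumpf_def field_simps)
 have P: "(s + d) powr (- 3/2) * (s + d) = (s + d) powr (- 1/2)" "(s + d) powr (- 5/2) * (s + d) = (s + d) powr (- 3/2)"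
  using powr_shift[OF sd, of "-1/2" 1] powr_shift[OF sd, of "-3/2" 1] by simp_all
 have c: "(1 + d) / (s + d) * (t * (s + d)) = (1 + d) * t" for t using sd by simp
 have ip: "i * (s + d) powr (- 1/2) \<le> (1 + d) * (s + d) powr (- 3/2)" "i * (s + d) powr (- 3/2) \<le> (1 + d) * (s + d) powr (- 5/2)"
  using mult_right_mono[OF i(2), of "(s + d) powr (- 3/2) * (s + d)"] mult_right_mono[OF i(2), of "(s + d) powr (- 5/2) * (s + d)"] sd
  unfolding c unfolding P by simp_all
 have d1: "1 + d \<le> (1 + d)\<^sup>2" "1 \<le> (1 + d)\<^sup>2" using d by (auto simp: power2_eq_square algebra_simps)
 show "\<bar>cg s\<bar> \<le> (s + d) powr (- 1/2)"
  unfolding cg_def abs_mult using mult_left_mono[OF b0, of "\<bar>(s + d) powr (- 1/2)\<bar>"] by simp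
 have "\<bar>cg1 s\<bar> \<le> 1/2 * (s + d) powr (- 3/2) * 1 + i * (s + d) powr (- 1/2) * 2"
 proof -
  have e: "cg1 s = - 1/2 * (s + d) powr (- 3/2) * bumpf 0 (1 - s / R\<^sup>2) - i * (s + d) powr (- 1/2) * bumpf 2 (1 - s / R\<^sup>2)"
  proof -
   have "1 / R\<^sup>2 * P * bumpf 2 (1 - s / R\<^sup>2) = i * P * bumpf 2 (1 - s / R\<^sup>2)" for P
    by (rule mult_mid_cong[OF ib])
   then show ?thesis by (simp only: cg1_def)
  qed
  show ?thesis unfolding e
   by (rule order_trans[OF abs_triangle_ineq4]) (use i b0 b2 in \<open>auto simp: abs_mult intro!: add_mono mult_left_mono mult_left_le mult_left_le_one_le\<close>)
 qed
 also have "\<dots> \<le> (1/2 + 2 * (1 + d)) * (s + d) powr (- 3/2)"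
  using ip(1) by (simp add: algebra_simps)
 also have "\<dots> \<le> 60 * (1 + d)\<^sup>2 * (s + d) powr (- 3/2)"
  using d1 by (intro mult_right_mono) auto
 finally show "\<bar>cg1 s\<bar> \<le> 60 * (1 + d)\<^sup>2 * (s + d) powr (- 3/2)" .
 have "\<bar>cg2 s\<bar> \<le> 3/4 * (s + d) powr (- 5/2) * 1 + i * (s + d) powr (- 3/2) * 2 + i * i * (s + d) powr (- 1/2) * 36"
 proof -
  have e: "cg2 s = 3/4 * (s + d) powr (- 5/2) * bumpf 0 (1 - s / R\<^sup>2) + i * (s + d) powr (- 3/2) * bumpf 2 (1 - s / R\<^sup>2)
   + i * i * (s + d) powr (- 1/2) * (bumpf 4 (1 - s / R\<^sup>2) - 2 * bumpf 3 (1 - s / R\<^sup>2))"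
  proof -
   have "1 / R ^ 4 * bumpf n (1 - s / R\<^sup>2) = i * i * bumpf n (1 - s / R\<^sup>2)" for n
   proof -
    have "1 / R ^ 4 = 1 / R\<^sup>2 * (1 / R\<^sup>2)" by (simp flip: power_add)
    then show ?thesis using ib[of n] by (metis mult.assoc mult.left_commute)
   qed
   from this[of 4] this[of 3] have "1 / R ^ 4 * (bumpf 4 (1 - s / R\<^sup>2) - 2 * bumpf 3 (1 - s / R\<^sup>2)) = i * i * (bumpf 4 (1 - s / R\<^sup>2) - 2 * bumpf 3 (1 - s / R\<^sup>2))"
    by (simp add: algebra_simps)
   note mult_mid_cong[OF this]
   then have "1 / R ^ 4 * P * (bumpf 4 (1 - s / R\<^sup>2) - 2 * bumpf 3 (1 - s / R\<^sup>2)) = i * i * P * (bumpf 4 (1 - s / R\<^sup>2) - 2 * bumpf 3 (1 - s / R\<^sup>2))" for P .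
   moreover have "1 / R\<^sup>2 * P * bumpf 2 (1 - s / R\<^sup>2) = i * P * bumpf 2 (1 - s / R\<^sup>2)" for P
    by (rule mult_mid_cong[OF ib])
   ultimately show ?thesis by (simp only: cg2_def)
  qed
  show ?thesis unfolding e
   by (intro order_trans[OF abs_triangle_ineq] add_mono)
     (use i b0 b2 b3 in \<open>auto simp: abs_mult intro!: add_mono mult_left_mono mult_left_le mult_left_le_one_le\<close>)
 qed
 also have "\<dots> \<le> (3/4 + 2 * (1 + d) + 36 * (1 + d)\<^sup>2) * (s + d) powr (- 5/2)"
 proof -
  have "i * (i * (s + d) powr (- 1/2)) \<le> i * ((1 + d) * (s + d) powr (- 3/2))"
   by (rule mult_left_mono[OF ip(1) i(1)])
  also have "\<dots> = (1 + d) * (i * (s + d) powr (- 3/2))" by simp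
  also have "\<dots> \<le> (1 + d) * ((1 + d) * (s + d) powr (- 5/2))"
   using d by (intro mult_left_mono ip(2)) auto
  finally show ?thesis using ip(2) by (simp add: algebra_simps power2_eq_square)
 qed
 also have "\<dots> \<le> 60 * (1 + d)\<^sup>2 * (s + d) powr (- 5/2)"
  using d1 by (intro mult_right_mono) auto
 finally show "\<bar>cg2 s\<bar> \<le> 60 * (1 + d)\<^sup>2 * (s + d) powr (- 5/2)" .
qed

end

lemma bump_radius_tendsto:
 "(\<lambda>n. bumpf k (1 - s / (real n + 1)\<^sup>2)) \<longlonglongrightarrow> bumpf k 1"
proof -
 have "(\<lambda>n. 1 - s / (real n + 1)\<^sup>2) \<longlonglongrightarrow> 1" by real_asymp
 then show ?thesis using isCont_tendsto_compose[OF bumpf_tendsto] by blast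
qed

lemma bumpf_zero_tendsto: "(\<lambda>n. 1 / (real n + 1) ^ 2) \<longlonglongrightarrow> 0" "(\<lambda>n. 1 / (real n + 1) ^ 4) \<longlonglongrightarrow> 0"
 by real_asymp+

lemma cg_tendsto:
 assumes d: "d > 0"
 shows "(\<lambda>n. cg d (real n + 1) s) \<longlonglongrightarrow> bumpf 0 1 * (s + d) powr (- 1/2)"
 "(\<lambda>n. cg1 d (real n + 1) s) \<longlonglongrightarrow> bumpf 0 1 * (- 1/2 * (s + d) powr (- 3/2))"
 "(\<lambda>n. cg2 d (real n + 1) s) \<longlonglongrightarrow> bumpf 0 1 * (3/4 * (s + d) powr (- 5/2))"
proof -
 have R: "1 \<le> real n + 1" for n by simp
 show "(\<lambda>n. cg d (real n + 1) s) \<longlonglongrightarrow> bumpf 0 1 * (s + d) powr (- 1/2)"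
  unfolding cg_def[OF d R] by (rule tendsto_cong_limit[OF tendsto_mult[OF tendsto_const bump_radius_tendsto]]) simp
 show "(\<lambda>n. cg1 d (real n + 1) s) \<longlonglongrightarrow> bumpf 0 1 * (- 1/2 * (s + d) powr (- 3/2))"
  unfolding cg1_def[OF d R]
  by (rule tendsto_cong_limit[OF tendsto_diff[OF tendsto_mult[OF tendsto_const bump_radius_tendsto]
     tendsto_mult[OF tendsto_mult[OF bumpf_zero_tendsto(1) tendsto_const] bump_radius_tendsto]]]) simp
 show "(\<lambda>n. cg2 d (real n + 1) s) \<longlonglongrightarrow> bumpf 0 1 * (3/4 * (s + d) powr (- 5/2))"
  unfolding cg2_def[OF d R]
  by (rule tendsto_cong_limit[OF tendsto_add[OF tendsto_add[OF tendsto_mult[OF tendsto_const bump_radius_tendsto]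
     tendsto_mult[OF tendsto_mult[OF bumpf_zero_tendsto(1) tendsto_const] bump_radius_tendsto]]
     tendsto_mult[OF tendsto_mult[OF bumpf_zero_tendsto(2) tendsto_const] tendsto_diff[OF bump_radius_tendsto tendsto_mult[OF tendsto_const bump_radius_tendsto]]]]]) simp
qed

section \<open>From distributions to regularised integral equations\<close>

lemma nn_integral_translate:
 fixes f :: "real^3 \<Rightarrow> ennreal"
 assumes [measurable]: "f \<in> borel_fun"
 shows "(\<integral>\<^sup>+x. f (x - a) \<partial>lborel) = (\<integral>\<^sup>+x. f x \<partial>lborel)"
 using nn_integral_lborel_affine[of "\<lambda>x. f (x - a)" 1 a] by simp

lemma nn_integral_radial_weight_finite:
 fixes x0 :: "real^3"
 assumes p: "p > 3" and d: "d > 0"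
 shows "(\<integral>\<^sup>+x. ennreal ((sqd x0 x + d) powr (- p / 2)) \<partial>lborel) < \<infinity>"
proof -
 define c where "c = min 1 d / 2"
 have c: "c > 0" using d by (simp add: c_def)
 have le: "(z \<bullet> z + d) powr (- p / 2) \<le> c powr (- p / 2) * (1 + norm z) powr (- p)" for z :: "real^3"
 proof -
  have "c * (1 + norm z)\<^sup>2 \<le> z \<bullet> z + d"
  proof -
   have "(1 + norm z)\<^sup>2 \<le> 2 * (1 + (norm z)\<^sup>2)"
    using zero_le_power2[of "1 - norm z"] by (simp add: power2_eq_square algebra_simps)
   then have "c * (1 + norm z)\<^sup>2 \<le> c * (2 * (1 + (norm z)\<^sup>2))" using c by (intro mult_left_mono) auto
   also have "\<dots> = min 1 d + min 1 d * (norm z)\<^sup>2" by (simp add: c_def algebra_simps)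
   also have "\<dots> \<le> d + 1 * (norm z)\<^sup>2" by (intro add_mono mult_right_mono) auto
   finally show ?thesis by (simp add: power2_norm_eq_inner)
  qed
  then have "(z \<bullet> z + d) powr (- p / 2) \<le> (c * (1 + norm z)\<^sup>2) powr (- p / 2)"
   using c p by (intro powr_mono2') (auto intro!: mult_pos_pos zero_less_power add_pos_nonneg)
  also have "\<dots> = c powr (- p / 2) * ((1 + norm z)\<^sup>2) powr (- p / 2)"
   using c by (simp add: powr_mult)
  also have "((1 + norm z)\<^sup>2) powr (- p / 2) = (1 + norm z) powr (- p)"
   by (simp add: powr_powr powr_numeral[symmetric] add_pos_nonneg del: powr_numeral)
  finally show ?thesis .
 qed
 have "(\<integral>\<^sup>+x. ennreal ((sqd x0 x + d) powr (- p / 2)) \<partial>lborel)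
   = (\<integral>\<^sup>+(z::real^3). ennreal ((z \<bullet> z + d) powr (- p / 2)) \<partial>lborel)"
  by (rule nn_integral_translate[of "\<lambda>z. ennreal ((z \<bullet> z + d) powr (- p / 2))"]) measurable
 also have "\<dots> \<le> (\<integral>\<^sup>+(z::real^3). ennreal (c powr (- p / 2)) * ennreal ((1 + norm z) powr (- p)) \<partial>lborel)"
  using le by (intro nn_integral_mono) (simp add: ennreal_leI flip: ennreal_mult)
 also have "\<dots> < \<infinity>"
  using nn_integral_decay_finite[OF p] by (simp add: nn_integral_cmult ennreal_mult_less_top)
 finally show ?thesis .
qed

lemma young_power:
 fixes a b :: real
 assumes "0 \<le> a" "0 \<le> b" "k \<le> n"
 shows "a ^ k * b ^ (n - k) \<le> a ^ n + b ^ n"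
proof -
 have "a ^ k * b ^ (n - k) \<le> max a b ^ k * max a b ^ (n - k)"
  using assms by (intro mult_mono power_mono) auto
 also have "\<dots> = max a b ^ n" using assms by (simp flip: power_add)
 also have "\<dots> \<le> a ^ n + b ^ n" using assms by (auto simp: max_def)
 finally show ?thesis .
qed

text \<open>Young's inequality splits the product into \<open>s^6\<close> and the weight raised to
  the conjugate power; \<open>6 < 2 * m + k\<close> says exactly that this power decays faster than
  \<open>|x|^-3\<close>.\<close>

lemma weight_integrable:
 fixes s :: "real^3 \<Rightarrow> real"
 assumes [measurable]: "s \<in> borel_fun" and s: "\<And>x. 0 \<le> s x" "(\<integral>\<^sup>+x. ennreal (s x ^ 6) \<partial>lborel) < \<infinity>"
  and k: "k < 6" "6 < 2 * m + k" and d: "d > 0"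
 shows "integrable lborel (\<lambda>x. s x ^ k * (sqd x0 x + d) powr (- real m / 2))"
proof (rule integrableI_bounded)
 define p where "p = 6 * real m / real (6 - k)"
 have p: "p > 3"
 proof -
  have "6 - k < 2 * m" using k by simp
  then have "real (6 - k) < 2 * real m" by linarith
  then show ?thesis using k by (simp add: p_def less_divide_eq)
 qed
 have "(\<integral>\<^sup>+x. ennreal (norm (s x ^ k * (sqd x0 x + d) powr (- real m / 2))) \<partial>lborel)
   \<le> (\<integral>\<^sup>+x. ennreal (s x ^ 6) + ennreal ((sqd x0 x + d) powr (- p / 2)) \<partial>lborel)"
 proof (rule nn_integral_mono)
  fix x
  define t where "t = sqd x0 x + d"
  have t: "t > 0" using d by (simp add: t_def add_nonneg_pos)
  define w where "w = t powr (- p / 12)"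
  have "w ^ (6 - k) = t powr (- real m / 2)" "w ^ 6 = t powr (- p / 2)"
   using t k by (simp_all add: w_def powr_powr flip: powr_realpow) (simp add: p_def)
  then have "s x ^ k * t powr (- real m / 2) \<le> s x ^ 6 + t powr (- p / 2)"
   using young_power[of "s x" w k 6] s(1)[of x] k by (simp add: w_def)
  then show "ennreal (norm (s x ^ k * (sqd x0 x + d) powr (- real m / 2)))
    \<le> ennreal (s x ^ 6) + ennreal ((sqd x0 x + d) powr (- p / 2))"
   using s(1)[of x] by (simp add: t_def[symmetric] ennreal_leI flip: ennreal_plus)
 qed
 also have "\<dots> < \<infinity>"
  using s(2) nn_integral_radial_weight_finite[OF p d, of x0] by (simp add: nn_integral_add)
 finally show "(\<integral>\<^sup>+x. ennreal (norm (s x ^ k * (sqd x0 x + d) powr (- real m / 2))) \<partial>lborel) < \<infinity>" .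
qed measurable

text \<open>Dominated convergence with the majorant of \<open>weight_integrable\<close>. The pairs
  \<open>(k, m)\<close> that occur are \<open>(1, 3)\<close> and \<open>(2, 3)\<close> for a
  solution against the Hessian, \<open>(5, 1)\<close> and \<open>(4, 2)\<close> for a right-hand
  side against the potential or its gradient.\<close>

lemma weighted_integral_tendsto:
 fixes s :: "real^3 \<Rightarrow> real" and f :: "real^3 \<Rightarrow> 'b::euclidean_space"
 assumes [measurable]: "s \<in> borel_fun" "f \<in> borel_fun" "\<And>n. w n \<in> borel_fun"
   "w' \<in> borel_fun"
  and s: "\<And>x. 0 \<le> s x" "(\<integral>\<^sup>+x. ennreal (s x ^ 6) \<partial>lborel) < \<infinity>" "\<And>x. norm (f x) \<le> s x ^ k"
  and k: "k < 6" "6 < 2 * m + k" and d: "d > 0"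
  and w: "\<And>n x. \<bar>w n x\<bar> \<le> K * (sqd x0 x + d) powr (- real m / 2)"
  and lim: "\<And>x. (\<lambda>n. w n x) \<longlonglongrightarrow> w' x"
 shows "(\<lambda>n. \<integral>x. w n x *\<^sub>R f x \<partial>lborel) \<longlonglongrightarrow> (\<integral>x. w' x *\<^sub>R f x \<partial>lborel)"
  and "integrable lborel (\<lambda>x. w n x *\<^sub>R f x)" and "integrable lborel (\<lambda>x. w' x *\<^sub>R f x)"
proof -
 define g where "g x = K * (s x ^ k * (sqd x0 x + d) powr (- real m / 2))" for x
 have g: "integrable lborel g"
  unfolding g_def by (intro integrable_mult_right weight_integrable s k d) measurable
 have b: "norm (w n x *\<^sub>R f x) \<le> g x" for n x
 proof -
  have "\<bar>w n x\<bar> * norm (f x) \<le> (K * (sqd x0 x + d) powr (- real m / 2)) * s x ^ k"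
   using w[of n x] s(3)[of x] order_trans[OF abs_ge_zero w[of n x]] by (intro mult_mono) auto
  then show ?thesis by (simp add: g_def mult_ac)
 qed
 have l: "AE x in lborel. (\<lambda>n. w n x *\<^sub>R f x) \<longlonglongrightarrow> w' x *\<^sub>R f x"
  by (intro AE_I2 tendsto_intros lim)
 show "(\<lambda>n. \<integral>x. w n x *\<^sub>R f x \<partial>lborel) \<longlonglongrightarrow> (\<integral>x. w' x *\<^sub>R f x \<partial>lborel)"
  by (rule integral_dominated_convergence[OF _ _ g l]) (use b in auto)
 show "integrable lborel (\<lambda>x. w' x *\<^sub>R f x)"
  by (rule integrable_dominated_convergence[OF _ _ g l]) (use b in auto)
 show "integrable lborel (\<lambda>x. w n x *\<^sub>R f x)"
  by (rule Bochner_Integration.integrable_bound[OF g]) (use b[of n] in \<open>auto intro: order_trans[OF _ abs_ge_self]\<close>)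
qed

context
 fixes x0 :: "real^3" and d R :: real
 assumes d: "d > 0" and R: "R \<ge> 1"
begin

lemma cphi_measurable:
 "cphi x0 d R \<in> borel_fun" "cphi1 x0 d R j \<in> borel_fun" "cphi2 x0 d R j k \<in> borel_fun"
proof -
 have [measurable]: "bumpf n \<in> borel_fun" for n
  unfolding bumpf_def by measurable
 show "cphi x0 d R \<in> borel_fun" "cphi1 x0 d R j \<in> borel_fun" "cphi2 x0 d R j k \<in> borel_fun"
  unfolding cphi_def[OF d R, abs_def] cphi1_def[OF d R, abs_def] cphi2_def[OF d R, abs_def]
   cg_def[OF d R] cg1_def[OF d R] cg2_def[OF d R] by measurable
qed

lemma cphi_bounds:
 "\<bar>cphi x0 d R x\<bar> \<le> 1 * (sqd x0 x + d) powr (- real 1 / 2)"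
 "\<bar>cphi1 x0 d R j x\<bar> \<le> 120 * (1 + d)\<^sup>2 * (sqd x0 x + d) powr (- real 2 / 2)"
 "\<bar>cphi2 x0 d R j k x\<bar> \<le> 360 * (1 + d)\<^sup>2 * (sqd x0 x + d) powr (- real 3 / 2)"
proof -
 define q where "q = sqd x0 x"
 have q: "q \<ge> 0" by (simp add: q_def)
 have qd: "q + d > 0" using q d by simp
 define D where "D = 60 * (1 + d)\<^sup>2"
 have D: "D \<ge> 0" by (simp add: D_def)
 have sq: "\<bar>x $ j + - x0 $ j\<bar> \<le> (q + d) powr (1/2)" for j
 proof -
  have "\<bar>(x - x0) $ j\<bar> \<le> norm (x - x0)" by (rule component_le_norm_cart)
  also have "norm (x - x0) = sqrt q" by (simp add: q_def norm_eq_sqrt_inner)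
  also have "\<dots> \<le> sqrt (q + d)" using d by simp
  finally show ?thesis using qd by (simp add: powr_half_sqrt)
 qed
 show "\<bar>cphi x0 d R x\<bar> \<le> 1 * (sqd x0 x + d) powr (- real 1 / 2)"
  using cg_bounds(1)[OF d R q] unfolding cphi_def[OF d R] q_def by simp
 have "\<bar>cphi1 x0 d R j x\<bar> = \<bar>cg1 d R q\<bar> * (2 * \<bar>x $ j + - x0 $ j\<bar>)"
  unfolding cphi1_def[OF d R] q_def[symmetric] by (simp only: abs_mult abs_numeral)
 also have "\<dots> \<le> D * (q + d) powr (- 3/2) * (2 * (q + d) powr (1/2))"
  using cg_bounds(2)[OF d R q] sq[of j] D by (intro mult_mono) (auto simp: D_def)
 also have "\<dots> = 2 * D * ((q + d) powr (- 3/2) * (q + d) powr (1/2))" by simp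
 also have "(q + d) powr (- 3/2) * (q + d) powr (1/2) = (q + d) powr (- real 2 / 2)"
  using qd by (simp flip: powr_add)
 finally show "\<bar>cphi1 x0 d R j x\<bar> \<le> 120 * (1 + d)\<^sup>2 * (sqd x0 x + d) powr (- real 2 / 2)"
  by (simp add: D_def q_def)
 have "\<bar>cphi2 x0 d R j k x\<bar> \<le> \<bar>cg2 d R q\<bar> * (2 * \<bar>x $ k + - x0 $ k\<bar>) * (2 * \<bar>x $ j + - x0 $ j\<bar>) + \<bar>cg1 d R q\<bar> * 2"
  unfolding cphi2_def[OF d R] q_def[symmetric]
  by (rule order_trans[OF abs_triangle_ineq]) (intro add_mono, simp_all only: abs_mult abs_numeral order_refl, auto intro: mult_left_mono)
 also have "\<dots> \<le> D * (q + d) powr (- 5/2) * (2 * (q + d) powr (1/2)) * (2 * (q + d) powr (1/2)) + D * (q + d) powr (- 3/2) * 2"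
  using cg_bounds(2,3)[OF d R q] sq D by (intro add_mono mult_mono) (auto simp: D_def)
 also have "\<dots> = 4 * D * ((q + d) powr (- 5/2) * (q + d) powr (1/2) * (q + d) powr (1/2)) + 2 * D * (q + d) powr (- 3/2)" by simp
 also have "(q + d) powr (- 5/2) * (q + d) powr (1/2) * (q + d) powr (1/2) = (q + d) powr (- 3/2)"
  using qd by (simp flip: powr_add)
 finally show "\<bar>cphi2 x0 d R j k x\<bar> \<le> 360 * (1 + d)\<^sup>2 * (sqd x0 x + d) powr (- real 3 / 2)"
  by (simp add: D_def q_def)
qed

end

definition hess :: "real^3 \<Rightarrow> real \<Rightarrow> 3 \<Rightarrow> 3 \<Rightarrow> real^3 \<Rightarrow> real"
 where "hess x0 d j k x = 3 * (sqd x0 x + d) powr (- 5/2) * (x $ k + - x0 $ k) * (x $ j + - x0 $ j)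
  - (sqd x0 x + d) powr (- 3/2) * (if j = k then 1 else 0)"

text \<open>The trace is the Laplacian of the regularised Newton potential. It has a fixed sign and
  concentrates at \<open>x0\<close> as \<open>d\<close> tends to 0: up to a constant, an approximate
  identity.\<close>

lemma hess_trace:
 assumes d: "d > 0"
 shows "(\<Sum>j\<in>UNIV. hess x0 d j j x) = - 3 * d * (sqd x0 x + d) powr (- 5/2)"
proof -
 define q where "q = sqd x0 x"
 have qd: "q + d > 0" using d by (simp add: q_def add_nonneg_pos)
 have q: "q = (\<Sum>j\<in>UNIV. (x $ j + - x0 $ j) * (x $ j + - x0 $ j))" by (simp add: q_def inner_vec_def)
 have "(q + d) powr (- 3/2) = (q + d) powr (- 5/2) * (q + d)"
 proof -
  have "(q + d) powr (- 3/2) = (q + d) powr (- 5/2 + 1)" by simp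
  also have "\<dots> = (q + d) powr (- 5/2) * (q + d) powr 1" by (rule powr_add)
  finally show ?thesis using qd by simp
 qed
 then have "(\<Sum>j\<in>UNIV. hess x0 d j j x) = 3 * (q + d) powr (- 5/2) * q - 3 * ((q + d) powr (- 5/2) * (q + d))"
  unfolding hess_def q_def[symmetric] by (subst (3) q) (simp add: sum_subtractf sum_distrib_left mult.assoc sum_3 algebra_simps)
 then show ?thesis by (simp add: q_def algebra_simps)
qed

lemma cphi_tendsto:
 assumes d: "d > 0"
 shows "(\<lambda>n. cphi x0 d (real n + 1) x) \<longlonglongrightarrow> bumpf 0 1 * (sqd x0 x + d) powr (- 1/2)"
  and "(\<lambda>n. cphi1 x0 d (real n + 1) j x) \<longlonglongrightarrow> bumpf 0 1 * (- (x $ j + - x0 $ j) * (sqd x0 x + d) powr (- 3/2))"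
  and "(\<lambda>n. cphi2 x0 d (real n + 1) j k x) \<longlonglongrightarrow> bumpf 0 1 * hess x0 d j k x"
proof -
 have R: "1 \<le> real n + 1" for n by simp
 have h1: "a * (- t * P) = a * (- 1/2 * P) * (2 * t)" for a P t :: real by simp
 have h2: "a * (3 * P * t * s - Q * (if c then 1 else 0)) = a * (3/4 * P) * (2 * t) * (2 * s) + a * (- 1/2 * Q) * (if c then 2 else 0)"
  for a P Q t s :: real and c by (simp add: algebra_simps)
 show "(\<lambda>n. cphi x0 d (real n + 1) x) \<longlonglongrightarrow> bumpf 0 1 * (sqd x0 x + d) powr (- 1/2)"
  unfolding cphi_def[OF d R] by (rule cg_tendsto[OF d])
 show "(\<lambda>n. cphi1 x0 d (real n + 1) j x) \<longlonglongrightarrow> bumpf 0 1 * (- (x $ j + - x0 $ j) * (sqd x0 x + d) powr (- 3/2))"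
  unfolding cphi1_def[OF d R]
  by (rule tendsto_cong_limit[OF tendsto_mult[OF cg_tendsto(2)[OF d] tendsto_const]]) (rule h1)
 show "(\<lambda>n. cphi2 x0 d (real n + 1) j k x) \<longlonglongrightarrow> bumpf 0 1 * hess x0 d j k x"
  unfolding cphi2_def[OF d R] hess_def
  by (rule tendsto_cong_limit[OF tendsto_add[OF tendsto_mult[OF tendsto_mult[OF cg_tendsto(3)[OF d] tendsto_const] tendsto_const]
      tendsto_mult[OF cg_tendsto(2)[OF d] tendsto_const]]]) (rule h2)
qed

section \<open>Linear algebra of Clifford matrices\<close>

lemma vector_smult_sum_right: "(a::complex) *s (\<Sum>i\<in>A. f i) = (\<Sum>i\<in>A. a *s (f i :: complex^'n))"
 by (induction A rule: infinite_finite_induct) (auto simp: vector_add_ldistrib)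

lemma mat_mul_smult: "A *v (a *s x) = (a::complex) *s (A *v x)"
 by (simp add: vec_eq_iff matrix_vector_mult_def sum_distrib_left mult_ac)

lemma mat_mul_scaleR: "A *v (a *\<^sub>R x) = a *\<^sub>R (A *v (x::complex^'n))"
 by (simp add: vec_eq_iff matrix_vector_mult_def scaleR_sum_right mult_scaleR_right)

lemma mat_mul_sum: "A *v (\<Sum>i\<in>S. f i) = (\<Sum>i\<in>S. A *v (f i :: complex^'n))"
 by (induction S rule: infinite_finite_induct) (auto simp: matrix_vector_right_distrib)

lemma bounded_linear_mat_mul: "bounded_linear (\<lambda>x::complex^'n. A *v x)"
 by (rule linear_conv_bounded_linear[THEN iffD1])
   (rule linearI; simp add: matrix_vector_right_distrib mat_mul_scaleR)

lemma bounded_linear_smult: "bounded_linear (\<lambda>x::complex^'n. a *s x)"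
 by (rule linear_conv_bounded_linear[THEN iffD1])
   (rule linearI; simp add: vec_eq_iff algebra_simps)

definition clifford :: "('k \<Rightarrow> complex^'n^'n::finite) \<Rightarrow> bool"
 where "clifford \<alpha> \<longleftrightarrow> (\<forall>j k. \<alpha> j ** \<alpha> k + \<alpha> k ** \<alpha> j = mat (if j = k then 2 else 0))"

text \<open>Exchanging \<open>j\<close> and \<open>k\<close> and averaging replaces products of
  matrices by anticommutators, so only the diagonal is left. For a Hessian this says that the square
  of the Dirac operator is minus the Laplacian; for
  \<open>X j k = (x $ j * x $ k) *\<^sub>R v\<close> it gives the square of Clifford
  multiplication.\<close>

lemma clifford_symmetric_sum:
 fixes \<alpha> :: "3 \<Rightarrow> complex^'n^'n::finite" and X :: "3 \<Rightarrow> 3 \<Rightarrow> complex^'n"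
 assumes c: "clifford \<alpha>" and X: "\<And>j k. X j k = X k j"
 shows "(\<Sum>k\<in>UNIV. \<alpha> k *v (\<Sum>j\<in>UNIV. \<alpha> j *v X j k)) = (\<Sum>j\<in>UNIV. X j j)"
proof -
 have mv: "mat (2::complex) *v x = 2 *s x" for x :: "complex^'n"
  by (simp add: vec_eq_iff matrix_vector_mult_def mat_def if_distrib[of "\<lambda>c. c * _"] cong: if_cong)
 define S where "S = (\<Sum>k\<in>UNIV. \<Sum>j\<in>UNIV. (\<alpha> k ** \<alpha> j) *v X j k)"
 have S1: "(\<Sum>k\<in>UNIV. \<alpha> k *v (\<Sum>j\<in>UNIV. \<alpha> j *v X j k)) = S"
  by (simp add: S_def mat_mul_sum matrix_vector_mul_assoc)
 have "S = (\<Sum>k\<in>UNIV. \<Sum>j\<in>UNIV. (\<alpha> j ** \<alpha> k) *v X j k)"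
  unfolding S_def by (subst sum.swap) (simp add: X)
 then have "S + S = (\<Sum>k\<in>UNIV. \<Sum>j\<in>UNIV. (\<alpha> k ** \<alpha> j + \<alpha> j ** \<alpha> k) *v X j k)"
  by (subst (1) S_def) (simp add: sum.distrib matrix_vector_mult_add_rdistrib)
 also have "\<dots> = (\<Sum>k\<in>UNIV. \<Sum>j\<in>UNIV. if k = j then 2 *s X k k else 0)"
 proof (intro sum.cong refl)
  fix k j :: 3
  have "\<alpha> k ** \<alpha> j + \<alpha> j ** \<alpha> k = mat (if k = j then 2 else 0)" using c by (simp add: clifford_def)
  moreover have "mat (0::complex) *v x = 0" for x :: "complex^'n"
   by (simp add: vec_eq_iff matrix_vector_mult_def mat_def)
  ultimately show "(\<alpha> k ** \<alpha> j + \<alpha> j ** \<alpha> k) *v X j k = (if k = j then 2 *s X k k else 0)"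
   by (simp add: mv)
 qed
 also have "\<dots> = 2 *s (\<Sum>k\<in>UNIV. X k k)" by (simp add: vector_smult_sum_right)
 finally have "2 *s S = 2 *s (\<Sum>k\<in>UNIV. X k k)" by (simp add: vec_eq_iff)
 then show ?thesis unfolding S1 by (simp add: vec_eq_iff)
qed

section \<open>Testing the weak equations with regularised potentials\<close>

locale critical_pair =
 fixes u :: "real^3 \<Rightarrow> real" and \<psi> :: "real^3 \<Rightarrow> complex^4"
 assumes u_meas [measurable]: "u \<in> borel_fun"
  and psi_meas [measurable]: "\<psi> \<in> borel_fun"
  and u_int: "(\<integral>\<^sup>+x. ennreal (\<bar>u x\<bar> ^ 6) \<partial>lborel) < \<infinity>"
  and psi_int: "(\<integral>\<^sup>+x. ennreal (norm (\<psi> x) ^ 3) \<partial>lborel) < \<infinity>"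
begin

text \<open>A common scale: \<open>|u| \<le> ss\<close> and \<open>|\<psi>| \<le> ss^2\<close>. One
  function in \<open>L^6\<close> then controls both components, and the right-hand sides are bounded
  by its powers 5 and 4.\<close>

definition ss :: "real^3 \<Rightarrow> real"
 where "ss x = max \<bar>u x\<bar> (sqrt (norm (\<psi> x)))"

lemma ss_meas [measurable]: "ss \<in> borel_fun"
 unfolding ss_def by measurable

lemma ss_nonneg: "0 \<le> ss x"
 by (simp add: ss_def le_max_iff_disj)

lemma u_le: "\<bar>u x\<bar> \<le> ss x"
 by (simp add: ss_def)

lemma psi_le: "norm (\<psi> x) \<le> ss x ^ 2"
proof -
 have "sqrt (norm (\<psi> x)) \<le> ss x" by (simp add: ss_def)
 then show ?thesis using real_sqrt_le_iff sqrt_le_D by blast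
qed

lemma ss_int: "(\<integral>\<^sup>+x. ennreal (ss x ^ 6) \<partial>lborel) < \<infinity>"
proof -
 have "(\<integral>\<^sup>+x. ennreal (ss x ^ 6) \<partial>lborel) \<le> (\<integral>\<^sup>+x. ennreal (\<bar>u x\<bar> ^ 6) + ennreal (norm (\<psi> x) ^ 3) \<partial>lborel)"
 proof (rule nn_integral_mono)
  fix x
  have "sqrt (norm (\<psi> x)) ^ 6 = ((sqrt (norm (\<psi> x)))\<^sup>2) ^ 3" by (subst power_mult[symmetric]) simp
  then have "sqrt (norm (\<psi> x)) ^ 6 = norm (\<psi> x) ^ 3" by simp
  then have "ss x ^ 6 \<le> \<bar>u x\<bar> ^ 6 + norm (\<psi> x) ^ 3" by (auto simp: ss_def max_def)
  then show "ennreal (ss x ^ 6) \<le> ennreal (\<bar>u x\<bar> ^ 6) + ennreal (norm (\<psi> x) ^ 3)"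
   by (simp add: ennreal_leI flip: ennreal_plus)
 qed
 also have "\<dots> < \<infinity>" using u_int psi_int by (simp add: nn_integral_add)
 finally show ?thesis .
qed

definition rhs1 :: "real^3 \<Rightarrow> real" where "rhs1 x = (norm (\<psi> x))\<^sup>2 * u x"
definition rhs2 :: "real^3 \<Rightarrow> complex^4" where "rhs2 x = \<bar>u x\<bar>\<^sup>2 *\<^sub>R \<psi> x"

lemma rhs_meas [measurable]: "rhs1 \<in> borel_fun" "rhs2 \<in> borel_fun"
 unfolding rhs1_def rhs2_def by measurable

lemma rhs_le: "norm (rhs1 x) \<le> ss x ^ 5" "norm (rhs2 x) \<le> ss x ^ 4"
proof -
 have "norm (rhs1 x) \<le> (ss x ^ 2)\<^sup>2 * ss x"
  unfolding rhs1_def norm_mult using power_mono[OF psi_le[of x] norm_ge_zero, of 2] u_le[of x] ss_nonneg[of x]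
  by (intro mult_mono) simp_all
 then show "norm (rhs1 x) \<le> ss x ^ 5" by (simp add: power_numeral_reduce mult_ac)
 have "norm (rhs2 x) \<le> (ss x)\<^sup>2 * ss x ^ 2"
  unfolding rhs2_def norm_scaleR using psi_le[of x] power_mono[OF u_le[of x] abs_ge_zero, of 2] ss_nonneg[of x]
  by (intro mult_mono) simp_all
 then show "norm (rhs2 x) \<le> ss x ^ 4" by (simp add: power_numeral_reduce mult_ac)
qed

end

text \<open>The factor \<open>\<i>\<close> in the second equation is the \<open>- \<i>\<close> of
  the Dirac operator times the \<open>- 1\<close> from moving the derivative to the test
  function.\<close>

locale weak_solution = critical_pair +
 fixes \<alpha> :: "3 \<Rightarrow> complex^4^4"
 assumes clifford: "clifford \<alpha>"
  and weak1: "test_function \<phi> \<Longrightarrow>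
   - 6 * (\<Sum>j\<in>UNIV. \<integral>x. partial_deriv j (partial_deriv j \<phi>) x *\<^sub>R u x \<partial>lborel) = (\<integral>x. \<phi> x *\<^sub>R rhs1 x \<partial>lborel)"
  and weak2: "test_function \<phi> \<Longrightarrow>
   \<i> *s (\<Sum>j\<in>UNIV. \<alpha> j *v (\<integral>x. partial_deriv j \<phi> x *\<^sub>R \<psi> x \<partial>lborel)) = (\<integral>x. \<phi> x *\<^sub>R rhs2 x \<partial>lborel)"
begin

text \<open>Test with the truncated potential and let the truncation radius
  \<open>real n + 1\<close> grow. The Laplacian of the limit is the trace of \<open>hess\<close>,
  whence \<open>18 = 6 * 3\<close>; the factor \<open>b\<close> left by the cutoff cancels.\<close>

lemma regularised1:
 assumes d: "d > 0"
 shows "18 * d * (\<integral>x. (sqd x0 x + d) powr (- 5/2) *\<^sub>R u x \<partial>lborel)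
  = (\<integral>x. (sqd x0 x + d) powr (- 1/2) *\<^sub>R rhs1 x \<partial>lborel)"
proof -
 have R: "1 \<le> real n + 1" for n by simp
 define b where "b = bumpf 0 1"
 have b: "b > 0" by (simp add: b_def bumpf_def)
 have [measurable]: "(\<lambda>x. b * hess x0 d j k x) \<in> borel_fun" for j k
  unfolding hess_def by measurable
 have u1: "norm (u x) \<le> ss x ^ 1" for x using u_le by simp
 have L1: "(\<lambda>n. \<integral>x. cphi2 x0 d (real n + 1) j j x *\<^sub>R u x \<partial>lborel) \<longlonglongrightarrow> (\<integral>x. (b * hess x0 d j j x) *\<^sub>R u x \<partial>lborel)" and
  int: "integrable lborel (\<lambda>x. (b * hess x0 d j j x) *\<^sub>R u x)" for j
  by (rule weighted_integral_tendsto[OF ss_meas u_meas cphi_measurable(3)[OF d R] _ ss_nonneg ss_int u1 _ _ d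
   cphi_bounds(3)[OF d R] cphi_tendsto(3)[OF d, folded b_def]]; simp)+
 have L: "(\<lambda>n. - 6 * (\<Sum>j\<in>UNIV. \<integral>x. cphi2 x0 d (real n + 1) j j x *\<^sub>R u x \<partial>lborel))
   \<longlonglongrightarrow> - 6 * (\<Sum>j\<in>UNIV. \<integral>x. (b * hess x0 d j j x) *\<^sub>R u x \<partial>lborel)"
  by (intro tendsto_mult tendsto_const tendsto_sum L1)
 have A: "(\<lambda>n. \<integral>x. cphi x0 d (real n + 1) x *\<^sub>R rhs1 x \<partial>lborel)
   \<longlonglongrightarrow> (\<integral>x. (b * (sqd x0 x + d) powr (- 1/2)) *\<^sub>R rhs1 x \<partial>lborel)"
  by (rule weighted_integral_tendsto(1)[OF ss_meas rhs_meas(1) cphi_measurable(1)[OF d R] _ ss_nonneg ss_int rhs_le(1) _ _ d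
   cphi_bounds(1)[OF d R] cphi_tendsto(1)[OF d, folded b_def]]) auto
 have B: "(\<lambda>n. \<integral>x. cphi x0 d (real n + 1) x *\<^sub>R rhs1 x \<partial>lborel) =
   (\<lambda>n. - 6 * (\<Sum>j\<in>UNIV. \<integral>x. cphi2 x0 d (real n + 1) j j x *\<^sub>R u x \<partial>lborel))"
  using weak1[OF cphi_test(1)[OF d R]]
  by (simp add: has_grad_partial_deriv[OF cphi_has_grad[OF d R]] has_grad_partial_deriv[OF cphi1_has_grad[OF d R]])
 have "- 6 * (\<Sum>j\<in>UNIV. \<integral>x. (b * hess x0 d j j x) *\<^sub>R u x \<partial>lborel) = (\<integral>x. (b * (sqd x0 x + d) powr (- 1/2)) *\<^sub>R rhs1 x \<partial>lborel)"
  by (rule LIMSEQ_unique[OF L]) (unfold B[symmetric], rule A)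
 also have "(\<Sum>j\<in>UNIV. \<integral>x. (b * hess x0 d j j x) *\<^sub>R u x \<partial>lborel) = (\<integral>x. (\<Sum>j\<in>UNIV. (b * hess x0 d j j x) *\<^sub>R u x) \<partial>lborel)"
  by (rule Bochner_Integration.integral_sum[symmetric]) (rule int)
 also have "(\<lambda>x. \<Sum>j\<in>UNIV. (b * hess x0 d j j x) *\<^sub>R u x) = (\<lambda>x. (b * (- 3 * d)) * ((sqd x0 x + d) powr (- 5/2) *\<^sub>R u x))"
  by (simp only: scaleR_sum_left[symmetric] sum_distrib_left[symmetric] hess_trace[OF d]) (simp add: mult_ac)
 finally have "- 6 * ((b * (- 3 * d)) * (\<integral>x. (sqd x0 x + d) powr (- 5/2) *\<^sub>R u x \<partial>lborel))
   = b * (\<integral>x. (sqd x0 x + d) powr (- 1/2) *\<^sub>R rhs1 x \<partial>lborel)"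
  by (simp only: real_scaleR_def mult.assoc[of b] integral_mult_right_zero)
 then show ?thesis using b by simp
qed

text \<open>Test with the \<open>k\<close>-th derivative of the truncated potential, apply
  \<open>\<alpha> k\<close> and sum over \<open>k\<close>. The Clifford relations collapse the
  symmetric Hessian to its trace, which isolates \<open>\<psi>\<close>.\<close>

lemma regularised2:
 assumes d: "d > 0"
 shows "(3 * d) *\<^sub>R (\<integral>x. (sqd x0 x + d) powr (- 5/2) *\<^sub>R \<psi> x \<partial>lborel)
  = - \<i> *s (\<Sum>k\<in>UNIV. \<alpha> k *v (\<integral>x. ((x $ k + - x0 $ k) * (sqd x0 x + d) powr (- 3/2)) *\<^sub>R rhs2 x \<partial>lborel))"
proof -
 have R: "1 \<le> real n + 1" for n by simp
 define b where "b = bumpf 0 1"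
 have b: "b > 0" by (simp add: b_def bumpf_def)
 have [measurable]: "(\<lambda>x. b * hess x0 d j k x) \<in> borel_fun" for j k
  unfolding hess_def by measurable
 define X where "X j k = (\<integral>x. (b * hess x0 d j k x) *\<^sub>R \<psi> x \<partial>lborel)" for j k
 define Y where "Y k = (\<integral>x. ((x $ k + - x0 $ k) * (sqd x0 x + d) powr (- 3/2)) *\<^sub>R rhs2 x \<partial>lborel)" for k
 have L1: "(\<lambda>n. \<integral>x. cphi2 x0 d (real n + 1) j k x *\<^sub>R \<psi> x \<partial>lborel) \<longlonglongrightarrow> X j k" and
  int: "integrable lborel (\<lambda>x. (b * hess x0 d j k x) *\<^sub>R \<psi> x)" for j k
  unfolding X_def
  by (rule weighted_integral_tendsto[OF ss_meas psi_meas cphi_measurable(3)[OF d R] _ ss_nonneg ss_int psi_le _ _ d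
   cphi_bounds(3)[OF d R] cphi_tendsto(3)[OF d, folded b_def]]; simp)+
 have L2: "(\<lambda>n. \<integral>x. cphi1 x0 d (real n + 1) k x *\<^sub>R rhs2 x \<partial>lborel) \<longlonglongrightarrow> (\<integral>x. (b * (- (x $ k + - x0 $ k) * (sqd x0 x + d) powr (- 3/2))) *\<^sub>R rhs2 x \<partial>lborel)" for k
  by (rule weighted_integral_tendsto(1)[OF ss_meas rhs_meas(2) cphi_measurable(2)[OF d R] _ ss_nonneg ss_int rhs_le(2) _ _ d
   cphi_bounds(2)[OF d R] cphi_tendsto(2)[OF d, folded b_def]]) auto
 have L2': "(\<integral>x. (b * (- (x $ k + - x0 $ k) * (sqd x0 x + d) powr (- 3/2))) *\<^sub>R rhs2 x \<partial>lborel) = (- b) *\<^sub>R Y k" for k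
 proof -
  have "(b * (- t * P)) *\<^sub>R r = (- b) *\<^sub>R ((t * P) *\<^sub>R r)" for t P and r :: "complex^4" by simp
  then show ?thesis
   unfolding Y_def integral_scaleR_right[symmetric] by (intro Bochner_Integration.integral_cong refl)
 qed
 have eq: "\<i> *s (\<Sum>j\<in>UNIV. \<alpha> j *v X j k) = (- b) *\<^sub>R Y k" for k
 proof -
  have A: "(\<lambda>n. \<i> *s (\<Sum>j\<in>UNIV. \<alpha> j *v (\<integral>x. cphi2 x0 d (real n + 1) k j x *\<^sub>R \<psi> x \<partial>lborel))) \<longlonglongrightarrow> \<i> *s (\<Sum>j\<in>UNIV. \<alpha> j *v X k j)"
   by (intro bounded_linear.tendsto[OF bounded_linear_smult] bounded_linear.tendsto[OF bounded_linear_mat_mul] tendsto_sum L1)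
  have B: "(\<lambda>n. \<i> *s (\<Sum>j\<in>UNIV. \<alpha> j *v (\<integral>x. cphi2 x0 d (real n + 1) k j x *\<^sub>R \<psi> x \<partial>lborel)))
    = (\<lambda>n. \<integral>x. cphi1 x0 d (real n + 1) k x *\<^sub>R rhs2 x \<partial>lborel)"
   using weak2[OF cphi_test(2)[OF d R]] by (simp add: has_grad_partial_deriv[OF cphi1_has_grad[OF d R]])
  have "\<i> *s (\<Sum>j\<in>UNIV. \<alpha> j *v X k j) = (- b) *\<^sub>R Y k"
   by (rule LIMSEQ_unique[OF A]) (unfold B, rule L2[of k, unfolded L2'])
  moreover have "X k j = X j k" for j by (simp add: X_def hess_def mult_ac)
  ultimately show ?thesis by simp
 qed
 have "(\<Sum>k\<in>UNIV. \<alpha> k *v (\<i> *s (\<Sum>j\<in>UNIV. \<alpha> j *v X j k))) = \<i> *s (\<Sum>j\<in>UNIV. X j j)"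
  by (simp add: mat_mul_smult clifford_symmetric_sum[OF clifford] X_def hess_def mult_ac flip: vector_smult_sum_right)
 then have "\<i> *s (\<Sum>j\<in>UNIV. X j j) = (- b) *\<^sub>R (\<Sum>k\<in>UNIV. \<alpha> k *v Y k)"
  by (simp only: eq mat_mul_scaleR scaleR_sum_right)
 moreover have "(\<Sum>j\<in>UNIV. X j j) = (b * (- 3 * d)) *\<^sub>R (\<integral>x. (sqd x0 x + d) powr (- 5/2) *\<^sub>R \<psi> x \<partial>lborel)"
 proof -
  have "(\<Sum>j\<in>UNIV. X j j) = (\<integral>x. (\<Sum>j\<in>UNIV. (b * hess x0 d j j x) *\<^sub>R \<psi> x) \<partial>lborel)"
   unfolding X_def by (rule Bochner_Integration.integral_sum[symmetric]) (rule int)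
  also have "(\<lambda>x. \<Sum>j\<in>UNIV. (b * hess x0 d j j x) *\<^sub>R \<psi> x) = (\<lambda>x. (b * (- 3 * d)) *\<^sub>R ((sqd x0 x + d) powr (- 5/2) *\<^sub>R \<psi> x))"
   by (simp only: scaleR_sum_left[symmetric] sum_distrib_left[symmetric] hess_trace[OF d]) (simp add: mult_ac)
  finally show ?thesis by (simp only: integral_scaleR_right)
 qed
 ultimately have *: "\<i> *s ((b * (- 3 * d)) *\<^sub>R (\<integral>x. (sqd x0 x + d) powr (- 5/2) *\<^sub>R \<psi> x \<partial>lborel)) = (- b) *\<^sub>R (\<Sum>k\<in>UNIV. \<alpha> k *v Y k)"
  by simp
 have "- \<i> *s (\<i> *s ((- 3 * d) *\<^sub>R P)) = (- 3 * d) *\<^sub>R P" for P :: "complex^4"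
  by (simp add: vec_eq_iff)
 have sc: "\<i> *s (c *\<^sub>R P) = c *\<^sub>R (\<i> *s P)" for c and P :: "complex^4"
  by (simp add: vec_eq_iff)
 define P where "P = (\<integral>x. (sqd x0 x + d) powr (- 5/2) *\<^sub>R \<psi> x \<partial>lborel)"
 have "b *\<^sub>R (\<i> *s ((3 * d) *\<^sub>R P)) = b *\<^sub>R (\<Sum>k\<in>UNIV. \<alpha> k *v Y k)"
  using * unfolding P_def[symmetric] sc by simp
 then have "\<i> *s ((3 * d) *\<^sub>R P) = (\<Sum>k\<in>UNIV. \<alpha> k *v Y k)" using b by simp
 then have "- \<i> *s (\<i> *s ((3 * d) *\<^sub>R P)) = - \<i> *s (\<Sum>k\<in>UNIV. \<alpha> k *v Y k)" by simp
 then show ?thesis unfolding P_def Y_def by (simp add: vector_smult_assoc)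
qed

end

section \<open>Removing the regularisation\<close>

text \<open>Dynkin's argument: boxes form an intersection-stable generator of the Borel sets.
  Everything takes place inside a fixed box, where \<open>F\<close> is integrable; the boxes exhaust
  space at the end.\<close>

lemma AE_zero_of_box_integrals:
 fixes F :: "real^3 \<Rightarrow> 'b::euclidean_space"
 assumes [measurable]: "F \<in> borel_fun"
  and int: "\<And>a b. integrable lborel (\<lambda>x. indicator (box a b) x *\<^sub>R F x)"
  and zero: "\<And>a b. (\<integral>x. indicator (box a b) x *\<^sub>R F x \<partial>lborel) = 0"
 shows "AE x in lborel. F x = 0"
proof -
 have set0: "(\<integral>x. indicator (A \<inter> box a b) x *\<^sub>R F x \<partial>lborel) = 0" if "A \<in> sets borel" for A a b
 proof -
  have intA: "integrable lborel (\<lambda>x. indicator (A \<inter> box a b) x *\<^sub>R F x)" if [measurable]: "A \<in> sets borel" for A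
   by (rule Bochner_Integration.integrable_bound[OF int[of a b]]) (auto simp: indicator_def)
  have "Int_stable (range (\<lambda>(a, b). box a b :: (real^3) set))"
   by (auto simp: Int_stable_def box_Int_box)
  moreover have "(range (\<lambda>(a, b). box a b :: (real^3) set)) \<subseteq> Pow UNIV"
   by auto
  moreover have "A \<in> sigma_sets UNIV (range (\<lambda>(a, b). box a b))"
   using that unfolding borel_eq_box by simp
  ultimately show ?thesis
  proof (induction rule: sigma_sets_induct_disjoint)
   case (basic A)
   then show ?case by (auto simp: box_Int_box zero)
  next
   case empty
   then show ?case by simp
  next
   case (compl A)
   then have [measurable]: "A \<in> sets borel" by (simp add: borel_eq_box)
   have "(\<lambda>x. indicator ((UNIV - A) \<inter> box a b) x *\<^sub>R F x) = (\<lambda>x. indicator (box a b) x *\<^sub>R F x - indicator (A \<inter> box a b) x *\<^sub>R F x)"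
    by (auto simp: indicator_def fun_eq_iff)
   then show ?case
    using compl.IH by (simp add: Bochner_Integration.integral_diff[OF int intA] zero)
  next
   case (union A)
   then have [measurable]: "A i \<in> sets borel" for i by (auto simp: borel_eq_box subset_eq)
   have "(\<lambda>n. \<integral>x. indicator ((\<Union>i<n. A i) \<inter> box a b) x *\<^sub>R F x \<partial>lborel) \<longlonglongrightarrow> (\<integral>x. indicator ((\<Union>i. A i) \<inter> box a b) x *\<^sub>R F x \<partial>lborel)"
   proof (rule integral_dominated_convergence[where w = "\<lambda>x. norm (indicator (box a b) x *\<^sub>R F x)"])
    show "AE x in lborel. (\<lambda>n. indicator ((\<Union>i<n. A i) \<inter> box a b) x *\<^sub>R F x) \<longlonglongrightarrow> indicator ((\<Union>i. A i) \<inter> box a b) x *\<^sub>R F x"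
    proof (intro AE_I2 tendsto_scaleR tendsto_const)
     fix x
     have "(\<lambda>n. indicator (\<Union>i<n. A i) x * indicator (box a b) x :: real) \<longlonglongrightarrow> indicator (\<Union>i. A i) x * indicator (box a b) x"
      by (intro tendsto_mult tendsto_const LIMSEQ_indicator_UN)
     then show "(\<lambda>n. indicator ((\<Union>i<n. A i) \<inter> box a b) x :: real) \<longlonglongrightarrow> indicator ((\<Union>i. A i) \<inter> box a b) x"
      by (simp add: indicator_inter_arith)
    qed
    show "integrable lborel (\<lambda>x. norm (indicator (box a b) x *\<^sub>R F x))"
     by (rule integrable_norm[OF int])
   qed (auto simp: indicator_def)
   moreover have "(\<integral>x. indicator ((\<Union>i<n. A i) \<inter> box a b) x *\<^sub>R F x \<partial>lborel) = 0" for n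
   proof -
    have e: "indicator ((\<Union>i<n. A i) \<inter> box a b) x *\<^sub>R F x = (\<Sum>i<n. indicator (A i \<inter> box a b) x *\<^sub>R F x)" for x
    proof -
     have "disjoint_family_on A {..<n}" using union(1) by (auto simp: disjoint_family_on_def)
     then show ?thesis
      by (simp only: indicator_inter_arith indicator_UN_disjoint[OF finite_lessThan] sum_distrib_right scaleR_sum_left)
    qed
    show ?thesis
     unfolding e by (subst Bochner_Integration.integral_sum) (auto intro!: intA sum.neutral union.IH)
   qed
   ultimately show ?case by (simp add: LIMSEQ_const_iff)
  qed
 qed
 have AEn: "AE x in lborel. x \<in> box a b \<longrightarrow> F x = 0" for a b
 proof -
  have "AE x in lborel. indicator (box a b) x *\<^sub>R F x = 0"
  proof (rule sigma_finite_measure.density_zero[OF sigma_finite_lborel int])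
   fix A :: "(real^3) set" assume "A \<in> sets lborel"
   then show "set_lebesgue_integral lborel A (\<lambda>x. indicator (box a b) x *\<^sub>R F x) = 0"
    using set0[of A a b] by (simp add: set_lebesgue_integral_def indicator_inter_arith)
  qed
  then show ?thesis by eventually_elim (auto simp: indicator_def)
 qed
 have "AE x in lborel. \<forall>n::nat. x \<in> box (\<chi> i. - real n) (\<chi> i. real n) \<longrightarrow> F x = 0"
  unfolding AE_all_countable using AEn by blast
 then show ?thesis
 proof eventually_elim
  case (elim x)
  obtain n :: nat where "norm x < real n" using reals_Archimedean2 by blast
  then have "x \<in> box (\<chi> i. - real n) (\<chi> i. real n)"
   using component_le_norm_cart[of x] by (auto simp: mem_box_cart abs_less_iff) (smt (verit))+
  then show ?case using elim by blast
 qed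
qed

text \<open>The kernel of \<open>hess_trace\<close> at \<open>d = 1\<close>, with the sign reversed.
  Its mass \<open>kappa\<close> equals 4 pi; the argument works with the integral itself and its
  positivity.\<close>

definition poisson :: "real^3 \<Rightarrow> real"
 where "poisson z = 3 * (z \<bullet> z + 1) powr (- 5/2)"

definition kappa :: real
 where "kappa = (\<integral>z. poisson z \<partial>lborel)"

lemma poisson_measurable [measurable]: "poisson \<in> borel_fun"
 unfolding poisson_def by measurable

lemma poisson_pos: "poisson z > 0"
proof -
 have "z \<bullet> z + 1 > 0" by (rule add_nonneg_pos) auto
 then show ?thesis by (simp add: poisson_def)
qed

lemma poisson_integrable: "integrable lborel poisson"
proof (rule integrableI_nonneg)
 have "(\<integral>\<^sup>+z. ennreal (poisson z) \<partial>lborel) = 3 * (\<integral>\<^sup>+(z::real^3). ennreal ((z \<bullet> z + 1) powr (- 5/2)) \<partial>lborel)"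
  by (simp add: poisson_def ennreal_mult nn_integral_cmult)
 also have "\<dots> < \<infinity>"
  using nn_integral_radial_weight_finite[of 5 1 0] by (simp add: ennreal_mult_less_top)
 finally show "(\<integral>\<^sup>+z. ennreal (poisson z) \<partial>lborel) < \<infinity>" .
qed (auto intro: less_imp_le[OF poisson_pos])

lemma kappa_pos: "kappa > 0"
proof -
 have "kappa \<ge> 0" unfolding kappa_def by (intro integral_nonneg_AE AE_I2 less_imp_le[OF poisson_pos])
 moreover have "kappa \<noteq> 0"
 proof
  assume "kappa = 0"
  then have "AE z in lborel. poisson z = 0"
   unfolding kappa_def using integral_nonneg_eq_0_iff_AE[OF poisson_integrable] poisson_pos by (simp add: less_imp_le)
  then have "AE z in (lborel :: (real^3) measure). False"
   by eventually_elim (use poisson_pos in \<open>metis less_irrefl\<close>)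
  then show False by (simp add: AE_iff_null null_sets_def)
 qed
 ultimately show ?thesis by simp
qed

lemma integral_lborel_affine:
 fixes f :: "real^3 \<Rightarrow> 'b::euclidean_space"
 assumes [measurable]: "f \<in> borel_fun" and c: "c > 0"
 shows "(\<integral>x. f x \<partial>lborel) = (c ^ 3) *\<^sub>R (\<integral>x. f (t + c *\<^sub>R x) \<partial>lborel)"
proof -
 have "(\<integral>x. f x \<partial>lborel) = (\<integral>x. f x \<partial>density (distr lborel borel (\<lambda>x. t + c *\<^sub>R x)) (\<lambda>_. ennreal (\<bar>c\<bar> ^ DIM(real^3))))"
  using c by (subst lborel_affine[of c t]) auto
 also have "\<dots> = (\<integral>x. (c ^ 3) *\<^sub>R f x \<partial>distr lborel borel (\<lambda>x. t + c *\<^sub>R x))"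
  using c by (subst integral_density) auto
 also have "\<dots> = (\<integral>x. (c ^ 3) *\<^sub>R f (t + c *\<^sub>R x) \<partial>lborel)"
  by (subst integral_distr) auto
 finally show ?thesis by simp
qed

text \<open>With \<open>d = e^2\<close> the factor \<open>e^2\<close>, the volume factor
  \<open>e^3\<close> and the kernel factor \<open>e^-5\<close> cancel, so the left-hand side is an
  average of \<open>f\<close> around \<open>x0\<close> at scale \<open>e\<close>.\<close>

lemma poisson_scaled:
 fixes f :: "real^3 \<Rightarrow> 'b::euclidean_space"
 assumes [measurable]: "f \<in> borel_fun" and e: "e > 0"
 shows "(3 * e\<^sup>2) *\<^sub>R (\<integral>x. (sqd x0 x + e\<^sup>2) powr (- 5/2) *\<^sub>R f x \<partial>lborel) = (\<integral>z. poisson z *\<^sub>R f (x0 + e *\<^sub>R z) \<partial>lborel)"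
proof -
 have "(\<integral>x. (sqd x0 x + e\<^sup>2) powr (- 5/2) *\<^sub>R f x \<partial>lborel)
   = e ^ 3 *\<^sub>R (\<integral>z. ((e *\<^sub>R z) \<bullet> (e *\<^sub>R z) + e\<^sup>2) powr (- 5/2) *\<^sub>R f (x0 + e *\<^sub>R z) \<partial>lborel)"
  by (subst integral_lborel_affine[OF _ e, where t = x0]) auto
 also have "(\<lambda>z. ((e *\<^sub>R z) \<bullet> (e *\<^sub>R z) + e\<^sup>2) powr (- 5/2) *\<^sub>R f (x0 + e *\<^sub>R z)) = (\<lambda>z. (e powr (-5)) *\<^sub>R ((z \<bullet> z + 1) powr (- 5/2) *\<^sub>R f (x0 + e *\<^sub>R z)))"
 proof
  fix z :: "real^3"
  have "(e *\<^sub>R z) \<bullet> (e *\<^sub>R z) + e\<^sup>2 = e powr 2 * (z \<bullet> z + 1)"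
   using e by (simp add: power2_eq_square algebra_simps)
  then have "((e *\<^sub>R z) \<bullet> (e *\<^sub>R z) + e\<^sup>2) powr (- 5/2) = e powr (-5) * (z \<bullet> z + 1) powr (- 5/2)"
   by (simp only: powr_mult powr_powr) simp
  then show "((e *\<^sub>R z) \<bullet> (e *\<^sub>R z) + e\<^sup>2) powr (- 5/2) *\<^sub>R f (x0 + e *\<^sub>R z) = (e powr (-5)) *\<^sub>R ((z \<bullet> z + 1) powr (- 5/2) *\<^sub>R f (x0 + e *\<^sub>R z))"
   by simp
 qed
 finally have "(3 * e\<^sup>2) *\<^sub>R (\<integral>x. (sqd x0 x + e\<^sup>2) powr (- 5/2) *\<^sub>R f x \<partial>lborel)
  = (e\<^sup>2 * e ^ 3 * e powr (-5)) *\<^sub>R (3 *\<^sub>R (\<integral>z. (z \<bullet> z + 1) powr (- 5/2) *\<^sub>R f (x0 + e *\<^sub>R z) \<partial>lborel))"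
  by (simp only: integral_scaleR_right) (simp only: scaleR_scaleR mult_ac)
 also have "e\<^sup>2 * e ^ 3 * e powr (-5) = 1"
  using e powr_realpow[of e 5] by (simp add: powr_minus flip: power_add)
 finally show ?thesis by (simp add: poisson_def flip: scaleR_scaleR integral_scaleR_right)
qed

text \<open>\<open>s\<close> dominates the data and \<open>H d\<close> the regularised right-hand sides.\<close>

locale regularised_equation =
 fixes s :: "real^3 \<Rightarrow> real" and f :: "real^3 \<Rightarrow> 'b::euclidean_space"
  and H :: "real \<Rightarrow> real^3 \<Rightarrow> real^3 \<Rightarrow> 'b" and l k :: nat and C :: real
 assumes s_meas [measurable]: "s \<in> borel_fun" and s_nonneg: "\<And>x. 0 \<le> s x"
  and s_int: "(\<integral>\<^sup>+x. ennreal (s x ^ 6) \<partial>lborel) < \<infinity>"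
  and f_meas [measurable]: "f \<in> borel_fun" and f_le: "\<And>x. norm (f x) \<le> s x ^ k"
  and H_meas [measurable]: "\<And>d. (\<lambda>p. H d (fst p) (snd p)) \<in> borel_measurable (borel \<Otimes>\<^sub>M borel)"
  and H_le: "\<And>d x y. 0 \<le> d \<Longrightarrow> x \<noteq> y \<Longrightarrow> norm (H d x y) \<le> C * (s y ^ (6 - l) / dist x y ^ l)"
  and H_lim: "\<And>x y. x \<noteq> y \<Longrightarrow> ((\<lambda>d. H d x y) \<longlongrightarrow> H 0 x y) (at_right 0)"
  and k: "k \<le> 6" and l: "1 \<le> l" "l < 3"
  and eqn: "\<And>d x. d > 0 \<Longrightarrow>
   (3 * d) *\<^sub>R (\<integral>y. (sqd x y + d) powr (- 5/2) *\<^sub>R f y \<partial>lborel) = (\<integral>y. H d x y \<partial>lborel)"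
begin

definition S where "S = enn2real (\<integral>\<^sup>+x. ennreal (s x ^ 6) \<partial>lborel)"

lemma S: "(\<integral>\<^sup>+x. ennreal (s x ^ 6) \<partial>lborel) = ennreal S" "0 \<le> S"
 using s_int by (auto simp: S_def less_top)

lemma s6_integrable: "integrable lborel (\<lambda>x. s x ^ 6)"
 using S by (intro integrableI_nonneg) (auto simp: s_nonneg)

lemma f_le': "norm (f x) \<le> s x ^ 6 + 1"
 using f_le[of x] young_power[OF s_nonneg[of x] zero_le_one, of k 6] k by simp

context
 fixes a b :: "real^3"
begin

abbreviation Q where "Q \<equiv> box a b"

lemma shifted_integrable: "integrable lborel (\<lambda>x. indicator Q x *\<^sub>R f (x + h))"
 and shifted_bound: "norm (\<integral>x. indicator Q x *\<^sub>R f (x + h) \<partial>lborel) \<le> S + measure lborel Q"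
  and shifted_nn_bound: "(\<integral>\<^sup>+x. ennreal (norm (indicator Q x *\<^sub>R f (x + h))) \<partial>lborel) \<le> ennreal (S + measure lborel Q)"
proof -
 have "(\<integral>\<^sup>+x. ennreal (norm (indicator Q x *\<^sub>R f (x + h))) \<partial>lborel) \<le> (\<integral>\<^sup>+x. ennreal (s (x + h) ^ 6) + indicator Q x \<partial>lborel)"
  using f_le'
  by (intro nn_integral_mono)
    (auto simp: indicator_def s_nonneg ennreal_leI simp flip: ennreal_1 ennreal_plus)
 also have "\<dots> = (\<integral>\<^sup>+x. ennreal (s (x + h) ^ 6) \<partial>lborel) + emeasure lborel Q"
  by (subst nn_integral_add) auto
 also have "(\<integral>\<^sup>+x. ennreal (s (x + h) ^ 6) \<partial>lborel) = ennreal S"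
  using nn_integral_translate[of "\<lambda>x. ennreal (s x ^ 6)" "- h"] by (simp add: S)
 also have "emeasure lborel Q = ennreal (measure lborel Q)"
  by (rule emeasure_eq_ennreal_measure) (auto simp: emeasure_lborel_box_eq)
 finally show nn: "(\<integral>\<^sup>+x. ennreal (norm (indicator Q x *\<^sub>R f (x + h))) \<partial>lborel) \<le> ennreal (S + measure lborel Q)"
  using S by (simp flip: ennreal_plus)
 then show i: "integrable lborel (\<lambda>x. indicator Q x *\<^sub>R f (x + h))"
  by (intro integrableI_bounded) (auto intro: le_less_trans)
 have "ennreal (norm (\<integral>x. indicator Q x *\<^sub>R f (x + h) \<partial>lborel)) \<le> ennreal (S + measure lborel Q)"
  by (rule order_trans[OF integral_norm_bound_ennreal[OF i] nn])
 then show "norm (\<integral>x. indicator Q x *\<^sub>R f (x + h) \<partial>lborel) \<le> S + measure lborel Q"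
  using S by (subst (asm) ennreal_le_iff) auto
qed

text \<open>The shift is moved from \<open>f\<close> to the indicator of the box, which converges
  pointwise off the boundary of the box, a null set. Boundedness of the shifts supplies one ball for
  the majorant.\<close>

lemma shifted_tendsto:
 assumes h: "h \<longlonglongrightarrow> 0"
 shows "(\<lambda>n. \<integral>x. indicator Q x *\<^sub>R f (x + h n) \<partial>lborel) \<longlonglongrightarrow> (\<integral>x. indicator Q x *\<^sub>R f x \<partial>lborel)"
proof -
 have tr: "(\<integral>x. indicator Q x *\<^sub>R f (x + h) \<partial>lborel) = (\<integral>x. indicator Q (x - h) *\<^sub>R f x \<partial>lborel)" for h
  using integral_lborel_affine[of "\<lambda>x. indicator Q (x - h) *\<^sub>R f x" 1 h] by (simp add: add.commute)
 obtain m where m: "\<And>n. norm (h n) \<le> m" using convergent_imp_Bseq[OF convergentI[OF h]] by (auto simp: Bseq_def)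
 obtain r where "\<forall>x\<in>Q. norm x \<le> r" using bounded_box[of a b] unfolding bounded_iff by blast
 then have r: "Q \<subseteq> cball 0 r" by auto
 have "(\<lambda>n. \<integral>x. indicator Q (x - h n) *\<^sub>R f x \<partial>lborel) \<longlonglongrightarrow> (\<integral>x. indicator Q x *\<^sub>R f x \<partial>lborel)"
 proof (rule integral_dominated_convergence[where w = "\<lambda>x. s x ^ 6 + indicator (cball 0 (r + m)) x"])
  show "integrable lborel (\<lambda>x. s x ^ 6 + indicator (cball (0::real^3) (r + m)) x)"
   by (intro Bochner_Integration.integrable_add s6_integrable integrable_real_indicator)
     (use emeasure_lborel_cball_finite in auto)
  have fr: "AE x in lborel. x \<notin> cbox a b - box a b"
  proof (rule AE_not_in)
   have "emeasure lborel (cbox a b - box a b) = emeasure lborel (cbox a b) - emeasure lborel (box a b)"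
    by (rule emeasure_Diff) (auto simp: emeasure_lborel_box_eq box_subset_cbox)
   also have "\<dots> = 0"
    by (cases "\<forall>i\<in>Basis. a \<bullet> i \<le> b \<bullet> i") (auto simp: emeasure_lborel_box_eq emeasure_lborel_cbox_eq)
   finally show "cbox a b - box a b \<in> null_sets lborel" by (auto simp: null_sets_def)
  qed
  then show "AE x in lborel. (\<lambda>n. indicator Q (x - h n) *\<^sub>R f x) \<longlonglongrightarrow> indicator Q x *\<^sub>R f x"
  proof eventually_elim
   case (elim x)
   have lim: "(\<lambda>n. x - h n) \<longlonglongrightarrow> x" using tendsto_diff[OF tendsto_const h, of x] by simp
   have "eventually (\<lambda>n. indicator Q (x - h n) = (indicator Q x :: real)) sequentially"
   proof (cases "x \<in> box a b")
    case True
    then show ?thesis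
     using topological_tendstoD[OF lim open_box[of a b]] by (auto elim!: eventually_mono)
   next
    case False
    then have "x \<in> - cbox a b" using elim by blast
    then have "eventually (\<lambda>n. x - h n \<in> - cbox a b) sequentially"
     using topological_tendstoD[OF lim, of "- cbox a b"] by (auto simp: closed_cbox open_Compl)
    then show ?thesis
     by eventually_elim (use False box_subset_cbox[of a b] in \<open>auto simp: indicator_def\<close>)
   qed
   then have "(\<lambda>n. indicator Q (x - h n) :: real) \<longlonglongrightarrow> indicator Q x"
    by (rule tendsto_eventually)
   then show ?case by (intro tendsto_scaleR tendsto_const)
  qed
  fix n
  show "AE x in lborel. norm (indicator Q (x - h n) *\<^sub>R f x) \<le> s x ^ 6 + indicator (cball 0 (r + m)) x"
  proof (rule AE_I2)
   fix x
   show "norm (indicator Q (x - h n) *\<^sub>R f x) \<le> s x ^ 6 + indicator (cball 0 (r + m)) x"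
   proof (cases "x - h n \<in> Q")
    case True
    then have "norm (x - h n) \<le> r" using r by (auto simp: subset_eq)
    then have "norm x \<le> r + m" using m[of n] norm_triangle_ineq[of "x - h n" "h n"] by simp
    then show ?thesis using True f_le'[of x] by simp
   qed (simp add: s_nonneg)
  qed
 qed auto
 then show ?thesis unfolding tr .
qed

text \<open>Fubini turns the box integral of averages into an average of shifted box integrals.
  These are bounded uniformly and converge for each \<open>z\<close>, so the average tends to
  \<open>kappa\<close> times the unshifted one.\<close>

lemma lhs_limit:
 assumes e: "\<And>n. e n > 0" "e \<longlonglongrightarrow> 0"
 shows "(\<lambda>n. \<integral>x. indicator Q x *\<^sub>R (\<integral>z. poisson z *\<^sub>R f (x + e n *\<^sub>R z) \<partial>lborel) \<partial>lborel) \<longlonglongrightarrow> kappa *\<^sub>R (\<integral>x. indicator Q x *\<^sub>R f x \<partial>lborel)"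
proof -
 define B where "B = S + measure lborel Q"
 have B: "B \<ge> 0" using S by (simp add: B_def)
 have swap: "(\<integral>x. indicator Q x *\<^sub>R (\<integral>z. poisson z *\<^sub>R f (x + e *\<^sub>R z) \<partial>lborel) \<partial>lborel)
   = (\<integral>z. poisson z *\<^sub>R (\<integral>x. indicator Q x *\<^sub>R f (x + e *\<^sub>R z) \<partial>lborel) \<partial>lborel)" for e
 proof -
  define G where "G p = poisson (snd p) *\<^sub>R (indicator Q (fst p) *\<^sub>R f (fst p + e *\<^sub>R snd p))" for p
  have [measurable]: "G \<in> borel_measurable (borel \<Otimes>\<^sub>M borel)"
   unfolding G_def by measurable
  have "integrable (lborel \<Otimes>\<^sub>M lborel) G"
  proof (rule integrableI_bounded)
   have "(\<integral>\<^sup>+p. ennreal (norm (G p)) \<partial>(lborel \<Otimes>\<^sub>M lborel)) = (\<integral>\<^sup>+z. \<integral>\<^sup>+x. ennreal (norm (G (x, z))) \<partial>lborel \<partial>lborel)"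
    by (rule lborel_pair.nn_integral_snd[symmetric]) measurable
   also have "\<dots> = (\<integral>\<^sup>+z. ennreal (poisson z) * (\<integral>\<^sup>+x. ennreal (norm (indicator Q x *\<^sub>R f (x + e *\<^sub>R z))) \<partial>lborel) \<partial>lborel)"
   proof (rule nn_integral_cong)
    fix z
    have "ennreal (norm (G (x, z))) = ennreal (poisson z) * ennreal (norm (indicator Q x *\<^sub>R f (x + e *\<^sub>R z)))" for x
     unfolding G_def fst_conv snd_conv norm_scaleR[of "poisson z"] using poisson_pos[of z] by (subst ennreal_mult[symmetric]) auto
    then show "(\<integral>\<^sup>+x. ennreal (norm (G (x, z))) \<partial>lborel) = ennreal (poisson z) * (\<integral>\<^sup>+x. ennreal (norm (indicator Q x *\<^sub>R f (x + e *\<^sub>R z))) \<partial>lborel)"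
     by (simp only:) (rule nn_integral_cmult, measurable)
   qed
   also have "\<dots> \<le> (\<integral>\<^sup>+z. ennreal (poisson z) * ennreal B \<partial>lborel)"
    unfolding B_def by (intro nn_integral_mono mult_left_mono shifted_nn_bound) auto
   also have "\<dots> < \<infinity>"
    using integrableD(2)[OF poisson_integrable] poisson_pos
    by (simp add: nn_integral_multc ennreal_mult_less_top less_imp_le less_top)
   finally show "(\<integral>\<^sup>+p. ennreal (norm (G p)) \<partial>(lborel \<Otimes>\<^sub>M lborel)) < \<infinity>" .
  qed measurable
  then have "integrable (lborel \<Otimes>\<^sub>M lborel) (case_prod (\<lambda>x z. G (x, z)))" by (simp add: case_prod_beta')
  from lborel_pair.Fubini_integral[OF this]
  have "(\<integral>z. \<integral>x. G (x, z) \<partial>lborel \<partial>lborel) = (\<integral>x. \<integral>z. G (x, z) \<partial>lborel \<partial>lborel)" .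
  moreover have "(\<integral>z. G (x, z) \<partial>lborel) = indicator Q x *\<^sub>R (\<integral>z. poisson z *\<^sub>R f (x + e *\<^sub>R z) \<partial>lborel)" for x
  proof -
   have "G (x, z) = indicator Q x *\<^sub>R (poisson z *\<^sub>R f (x + e *\<^sub>R z))" for z
    by (simp add: G_def mult.commute)
   then show ?thesis by (simp only: integral_scaleR_right)
  qed
  moreover have "(\<integral>x. G (x, z) \<partial>lborel) = poisson z *\<^sub>R (\<integral>x. indicator Q x *\<^sub>R f (x + e *\<^sub>R z) \<partial>lborel)" for z
   by (simp only: G_def fst_conv snd_conv integral_scaleR_right)
  ultimately show ?thesis by simp
 qed
 have "(\<lambda>n. \<integral>z. poisson z *\<^sub>R (\<integral>x. indicator Q x *\<^sub>R f (x + e n *\<^sub>R z) \<partial>lborel) \<partial>lborel) \<longlonglongrightarrow> (\<integral>z. poisson z *\<^sub>R (\<integral>x. indicator Q x *\<^sub>R f x \<partial>lborel) \<partial>lborel)"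
 proof (rule integral_dominated_convergence[where w = "\<lambda>z. B * poisson z"])
  show "integrable lborel (\<lambda>z. B * poisson z)" by (intro integrable_mult_right poisson_integrable)
  show "AE z in lborel. (\<lambda>n. poisson z *\<^sub>R (\<integral>x. indicator Q x *\<^sub>R f (x + e n *\<^sub>R z) \<partial>lborel)) \<longlonglongrightarrow> poisson z *\<^sub>R (\<integral>x. indicator Q x *\<^sub>R f x \<partial>lborel)"
  proof (intro AE_I2 tendsto_scaleR tendsto_const shifted_tendsto)
   fix z :: "real^3"
   show "(\<lambda>n. e n *\<^sub>R z) \<longlonglongrightarrow> 0" using tendsto_scaleR[OF e(2) tendsto_const, of z] by simp
  qed
  fix n
  show "AE z in lborel. norm (poisson z *\<^sub>R (\<integral>x. indicator Q x *\<^sub>R f (x + e n *\<^sub>R z) \<partial>lborel)) \<le> B * poisson z"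
  proof (intro AE_I2)
   fix z
   have "poisson z * norm (\<integral>x. indicator Q x *\<^sub>R f (x + e n *\<^sub>R z) \<partial>lborel) \<le> poisson z * B"
    unfolding B_def using poisson_pos[of z] by (intro mult_left_mono shifted_bound) auto
   then show "norm (poisson z *\<^sub>R (\<integral>x. indicator Q x *\<^sub>R f (x + e n *\<^sub>R z) \<partial>lborel)) \<le> B * poisson z"
    using poisson_pos[of z] by (simp add: mult.commute)
  qed
 qed measurable
 then show ?thesis unfolding swap kappa_def by (simp only: integral_scaleR_left[OF poisson_integrable])
qed

lemma H_dominated:
 shows "integrable (lborel \<Otimes>\<^sub>M lborel) (\<lambda>p. indicator Q (fst p) * (C * (s (snd p) ^ (6 - l) / dist (fst p) (snd p) ^ l)))"
proof -
 \<comment> \<open>Enlarging \<open>s\<close> to 1 on the box makes the powers of \<open>t\<close>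
   dominate both the indicator and \<open>s\<close>, so the diagonal inequality gives integrability
   of the kernel over box times space.\<close>
 define t where "t x = max (s x) (indicator Q x)" for x
 have [measurable]: "t \<in> borel_fun" unfolding t_def by measurable
 have t0: "0 \<le> t x" for x by (simp add: t_def le_max_iff_disj)
 define B where "B = S + measure lborel Q"
 have t6: "(\<integral>\<^sup>+x. ennreal (t x ^ 6) \<partial>lborel) \<le> ennreal B"
 proof -
  have "(\<integral>\<^sup>+x. ennreal (t x ^ 6) \<partial>lborel) \<le> (\<integral>\<^sup>+x. ennreal (s x ^ 6) + indicator Q x \<partial>lborel)"
  proof (rule nn_integral_mono)
   fix x
   have "t x ^ 6 \<le> s x ^ 6 + indicator Q x"
    using s_nonneg[of x] by (auto simp: t_def max_def indicator_def)
   then have "ennreal (t x ^ 6) \<le> ennreal (s x ^ 6 + indicator Q x)" by (rule ennreal_leI)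
   also have "\<dots> = ennreal (s x ^ 6) + indicator Q x"
    using s_nonneg[of x] by (subst ennreal_plus) (auto simp: ennreal_indicator)
   finally show "ennreal (t x ^ 6) \<le> ennreal (s x ^ 6) + indicator Q x" .
  qed
  also have "\<dots> = ennreal S + emeasure lborel Q"
   by (subst nn_integral_add) (auto simp: S)
  also have "emeasure lborel Q = ennreal (measure lborel Q)"
   by (rule emeasure_eq_ennreal_measure) (auto simp: emeasure_lborel_box_eq)
  finally show ?thesis using S by (simp add: B_def)
 qed
 have "integrable (lborel \<Otimes>\<^sub>M lborel) (\<lambda>p. indicator Q (fst p) * (s (snd p) ^ (6 - l) / dist (fst p) (snd p) ^ l))"
 proof (rule integrableI_bounded)
  have "(\<integral>\<^sup>+p. ennreal (norm (indicator Q (fst p) * (s (snd p) ^ (6 - l) / dist (fst p) (snd p) ^ l))) \<partial>(lborel \<Otimes>\<^sub>M lborel))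
    = (\<integral>\<^sup>+x. \<integral>\<^sup>+y. ennreal (norm (indicator Q x * (s y ^ (6 - l) / dist x y ^ l))) \<partial>lborel \<partial>lborel)"
   by (subst lborel.nn_integral_fst[symmetric]) auto
  also have "\<dots> \<le> (\<integral>\<^sup>+x. \<integral>\<^sup>+y. ennreal (t x ^ (6 - l) * t y ^ (6 - l) / dist x y ^ l) \<partial>lborel \<partial>lborel)"
  proof (intro nn_integral_mono ennreal_leI)
   fix x y
   have "norm (indicator Q x * (s y ^ (6 - l) / dist x y ^ l)) = indicator Q x ^ (6 - l) * s y ^ (6 - l) / dist x y ^ l"
    using s_nonneg[of y] l by (simp add: abs_mult indicator_def power_0_left)
   also have "\<dots> \<le> t x ^ (6 - l) * t y ^ (6 - l) / dist x y ^ l"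
    using s_nonneg[of y] t0 by (intro divide_right_mono mult_mono power_mono) (auto simp: t_def)
   finally show "norm (indicator Q x * (s y ^ (6 - l) / dist x y ^ l)) \<le> \<dots>" .
  qed
  also have "\<dots> \<le> ennreal (B\<^sup>2 + 2 * hls_const l * B)"
   by (rule hls_diagonal[OF _ t0 t6 _ l]) (auto simp: B_def S)
  finally show "(\<integral>\<^sup>+p. ennreal (norm (indicator Q (fst p) * (s (snd p) ^ (6 - l) / dist (fst p) (snd p) ^ l))) \<partial>(lborel \<Otimes>\<^sub>M lborel)) < \<infinity>"
   by (rule le_less_trans) simp
 qed measurable
 then have "integrable (lborel \<Otimes>\<^sub>M lborel) (\<lambda>p. C * (indicator Q (fst p) * (s (snd p) ^ (6 - l) / dist (fst p) (snd p) ^ l)))"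
  by (rule integrable_mult_right)
 then show ?thesis by (simp add: mult.left_commute)
qed

lemma AE_pair_neq: "AE p in (lborel \<Otimes>\<^sub>M lborel). fst p \<noteq> (snd p :: real^3)"
proof -
 have "{p \<in> space (lborel \<Otimes>\<^sub>M lborel). fst p \<noteq> (snd p :: real^3)} \<in> sets (lborel \<Otimes>\<^sub>M lborel)" by measurable
 then show ?thesis
  by (rule lborel_pair.AE_pair_measure) (auto intro!: AE_I2 eventually_mono[OF AE_lborel_singleton])
qed

lemma H_integrable:
 assumes "0 \<le> d"
 shows "integrable (lborel \<Otimes>\<^sub>M lborel) (\<lambda>p. indicator Q (fst p) *\<^sub>R H d (fst p) (snd p))"
proof (rule Bochner_Integration.integrable_bound[OF H_dominated])
 show "AE p in (lborel \<Otimes>\<^sub>M lborel). norm (indicator Q (fst p) *\<^sub>R H d (fst p) (snd p)) \<le> norm (indicator Q (fst p) * (C * (s (snd p) ^ (6 - l) / dist (fst p) (snd p) ^ l)))"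
  using AE_pair_neq
 proof eventually_elim
  case (elim p)
  show ?case
  proof (cases "fst p \<in> Q")
   case True
   have "norm (H d (fst p) (snd p)) \<le> \<bar>C * (s (snd p) ^ (6 - l) / dist (fst p) (snd p) ^ l)\<bar>"
    by (rule order_trans[OF H_le[OF assms elim] abs_ge_self])
   then show ?thesis using True by simp
  qed simp
 qed
qed measurable

lemma H_iterated:
 assumes "0 \<le> d"
 shows "(\<integral>x. indicator Q x *\<^sub>R (\<integral>y. H d x y \<partial>lborel) \<partial>lborel) = (\<integral>p. indicator Q (fst p) *\<^sub>R H d (fst p) (snd p) \<partial>(lborel \<Otimes>\<^sub>M lborel))"
  and "integrable lborel (\<lambda>x. indicator Q x *\<^sub>R (\<integral>y. H d x y \<partial>lborel))"
proof -
 show "(\<integral>x. indicator Q x *\<^sub>R (\<integral>y. H d x y \<partial>lborel) \<partial>lborel) = (\<integral>p. indicator Q (fst p) *\<^sub>R H d (fst p) (snd p) \<partial>(lborel \<Otimes>\<^sub>M lborel))"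
  using lborel_pair.integral_fst'[OF H_integrable[OF assms]] by simp
 show "integrable lborel (\<lambda>x. indicator Q x *\<^sub>R (\<integral>y. H d x y \<partial>lborel))"
  using lborel_pair.integrable_fst'[OF H_integrable[OF assms]] by simp
qed

lemma rhs_limit:
 assumes e: "\<And>n. e n > 0" "e \<longlonglongrightarrow> 0"
 shows "(\<lambda>n. \<integral>x. indicator Q x *\<^sub>R (\<integral>y. H ((e n)\<^sup>2) x y \<partial>lborel) \<partial>lborel) \<longlonglongrightarrow> (\<integral>x. indicator Q x *\<^sub>R (\<integral>y. H 0 x y \<partial>lborel) \<partial>lborel)"
proof -
 have "(\<lambda>n. \<integral>p. indicator Q (fst p) *\<^sub>R H ((e n)\<^sup>2) (fst p) (snd p) \<partial>(lborel \<Otimes>\<^sub>M lborel)) \<longlonglongrightarrow> (\<integral>p. indicator Q (fst p) *\<^sub>R H 0 (fst p) (snd p) \<partial>(lborel \<Otimes>\<^sub>M lborel))"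
 proof (rule integral_dominated_convergence[OF _ _ H_dominated])
  show "AE p in (lborel \<Otimes>\<^sub>M lborel). (\<lambda>n. indicator Q (fst p) *\<^sub>R H ((e n)\<^sup>2) (fst p) (snd p)) \<longlonglongrightarrow> indicator Q (fst p) *\<^sub>R H 0 (fst p) (snd p)"
   using AE_pair_neq
  proof eventually_elim
   case (elim p)
   have "filterlim (\<lambda>n. (e n)\<^sup>2) (at_right 0) sequentially"
    unfolding filterlim_at
   proof
    show "(\<lambda>n. (e n)\<^sup>2) \<longlonglongrightarrow> 0" using tendsto_power[OF e(2), of 2] by simp
    show "\<forall>\<^sub>F n in sequentially. (e n)\<^sup>2 \<in> {0<..} \<and> (e n)\<^sup>2 \<noteq> 0" using e(1) by (auto simp: less_imp_neq[symmetric])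
   qed
   from filterlim_compose[OF H_lim[OF elim] this]
   show ?case by (intro tendsto_scaleR tendsto_const)
  qed
  fix n
  show "AE p in (lborel \<Otimes>\<^sub>M lborel). norm (indicator Q (fst p) *\<^sub>R H ((e n)\<^sup>2) (fst p) (snd p)) \<le> indicator Q (fst p) * (C * (s (snd p) ^ (6 - l) / dist (fst p) (snd p) ^ l))"
   using AE_pair_neq by eventually_elim (use H_le in \<open>auto simp: indicator_def\<close>)
 qed measurable
 then show ?thesis by (simp add: H_iterated)
qed

lemma box_identity:
 "kappa *\<^sub>R (\<integral>x. indicator Q x *\<^sub>R f x \<partial>lborel) = (\<integral>x. indicator Q x *\<^sub>R (\<integral>y. H 0 x y \<partial>lborel) \<partial>lborel)"
proof -
 define e where "e n = 1 / real (Suc n)" for n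
 have e1: "e n > 0" for n
  by (simp add: e_def)
 have e2: "e \<longlonglongrightarrow> 0"
  unfolding e_def by (rule LIMSEQ_Suc[OF lim_1_over_n])
 have "(\<integral>z. poisson z *\<^sub>R f (x + e n *\<^sub>R z) \<partial>lborel) = (\<integral>y. H ((e n)\<^sup>2) x y \<partial>lborel)" for n x
  using poisson_scaled[OF f_meas e1, of n x] eqn[of "(e n)\<^sup>2" x] e1[of n] by simp
 note seq = this
 show ?thesis
  by (rule LIMSEQ_unique[OF lhs_limit[OF e1 e2]]) (unfold seq, rule rhs_limit[OF e1 e2])
qed

end

lemma integral_equation_AE: "AE x in lborel. kappa *\<^sub>R f x = (\<integral>y. H 0 x y \<partial>lborel)"
proof -
 have "AE x in lborel. kappa *\<^sub>R f x - (\<integral>y. H 0 x y \<partial>lborel) = 0"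
 proof (rule AE_zero_of_box_integrals)
  fix a b
  have i: "integrable lborel (\<lambda>x. indicator (box a b) x *\<^sub>R f x)"
   using shifted_integrable[of a b 0] by simp
  note i' = H_iterated(2)[of 0 a b, OF order_refl]
  have eq: "(\<lambda>x. indicator (box a b) x *\<^sub>R (kappa *\<^sub>R f x - (\<integral>y. H 0 x y \<partial>lborel))) =
    (\<lambda>x. kappa *\<^sub>R (indicator (box a b) x *\<^sub>R f x) - indicator (box a b) x *\<^sub>R (\<integral>y. H 0 x y \<partial>lborel))"
   by (simp add: fun_eq_iff scaleR_diff_right scaleR_left_commute)
  show "integrable lborel (\<lambda>x. indicator (box a b) x *\<^sub>R (kappa *\<^sub>R f x - (\<integral>y. H 0 x y \<partial>lborel)))"
   unfolding eq by (rule Bochner_Integration.integrable_diff[OF integrable_scaleR_right[OF i] i'])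
  show "(\<integral>x. indicator (box a b) x *\<^sub>R (kappa *\<^sub>R f x - (\<integral>y. H 0 x y \<partial>lborel)) \<partial>lborel) = 0"
   unfolding eq
   by (subst Bochner_Integration.integral_diff[OF integrable_scaleR_right[OF i] i'])
     (simp only: integral_scaleR_right box_identity diff_self)
 next
  have "(\<lambda>(x, y). H 0 x y) \<in> borel_measurable (borel \<Otimes>\<^sub>M lborel)"
   using H_meas[of 0] by (simp add: case_prod_beta')
  then have "(\<lambda>x. \<integral>y. H 0 x y \<partial>lborel) \<in> borel_fun"
   by (rule lborel.borel_measurable_lebesgue_integral)
  then show "(\<lambda>x. kappa *\<^sub>R f x - (\<integral>y. H 0 x y \<partial>lborel)) \<in> borel_fun" by measurable
 qed
 then show ?thesis by eventually_elim simp
qed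

end

section \<open>The integral equations satisfied by a weak solution\<close>

lemma inner_diff_dist: "sqd x y = (dist x (y::real^3))\<^sup>2"
 by (simp add: dist_norm power2_norm_eq_inner norm_minus_commute flip: power2_norm_eq_inner)

lemma powr_dist_le:
 assumes "0 \<le> d" "x \<noteq> (y::real^3)"
 shows "(sqd x y + d) powr (- real n / 2) \<le> 1 / dist x y ^ n"
proof -
 have p: "dist x y > 0" using assms by simp
 have "(sqd x y + d) powr (- real n / 2) \<le> ((dist x y)\<^sup>2) powr (- real n / 2)"
  unfolding inner_diff_dist using assms p by (intro powr_mono2') auto
 also have "\<dots> = (dist x y powr 2) powr (- real n / 2)" using p by simp
 also have "\<dots> = dist x y powr (- real n)" by (simp only: powr_powr) simp
 also have "\<dots> = 1 / dist x y ^ n" using p by (simp add: powr_minus powr_realpow divide_inverse)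
 finally show ?thesis .
qed

text \<open>On the diagonal both \<open>0 powr p\<close> and \<open>1 / 0\<close> are 0, so the
  regularised kernel at \<open>d = 0\<close> is the singular kernel at every pair of points.\<close>

lemma powr_dist_eq: "(sqd x y) powr (- real n / 2) = (if x = y then 0 else 1 / dist x (y::real^3) ^ n)"
proof (cases "x = y")
 case False
 then have p: "dist x y > 0" by simp
 have "((dist x y)\<^sup>2) powr (- real n / 2) = (dist x y powr 2) powr (- real n / 2)" using p by simp
 also have "\<dots> = dist x y powr (- real n)" by (simp only: powr_powr) simp
 also have "\<dots> = 1 / dist x y ^ n" using p by (simp add: powr_minus powr_realpow divide_inverse)
 finally show ?thesis using False by (simp add: inner_diff_dist)
qed simp

lemma powr_reg_tendsto:
 assumes "x \<noteq> (y::real^3)"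
 shows "((\<lambda>d. (sqd x y + d) powr p) \<longlongrightarrow> (sqd x y + 0) powr p) (at_right 0)"
proof -
 have "sqd x y > 0" using assms by simp
 then show ?thesis by (intro tendsto_intros) auto
qed

definition dirac_part :: "(3 \<Rightarrow> complex^4^4) \<Rightarrow> real^3 \<Rightarrow> complex^4 \<Rightarrow> complex^4"
 where "dirac_part \<alpha> z v = \<i> *s (\<Sum>k\<in>UNIV. \<alpha> k *v ((z $ k) *\<^sub>R v))"

lemma dirac_part_linear: "bounded_linear (dirac_part \<alpha> z)"
proof -
 have "bounded_linear (\<lambda>v. \<alpha> k *v ((z $ k) *\<^sub>R v))" for k
  using bounded_linear_compose[OF bounded_linear_mat_mul[of "\<alpha> k"] bounded_linear_scaleR_right[of "z $ k"]] by (simp add: o_def)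
 then show ?thesis
  unfolding dirac_part_def[abs_def]
  using bounded_linear_compose[OF bounded_linear_smult[of "\<i>"] bounded_linear_sum[of UNIV "\<lambda>k v. \<alpha> k *v ((z $ k) *\<^sub>R v)"]]
  by (simp add: o_def)
qed

lemma dirac_part_bound: "\<exists>C\<ge>0. \<forall>z v. norm (dirac_part \<alpha> z v) \<le> C * (norm z * norm v)"
proof -
 have "\<exists>C\<ge>0. \<forall>v. norm (\<alpha> k *v v) \<le> norm v * C" for k
  using bounded_linear.nonneg_bounded[OF bounded_linear_mat_mul[of "\<alpha> k"]] by blast
 then obtain c where c: "\<And>k. c k \<ge> 0" "\<And>k v. norm (\<alpha> k *v v) \<le> norm v * c k" by metis
 have ni: "norm (\<i> *s v) = norm v" for v :: "complex^4"
  by (simp add: norm_vec_def norm_mult)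
 have "norm (dirac_part \<alpha> z v) \<le> (\<Sum>k\<in>UNIV. c k) * (norm z * norm v)" for z v
 proof -
  have "norm (dirac_part \<alpha> z v) \<le> (\<Sum>k\<in>UNIV. c k * (norm z * norm v))"
   unfolding dirac_part_def ni
  proof (rule sum_norm_le)
   fix k
   have "norm (\<alpha> k *v ((z $ k) *\<^sub>R v)) \<le> \<bar>z $ k\<bar> * norm v * c k" using c(2)[of k "(z $ k) *\<^sub>R v"] by simp
   also have "\<dots> \<le> norm z * norm v * c k"
    using c(1)[of k] by (intro mult_right_mono component_le_norm_cart) auto
   finally show "norm (\<alpha> k *v ((z $ k) *\<^sub>R v)) \<le> c k * (norm z * norm v)" by (simp add: mult_ac)
  qed
  then show ?thesis by (simp add: sum_distrib_right)
 qed
 moreover have "(\<Sum>k\<in>UNIV. c k) \<ge> 0" by (intro sum_nonneg c(1))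
 ultimately show ?thesis by blast
qed

lemma dirac_part_scaleR: "dirac_part \<alpha> z (c *\<^sub>R v) = c *\<^sub>R dirac_part \<alpha> z v"
 using linear_cmul[OF bounded_linear.linear[OF dirac_part_linear]] .

lemma dirac_part_minus: "dirac_part \<alpha> (x - y) v = - dirac_part \<alpha> (y - x) v"
proof -
 have "((x - y) $ k) *\<^sub>R v = - 1 *\<^sub>R (((y - x) $ k) *\<^sub>R v)" for k by (simp add: algebra_simps)
 then have "dirac_part \<alpha> (x - y) v = \<i> *s (- 1 *\<^sub>R (\<Sum>k\<in>UNIV. \<alpha> k *v (((y - x) $ k) *\<^sub>R v)))"
  by (simp only: dirac_part_def mat_mul_scaleR scaleR_sum_right)
 then show ?thesis by (simp add: dirac_part_def vec_eq_iff)
qed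

locale integral_solution = critical_pair +
 fixes \<alpha> :: "3 \<Rightarrow> complex^4^4"
 assumes int_eq1: "AE x in lborel. u x = 1 / (6 * kappa) * (\<integral>y. rhs1 y / dist x y \<partial>lborel)"
  and int_eq2: "AE x in lborel. \<psi> x = (1 / kappa) *\<^sub>R (\<integral>y. (1 / dist x y ^ 3) *\<^sub>R dirac_part \<alpha> (x - y) (rhs2 y) \<partial>lborel)"

context weak_solution
begin

lemma integral_equation1: "AE x in lborel. u x = 1 / (6 * kappa) * (\<integral>y. rhs1 y / dist x y \<partial>lborel)"
proof -
 define H where "H d x y = (1/6 * (sqd x y + d) powr (- real 1/2)) *\<^sub>R rhs1 y" for d x y
 \<comment> \<open>The solution \<open>u\<close> has scale \<open>ss^1\<close>, and the kernel
   \<open>1 / |x - y|\<close> acts on \<open>rhs1\<close>, of scale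
   \<open>ss^5 = ss^(6 - 1)\<close>. The factor \<open>1/6\<close> turns the \<open>18 * d\<close>
   of \<open>regularised1\<close> into \<open>3 * d\<close>.\<close>
 interpret regularised_equation ss u H 1 1 "1/6"
 proof
  show "ss \<in> borel_fun" "\<And>x. 0 \<le> ss x" "(\<integral>\<^sup>+x. ennreal (ss x ^ 6) \<partial>lborel) < \<infinity>" "u \<in> borel_fun"
   using ss_meas ss_nonneg ss_int u_meas by auto
  show "norm (u x) \<le> ss x ^ 1" for x using u_le[of x] by simp
  show "(\<lambda>p. H d (fst p) (snd p)) \<in> borel_measurable (borel \<Otimes>\<^sub>M borel)" for d
   unfolding H_def by measurable
  show "norm (H d x y) \<le> 1/6 * (ss y ^ (6 - 1) / dist x y ^ 1)" if "0 \<le> d" "x \<noteq> y" for d x y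
  proof -
   have "norm (H d x y) = 1/6 * ((sqd x y + d) powr (- real 1/2) * norm (rhs1 y))"
    by (simp add: H_def abs_mult)
   also have "\<dots> \<le> 1/6 * (1 / dist x y ^ 1 * ss y ^ (6 - 1))"
    using powr_dist_le[OF that, of 1] rhs_le(1)[of y] by (intro mult_left_mono mult_mono) auto
   finally show ?thesis by simp
  qed
  show "((\<lambda>d. H d x y) \<longlongrightarrow> H 0 x y) (at_right 0)" if "x \<noteq> y" for x y
   unfolding H_def by (intro tendsto_scaleR tendsto_mult tendsto_const powr_reg_tendsto that)
  show "(3 * d) *\<^sub>R (\<integral>y. (sqd x y + d) powr (- 5/2) *\<^sub>R u y \<partial>lborel) = (\<integral>y. H d x y \<partial>lborel)" if "d > 0" for d x
  proof -
   have "(\<integral>y. H d x y \<partial>lborel) = 1/6 * (\<integral>y. (sqd x y + d) powr (- 1/2) *\<^sub>R rhs1 y \<partial>lborel)"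
    by (simp add: H_def mult.assoc del: of_nat_numeral flip: integral_mult_right_zero)
   then show ?thesis using regularised1[OF that, of x] by simp
  qed
 qed auto
 from integral_equation_AE show ?thesis
 proof eventually_elim
  case (elim x)
  have "(\<integral>y. H 0 x y \<partial>lborel) = (\<integral>y. 1/6 * (rhs1 y / dist x y) \<partial>lborel)"
   unfolding H_def add_0_right powr_dist_eq by (intro Bochner_Integration.integral_cong) auto
  then have "kappa * u x = 1/6 * (\<integral>y. rhs1 y / dist x y \<partial>lborel)"
   using elim by (simp only: integral_mult_right_zero real_scaleR_def)
  then show ?case using kappa_pos by (simp add: field_simps)
 qed
qed

lemma integral_equation2: "AE x in lborel. \<psi> x = (1 / kappa) *\<^sub>R (\<integral>y. (1 / dist x y ^ 3) *\<^sub>R dirac_part \<alpha> (x - y) (rhs2 y) \<partial>lborel)"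
proof -
 obtain C where C: "C \<ge> 0" "\<And>z v. norm (dirac_part \<alpha> z v) \<le> C * (norm z * norm v)" using dirac_part_bound by metis
 define H where "H d x y = ((sqd x y + d) powr (- real 3/2)) *\<^sub>R dirac_part \<alpha> (x - y) (rhs2 y)" for d x y
 have dp [measurable]: "(\<lambda>p. dirac_part \<alpha> (fst p - snd p) (rhs2 (snd p))) \<in> borel_measurable (borel \<Otimes>\<^sub>M borel)"
 proof -
  have m: "(\<lambda>v::complex^4. \<alpha> k *v v) \<in> borel_fun" for k
   by (intro borel_measurable_continuous_onI linear_continuous_on bounded_linear_mat_mul)
  have i: "(\<lambda>v::complex^4. \<i> *s v) \<in> borel_fun"
   by (intro borel_measurable_continuous_onI linear_continuous_on bounded_linear_smult)
  have n: "(\<lambda>v::real^3. v $ k) \<in> borel_fun" for k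
   by (intro borel_measurable_continuous_onI linear_continuous_on bounded_linear_vec_nth)
  show ?thesis unfolding dirac_part_def
   by (intro measurable_compose[OF _ i] borel_measurable_sum measurable_compose[OF _ m] borel_measurable_scaleR
      measurable_compose[OF _ n] borel_measurable_diff measurable_compose[OF measurable_snd rhs_meas(2)] measurable_fst'' measurable_snd'') measurable
 qed
 interpret regularised_equation ss \<psi> H 2 2 C
 proof
  show "ss \<in> borel_fun" "\<And>x. 0 \<le> ss x" "(\<integral>\<^sup>+x. ennreal (ss x ^ 6) \<partial>lborel) < \<infinity>" "\<psi> \<in> borel_fun"
   using ss_meas ss_nonneg ss_int psi_meas by auto
  show "norm (\<psi> x) \<le> ss x ^ 2" for x using psi_le[of x] by simp
  show "(\<lambda>p. H d (fst p) (snd p)) \<in> borel_measurable (borel \<Otimes>\<^sub>M borel)" for d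
   unfolding H_def by measurable
  show "norm (H d x y) \<le> C * (ss y ^ (6 - 2) / dist x y ^ 2)" if "0 \<le> d" "x \<noteq> y" for d x y
  proof -
   have "norm (H d x y) = (sqd x y + d) powr (- real 3/2) * norm (dirac_part \<alpha> (x - y) (rhs2 y))"
    by (simp add: H_def)
   also have "\<dots> \<le> 1 / dist x y ^ 3 * (C * (norm (x - y) * ss y ^ 4))"
    using powr_dist_le[OF that, of 3] rhs_le(2)[of y] C(1)
    by (intro mult_mono order_trans[OF C(2)] mult_left_mono) auto
   also have "\<dots> = C * (ss y ^ (6 - 2) / dist x y ^ 2)"
    using that by (simp add: dist_norm power_numeral_reduce)
   finally show ?thesis .
  qed
  show "((\<lambda>d. H d x y) \<longlongrightarrow> H 0 x y) (at_right 0)" if "x \<noteq> y" for x y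
   unfolding H_def by (intro tendsto_scaleR tendsto_const powr_reg_tendsto that)
  show "(3 * d) *\<^sub>R (\<integral>y. (sqd x y + d) powr (- 5/2) *\<^sub>R \<psi> y \<partial>lborel) = (\<integral>y. H d x y \<partial>lborel)" if d: "d > 0" for d x
  proof -
   have int: "integrable lborel (\<lambda>y. ((y $ k + - x $ k) * (sqd x y + d) powr (- 3/2)) *\<^sub>R rhs2 y)" for k
   proof (rule weighted_integral_tendsto(2)[OF ss_meas rhs_meas(2) _ _ ss_nonneg ss_int rhs_le(2) _ _ d, where w = "\<lambda>n y. (y $ k + - x $ k) * (sqd x y + d) powr (- 3/2)"
     and w' = "\<lambda>y. (y $ k + - x $ k) * (sqd x y + d) powr (- 3/2)" and K = 1 and ?x0.0 = x and m = 2])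
    fix y
    define q where "q = sqd x y + d"
    have q: "q > 0" using d by (simp add: q_def add_nonneg_pos)
    have "\<bar>y $ k + - x $ k\<bar> \<le> q powr (1/2)"
    proof -
     have "\<bar>(y - x) $ k\<bar> \<le> norm (y - x)" by (rule component_le_norm_cart)
     also have "norm (y - x) = sqrt (sqd x y)" by (simp add: norm_eq_sqrt_inner)
     also have "\<dots> \<le> sqrt q" using d by (simp add: q_def)
     finally show ?thesis using q by (simp add: powr_half_sqrt)
    qed
    then have "\<bar>y $ k + - x $ k\<bar> * q powr (- 3/2) \<le> q powr (1/2) * q powr (- 3/2)"
     by (intro mult_right_mono) auto
    also have "\<dots> = q powr (- real 2/2)" using q by (simp flip: powr_add)
    finally show "\<bar>(y $ k + - x $ k) * (sqd x y + d) powr (- 3/2)\<bar> \<le> 1 * (sqd x y + d) powr (- real 2/2)"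
     by (simp add: abs_mult q_def)
   qed auto
   have "(\<integral>y. H d x y \<partial>lborel) = (\<integral>y. - \<i> *s (\<Sum>k\<in>UNIV. \<alpha> k *v (((y $ k + - x $ k) * (sqd x y + d) powr (- 3/2)) *\<^sub>R rhs2 y)) \<partial>lborel)"
   proof (intro Bochner_Integration.integral_cong refl)
    fix y
    have "H d x y = - ((sqd x y + d) powr (- real 3/2)) *\<^sub>R (\<i> *s (\<Sum>k\<in>UNIV. \<alpha> k *v (((y - x) $ k) *\<^sub>R rhs2 y)))"
     by (simp only: H_def dirac_part_minus[of \<alpha> x y] scaleR_minus_right scaleR_minus_left) (simp only: dirac_part_def)
    also have "\<dots> = - \<i> *s (((sqd x y + d) powr (- real 3/2)) *\<^sub>R (\<Sum>k\<in>UNIV. \<alpha> k *v (((y - x) $ k) *\<^sub>R rhs2 y)))"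
     by (simp add: vec_eq_iff)
    also have "((sqd x y + d) powr (- real 3/2)) *\<^sub>R (\<Sum>k\<in>UNIV. \<alpha> k *v (((y - x) $ k) *\<^sub>R rhs2 y))
      = (\<Sum>k\<in>UNIV. \<alpha> k *v (((y $ k + - x $ k) * (sqd x y + d) powr (- 3/2)) *\<^sub>R rhs2 y))"
     by (simp add: scaleR_sum_right mult.commute flip: mat_mul_scaleR)
    finally show "H d x y = - \<i> *s (\<Sum>k\<in>UNIV. \<alpha> k *v (((y $ k + - x $ k) * (sqd x y + d) powr (- 3/2)) *\<^sub>R rhs2 y))" .
   qed
   also have "\<dots> = - \<i> *s (\<Sum>k\<in>UNIV. \<alpha> k *v (\<integral>y. ((y $ k + - x $ k) * (sqd x y + d) powr (- 3/2)) *\<^sub>R rhs2 y \<partial>lborel))"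
   proof -
    have i2: "integrable lborel (\<lambda>y. \<alpha> k *v (((y $ k + - x $ k) * (sqd x y + d) powr (- 3/2)) *\<^sub>R rhs2 y))" for k
     by (rule integrable_bounded_linear[OF bounded_linear_mat_mul int])
    show ?thesis
     by (subst integral_bounded_linear[OF bounded_linear_smult], intro Bochner_Integration.integrable_sum i2)
       (subst Bochner_Integration.integral_sum[OF i2], simp only: integral_bounded_linear[OF bounded_linear_mat_mul int])
   qed
   finally show ?thesis using regularised2[OF d, of x] by simp
  qed
 qed auto
 from integral_equation_AE show ?thesis
 proof eventually_elim
  case (elim x)
  have "(\<integral>y. H 0 x y \<partial>lborel) = (\<integral>y. (1 / dist x y ^ 3) *\<^sub>R dirac_part \<alpha> (x - y) (rhs2 y) \<partial>lborel)"
   unfolding H_def add_0_right powr_dist_eq by (intro Bochner_Integration.integral_cong) auto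
  moreover have "\<psi> x = (1 / kappa) *\<^sub>R (kappa *\<^sub>R \<psi> x)" using kappa_pos by simp
  ultimately show ?case using elim by simp
 qed
qed

sublocale integral_solution u \<psi> \<alpha>
 by unfold_locales (fact integral_equation1 integral_equation2)+

end

section \<open>The cubic integral operators in a Banach algebra\<close>

text \<open>Extends second countability from \<open>mps\<close> to the spaces in which spinor-valued
  power series live.\<close>

instance vec :: ("{metric_space, second_countable_topology}", finite) second_countable_topology
proof
 obtain B :: "'a set set" where B: "countable B" "topological_basis B"
  using ex_countable_basis by blast
 define V where "V f = {x :: 'a^'b. \<forall>i. x $ i \<in> f i}" for f :: "'b \<Rightarrow> 'a set"
 define BB where "BB = V ` (PiE UNIV (\<lambda>_. B))"
 have "countable BB" unfolding BB_def using B(1) by (intro countable_image countable_PiE) auto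
 moreover have "topological_basis BB"
 proof (rule topological_basisI)
  fix W assume "W \<in> BB"
  then show "open W" unfolding BB_def V_def using topological_basis_open[OF B(2)]
   by (auto simp: PiE_iff intro!: open_vector_box)
 next
  fix W :: "('a^'b) set" and x assume "open W" "x \<in> W"
  then obtain A where A: "\<And>i. open (A i)" "\<And>i. x $ i \<in> A i" "\<And>y. \<forall>i. y $ i \<in> A i \<Longrightarrow> y \<in> W"
   unfolding open_vec_def by metis
  have "\<exists>b\<in>B. x $ i \<in> b \<and> b \<subseteq> A i" for i
   using topological_basisE[OF B(2) A(1) A(2)] by metis
  then obtain f where f: "\<And>i. f i \<in> B" "\<And>i. x $ i \<in> f i" "\<And>i. f i \<subseteq> A i" by metis
  show "\<exists>W'\<in>BB. x \<in> W' \<and> W' \<subseteq> W"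
  proof (intro bexI[of _ "V f"] conjI)
   show "V f \<in> BB" unfolding BB_def using f(1) by (intro imageI) auto
   show "x \<in> V f" using f(2) by (simp add: V_def)
   show "V f \<subseteq> W" using f(3) A(3) by (auto simp: V_def subset_eq)
  qed
 qed
 ultimately show "\<exists>B::('a^'b) set set. countable B \<and> open = generate_topology B"
  using topological_basis_imp_subbasis by blast
qed

lemma continuous_axis: "continuous_on UNIV (\<lambda>x::'a::real_normed_vector. axis i x :: 'a^'n::finite)"
 unfolding axis_def
proof (intro continuous_on_vec_lambda)
 fix j show "continuous_on UNIV (\<lambda>x::'a. if j = i then x else 0)" by (cases "j = i") auto
qed

lemma vec_lambda_eq_sum_axis: "(\<chi> i. g i) = (\<Sum>i\<in>UNIV. axis i (g i) :: 'a::comm_monoid_add^'n::finite)"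
 by (simp add: vec_eq_iff axis_def)

lemma borel_measurable_vec_lambda [measurable (raw)]:
 fixes g :: "'n::finite \<Rightarrow> 'x \<Rightarrow> 'a::{second_countable_topology, real_normed_vector}"
 assumes "\<And>i. g i \<in> borel_measurable M"
 shows "(\<lambda>x. \<chi> i. g i x) \<in> borel_measurable M"
 unfolding vec_lambda_eq_sum_axis
 by (intro borel_measurable_sum measurable_compose[OF assms] borel_measurable_continuous_onI continuous_axis)

lemma borel_measurable_vec_nth [measurable (raw)]:
 fixes g :: "'x \<Rightarrow> ('a::real_normed_vector)^'n::finite"
 assumes "g \<in> borel_measurable M"
 shows "(\<lambda>x. g x $ i) \<in> borel_measurable M"
 by (rule measurable_compose[OF assms]) (intro borel_measurable_continuous_onI linear_continuous_on bounded_linear_vec_nth)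

lemma norm_vec_le_sum: "norm (x :: 'a::real_normed_vector^'n::finite) \<le> (\<Sum>i\<in>UNIV. norm (x $ i))"
 unfolding norm_vec_def by (rule L2_set_le_sum) simp

lemma norm_sum_mult_le:
 fixes a b :: "('a::real_normed_algebra)^'n::finite"
 shows "norm (\<Sum>i\<in>UNIV. a $ i * b $ i) \<le> norm a * norm b"
proof -
 have "norm (\<Sum>i\<in>UNIV. a $ i * b $ i) \<le> (\<Sum>i\<in>UNIV. \<bar>norm (a $ i)\<bar> * \<bar>norm (b $ i)\<bar>)"
  by (rule sum_norm_le) (simp add: norm_mult_ineq)
 also have "\<dots> \<le> L2_set (\<lambda>i. norm (a $ i)) UNIV * L2_set (\<lambda>i. norm (b $ i)) UNIV"
  by (rule L2_set_mult_ineq)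
 finally show ?thesis by (simp add: norm_vec_def)
qed

text \<open>The nonlinearity as a polynomial over a commutative algebra, with
  \<open>\<kappa>\<close> the value of the kernel. Over the reals the sum of squares is the squared
  norm of \<open>b\<close>; over \<open>mps\<close> it stays inside the algebra.\<close>

definition cubic1 :: "'a::comm_ring_1 \<Rightarrow> 'a \<Rightarrow> 'a^'i::finite \<Rightarrow> 'a"
 where "cubic1 \<kappa> a b = \<kappa> * (\<Sum>i\<in>UNIV. b $ i * b $ i) * a"

text \<open>The entries of \<open>bm k\<close> stand for the Dirac matrices in real coordinates, and
  \<open>\<kappa> k\<close> for the components of the vector-valued kernel.\<close>

definition cubic2 :: "(3 \<Rightarrow> 'i \<Rightarrow> 'i \<Rightarrow> real) \<Rightarrow> (3 \<Rightarrow> 'a) \<Rightarrow> 'a::{comm_ring_1,real_algebra_1} \<Rightarrow> 'a^'i::finite \<Rightarrow> 'a^'i"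
 where "cubic2 bm \<kappa> a b = (\<chi> i. \<Sum>k\<in>UNIV. \<Sum>j\<in>UNIV. \<kappa> k * (bm k i j *\<^sub>R (a * a * b $ j)))"

lemma norm_cubic1_diff:
 fixes a a' :: "'a::{comm_ring_1,real_normed_algebra_1}"
 assumes k: "norm \<kappa> \<le> k" and P: "norm a + norm a' \<le> P" and Q: "norm b + norm b' \<le> Q"
 shows "norm (cubic1 \<kappa> a b - cubic1 \<kappa> a' b') \<le> k * (norm (a - a') * Q\<^sup>2 + P * Q * norm (b - b'))"
proof -
 have k0: "0 \<le> k" using k norm_ge_zero order_trans by blast
 have P0: "0 \<le> P" "norm a' \<le> P" using P norm_ge_zero[of a] norm_ge_zero[of a'] by linarith+
 have Q0: "0 \<le> Q" "norm b \<le> Q" using Q norm_ge_zero[of b] norm_ge_zero[of b'] by linarith+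
 define s where "s b = (\<Sum>i\<in>UNIV. b $ i * b $ i)" for b :: "'a^'b"
 have "cubic1 \<kappa> a b - cubic1 \<kappa> a' b' = \<kappa> * (s b * (a - a') + (s b - s b') * a')"
  by (simp add: cubic1_def s_def algebra_simps)
 also have "norm \<dots> \<le> norm \<kappa> * (norm (s b) * norm (a - a') + norm (s b - s b') * norm a')"
  by (intro order_trans[OF norm_mult_ineq] mult_left_mono order_trans[OF norm_triangle_ineq] add_mono norm_mult_ineq) auto
 also have "\<dots> \<le> k * (Q\<^sup>2 * norm (a - a') + (norm (b - b') * Q) * P)"
 proof (intro mult_mono add_mono k P0 k0)
  have "norm (s b) \<le> norm b * norm b" unfolding s_def by (rule norm_sum_mult_le)
  also have "\<dots> \<le> Q\<^sup>2" unfolding power2_eq_square using Q0 by (intro mult_mono) auto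
  finally show "norm (s b) \<le> Q\<^sup>2" .
  have "s b - s b' = (\<Sum>i\<in>UNIV. (b - b') $ i * (b + b') $ i)"
   unfolding s_def sum_subtractf[symmetric] by (intro sum.cong) (auto simp: algebra_simps)
  then have "norm (s b - s b') \<le> norm (b - b') * norm (b + b')" using norm_sum_mult_le[of "b - b'" "b + b'"] by simp
  also have "\<dots> \<le> norm (b - b') * Q" using norm_triangle_ineq[of b b'] Q by (intro mult_left_mono) auto
  finally show "norm (s b - s b') \<le> norm (b - b') * Q" .
 qed (use P0 Q0 in \<open>auto intro!: add_nonneg_nonneg mult_nonneg_nonneg\<close>)
 finally show ?thesis by (simp add: algebra_simps)
qed

text \<open>The summand 1 makes the constant at least 1, so that \<open>D = C * bm_const bm\<close>
  serves for both operators.\<close>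

definition bm_const :: "(3 \<Rightarrow> 'i \<Rightarrow> 'i::finite \<Rightarrow> real) \<Rightarrow> real"
 where "bm_const bm = 1 + (\<Sum>i\<in>UNIV. \<Sum>k\<in>UNIV. \<Sum>j\<in>UNIV. \<bar>bm k i j\<bar>)"

lemma bm_const_ge_1: "1 \<le> bm_const bm"
 unfolding bm_const_def by (auto intro!: sum_nonneg)

lemma norm_cubic2_diff:
 fixes a a' :: "'a::{comm_ring_1,real_normed_algebra_1}" and b b' :: "'a^'i::finite"
 assumes k: "\<And>j. norm (\<kappa> j) \<le> k" and P: "norm a + norm a' \<le> P" and Q: "norm b + norm b' \<le> Q"
 shows "norm (cubic2 bm \<kappa> a b - cubic2 bm \<kappa> a' b') \<le> bm_const bm * k * (norm (a - a') * P * Q + P\<^sup>2 * norm (b - b'))"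
proof -
 have k0: "0 \<le> k" using k norm_ge_zero order_trans by blast
 have P0: "0 \<le> P" "norm a' \<le> P" using P norm_ge_zero[of a] norm_ge_zero[of a'] by linarith+
 have Q0: "0 \<le> Q" "norm b \<le> Q" using Q norm_ge_zero[of b] norm_ge_zero[of b'] by linarith+
 define E where "E = norm (a - a') * P * Q + P\<^sup>2 * norm (b - b')"
 have E0: "0 \<le> E" using P0 Q0 by (simp add: E_def)
 have d: "norm (a * a * b $ j - a' * a' * b' $ j) \<le> E" for j
 proof -
  have "a * a * b $ j - a' * a' * b' $ j = (a - a') * (a + a') * b $ j + a' * a' * (b - b') $ j"
   by (simp add: algebra_simps)
  also have "norm \<dots> \<le> norm (a - a') * norm (a + a') * norm (b $ j) + norm a' * norm a' * norm ((b - b') $ j)"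
   by (intro order_trans[OF norm_triangle_ineq] add_mono order_trans[OF norm_mult_ineq] mult_right_mono norm_mult_ineq) auto
  also have "\<dots> \<le> norm (a - a') * P * Q + P * P * norm (b - b')"
   using norm_triangle_ineq[of a a'] P P0 Q0 Finite_Cartesian_Product.norm_nth_le[of b j] Finite_Cartesian_Product.norm_nth_le[of "b - b'" j]
   by (intro add_mono mult_mono) (auto intro: order_trans)
  finally show ?thesis by (simp add: E_def power2_eq_square)
 qed
 have "norm (cubic2 bm \<kappa> a b - cubic2 bm \<kappa> a' b') \<le> (\<Sum>i\<in>UNIV. norm ((cubic2 bm \<kappa> a b - cubic2 bm \<kappa> a' b') $ i))"
  by (rule norm_vec_le_sum)
 also have "\<dots> \<le> (\<Sum>i\<in>UNIV. \<Sum>l\<in>UNIV. \<Sum>j\<in>UNIV. \<bar>bm l i j\<bar> * (k * E))"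
 proof (intro sum_mono)
  fix i :: 'i
  have "(cubic2 bm \<kappa> a b - cubic2 bm \<kappa> a' b') $ i = (\<Sum>l\<in>UNIV. \<Sum>j\<in>UNIV. \<kappa> l * (bm l i j *\<^sub>R (a * a * b $ j - a' * a' * b' $ j)))"
   by (simp add: cubic2_def sum_subtractf algebra_simps)
  also have "norm \<dots> \<le> (\<Sum>l\<in>UNIV. \<Sum>j\<in>UNIV. \<bar>bm l i j\<bar> * (k * E))"
  proof (intro sum_norm_le)
   fix l j
   have "norm (\<kappa> l * (bm l i j *\<^sub>R (a * a * b $ j - a' * a' * b' $ j))) \<le> norm (\<kappa> l) * norm (bm l i j *\<^sub>R (a * a * b $ j - a' * a' * b' $ j))"
    by (rule norm_mult_ineq)
   also have "\<dots> \<le> k * (\<bar>bm l i j\<bar> * E)"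
    using k k0 d[of j] by (intro mult_mono) (auto intro: mult_left_mono)
   finally show "norm (\<kappa> l * (bm l i j *\<^sub>R (a * a * b $ j - a' * a' * b' $ j))) \<le> \<bar>bm l i j\<bar> * (k * E)" by (simp add: mult_ac)
  qed
  finally show "norm ((cubic2 bm \<kappa> a b - cubic2 bm \<kappa> a' b') $ i) \<le> \<dots>" .
 qed
 also have "\<dots> = (bm_const bm - 1) * (k * E)"
  by (simp add: bm_const_def sum_distrib_right)
 also have "\<dots> \<le> bm_const bm * (k * E)" using k0 E0 by (intro mult_right_mono) auto
 finally show ?thesis by (simp add: E_def mult.assoc)
qed

locale cubic =
 fixes K0 :: "real^3 \<Rightarrow> real^3 \<Rightarrow> 'a::{comm_ring_1,real_normed_algebra_1,banach,second_countable_topology}"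
  and K :: "3 \<Rightarrow> real^3 \<Rightarrow> real^3 \<Rightarrow> 'a" and bm :: "3 \<Rightarrow> 'i \<Rightarrow> 'i::finite \<Rightarrow> real" and C :: real
 assumes K0_meas [measurable]: "(\<lambda>p. K0 (fst p) (snd p)) \<in> borel_measurable (borel \<Otimes>\<^sub>M borel)"
  and K_meas [measurable]: "\<And>k. (\<lambda>p. K k (fst p) (snd p)) \<in> borel_measurable (borel \<Otimes>\<^sub>M borel)"
  and K0_le: "\<And>x y. norm (K0 x y) \<le> C * (1 / dist x y)"
  and K_le: "\<And>k x y. norm (K k x y) \<le> C * (1 / dist x y ^ 2)"
  and C_pos: "C > 0"
begin

definition N1 where "N1 x y a b = cubic1 (K0 x y) a (b :: 'a^'i)"
definition N2 where "N2 x y a b = cubic2 bm (\<lambda>k. K k x y) a (b :: 'a^'i)"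
definition T1 where "T1 U V x = (\<integral>y. N1 x y (U y) (V y) \<partial>lborel)"
definition T2 where "T2 U V x = (\<integral>y. N2 x y (U y) (V y) \<partial>lborel)"
definition D where "D = C * bm_const bm"

lemma D_pos: "D > 0"
 using C_pos bm_const_ge_1[of bm] by (simp add: D_def)

lemma N_meas [measurable]:
 assumes [measurable]: "U \<in> borel_fun" "V \<in> borel_fun"
 shows "(\<lambda>p. N1 (fst p) (snd p) (U (snd p)) (V (snd p))) \<in> borel_measurable (borel \<Otimes>\<^sub>M borel)"
  and "(\<lambda>p. N2 (fst p) (snd p) (U (snd p)) (V (snd p))) \<in> borel_measurable (borel \<Otimes>\<^sub>M borel)"
 unfolding N1_def N2_def cubic1_def cubic2_def by measurable

lemma N_meas_snd [measurable]:
 assumes [measurable]: "U \<in> borel_fun" "V \<in> borel_fun"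
 shows "(\<lambda>y. N1 x y (U y) (V y)) \<in> borel_fun" "(\<lambda>y. N2 x y (U y) (V y)) \<in> borel_fun"
 using measurable_compose[OF measurable_Pair1'[of x borel borel] N_meas(1)[OF assms]]
  measurable_compose[OF measurable_Pair1'[of x borel borel] N_meas(2)[OF assms]] by simp_all

lemma T_meas [measurable]:
 assumes [measurable]: "U \<in> borel_fun" "V \<in> borel_fun"
 shows "T1 U V \<in> borel_fun" "T2 U V \<in> borel_fun"
proof -
 have "(\<lambda>(x, y). N1 x y (U y) (V y)) \<in> borel_measurable (borel \<Otimes>\<^sub>M lborel)"
    "(\<lambda>(x, y). N2 x y (U y) (V y)) \<in> borel_measurable (borel \<Otimes>\<^sub>M lborel)"
  using N_meas[OF assms] by (simp_all add: case_prod_beta')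
 from this[THEN lborel.borel_measurable_lebesgue_integral]
 show "T1 U V \<in> borel_fun" "T2 U V \<in> borel_fun"
  unfolding T1_def[abs_def] T2_def[abs_def] .
qed

lemma N1_diff:
 assumes "norm a + norm a' \<le> P" "norm b + norm b' \<le> Q"
 shows "norm (N1 x y a b - N1 x y a' b') \<le> D * ((norm (a - a') * Q\<^sup>2 + P * Q * norm (b - b')) * (1 / dist x y ^ 1))"
proof -
 have 0: "0 \<le> P" "0 \<le> Q" using assms norm_ge_zero[of a] norm_ge_zero[of a'] norm_ge_zero[of b] norm_ge_zero[of b'] by linarith+
 have "norm (N1 x y a b - N1 x y a' b') \<le> C * (1 / dist x y) * (norm (a - a') * Q\<^sup>2 + P * Q * norm (b - b'))"
  unfolding N1_def by (rule norm_cubic1_diff[OF K0_le assms])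
 also have "\<dots> \<le> D * (1 / dist x y) * (norm (a - a') * Q\<^sup>2 + P * Q * norm (b - b'))"
  using C_pos bm_const_ge_1[of bm] 0 by (intro mult_right_mono) (auto simp: D_def)
 finally show ?thesis by (simp add: mult_ac)
qed

lemma N2_diff:
 assumes "norm a + norm a' \<le> P" "norm b + norm b' \<le> Q"
 shows "norm (N2 x y a b - N2 x y a' b') \<le> D * ((norm (a - a') * P * Q + P\<^sup>2 * norm (b - b')) * (1 / dist x y ^ 2))"
 using norm_cubic2_diff[of "\<lambda>k. K k x y" "C * (1 / dist x y ^ 2)", OF K_le assms, of bm]
 unfolding N2_def D_def by (simp add: mult_ac)

lemma N_zero [simp]: "N1 x y 0 0 = 0" "N2 x y 0 0 = 0"
 by (simp_all add: N1_def N2_def cubic1_def cubic2_def vec_eq_iff)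

lemma integrable_bound_riesz:
 fixes f :: "real^3 \<Rightarrow> 'c::{banach,second_countable_topology}"
 assumes [measurable]: "f \<in> borel_fun" "g \<in> borel_fun"
  and le: "\<And>y. norm (f y) \<le> D * (g y * (1 / dist x y ^ l))" and g: "\<And>y. 0 \<le> g y"
 shows "(\<integral>\<^sup>+y. ennreal (norm (f y)) \<partial>lborel) \<le> ennreal D * riesz l (\<lambda>y. ennreal (g y)) x"
proof -
 have "(\<integral>\<^sup>+y. ennreal (norm (f y)) \<partial>lborel) \<le> (\<integral>\<^sup>+y. ennreal D * (ennreal (g y) * ennreal (1 / dist x y ^ l)) \<partial>lborel)"
  using le g D_pos by (intro nn_integral_mono) (simp add: ennreal_leI flip: ennreal_mult)
 then show ?thesis by (simp add: riesz_def nn_integral_cmult)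
qed

lemma riesz_finite_AE:
 assumes "(\<integral>\<^sup>+x. riesz l g x ^ m \<partial>lborel) \<le> ennreal c" "m > 0" and [measurable]: "g \<in> borel_fun"
 shows "AE x in lborel. riesz l g x < \<infinity>"
proof -
 have "AE x in lborel. riesz l g x ^ m \<noteq> \<infinity>"
  by (rule nn_integral_noteq_infinite) (use assms(1) in \<open>auto simp: top_unique\<close>)
 then show ?thesis
  by eventually_elim (use assms(2) in \<open>auto simp: less_top[symmetric] power_eq_top_ennreal\<close>)
qed

text \<open>Differences from the zero pair are dominated by Riesz potentials. Powers of these have
  finite integrals, so the potentials are finite almost everywhere.\<close>

lemma T_integrable:
 assumes M: "pair_le M (\<lambda>x. norm (U x)) (\<lambda>x. norm (V x))" "M > 0"
  and [measurable]: "U \<in> borel_fun" "V \<in> borel_fun"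
 shows "AE x in lborel. integrable lborel (\<lambda>y. N1 x y (U y) (V y)) \<and> integrable lborel (\<lambda>y. N2 x y (U y) (V y))"
proof -
 note b = pair_le_riesz[OF M(1) M(1) M(2) M(2)]
 have "AE x in lborel. riesz 1 (\<lambda>y. ennreal (norm (U y) * (norm (V y))\<^sup>2 + norm (U y) * norm (V y) * norm (V y))) x < \<infinity>"
  by (rule riesz_finite_AE[OF b(1)]) auto
 moreover have "AE x in lborel. riesz 2 (\<lambda>y. ennreal (norm (U y) * norm (U y) * norm (V y) + (norm (U y))\<^sup>2 * norm (V y))) x < \<infinity>"
  by (rule riesz_finite_AE[OF b(2)]) auto
 ultimately show ?thesis
 proof eventually_elim
  case (elim x)
  have "(\<integral>\<^sup>+y. ennreal (norm (N1 x y (U y) (V y))) \<partial>lborel) \<le> ennreal D * riesz 1 (\<lambda>y. ennreal (norm (U y) * (norm (V y))\<^sup>2 + norm (U y) * norm (V y) * norm (V y))) x"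
   using N1_diff[of "U y" 0 "norm (U y)" "V y" 0 "norm (V y)" x y for y] by (intro integrable_bound_riesz) auto
  also have "\<dots> < \<infinity>" using elim(1) by (simp add: ennreal_mult_less_top)
  finally have 1: "integrable lborel (\<lambda>y. N1 x y (U y) (V y))" by (intro integrableI_bounded) auto
  have "(\<integral>\<^sup>+y. ennreal (norm (N2 x y (U y) (V y))) \<partial>lborel) \<le> ennreal D * riesz 2 (\<lambda>y. ennreal (norm (U y) * norm (U y) * norm (V y) + (norm (U y))\<^sup>2 * norm (V y))) x"
   using N2_diff[of "U y" 0 "norm (U y)" "V y" 0 "norm (V y)" x y for y] by (intro integrable_bound_riesz) auto
  also have "\<dots> < \<infinity>" using elim(2) by (simp add: ennreal_mult_less_top)
  finally have 2: "integrable lborel (\<lambda>y. N2 x y (U y) (V y))" by (intro integrableI_bounded) auto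
  show ?case using 1 2 ..
 qed
qed

text \<open>\<open>P\<close> and \<open>Q\<close> only have to dominate where the two arguments differ, so that the contraction
 factor is governed by the size of the solution on a small ball.\<close>

lemma T_diff:
 assumes eta: "pair_le \<eta> (\<lambda>x. norm (U x - U' x)) (\<lambda>x. norm (V x - V' x))" "\<eta> > 0"
  and S: "pair_le S P Q" "S > 0"
  and le: "\<And>y. U y = U' y \<and> V y = V' y \<or> norm (U y) + norm (U' y) \<le> P y \<and> norm (V y) + norm (V' y) \<le> Q y"
  and M: "pair_le M (\<lambda>x. norm (U x)) (\<lambda>x. norm (V x))" "M > 0"
  and M': "pair_le M' (\<lambda>x. norm (U' x)) (\<lambda>x. norm (V' x))" "M' > 0"
  and [measurable]: "U \<in> borel_fun" "V \<in> borel_fun"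
    "U' \<in> borel_fun" "V' \<in> borel_fun"
 shows "pair_le (D * (pair_const * S\<^sup>2 * \<eta>)) (\<lambda>x. norm (T1 U V x - T1 U' V' x)) (\<lambda>x. norm (T2 U V x - T2 U' V' x))"
proof -
 define g1 where "g1 y = norm (U y - U' y) * (Q y)\<^sup>2 + P y * Q y * norm (V y - V' y)" for y
 define g2 where "g2 y = norm (U y - U' y) * P y * Q y + (P y)\<^sup>2 * norm (V y - V' y)" for y
 have PQ [measurable]: "P \<in> borel_fun" "Q \<in> borel_fun" and PQ0: "\<And>x. 0 \<le> P x" "\<And>x. 0 \<le> Q x"
  using S by (auto simp: pair_le_def)
 have [measurable]: "g1 \<in> borel_fun" "g2 \<in> borel_fun"
  unfolding g1_def g2_def by measurable
 have g0: "0 \<le> g1 y" "0 \<le> g2 y" for y using PQ0[of y] by (auto simp: g1_def g2_def)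
 have le1: "norm (N1 x y (U y) (V y) - N1 x y (U' y) (V' y)) \<le> D * (g1 y * (1 / dist x y ^ 1))" for x y
  using le[of y]
 proof
  assume "U y = U' y \<and> V y = V' y"
  then show ?thesis using g0(1)[of y] D_pos by simp
 next
  assume "norm (U y) + norm (U' y) \<le> P y \<and> norm (V y) + norm (V' y) \<le> Q y"
  then show ?thesis unfolding g1_def by (intro N1_diff) auto
 qed
 have le2: "norm (N2 x y (U y) (V y) - N2 x y (U' y) (V' y)) \<le> D * (g2 y * (1 / dist x y ^ 2))" for x y
  using le[of y]
 proof
  assume "U y = U' y \<and> V y = V' y"
  then show ?thesis using g0(2)[of y] D_pos by simp
 next
  assume "norm (U y) + norm (U' y) \<le> P y \<and> norm (V y) + norm (V' y) \<le> Q y"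
  then show ?thesis unfolding g2_def by (intro N2_diff) auto
 qed
 have AE: "AE x in lborel. ennreal (norm (T1 U V x - T1 U' V' x)) \<le> ennreal D * riesz 1 (\<lambda>y. ennreal (g1 y)) x
   \<and> ennreal (norm (T2 U V x - T2 U' V' x)) \<le> ennreal D * riesz 2 (\<lambda>y. ennreal (g2 y)) x"
  using T_integrable[OF M assms(10,11)] T_integrable[OF M' assms(12,13)]
 proof eventually_elim
  case (elim x)
  have i1: "integrable lborel (\<lambda>y. N1 x y (U y) (V y) - N1 x y (U' y) (V' y))"
   using elim by (intro Bochner_Integration.integrable_diff) auto
  have "ennreal (norm (T1 U V x - T1 U' V' x)) = ennreal (norm (\<integral>y. N1 x y (U y) (V y) - N1 x y (U' y) (V' y) \<partial>lborel))"
   unfolding T1_def using elim by (subst Bochner_Integration.integral_diff) auto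
  also have "\<dots> \<le> (\<integral>\<^sup>+y. ennreal (norm (N1 x y (U y) (V y) - N1 x y (U' y) (V' y))) \<partial>lborel)"
   by (rule integral_norm_bound_ennreal[OF i1])
  also have "\<dots> \<le> ennreal D * riesz 1 (\<lambda>y. ennreal (g1 y)) x"
   by (rule integrable_bound_riesz[OF _ _ le1 g0(1)]) auto
  finally have 1: "ennreal (norm (T1 U V x - T1 U' V' x)) \<le> ennreal D * riesz 1 (\<lambda>y. ennreal (g1 y)) x" .
  have i2: "integrable lborel (\<lambda>y. N2 x y (U y) (V y) - N2 x y (U' y) (V' y))"
   using elim by (intro Bochner_Integration.integrable_diff) auto
  have "ennreal (norm (T2 U V x - T2 U' V' x)) = ennreal (norm (\<integral>y. N2 x y (U y) (V y) - N2 x y (U' y) (V' y) \<partial>lborel))"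
   unfolding T2_def using elim by (subst Bochner_Integration.integral_diff) auto
  also have "\<dots> \<le> (\<integral>\<^sup>+y. ennreal (norm (N2 x y (U y) (V y) - N2 x y (U' y) (V' y))) \<partial>lborel)"
   by (rule integral_norm_bound_ennreal[OF i2])
  also have "\<dots> \<le> ennreal D * riesz 2 (\<lambda>y. ennreal (g2 y)) x"
   by (rule integrable_bound_riesz[OF _ _ le2 g0(2)]) auto
  finally show ?case using 1 by simp
 qed
 note b = pair_le_riesz[OF eta(1) S(1) eta(2) S(2), folded g1_def g2_def]
 have conv: "(\<integral>\<^sup>+x. ennreal (f x ^ m) \<partial>lborel) \<le> ennreal ((D * (pair_const * S\<^sup>2 * \<eta>)) ^ m)"
  if f: "AE x in lborel. ennreal (f x) \<le> ennreal D * riesz l g x" "\<And>x. 0 \<le> f x"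
   and b: "(\<integral>\<^sup>+x. riesz l g x ^ m \<partial>lborel) \<le> ennreal ((pair_const * S\<^sup>2 * \<eta>) ^ m)"
   and [measurable]: "g \<in> borel_fun" for f l g m
 proof -
  have "(\<integral>\<^sup>+x. ennreal (f x ^ m) \<partial>lborel) \<le> (\<integral>\<^sup>+x. ennreal (D ^ m) * riesz l g x ^ m \<partial>lborel)"
  proof (rule nn_integral_mono_AE)
   show "AE x in lborel. ennreal (f x ^ m) \<le> ennreal (D ^ m) * riesz l g x ^ m"
    using f(1)
   proof eventually_elim
    case (elim x)
    have "ennreal (f x) ^ m \<le> (ennreal D * riesz l g x) ^ m" by (rule power_mono[OF elim]) simp
    then show ?case using f(2)[of x] D_pos by (simp add: power_mult_distrib ennreal_power)
   qed
  qed
  also have "\<dots> = ennreal (D ^ m) * (\<integral>\<^sup>+x. riesz l g x ^ m \<partial>lborel)" by (simp add: nn_integral_cmult)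
  also have "\<dots> \<le> ennreal (D ^ m) * ennreal ((pair_const * S\<^sup>2 * \<eta>) ^ m)" by (intro mult_left_mono b) simp
  also have "\<dots> = ennreal ((D * (pair_const * S\<^sup>2 * \<eta>)) ^ m)"
   using D_pos pair_const_pos eta(2) by (simp add: power_mult_distrib flip: ennreal_mult)
  finally show ?thesis .
 qed
 show ?thesis
  unfolding pair_le_def
 proof (intro conjI allI)
  show "(\<integral>\<^sup>+x. ennreal (norm (T1 U V x - T1 U' V' x) ^ 6) \<partial>lborel) \<le> ennreal ((D * (pair_const * S\<^sup>2 * \<eta>)) ^ 6)"
   by (rule conv[OF _ norm_ge_zero b(1)]) (use AE in auto)
  show "(\<integral>\<^sup>+x. ennreal (norm (T2 U V x - T2 U' V' x) ^ 3) \<partial>lborel) \<le> ennreal ((D * (pair_const * S\<^sup>2 * \<eta>)) ^ 3)"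
   by (rule conv[OF _ norm_ge_zero b(2)]) (use AE in auto)
 qed auto
qed

lemma T_zero [simp]: "T1 (\<lambda>_. 0) (\<lambda>_. 0) = (\<lambda>_. 0)" "T2 (\<lambda>_. 0) (\<lambda>_. 0) = (\<lambda>_. 0)"
 by (simp_all add: T1_def T2_def fun_eq_iff)

lemma T_bound:
 assumes M: "pair_le M (\<lambda>x. norm (U x)) (\<lambda>x. norm (V x))" "M > 0"
  and [measurable]: "U \<in> borel_fun" "V \<in> borel_fun"
 shows "pair_le (D * (pair_const * M\<^sup>2 * M)) (\<lambda>x. norm (T1 U V x)) (\<lambda>x. norm (T2 U V x))"
proof -
 have z: "pair_le M (\<lambda>x. norm (0::'a)) (\<lambda>x. norm (0::'a^'i))"
  using M by (simp add: pair_le_def)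
 show ?thesis
  using T_diff[of M U "\<lambda>_. 0" V "\<lambda>_. 0" M "\<lambda>x. norm (U x)" "\<lambda>x. norm (V x)" M M] M z by simp
qed

end

subsection \<open>Picard iteration on a small ball\<close>

lemma pair_le_mono_AE:
 assumes "pair_le a p q" "0 \<le> a" "a \<le> b"
  and "p' \<in> borel_fun" "q' \<in> borel_fun"
  and "\<And>x. 0 \<le> p' x" "\<And>x. 0 \<le> q' x" "AE x in lborel. p' x \<le> p x \<and> q' x \<le> q x"
 shows "pair_le b p' q'"
proof -
 have 1: "AE x in lborel. ennreal (p' x ^ 6) \<le> ennreal (p x ^ 6)" "AE x in lborel. ennreal (q' x ^ 3) \<le> ennreal (q x ^ 3)"
  using assms(8) by (eventually_elim, auto intro!: ennreal_leI power_mono simp: assms(6,7))+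
 have "ennreal (a ^ 6) \<le> ennreal (b ^ 6)" "ennreal (a ^ 3) \<le> ennreal (b ^ 3)"
  using assms(2,3) by (auto intro!: ennreal_leI power_mono)
 then show ?thesis
  using assms(1,4,5,6,7) nn_integral_mono_AE[OF 1(1)] nn_integral_mono_AE[OF 1(2)]
  unfolding pair_le_def by (auto intro: order_trans)
qed

text \<open>The norms decay like \<open>2^-n\<close>. After division by the slower
  \<open>(3/4)^n\<close> the \<open>m\<close>-th powers still have integrals summable with ratio
  \<open>(2/3)^m\<close>, so their sum is finite almost everywhere. This converts decay of norms
  into pointwise geometric decay.\<close>

lemma nn_integral_powers_bounded_AE:
 fixes p :: "nat \<Rightarrow> real^3 \<Rightarrow> real"
 assumes [measurable]: "\<And>n. p n \<in> borel_fun" and p0: "\<And>n x. 0 \<le> p n x" and m: "m > 0" and c: "c \<ge> 0"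
  and le: "\<And>n. (\<integral>\<^sup>+x. ennreal (p n x ^ m) \<partial>lborel) \<le> ennreal ((c * (1/2) ^ n) ^ m)"
 shows "AE x in lborel. \<exists>M. \<forall>n. p n x \<le> M * (3/4) ^ n"
proof -
 have "(\<integral>\<^sup>+x. (\<Sum>n. ennreal ((p n x / (3/4) ^ n) ^ m)) \<partial>lborel) = (\<Sum>n. \<integral>\<^sup>+x. ennreal ((p n x / (3/4) ^ n) ^ m) \<partial>lborel)"
  by (rule nn_integral_suminf) measurable
 also have "\<dots> \<le> (\<Sum>n. ennreal (c ^ m * ((2/3) ^ m) ^ n))"
 proof (intro suminf_le summableI)
  fix n
  have h: "ennreal ((t / d) ^ m) = ennreal (1 / d ^ m) * ennreal (t ^ m)" if "0 \<le> t" "0 < d" for t d :: real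
   using that by (simp add: power_divide flip: ennreal_mult)
  have "(\<integral>\<^sup>+x. ennreal ((p n x / (3/4) ^ n) ^ m) \<partial>lborel) = ennreal (1 / ((3/4) ^ n) ^ m) * (\<integral>\<^sup>+x. ennreal (p n x ^ m) \<partial>lborel)"
   by (simp only: h[OF p0, of "(3/4) ^ n", simplified]) (rule nn_integral_cmult, simp)
  also have "\<dots> \<le> ennreal (1 / ((3/4) ^ n) ^ m) * ennreal ((c * (1/2) ^ n) ^ m)"
   by (intro mult_left_mono le) auto
  also have "\<dots> = ennreal ((c * (1/2) ^ n / (3/4) ^ n) ^ m)"
   using c by (intro h[symmetric]) auto
  also have "c * (1/2) ^ n / (3/4) ^ n = c * (2/3) ^ n"
   by (simp add: power_divide[symmetric] flip: times_divide_eq_right)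
  also have "(c * (2/3) ^ n) ^ m = c ^ m * ((2/3) ^ m) ^ n"
   by (simp only: power_mult_distrib power_mult[symmetric] mult.commute)
  finally show "(\<integral>\<^sup>+x. ennreal ((p n x / (3/4) ^ n) ^ m) \<partial>lborel) \<le> ennreal (c ^ m * ((2/3) ^ m) ^ n)" by simp
 qed
 also have "\<dots> < \<infinity>"
 proof -
  have "(2/3::real) ^ m < 1" using m by (simp add: power_less_one_iff)
  then show ?thesis
   using c by (subst suminf_ennreal2) (auto intro!: summable_mult summable_geometric)
 qed
 finally have "AE x in lborel. (\<Sum>n. ennreal ((p n x / (3/4) ^ n) ^ m)) \<noteq> \<infinity>"
  by (intro nn_integral_noteq_infinite) auto
 then show ?thesis
 proof eventually_elim
  case (elim x)
  define S where "S = enn2real (\<Sum>n. ennreal ((p n x / (3/4) ^ n) ^ m))"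
  have S: "(\<Sum>n. ennreal ((p n x / (3/4) ^ n) ^ m)) = ennreal S" using elim by (simp add: S_def less_top)
  have S0: "0 \<le> S" by (simp add: S_def)
  have "p n x \<le> (1 + S) * (3/4) ^ n" for n
  proof -
   have "(\<Sum>n\<in>{n}. ennreal ((p n x / (3/4) ^ n) ^ m)) \<le> ennreal S"
    unfolding S[symmetric] by (rule sum_le_suminf) auto
   then have "(p n x / (3/4) ^ n) ^ m \<le> S" using S0 by (simp add: ennreal_le_iff)
   then have "(p n x / (3/4) ^ n) ^ m \<le> (1 + S) ^ m"
    using self_le_power[of "1 + S" m] S0 m by linarith
   then have "p n x / (3/4) ^ n \<le> 1 + S" using S0 m by (subst (asm) power_mono_iff) (auto simp: p0)
   then show ?thesis by (simp add: divide_le_eq)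
  qed
  then show ?case by blast
 qed
qed

lemma pair_le_geometric_AE:
 assumes "\<And>n. pair_le (c * (1/2) ^ n) (p n) (q n)" "c \<ge> 0"
 shows "AE x in lborel. \<exists>M. \<forall>n. p n x \<le> M * (3/4) ^ n \<and> q n x \<le> M * (3/4) ^ n"
proof -
 have "AE x in lborel. \<exists>M. \<forall>n. p n x \<le> M * (3/4) ^ n"
  by (rule nn_integral_powers_bounded_AE[of _ 6 c]) (use assms in \<open>auto simp: pair_le_def\<close>)
 moreover have "AE x in lborel. \<exists>M. \<forall>n. q n x \<le> M * (3/4) ^ n"
  by (rule nn_integral_powers_bounded_AE[of _ 3 c]) (use assms in \<open>auto simp: pair_le_def\<close>)
 ultimately show ?thesis
 proof eventually_elim
  case (elim x)
  then obtain M M' where *: "\<And>n. p n x \<le> M * (3/4) ^ n" "\<And>n. q n x \<le> M' * (3/4) ^ n" by blast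
  have "p n x \<le> max M M' * (3/4) ^ n \<and> q n x \<le> max M M' * (3/4) ^ n" for n
   by (intro conjI order_trans[OF *(1)] order_trans[OF *(2)] mult_right_mono) auto
  then show ?case by blast
 qed
qed

lemma convergent_of_geometric_steps:
 fixes X :: "nat \<Rightarrow> 'b::banach"
 assumes "\<And>n. norm (X (Suc n) - X n) \<le> M * (3/4) ^ n"
 shows "convergent X"
proof -
 have "summable (\<lambda>n. M * (3/4::real) ^ n)" by (intro summable_mult summable_geometric) simp
 then have "summable (\<lambda>n. X (Suc n) - X n)"
  by (rule summable_comparison_test') (use assms in auto)
 then have "convergent (\<lambda>n. \<Sum>i<n. X (Suc i) - X i)" by (simp add: summable_iff_convergent)
 then have "convergent (\<lambda>n. X n - X 0)" by (simp add: sum_lessThan_telescope)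
 then show ?thesis using convergent_diff_const_right_iff by blast
qed

context cubic
begin

text \<open>Two pairs of size \<open>3 * \<epsilon>\<close> on the ball have a sum of size
  \<open>6 * \<epsilon>\<close>; inserted into \<open>T_diff\<close> this gives the contraction
  factor \<open>1/2\<close>.\<close>

definition small :: "real \<Rightarrow> bool"
 where "small \<epsilon> \<longleftrightarrow> \<epsilon> > 0 \<and> D * (pair_const * (6 * \<epsilon>)\<^sup>2) \<le> 1/2"

definition on :: "(real^3) set \<Rightarrow> (real^3 \<Rightarrow> 'b::real_normed_vector) \<Rightarrow> real^3 \<Rightarrow> real"
 where "on B f x = indicator B x * norm (f x)"

lemma on_meas [measurable]:
 assumes [measurable]: "B \<in> sets borel" "f \<in> borel_fun"
 shows "on B f \<in> borel_fun"
 unfolding on_def by measurable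

lemma T_contract:
 assumes e: "small \<epsilon>" and [measurable]: "B \<in> sets borel" "U \<in> borel_fun" "V \<in> borel_fun"
    "U' \<in> borel_fun" "V' \<in> borel_fun"
  and off: "\<And>x. x \<notin> B \<Longrightarrow> U x = U' x \<and> V x = V' x"
  and sB: "pair_le (3 * \<epsilon>) (on B U) (on B V)" "pair_le (3 * \<epsilon>) (on B U') (on B V')"
  and M: "pair_le M (\<lambda>x. norm (U x)) (\<lambda>x. norm (V x))" "pair_le M (\<lambda>x. norm (U' x)) (\<lambda>x. norm (V' x))" "M > 0"
  and eta: "pair_le \<eta> (\<lambda>x. norm (U x - U' x)) (\<lambda>x. norm (V x - V' x))" "\<eta> > 0"
 shows "pair_le (\<eta> / 2) (\<lambda>x. norm (T1 U V x - T1 U' V' x)) (\<lambda>x. norm (T2 U V x - T2 U' V' x))"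
proof -
 have e0: "\<epsilon> > 0" using e by (simp add: small_def)
 have S: "pair_le (6 * \<epsilon>) (\<lambda>x. on B U x + on B U' x) (\<lambda>x. on B V x + on B V' x)"
  using pair_le_add[OF sB] e0 by simp
 have "pair_le (D * (pair_const * (6 * \<epsilon>)\<^sup>2 * \<eta>)) (\<lambda>x. norm (T1 U V x - T1 U' V' x)) (\<lambda>x. norm (T2 U V x - T2 U' V' x))"
 proof (rule T_diff[OF eta S _ _ M(1) M(3) M(2) M(3)])
  fix y
  show "U y = U' y \<and> V y = V' y \<or> norm (U y) + norm (U' y) \<le> on B U y + on B U' y \<and> norm (V y) + norm (V' y) \<le> on B V y + on B V' y"
   using off[of y] by (cases "y \<in> B") (auto simp: on_def)
 qed (use e0 in auto)
 then show ?thesis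
 proof (rule pair_le_mono)
  have "D * (pair_const * (6 * \<epsilon>)\<^sup>2) * \<eta> \<le> 1/2 * \<eta>" using e eta(2) by (intro mult_right_mono) (auto simp: small_def)
  then show "D * (pair_const * (6 * \<epsilon>)\<^sup>2 * \<eta>) \<le> \<eta> / 2" by (simp add: mult.assoc)
  show "0 \<le> D * (pair_const * (6 * \<epsilon>)\<^sup>2 * \<eta>)" using D_pos pair_const_pos eta(2) by (intro mult_nonneg_nonneg) auto
 qed auto
qed

text \<open>Outside \<open>B\<close> every iterate keeps the initial data. Two iterates therefore
  differ only on \<open>B\<close>, where they are small, while the possibly large data outside enter
  both unchanged.\<close>

primrec picard :: "(real^3) set \<Rightarrow> (real^3 \<Rightarrow> 'a) \<Rightarrow> (real^3 \<Rightarrow> 'a^'i) \<Rightarrow> nat \<Rightarrow> (real^3 \<Rightarrow> 'a) \<times> (real^3 \<Rightarrow> 'a^'i)" where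
 "picard B U V 0 = (U, V)"
| "picard B U V (Suc n) = (let (U', V') = picard B U V n in
   (\<lambda>x. if x \<in> B then T1 U' V' x else U x, \<lambda>x. if x \<in> B then T2 U' V' x else V x))"

context
 fixes B :: "(real^3) set" and U0 :: "real^3 \<Rightarrow> 'a" and V0 :: "real^3 \<Rightarrow> 'a^'i" and \<epsilon> M :: real
 assumes e: "small \<epsilon>" and B_meas [measurable]: "B \<in> sets borel"
  and U0_meas [measurable]: "U0 \<in> borel_fun" and V0_meas [measurable]: "V0 \<in> borel_fun"
  and M0: "pair_le M (\<lambda>x. norm (U0 x)) (\<lambda>x. norm (V0 x))" "M > 0"
  and small0: "pair_le \<epsilon> (on B U0) (on B V0)"
  and first0: "pair_le \<epsilon> (on B (\<lambda>x. T1 U0 V0 x - U0 x)) (on B (\<lambda>x. T2 U0 V0 x - V0 x))"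
begin

definition UU where "UU n = fst (picard B U0 V0 n)"
definition VV where "VV n = snd (picard B U0 V0 n)"

lemma UU_0 [simp]: "UU 0 = U0" "VV 0 = V0"
 by (simp_all add: UU_def VV_def)

lemma UU_Suc: "UU (Suc n) x = (if x \<in> B then T1 (UU n) (VV n) x else U0 x)"
 "VV (Suc n) x = (if x \<in> B then T2 (UU n) (VV n) x else V0 x)"
 by (simp_all add: UU_def VV_def case_prod_beta Let_def)

lemma UU_off: "x \<notin> B \<Longrightarrow> UU n x = U0 x" "x \<notin> B \<Longrightarrow> VV n x = V0 x"
 by (cases n; simp add: UU_Suc)+

lemma UU_meas [measurable]: "UU n \<in> borel_fun" "VV n \<in> borel_fun"
proof (induction n)
 case (Suc n)
 note [measurable] = Suc
 have "(\<lambda>x. if x \<in> B then T1 (UU n) (VV n) x else U0 x) \<in> borel_fun"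
  "(\<lambda>x. if x \<in> B then T2 (UU n) (VV n) x else V0 x) \<in> borel_fun"
  by measurable
 then show "UU (Suc n) \<in> borel_fun" "VV (Suc n) \<in> borel_fun"
  by (simp_all add: UU_Suc[abs_def])
qed simp_all

text \<open>The steps halve, and the size on \<open>B\<close> starts at \<open>\<epsilon>\<close>
  and grows by them: \<open>\<epsilon> + \<epsilon> * (1 + 1/2 + ... + 2^(1-n)) = 3 * \<epsilon> - 2
  * \<epsilon> / 2^n\<close>. So the iterates never leave the range \<open>3 * \<epsilon>\<close> in
  which \<open>small\<close> yields contraction.\<close>

lemma picard_bounds:
 "pair_le (\<epsilon> * (1/2) ^ n) (\<lambda>x. norm (UU (Suc n) x - UU n x)) (\<lambda>x. norm (VV (Suc n) x - VV n x))
  \<and> pair_le (3 * \<epsilon> - 2 * \<epsilon> * (1/2) ^ n) (on B (UU n)) (on B (VV n))"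
proof (induction n)
 case 0
 have "(\<lambda>x. norm (UU (Suc 0) x - UU 0 x)) = on B (\<lambda>x. T1 U0 V0 x - U0 x)"
  "(\<lambda>x. norm (VV (Suc 0) x - VV 0 x)) = on B (\<lambda>x. T2 U0 V0 x - V0 x)"
  by (auto simp: fun_eq_iff on_def UU_Suc indicator_def)
 then show ?case using first0 small0 by simp
next
 case (Suc n)
 have e0: "\<epsilon> > 0" using e by (simp add: small_def)
 define b where "b = 3 * \<epsilon> - 2 * \<epsilon> * (1/2) ^ n"
 have p1: "0 < (1/2::real) ^ n" "(1/2::real) ^ n \<le> 1" by (auto intro: power_le_one)
 have b: "b > 0" "b + \<epsilon> * (1/2) ^ n = 3 * \<epsilon> - 2 * \<epsilon> * (1/2) ^ Suc n" "3 * \<epsilon> - 2 * \<epsilon> * (1/2) ^ Suc n \<le> 3 * \<epsilon>" "b \<le> 3 * \<epsilon>"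
 proof -
  have "\<epsilon> * (1/2) ^ n \<le> \<epsilon>" "0 < \<epsilon> * (1/2) ^ n" using p1 e0 by (auto intro: mult_left_le)
  then show "b > 0" "b + \<epsilon> * (1/2) ^ n = 3 * \<epsilon> - 2 * \<epsilon> * (1/2) ^ Suc n" "3 * \<epsilon> - 2 * \<epsilon> * (1/2) ^ Suc n \<le> 3 * \<epsilon>" "b \<le> 3 * \<epsilon>"
   unfolding b_def power_Suc by linarith+
 qed
 have IH1: "pair_le (\<epsilon> * (1/2) ^ n) (\<lambda>x. norm (UU (Suc n) x - UU n x)) (\<lambda>x. norm (VV (Suc n) x - VV n x))"
  and IH2: "pair_le b (on B (UU n)) (on B (VV n))" using Suc by (auto simp: b_def)
 have S: "pair_le (3 * \<epsilon> - 2 * \<epsilon> * (1/2) ^ Suc n) (on B (UU (Suc n))) (on B (VV (Suc n)))"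
 proof (rule pair_le_mono)
  show "pair_le (3 * \<epsilon> - 2 * \<epsilon> * (1/2) ^ Suc n) (\<lambda>x. on B (UU n) x + norm (UU (Suc n) x - UU n x)) (\<lambda>x. on B (VV n) x + norm (VV (Suc n) x - VV n x))"
   using pair_le_add[OF IH2 IH1] b e0 by simp
  show "on B (UU (Suc n)) x \<le> on B (UU n) x + norm (UU (Suc n) x - UU n x)" "on B (VV (Suc n)) x \<le> on B (VV n) x + norm (VV (Suc n) x - VV n x)" for x
   using norm_triangle_sub[of "UU (Suc n) x" "UU n x"] norm_triangle_sub[of "VV (Suc n) x" "VV n x"]
   by (auto simp: on_def indicator_def)
 qed (use b(1) b(2)[symmetric] p1 e0 in \<open>auto simp: on_def\<close>)
 \<comment> \<open>Finite global norms guarantee integrability of the cubic terms; they hold because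
   nothing changes outside \<open>B\<close>.\<close>
 have glob: "pair_le (M + 3 * \<epsilon>) (\<lambda>x. norm (UU k x)) (\<lambda>x. norm (VV k x))" if "pair_le (3 * \<epsilon>) (on B (UU k)) (on B (VV k))" for k
 proof (rule pair_le_mono)
  show "pair_le (M + 3 * \<epsilon>) (\<lambda>x. norm (U0 x) + on B (UU k) x) (\<lambda>x. norm (V0 x) + on B (VV k) x)"
   using pair_le_add[OF M0(1) that M0(2)] e0 by simp
  show "norm (UU k x) \<le> norm (U0 x) + on B (UU k) x" "norm (VV k x) \<le> norm (V0 x) + on B (VV k) x" for x
   by (cases "x \<in> B"; simp add: on_def UU_off)+
 qed (use M0 e0 in auto)
 have S': "pair_le (3 * \<epsilon>) (on B (UU (Suc n))) (on B (VV (Suc n)))"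
  by (rule pair_le_mono[OF S]) (use b(1) b(2)[symmetric] b(3) p1 e0 in \<open>auto simp: on_def\<close>)
 have IH2': "pair_le (3 * \<epsilon>) (on B (UU n)) (on B (VV n))"
  by (rule pair_le_mono[OF IH2]) (use b e0 in \<open>auto simp: on_def\<close>)
 have "pair_le (\<epsilon> * (1/2) ^ n / 2) (\<lambda>x. norm (T1 (UU (Suc n)) (VV (Suc n)) x - T1 (UU n) (VV n) x)) (\<lambda>x. norm (T2 (UU (Suc n)) (VV (Suc n)) x - T2 (UU n) (VV n) x))"
  by (rule T_contract[OF e B_meas _ _ _ _ _ S' IH2' glob[OF S'] glob[OF IH2'] _ IH1]) (use M0 e0 in \<open>auto simp: UU_off\<close>)
 then have "pair_le (\<epsilon> * (1/2) ^ Suc n) (\<lambda>x. norm (UU (Suc (Suc n)) x - UU (Suc n) x)) (\<lambda>x. norm (VV (Suc (Suc n)) x - VV (Suc n) x))"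
 proof (rule pair_le_mono)
  show "norm (UU (Suc (Suc n)) x - UU (Suc n) x) \<le> norm (T1 (UU (Suc n)) (VV (Suc n)) x - T1 (UU n) (VV n) x)"
   "norm (VV (Suc (Suc n)) x - VV (Suc n) x) \<le> norm (T2 (UU (Suc n)) (VV (Suc n)) x - T2 (UU n) (VV n) x)" for x
   by (simp_all add: UU_Suc(1)[of "Suc n"] UU_Suc(2)[of "Suc n"] UU_Suc(1)[of n] UU_Suc(2)[of n])
 qed (use e0 in auto)
 then show ?case using S by simp
qed

lemma picard_small: "pair_le (3 * \<epsilon>) (on B (UU n)) (on B (VV n))"
 and picard_global: "pair_le (M + 3 * \<epsilon>) (\<lambda>x. norm (UU n x)) (\<lambda>x. norm (VV n x))"
proof -
 have e0: "\<epsilon> > 0" using e by (simp add: small_def)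
 have p1: "0 < (1/2::real) ^ n" "(1/2::real) ^ n \<le> 1" by (auto intro: power_le_one)
 have "\<epsilon> * (1/2) ^ n \<le> \<epsilon>" "0 < \<epsilon> * (1/2) ^ n" using p1 e0 by (auto intro: mult_left_le)
 then show *: "pair_le (3 * \<epsilon>) (on B (UU n)) (on B (VV n))"
  by (intro pair_le_mono[OF conjunct2[OF picard_bounds[of n]]]) (use e0 in \<open>auto simp: on_def\<close>)
 show "pair_le (M + 3 * \<epsilon>) (\<lambda>x. norm (UU n x)) (\<lambda>x. norm (VV n x))"
 proof (rule pair_le_mono)
  show "pair_le (M + 3 * \<epsilon>) (\<lambda>x. norm (U0 x) + on B (UU n) x) (\<lambda>x. norm (V0 x) + on B (VV n) x)"
   using pair_le_add[OF M0(1) * M0(2)] e0 by simp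
  show "norm (UU n x) \<le> norm (U0 x) + on B (UU n) x" "norm (VV n x) \<le> norm (V0 x) + on B (VV n) x" for x
   by (cases "x \<in> B"; simp add: on_def UU_off)+
 qed (use M0 e0 in auto)
qed

lemma picard_convergent: "AE x in lborel. convergent (\<lambda>n. UU n x) \<and> convergent (\<lambda>n. VV n x)"
proof -
 have e0: "\<epsilon> \<ge> 0" using e by (simp add: small_def)
 have "AE x in lborel. \<exists>M. \<forall>n. norm (UU (Suc n) x - UU n x) \<le> M * (3/4) ^ n \<and> norm (VV (Suc n) x - VV n x) \<le> M * (3/4) ^ n"
  by (rule pair_le_geometric_AE[OF conjunct1[OF picard_bounds] e0])
 then show ?thesis by eventually_elim (auto intro: convergent_of_geometric_steps)
qed

end

text \<open>Iterates with the same data outside \<open>B\<close> as a fixed point start within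
  \<open>6 * \<epsilon>\<close> of it and contract towards it. This is meant for the images of the
  algebra-valued iterates under evaluation and for the moved solution, whose identity with the limit
  it establishes.\<close>

lemma iterates_tendsto_fixed_point:
 assumes e: "small \<epsilon>" and B [measurable]: "B \<in> sets borel"
  and W [measurable]: "\<And>n. W n \<in> borel_fun" "\<And>n. W' n \<in> borel_fun"
  and Z [measurable]: "Z \<in> borel_fun" "Z' \<in> borel_fun"
  and off: "\<And>n x. x \<notin> B \<Longrightarrow> W n x = Z x \<and> W' n x = Z' x"
  and sW: "\<And>n. pair_le (3 * \<epsilon>) (on B (W n)) (on B (W' n))" and sZ: "pair_le (3 * \<epsilon>) (on B Z) (on B Z')"
  and M: "\<And>n. pair_le M (\<lambda>x. norm (W n x)) (\<lambda>x. norm (W' n x))" "pair_le M (\<lambda>x. norm (Z x)) (\<lambda>x. norm (Z' x))" "M > 0"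
  and step: "\<And>n. AE x in lborel. x \<in> B \<longrightarrow> W (Suc n) x = T1 (W n) (W' n) x \<and> W' (Suc n) x = T2 (W n) (W' n) x"
  and fix': "AE x in lborel. x \<in> B \<longrightarrow> Z x = T1 Z Z' x \<and> Z' x = T2 Z Z' x"
 shows "AE x in lborel. (\<lambda>n. W n x) \<longlonglongrightarrow> Z x \<and> (\<lambda>n. W' n x) \<longlonglongrightarrow> Z' x"
proof -
 have e0: "\<epsilon> > 0" using e by (simp add: small_def)
 have geo: "pair_le (6 * \<epsilon> * (1/2) ^ n) (\<lambda>x. norm (W n x - Z x)) (\<lambda>x. norm (W' n x - Z' x))" for n
 proof (induction n)
  case 0
  have "pair_le (6 * \<epsilon>) (\<lambda>x. norm (W 0 x - Z x)) (\<lambda>x. norm (W' 0 x - Z' x))"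
  proof (rule pair_le_mono)
   show "pair_le (6 * \<epsilon>) (\<lambda>x. on B (W 0) x + on B Z x) (\<lambda>x. on B (W' 0) x + on B Z' x)"
    using pair_le_add[OF sW[of 0] sZ] e0 by simp
   show "norm (W 0 x - Z x) \<le> on B (W 0) x + on B Z x" "norm (W' 0 x - Z' x) \<le> on B (W' 0) x + on B Z' x" for x
    using off[of x 0] norm_triangle_ineq4[of "W 0 x" "Z x"] norm_triangle_ineq4[of "W' 0 x" "Z' x"]
    by (cases "x \<in> B"; simp add: on_def)+
  qed (use e0 in auto)
  then show ?case by simp
 next
  case (Suc n)
  have "pair_le (6 * \<epsilon> * (1/2) ^ n / 2) (\<lambda>x. norm (T1 (W n) (W' n) x - T1 Z Z' x)) (\<lambda>x. norm (T2 (W n) (W' n) x - T2 Z Z' x))"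
   by (rule T_contract[OF e B W Z off sW sZ M Suc]) (use e0 in auto)
  then have "pair_le (6 * \<epsilon> * (1/2) ^ n / 2) (\<lambda>x. norm (W (Suc n) x - Z x)) (\<lambda>x. norm (W' (Suc n) x - Z' x))"
  proof (rule pair_le_mono_AE)
   show "AE x in lborel. norm (W (Suc n) x - Z x) \<le> norm (T1 (W n) (W' n) x - T1 Z Z' x)
     \<and> norm (W' (Suc n) x - Z' x) \<le> norm (T2 (W n) (W' n) x - T2 Z Z' x)"
    using step[of n] fix'
   proof eventually_elim
    case (elim x)
    show ?case
    proof (cases "x \<in> B")
     case False then show ?thesis using off[OF False, of "Suc n"] by simp
    qed (use elim in simp)
   qed
  qed (use e0 in auto)
  then show ?case by simp
 qed
 have "AE x in lborel. \<exists>M. \<forall>n. norm (W n x - Z x) \<le> M * (3/4) ^ n \<and> norm (W' n x - Z' x) \<le> M * (3/4) ^ n"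
  by (rule pair_le_geometric_AE[OF geo]) (use e0 in simp)
 then show ?thesis
 proof eventually_elim
  case (elim x)
  then obtain M where Mx: "\<And>n. norm (W n x - Z x) \<le> M * (3/4) ^ n" "\<And>n. norm (W' n x - Z' x) \<le> M * (3/4) ^ n" by blast
  have lim: "(\<lambda>n. M * (3/4::real) ^ n) \<longlonglongrightarrow> 0"
   by (rule tendsto_mult_right_zero, rule LIMSEQ_realpow_zero) auto
  have "(\<lambda>n. W n x - Z x) \<longlonglongrightarrow> 0" "(\<lambda>n. W' n x - Z' x) \<longlonglongrightarrow> 0"
   by (rule Lim_null_comparison[OF always_eventually lim], use Mx in blast)+
  then show ?case by (simp add: LIM_zero_iff)
 qed
qed

end

section \<open>Changes of variables\<close>

text \<open>Two measures are compared on bounded Borel sets, whose images have finite measure so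
  that the theorem on measures of differentiable images applies; balls then exhaust the general
  Borel set.\<close>

lemma nn_integral_change_of_variables:
 fixes f :: "real^3 \<Rightarrow> real^3"
 assumes S [measurable]: "S \<in> sets borel" and f [measurable]: "f \<in> borel_fun"
  and jm [measurable]: "jac \<in> borel_fun" and T [measurable]: "T \<in> sets borel"
  and der: "\<And>x. x \<in> S \<Longrightarrow> (f has_derivative f' x) (at x)" and inj: "inj_on f S" and im: "f ` S = T"
  and jac: "\<And>x. x \<in> S \<Longrightarrow> jac x = \<bar>det (matrix (f' x))\<bar>"
  and g [measurable]: "g \<in> borel_fun"
 shows "(\<integral>\<^sup>+x. g (f x) * (ennreal (jac x) * indicator S x) \<partial>lborel) = (\<integral>\<^sup>+x. g x * indicator T x \<partial>lborel)"
proof -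
 define N where "N = distr (density lborel (\<lambda>x. ennreal (jac x) * indicator S x)) borel f"
 define L where "L = density lborel (\<lambda>x. indicator T x :: ennreal)"
 have bdd: "emeasure N A = emeasure L A" if A [measurable]: "A \<in> sets borel" and "bounded A" for A
 proof -
  define SA where "SA = S \<inter> f -` A"
  have fA [measurable]: "f -` A \<in> sets borel" by (rule measurable_sets_borel[OF f A])
  have SA [measurable]: "SA \<in> sets borel" unfolding SA_def by (intro sets.Int S measurable_sets_borel[OF f A])
  have imA: "f ` SA = A \<inter> T" using im by (auto simp: SA_def)
  have "A \<inter> T \<in> lmeasurable"
   by (rule bounded_set_imp_lmeasurable) (use that in \<open>auto intro: bounded_subset\<close>)
  then have "((\<lambda>x. \<bar>det (matrix (f' x))\<bar>) has_integral measure lebesgue (A \<inter> T)) SA"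
   using has_measure_differentiable_image[of SA f f' "measure lebesgue (A \<inter> T)"] imA
   by (auto simp: SA_def intro: has_derivative_at_withinI der inj_on_subset[OF inj])
  then have "integral\<^sup>N lborel (\<lambda>x. ennreal (indicator SA x * \<bar>det (matrix (f' x))\<bar>)) = ennreal (measure lebesgue (A \<inter> T))"
   by (intro nn_integral_has_integral_lebesgue) auto
  moreover have "emeasure N A = integral\<^sup>N lborel (\<lambda>x. ennreal (indicator SA x * \<bar>det (matrix (f' x))\<bar>))"
  proof -
   have "emeasure N A = (\<integral>\<^sup>+x. (ennreal (jac x) * indicator S x) * indicator (f -` A) x \<partial>lborel)"
    unfolding N_def by (simp add: emeasure_distr emeasure_density fA)
   also have "\<dots> = integral\<^sup>N lborel (\<lambda>x. ennreal (indicator SA x * \<bar>det (matrix (f' x))\<bar>))"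
    by (intro nn_integral_cong) (auto simp: SA_def indicator_def jac)
   finally show ?thesis .
  qed
  moreover have "emeasure L A = emeasure lborel (A \<inter> T)"
   unfolding L_def by (subst emeasure_density) (auto simp: indicator_inter_arith[symmetric] Int_commute simp flip: nn_integral_indicator)
  moreover have "emeasure lborel (A \<inter> T) = ennreal (measure lebesgue (A \<inter> T))"
  proof -
   have "emeasure lborel (A \<inter> T) = ennreal (measure lborel (A \<inter> T))"
    by (rule emeasure_eq_ennreal_measure)
      (use emeasure_bounded_finite[of "A \<inter> T"] that in \<open>auto intro: bounded_subset simp: less_top\<close>)
   also have "measure lborel (A \<inter> T) = measure lebesgue (A \<inter> T)" by simp
   finally show ?thesis .
  qed
  ultimately show ?thesis by simp
 qed
 have "N = L"
 proof (rule measure_eqI)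
  show "sets N = sets L" by (simp add: N_def L_def)
  fix A assume "A \<in> sets N"
  then have A [measurable]: "A \<in> sets borel" by (simp add: N_def)
  have un: "(\<Union>n. A \<inter> cball 0 (real n)) = A" using real_arch_simple by (auto simp: set_eq_iff)
  have inc: "incseq (\<lambda>n. A \<inter> cball (0::real^3) (real n))" by (auto simp: incseq_def)
  have "emeasure M A = (SUP n. emeasure M (A \<inter> cball 0 (real n)))" if "sets M = sets borel" for M
  proof -
   have "range (\<lambda>n. A \<inter> cball (0::real^3) (real n)) \<subseteq> sets M" unfolding that by auto
   from SUP_emeasure_incseq[OF this inc] show ?thesis unfolding un by (rule sym)
  qed
  then show "emeasure N A = emeasure L A"
   using bdd[of "A \<inter> cball 0 (real n)" for n] by (simp add: N_def L_def bounded_Int)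
 qed
 then have "integral\<^sup>N N g = integral\<^sup>N L g" by simp
 moreover have "integral\<^sup>N N g = (\<integral>\<^sup>+x. g (f x) * (ennreal (jac x) * indicator S x) \<partial>lborel)"
  unfolding N_def by (subst nn_integral_distr, measurable) (subst nn_integral_density, auto simp: mult.commute)
 moreover have "integral\<^sup>N L g = (\<integral>\<^sup>+x. g x * indicator T x \<partial>lborel)"
  unfolding L_def by (subst nn_integral_density) (auto simp: mult.commute)
 ultimately show ?thesis by simp
qed

text \<open>Common interface for the tent flow and for inversion. Positivity is almost everywhere
  because the density \<open>1 / norm y ^ 6\<close> of inversion has the value 0 at the
  origin.\<close>

locale substitution =
 fixes \<Phi> :: "real^3 \<Rightarrow> real^3" and J :: "real^3 \<Rightarrow> real"
 assumes map_measurable [measurable]: "\<Phi> \<in> borel_fun" and jac_measurable [measurable]: "J \<in> borel_fun"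
  and jac_pos: "AE y in lborel. 0 < J y"
  and nn_integral_subst: "\<And>g. g \<in> borel_fun \<Longrightarrow> (\<integral>\<^sup>+y. g (\<Phi> y) * ennreal (J y) \<partial>lborel) = (\<integral>\<^sup>+y. g y \<partial>lborel)"
begin

lemma distr_density_subst: "distr (density lborel (\<lambda>y. ennreal (J y))) borel \<Phi> = lborel"
proof (rule measure_eqI)
 fix A assume "A \<in> sets (distr (density lborel (\<lambda>y. ennreal (J y))) borel \<Phi>)"
 then have [measurable]: "A \<in> sets borel" by simp
 have fA [measurable]: "\<Phi> -` A \<in> sets borel" by (rule measurable_sets_borel[OF map_measurable]) simp
 have "emeasure (distr (density lborel (\<lambda>y. ennreal (J y))) borel \<Phi>) A = (\<integral>\<^sup>+y. indicator A (\<Phi> y) * ennreal (J y) \<partial>lborel)"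
  by (simp add: emeasure_distr emeasure_density fA) (auto simp: indicator_def intro!: nn_integral_cong)
 also have "\<dots> = emeasure lborel A" by (subst nn_integral_subst) auto
 finally show "emeasure (distr (density lborel (\<lambda>y. ennreal (J y))) borel \<Phi>) A = emeasure lborel A" .
qed simp

lemma integral_subst:
 fixes g :: "real^3 \<Rightarrow> 'b::{banach,second_countable_topology}"
 assumes [measurable]: "g \<in> borel_fun"
 shows "(\<integral>y. J y *\<^sub>R g (\<Phi> y) \<partial>lborel) = (\<integral>y. g y \<partial>lborel)"
proof -
 have "(\<integral>y. g y \<partial>lborel) = (\<integral>y. g y \<partial>distr (density lborel (\<lambda>y. ennreal (J y))) borel \<Phi>)"
  by (simp only: distr_density_subst)
 also have "\<dots> = (\<integral>y. g (\<Phi> y) \<partial>density lborel (\<lambda>y. ennreal (J y)))"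
  by (subst integral_distr) auto
 also have "\<dots> = (\<integral>y. J y *\<^sub>R g (\<Phi> y) \<partial>lborel)"
  by (subst integral_density) (use jac_pos in \<open>auto elim: eventually_mono\<close>)
 finally show ?thesis ..
qed

text \<open>The preimage of a null set has weighted measure 0, and the weight is positive almost
  everywhere.\<close>

lemma AE_subst:
 assumes P: "AE y in lborel. P y"
 shows "AE y in lborel. P (\<Phi> y)"
proof -
 obtain A where A: "A \<in> null_sets lborel" "{y. \<not> P y} \<subseteq> A"
  using P by (auto elim!: AE_E simp: null_sets_def)
 then have [measurable]: "A \<in> sets borel" by auto
 have "(\<integral>\<^sup>+y. indicator A (\<Phi> y) * ennreal (J y) \<partial>lborel) = 0"
  using A by (subst nn_integral_subst) auto
 then have "AE y in lborel. indicator A (\<Phi> y) * ennreal (J y) = 0"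
  by (subst (asm) nn_integral_0_iff_AE) auto
 then show ?thesis
  using jac_pos
 proof eventually_elim
  case (elim y)
  then have "\<Phi> y \<notin> A" by (auto simp: indicator_def)
  then show ?case using A(2) by blast
 qed
qed

end

text \<open>Determinant of a rank-one perturbation of the identity. It gives the Jacobian of the
  tent flow and, with \<open>w\<close> and \<open>t\<close> both radial, that of inversion.\<close>

lemma det_rank_one:
 fixes w t :: "real^3"
 shows "det (matrix (\<lambda>h. h + (w \<bullet> h) *\<^sub>R t)) = 1 + w \<bullet> t"
proof -
 have "matrix (\<lambda>h. h + (w \<bullet> h) *\<^sub>R t) $ i $ j = (if i = j then 1 else 0) + w $ j * t $ i" for i j
  by (simp add: matrix_def axis_nth_if inner_axis)
 then show ?thesis
  by (simp add: det_3 inner_vec_def sum_3 algebra_simps)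
qed

subsection \<open>A tent flow\<close>

text \<open>The flow \<open>y \<mapsto> y + \<theta>(y) t\<close> with a tent function \<open>\<theta>\<close> supported in a ball moves the ball into itself and
 fixes its complement. Analyticity of a solution \<open>w\<close> at \<open>x\<close> will be read off from \<open>t \<mapsto> w(x + \<theta>(x) t)\<close>.\<close>

definition tent :: "real^3 \<Rightarrow> real \<Rightarrow> real^3 \<Rightarrow> real"
 where "tent c R y = max 0 ((R\<^sup>2 - (norm (y - c))\<^sup>2) / R)"

text \<open>On the sphere, where the tent has a kink, the value 0 makes \<open>tent_jac\<close>
  equal to 1 on the whole complement of the ball. The substitution formula can then be split into
  the open ball and a set on which the flow is the identity.\<close>

definition tent_grad :: "real^3 \<Rightarrow> real \<Rightarrow> real^3 \<Rightarrow> real^3"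
 where "tent_grad c R y = (if y \<in> ball c R then (- 2 / R) *\<^sub>R (y - c) else 0)"

definition tent_flow :: "real^3 \<Rightarrow> real \<Rightarrow> real^3 \<Rightarrow> real^3 \<Rightarrow> real^3"
 where "tent_flow c R t y = y + tent c R y *\<^sub>R t"

definition tent_jac :: "real^3 \<Rightarrow> real \<Rightarrow> real^3 \<Rightarrow> real^3 \<Rightarrow> real"
 where "tent_jac c R t y = 1 + tent_grad c R y \<bullet> t"

lemma ball_borel [measurable]: "ball (a::real^3) r \<in> sets borel"
 by (rule borel_open) simp

lemma tent_measurable [measurable]:
 "tent c R \<in> borel_fun" "tent_grad c R \<in> borel_fun"
 "tent_flow c R t \<in> borel_fun" "tent_jac c R t \<in> borel_fun"
 unfolding tent_def tent_grad_def tent_flow_def tent_jac_def by measurable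

context
 fixes c :: "real^3" and R :: real
 assumes R: "R > 0"
begin

lemma tent_off: "y \<notin> ball c R \<Longrightarrow> tent c R y = 0"
proof -
 assume "y \<notin> ball c R"
 then have "R\<^sup>2 \<le> (norm (y - c))\<^sup>2" using R by (intro power_mono) (auto simp: dist_norm norm_minus_commute)
 then show ?thesis using R by (auto simp: tent_def max_def divide_le_0_iff zero_le_divide_iff)
qed

lemma tent_on: "y \<in> ball c R \<Longrightarrow> tent c R y = (R\<^sup>2 - (norm (y - c))\<^sup>2) / R"
proof -
 assume "y \<in> ball c R"
 then have "(norm (y - c))\<^sup>2 \<le> R\<^sup>2" using R by (intro power_mono) (auto simp: dist_norm norm_minus_commute)
 then show ?thesis using R by (simp add: tent_def)
qed

text \<open>As a function of the radius the tent has slope \<open>- 2 * r / R\<close> inside the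
  ball, of size at most 2. Dividing the parabola by \<open>R\<close> is what makes the constant
  independent of \<open>R\<close>.\<close>

lemma tent_lipschitz: "\<bar>tent c R x - tent c R y\<bar> \<le> 2 * dist x y"
proof -
 define g where "g r = max 0 ((R\<^sup>2 - r\<^sup>2) / R)" for r
 have le: "\<bar>g r - g r'\<bar> \<le> 2 * (r' - r)" if "0 \<le> r" "r \<le> r'" for r r'
 proof -
  have eq: "(R\<^sup>2 - a\<^sup>2) / R = (R - a) * ((R + a) / R)" for a by (simp add: power2_eq_square algebra_simps)
  consider "R \<le> r" | "r < R" "R < r'" | "r' \<le> R" by linarith
  then show ?thesis
  proof cases
   case 1
   then have "R\<^sup>2 \<le> r\<^sup>2" "R\<^sup>2 \<le> r'\<^sup>2" using R that by (auto intro!: power_mono)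
   then have "g r = 0" "g r' = 0" using R by (auto simp: g_def max_def divide_le_0_iff zero_le_divide_iff)
   then show ?thesis using that by simp
  next
   case 2
   then have "R\<^sup>2 \<le> r'\<^sup>2" using R that by (auto intro!: power_mono)
   then have "g r' = 0" using R by (auto simp: g_def max_def divide_le_0_iff zero_le_divide_iff)
   moreover have "0 \<le> g r" by (simp add: g_def)
   moreover have "g r \<le> 2 * (R - r)"
   proof -
    have "(R + r) / R \<le> 2" using 2 R by (simp add: field_simps)
    then have "(R - r) * ((R + r) / R) \<le> (R - r) * 2" using 2 by (intro mult_left_mono) auto
    then show ?thesis using 2 unfolding g_def eq by simp
   qed
   ultimately show ?thesis using 2 by simp
  next
   case 3
   have "(r' + r) / R \<le> 2" using 3 that R by (simp add: field_simps)
   then have *: "(r' - r) * ((r' + r) / R) \<le> (r' - r) * 2" using that by (intro mult_left_mono) auto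
   have "r\<^sup>2 \<le> r'\<^sup>2" "r'\<^sup>2 \<le> R\<^sup>2" using 3 that by (auto intro!: power_mono)
   then have "g r - g r' = (R\<^sup>2 - r\<^sup>2) / R - (R\<^sup>2 - r'\<^sup>2) / R" using R by (simp add: g_def)
   also have "\<dots> = (r' - r) * ((r' + r) / R)"
    by (simp add: power2_eq_square algebra_simps diff_divide_distrib)
   finally have e: "g r - g r' = (r' - r) * ((r' + r) / R)" .
   have "0 \<le> (r' - r) * ((r' + r) / R)" using that R by (intro mult_nonneg_nonneg divide_nonneg_nonneg) auto
   then show ?thesis using * unfolding e by simp
  qed
 qed
 have "\<bar>g (norm (x - c)) - g (norm (y - c))\<bar> \<le> 2 * \<bar>norm (x - c) - norm (y - c)\<bar>"
 proof (cases "norm (x - c) \<le> norm (y - c)")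
  case True
  then show ?thesis using le[of "norm (x - c)" "norm (y - c)"] by simp
 next
  case False
  then show ?thesis using le[of "norm (y - c)" "norm (x - c)"] by (simp add: abs_minus_commute)
 qed
 also have "\<bar>norm (x - c) - norm (y - c)\<bar> \<le> norm ((x - c) - (y - c))" by (rule norm_triangle_ineq3)
 finally show ?thesis by (simp add: g_def tent_def dist_norm)
qed

lemma norm_tent_grad: "norm (tent_grad c R y) \<le> 2"
proof (cases "y \<in> ball c R")
 case True
 then have "norm (y - c) \<le> R" by (simp add: dist_norm norm_minus_commute)
 moreover have "norm ((- 2 / R) *\<^sub>R (y - c)) = 2 / R * norm (y - c)" using R by (simp only: norm_scaleR) simp
 ultimately show ?thesis using True R by (simp only: tent_grad_def if_True) (simp add: field_simps)
qed (simp add: tent_grad_def)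

context
 fixes t :: "real^3"
 assumes t: "norm t \<le> 1/4"
begin

text \<open>The displacements of two points differ by at most \<open>2 * (1/4)\<close> times their
  distance, so at least half of the distance survives.\<close>

lemma tent_flow_expand: "dist x y \<le> 2 * dist (tent_flow c R t x) (tent_flow c R t y)"
proof -
 have "x - y = (tent_flow c R t x - tent_flow c R t y) - (tent c R x - tent c R y) *\<^sub>R t"
  by (simp add: tent_flow_def algebra_simps)
 then have "norm (x - y) \<le> norm (tent_flow c R t x - tent_flow c R t y) + norm ((tent c R x - tent c R y) *\<^sub>R t)"
  by (metis norm_triangle_ineq4)
 also have "norm ((tent c R x - tent c R y) *\<^sub>R t) \<le> (2 * dist x y) * (1/4)"
  unfolding norm_scaleR real_norm_def using tent_lipschitz t by (intro mult_mono) auto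
 finally show ?thesis by (simp add: dist_norm)
qed

lemma tent_flow_inj: "inj_on (tent_flow c R t) S"
 by (rule inj_onI) (use tent_flow_expand in \<open>metis dist_eq_0_iff dist_le_zero_iff mult_zero_right\<close>)

lemma tent_flow_off: "y \<notin> ball c R \<Longrightarrow> tent_flow c R t y = y"
 by (simp add: tent_flow_def tent_off)

text \<open>If a point of the ball were moved out, its image would be fixed by the flow; by
  injectivity the point would then be its own image.\<close>

lemma tent_flow_ball_iff: "tent_flow c R t y \<in> ball c R \<longleftrightarrow> y \<in> ball c R"
proof
 assume y: "y \<in> ball c R"
 show "tent_flow c R t y \<in> ball c R"
 proof (rule ccontr)
  assume "tent_flow c R t y \<notin> ball c R"
  then have "tent_flow c R t (tent_flow c R t y) = tent_flow c R t y" by (rule tent_flow_off)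
  then have "tent_flow c R t y = y" using tent_flow_inj[of UNIV] by (simp add: inj_on_def)
  then show False using y \<open>tent_flow c R t y \<notin> ball c R\<close> by simp
 qed
qed (metis tent_flow_off)

text \<open>Solve \<open>y = z - tent c R y *\<^sub>R t\<close>, whose right-hand side is a
  contraction with factor \<open>2 * (1/4)\<close>.\<close>

lemma tent_flow_surj: "\<exists>y. tent_flow c R t y = z"
proof -
 have "\<exists>!y. z - tent c R y *\<^sub>R t = y"
 proof (rule banach_fix_type[of "1/2"])
  show "\<forall>x. \<forall>y. dist (z - tent c R x *\<^sub>R t) (z - tent c R y *\<^sub>R t) \<le> 1/2 * dist x y"
  proof (intro allI)
   fix x y
   have "dist (z - tent c R x *\<^sub>R t) (z - tent c R y *\<^sub>R t) = \<bar>tent c R y - tent c R x\<bar> * norm t"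
   proof -
    have e: "(z - tent c R x *\<^sub>R t) - (z - tent c R y *\<^sub>R t) = (tent c R y - tent c R x) *\<^sub>R t"
     by (simp add: scaleR_diff_left)
    show ?thesis unfolding dist_norm e by simp
   qed
   also have "\<dots> \<le> (2 * dist x y) * (1/4)"
    using tent_lipschitz[of y x] t by (intro mult_mono) (auto simp: dist_commute)
   finally show "dist (z - tent c R x *\<^sub>R t) (z - tent c R y *\<^sub>R t) \<le> 1/2 * dist x y" by simp
  qed
 qed auto
 then obtain y where "z - tent c R y *\<^sub>R t = y" by blast
 then have "tent_flow c R t y = z" by (metis add.commute diff_add_cancel tent_flow_def)
 then show ?thesis ..
qed

lemma tent_flow_image: "tent_flow c R t ` ball c R = ball c R"
proof
 show "ball c R \<subseteq> tent_flow c R t ` ball c R"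
 proof
  fix z assume z: "z \<in> ball c R"
  obtain y where "tent_flow c R t y = z" using tent_flow_surj by blast
  then show "z \<in> tent_flow c R t ` ball c R" using z tent_flow_ball_iff[of y] by blast
 qed
qed (auto simp: tent_flow_ball_iff simp del: mem_ball)

lemma tent_jac_bounds: "1/2 \<le> tent_jac c R t y" "tent_jac c R t y \<le> 3/2"
proof -
 have "\<bar>tent_grad c R y \<bullet> t\<bar> \<le> norm (tent_grad c R y) * norm t" by (rule Cauchy_Schwarz_ineq2)
 also have "\<dots> \<le> 2 * (1/4)" using norm_tent_grad t by (intro mult_mono) auto
 finally show "1/2 \<le> tent_jac c R t y" "tent_jac c R t y \<le> 3/2" by (auto simp: tent_jac_def)
qed

lemma tent_flow_has_derivative:
 assumes "y \<in> ball c R"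
 shows "(tent_flow c R t has_derivative (\<lambda>h. h + (tent_grad c R y \<bullet> h) *\<^sub>R t)) (at y)"
proof -
 have g: "tent_grad c R y \<bullet> h = - (2 * ((y - c) \<bullet> h)) / R" for h
  using assms by (simp only: tent_grad_def if_True inner_scaleR_left) simp
 have "((\<lambda>y. y + ((R\<^sup>2 - (y - c) \<bullet> (y - c)) / R) *\<^sub>R t) has_derivative (\<lambda>h. h + (tent_grad c R y \<bullet> h) *\<^sub>R t)) (at y)"
 proof -
  have d1: "((\<lambda>y. (y - c) \<bullet> (y - c)) has_derivative (\<lambda>h. 2 * ((y - c) \<bullet> h))) (at y)"
   by (auto intro!: derivative_eq_intros simp: inner_commute)
  have d2: "((\<lambda>y. (R\<^sup>2 - (y - c) \<bullet> (y - c)) * inverse R) has_derivative (\<lambda>h. (0 - 2 * ((y - c) \<bullet> h)) * inverse R)) (at y)"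
   by (intro has_derivative_mult_left has_derivative_diff has_derivative_const d1)
  have "((\<lambda>y. y + ((R\<^sup>2 - (y - c) \<bullet> (y - c)) * inverse R) *\<^sub>R t) has_derivative (\<lambda>h. h + ((0 - 2 * ((y - c) \<bullet> h)) * inverse R) *\<^sub>R t)) (at y)"
   by (intro has_derivative_add has_derivative_ident has_derivative_scaleR_left d2)
  then show ?thesis by (simp add: g divide_inverse)
 qed
 then show ?thesis
  by (rule has_derivative_transform_within_open[of _ _ _ _ "ball c R"])
    (use assms in \<open>auto simp: tent_flow_def tent_on power2_norm_eq_inner simp del: mem_ball\<close>)
qed

lemma nn_integral_tent_flow:
 assumes [measurable]: "g \<in> borel_fun"
 shows "(\<integral>\<^sup>+y. g (tent_flow c R t y) * ennreal (tent_jac c R t y) \<partial>lborel) = (\<integral>\<^sup>+y. g y \<partial>lborel)"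
proof -
 have on: "(\<integral>\<^sup>+y. g (tent_flow c R t y) * (ennreal (tent_jac c R t y) * indicator (ball c R) y) \<partial>lborel) = (\<integral>\<^sup>+y. g y * indicator (ball c R) y \<partial>lborel)"
 proof (rule nn_integral_change_of_variables[OF _ _ _ _ tent_flow_has_derivative tent_flow_inj tent_flow_image])
  fix y assume "y \<in> ball c R"
  show "tent_jac c R t y = \<bar>det (matrix (\<lambda>h. h + (tent_grad c R y \<bullet> h) *\<^sub>R t))\<bar>"
   using tent_jac_bounds(1)[of y] unfolding det_rank_one by (simp add: tent_jac_def)
 qed auto
 have split: "f y = f y * indicator (ball c R) y + f y * indicator (- ball c R) y" for f :: "real^3 \<Rightarrow> ennreal" and y
  by (auto simp: indicator_def)
 have "(\<integral>\<^sup>+y. g (tent_flow c R t y) * ennreal (tent_jac c R t y) \<partial>lborel)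
   = (\<integral>\<^sup>+y. g (tent_flow c R t y) * (ennreal (tent_jac c R t y) * indicator (ball c R) y) + g y * indicator (- ball c R) y \<partial>lborel)"
  by (intro nn_integral_cong) (auto simp: indicator_def tent_flow_off tent_jac_def tent_grad_def simp del: mem_ball)
 also have "\<dots> = (\<integral>\<^sup>+y. g y * indicator (ball c R) y \<partial>lborel) + (\<integral>\<^sup>+y. g y * indicator (- ball c R) y \<partial>lborel)"
  by (subst nn_integral_add) (auto simp: on)
 also have "\<dots> = (\<integral>\<^sup>+y. g y * indicator (ball c R) y + g y * indicator (- ball c R) y \<partial>lborel)"
  by (rule nn_integral_add[symmetric]) auto
 also have "\<dots> = (\<integral>\<^sup>+y. g y \<partial>lborel)" by (intro nn_integral_cong split[symmetric])
 finally show ?thesis .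
qed

lemma substitution_tent_flow: "substitution (tent_flow c R t) (tent_jac c R t)"
 by standard (auto intro!: AE_I2 less_le_trans[OF _ tent_jac_bounds(1)] nn_integral_tent_flow)

lemmas integral_tent_flow = substitution.integral_subst[OF substitution_tent_flow]
lemmas AE_tent_flow = substitution.AE_subst[OF substitution_tent_flow]


end

end

section \<open>The kernels along the tent flow as power series in the flow parameter\<close>

text \<open>The binomial series of \<open>(1 + q) powr (- 1/2)\<close>, which also makes sense for
  \<open>q\<close> of norm below 1 in a Banach algebra.\<close>

definition rsq :: "'a::{comm_ring_1,real_normed_algebra_1,banach} \<Rightarrow> 'a"
 where "rsq q = (\<Sum>n. ((-1/2::real) gchoose n) *\<^sub>R q ^ n)"

text \<open>The ratio of consecutive coefficients is \<open>(- 1/2 - n) / (n + 1)\<close>, of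
  absolute value at most 1.\<close>

lemma abs_gchoose_half_le: "\<bar>(-1/2::real) gchoose n\<bar> \<le> 1"
proof (induction n)
 case (Suc n)
 have "real (Suc n) * ((-1/2::real) gchoose Suc n) = (-1/2 - real n) * ((-1/2) gchoose n)"
  by (simp add: gbinomial_absorption gbinomial_mult_1[symmetric] gbinomial_prod_rev prod.atLeast0_lessThan_Suc divide_simps)
 then have "real (Suc n) * \<bar>(-1/2::real) gchoose Suc n\<bar> = \<bar>-1/2 - real n\<bar> * \<bar>(-1/2) gchoose n\<bar>"
  by (metis abs_mult abs_of_nat)
 also have "\<dots> \<le> real (Suc n) * 1"
  using Suc by (intro mult_mono) auto
 finally show ?case by (simp del: of_nat_Suc)
qed simp

lemma rsq_summable:
 fixes q :: "'a::{comm_ring_1,real_normed_algebra_1,banach}"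
 assumes "norm q < 1"
 shows "summable (\<lambda>n. ((-1/2::real) gchoose n) *\<^sub>R q ^ n)"
proof (rule summable_comparison_test')
 show "summable (\<lambda>n. norm q ^ n)" using assms by (intro summable_geometric) simp
 fix n
 have "\<bar>(-1/2::real) gchoose n\<bar> * norm (q ^ n) \<le> 1 * norm q ^ n"
  by (intro mult_mono abs_gchoose_half_le norm_power_ineq) auto
 then show "norm (((-1/2::real) gchoose n) *\<^sub>R q ^ n) \<le> norm q ^ n" by simp
qed

lemma norm_rsq_minus_1:
 fixes q :: "'a::{comm_ring_1,real_normed_algebra_1,banach}"
 assumes "norm q \<le> 1/2"
 shows "norm (rsq q - 1) \<le> 2 * norm q"
proof -
 define f where "f = (\<lambda>n. ((-1/2::real) gchoose n) *\<^sub>R q ^ n)"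
 have s: "summable f" unfolding f_def by (rule rsq_summable) (use assms in auto)
 have "rsq q - 1 = (\<Sum>n. f (Suc n))"
  proof -
  have "f 0 = 1" by (simp add: f_def)
  then show ?thesis using suminf_split_head[OF s] rsq_def[of q, folded f_def] by simp
 qed
 also have "norm \<dots> \<le> (\<Sum>n. norm q * norm q ^ n)"
 proof (rule norm_suminf_le)
  fix n
  have "\<bar>(-1/2::real) gchoose Suc n\<bar> * norm (q ^ Suc n) \<le> 1 * norm q ^ Suc n"
   by (intro mult_mono abs_gchoose_half_le norm_power_ineq) auto
  then show "norm (f (Suc n)) \<le> norm q * norm q ^ n" by (simp add: f_def)
 qed (use assms in \<open>auto intro!: summable_mult summable_geometric\<close>)
 also have "\<dots> = norm q * (1 / (1 - norm q))"
  using assms by (subst suminf_mult) (auto intro!: summable_geometric simp: suminf_geometric)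
 also have "\<dots> \<le> norm q * 2"
  using assms by (intro mult_left_mono) (auto simp: field_simps)
 finally show ?thesis by simp
qed

lemma rsq_real_sqrt:
 fixes q :: real
 assumes "\<bar>q\<bar> < 1"
 shows "rsq q = 1 / sqrt (1 + q)"
proof -
 have "rsq q = (1 + q) powr (- 1/2)"
  using sums_unique[OF gen_binomial_real[OF assms, of "-1/2"]] by (simp add: rsq_def)
 also have "\<dots> = inverse ((1 + q) powr (1/2))" by (simp add: powr_minus)
 also have "(1 + q) powr (1/2) = sqrt (1 + q)" by (rule powr_half_sqrt) (use assms in linarith)
 finally show ?thesis by (simp add: divide_inverse)
qed

lemma msub_rsq:
 fixes t :: "real^3"
 assumes t: "norm t \<le> 1" and q: "norm q < 1"
 shows "msub t (rsq q) = rsq (msub t q)"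
proof -
 note t' = component_le_one[OF t]
 have "msub t (rsq q) = (\<Sum>n. msub t (((-1/2::real) gchoose n) *\<^sub>R q ^ n))"
  unfolding rsq_def by (rule bounded_linear.suminf[OF bounded_linear_msub[OF t'] rsq_summable[OF q]])
 then show ?thesis by (simp only: msub_scaleR[OF t'] msub_power[OF t'] rsq_def)
qed

lemma borel_measurable_power_algebra:
 fixes f :: "'x \<Rightarrow> 'a::{real_normed_algebra_1,second_countable_topology}"
 assumes [measurable]: "f \<in> borel_measurable M"
 shows "(\<lambda>x. f x ^ n) \<in> borel_measurable M"
 by (induction n) auto

lemma rsq_measurable:
 fixes f :: "'x \<Rightarrow> 'a::{comm_ring_1,real_normed_algebra_1,banach,second_countable_topology}"
 assumes [measurable]: "f \<in> borel_measurable M"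
 shows "(\<lambda>x. rsq (f x)) \<in> borel_measurable M"
 unfolding rsq_def
 by (intro borel_measurable_suminf borel_measurable_scaleR borel_measurable_power_algebra) auto

text \<open>With \<open>r\<close> and \<open>n\<close> the difference quotients of \<open>\<theta>\<close> and of the coordinates, two points that are moved by the
 flow have distance \<open>|x - y| (1 + q)\<^sup>1\<^sup>/\<^sup>2\<close> with \<open>q = \<Sum>\<^sub>j (2 r n\<^sub>j t\<^sub>j + r\<^sup>2 t\<^sub>j\<^sup>2)\<close>. The kernels \<open>fK0\<close> and \<open>fK\<close> below are
 \<open>1/|z|\<close> and \<open>z\<^sub>k/|z|\<^sup>3\<close> along the flow, times the Jacobian; \<open>X\<close> is either the parameter \<open>t\<close> itself
 or a scaled family of indeterminates of the power series algebra.\<close>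

definition fr :: "real^3 \<Rightarrow> real \<Rightarrow> real^3 \<Rightarrow> real^3 \<Rightarrow> real"
 where "fr c R x y = (tent c R x - tent c R y) / dist x y"

definition fn :: "3 \<Rightarrow> real^3 \<Rightarrow> real^3 \<Rightarrow> real"
 where "fn k x y = (x $ k - y $ k) / dist x y"

definition fq :: "real^3 \<Rightarrow> real \<Rightarrow> (3 \<Rightarrow> 'a) \<Rightarrow> real^3 \<Rightarrow> real^3 \<Rightarrow> 'a::{comm_ring_1,real_normed_algebra_1,banach}"
 where "fq c R X x y = (\<Sum>j\<in>UNIV. (2 * fr c R x y * fn j x y) *\<^sub>R X j + (fr c R x y)\<^sup>2 *\<^sub>R (X j * X j))"

definition fJ :: "real^3 \<Rightarrow> real \<Rightarrow> (3 \<Rightarrow> 'a) \<Rightarrow> real^3 \<Rightarrow> 'a::{comm_ring_1,real_normed_algebra_1,banach}"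
 where "fJ c R X y = 1 + (\<Sum>j\<in>UNIV. (tent_grad c R y $ j) *\<^sub>R X j)"

definition fK0 :: "real^3 \<Rightarrow> real \<Rightarrow> (3 \<Rightarrow> 'a) \<Rightarrow> real^3 \<Rightarrow> real^3 \<Rightarrow> 'a::{comm_ring_1,real_normed_algebra_1,banach}"
 where "fK0 c R X x y = (1 / dist x y) *\<^sub>R (rsq (fq c R X x y) * fJ c R X y)"

definition fK :: "real^3 \<Rightarrow> real \<Rightarrow> (3 \<Rightarrow> 'a) \<Rightarrow> 3 \<Rightarrow> real^3 \<Rightarrow> real^3 \<Rightarrow> 'a::{comm_ring_1,real_normed_algebra_1,banach}"
 where "fK c R X k x y = (1 / dist x y ^ 2) *\<^sub>R ((fn k x y *\<^sub>R 1 + fr c R x y *\<^sub>R X k) * rsq (fq c R X x y) ^ 3 * fJ c R X y)"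

lemma abs_fn_le: "\<bar>fn k x y\<bar> \<le> 1"
proof (cases "x = y")
 case False
 have "\<bar>(x - y) $ k\<bar> \<le> norm (x - y)" by (rule component_le_norm_cart)
 then show ?thesis using False by (simp add: fn_def dist_norm divide_le_eq_1)
qed (simp add: fn_def)

lemma abs_fr_le:
 assumes "R > 0"
 shows "\<bar>fr c R x y\<bar> \<le> 2"
proof (cases "x = y")
 case False
 then show ?thesis using tent_lipschitz[OF assms, of c x y] by (simp add: fr_def divide_le_eq)
qed (simp add: fr_def)

lemma fK_measurable:
 fixes X :: "3 \<Rightarrow> 'a::{comm_ring_1,real_normed_algebra_1,banach,second_countable_topology}"
 shows "(\<lambda>p. fK0 c R X (fst p) (snd p)) \<in> borel_measurable (borel \<Otimes>\<^sub>M borel)"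
  and "(\<lambda>p. fK c R X k (fst p) (snd p)) \<in> borel_measurable (borel \<Otimes>\<^sub>M borel)"
proof -
 have [measurable]: "(\<lambda>p. fr c R (fst p) (snd p)) \<in> borel_measurable (borel \<Otimes>\<^sub>M borel)"
  "(\<lambda>p. fn k (fst p) (snd p)) \<in> borel_measurable (borel \<Otimes>\<^sub>M borel)" for k
  unfolding fr_def fn_def by measurable
 have [measurable]: "(\<lambda>p. fq c R X (fst p) (snd p)) \<in> borel_measurable (borel \<Otimes>\<^sub>M borel)"
  unfolding fq_def by measurable
 note [measurable] = rsq_measurable[OF this]
 have [measurable]: "(\<lambda>p. fJ c R X (snd p)) \<in> borel_measurable (borel \<Otimes>\<^sub>M (borel :: (real^3) measure))"
  unfolding fJ_def by measurable
 have [measurable]: "(\<lambda>p. rsq (fq c R X (fst p) (snd p)) ^ 3) \<in> borel_measurable (borel \<Otimes>\<^sub>M borel)"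
  by (rule borel_measurable_power_algebra) measurable
 show "(\<lambda>p. fK0 c R X (fst p) (snd p)) \<in> borel_measurable (borel \<Otimes>\<^sub>M borel)"
  unfolding fK0_def by measurable
 show "(\<lambda>p. fK c R X k (fst p) (snd p)) \<in> borel_measurable (borel \<Otimes>\<^sub>M borel)"
  unfolding fK_def by measurable
qed

context
 fixes c :: "real^3" and R \<rho> :: real and X :: "3 \<Rightarrow> 'a::{comm_ring_1,real_normed_algebra_1,banach}"
 assumes R: "R > 0" and X: "\<And>j. norm (X j) \<le> \<rho>" and rho: "\<rho> \<le> 1/100"
begin

lemma rho_nonneg: "0 \<le> \<rho>"
 using order_trans[OF norm_ge_zero X] .

lemma norm_fq: "norm (fq c R X x y) \<le> 24 * \<rho>"
proof -
 have "norm (fq c R X x y) \<le> (\<Sum>j\<in>(UNIV::3 set). 8 * \<rho>)"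
  unfolding fq_def
 proof (rule sum_norm_le)
  fix j :: 3
  have f: "\<bar>fr c R x y\<bar> \<le> 2" "\<bar>fn j x y\<bar> \<le> 1" using abs_fr_le[OF R] abs_fn_le by auto
  have "norm ((2 * fr c R x y * fn j x y) *\<^sub>R X j + (fr c R x y)\<^sup>2 *\<^sub>R (X j * X j))
    \<le> (2 * \<bar>fr c R x y\<bar> * \<bar>fn j x y\<bar>) * norm (X j) + \<bar>fr c R x y\<bar>\<^sup>2 * (norm (X j) * norm (X j))"
   by (rule order_trans[OF norm_triangle_ineq])
     (auto simp: abs_mult intro!: add_mono mult_left_mono norm_mult_ineq)
  \<comment> \<open>The difference quotients are at most 2 for the tent and 1 for a coordinate. Each
    of the three coordinates contributes at most \<open>8 * \<rho>\<close>.\<close>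
  also have "\<dots> \<le> (2 * 2 * 1) * \<rho> + 2\<^sup>2 * (\<rho> * 1)"
  proof (intro add_mono mult_mono power_mono)
   show "norm (X j) \<le> 1" using X[of j] rho by linarith
  qed (use f X rho_nonneg in auto)
  finally show "norm ((2 * fr c R x y * fn j x y) *\<^sub>R X j + (fr c R x y)\<^sup>2 *\<^sub>R (X j * X j)) \<le> 8 * \<rho>" by simp
 qed
 then show ?thesis by simp
qed

lemma norm_fJ_minus_1: "norm (fJ c R X y - 1) \<le> 6 * \<rho>"
proof -
 have "norm (fJ c R X y - 1) \<le> (\<Sum>j\<in>(UNIV::3 set). 2 * \<rho>)"
  unfolding fJ_def add_diff_cancel_left'
 proof (rule sum_norm_le)
  fix j :: 3
  have "\<bar>tent_grad c R y $ j\<bar> \<le> 2" using component_le_norm_cart[of "tent_grad c R y" j] norm_tent_grad[OF R, of c y] by linarith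
  then show "norm ((tent_grad c R y $ j) *\<^sub>R X j) \<le> 2 * \<rho>" using X[of j] by (simp add: mult_mono)
 qed
 then show ?thesis by simp
qed

lemma norm_rsq_fq: "norm (rsq (fq c R X x y) - 1) \<le> 48 * \<rho>" "norm (rsq (fq c R X x y)) \<le> 3/2"
 "norm (rsq (fq c R X x y) ^ 3 - 1) \<le> 240 * \<rho>"
proof -
 define s where "s = rsq (fq c R X x y)"
 have "norm (fq c R X x y) \<le> 1/2" using norm_fq[of x y] rho by simp
 then have "norm (s - 1) \<le> 2 * norm (fq c R X x y)" unfolding s_def by (rule norm_rsq_minus_1)
 then show 1: "norm (rsq (fq c R X x y) - 1) \<le> 48 * \<rho>" using norm_fq[of x y] by (simp add: s_def)
 have "norm s \<le> norm (s - 1) + norm (1::'a)" using norm_triangle_ineq[of "s - 1" 1] by simp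
 then show 2: "norm (rsq (fq c R X x y)) \<le> 3/2" using 1 rho by (simp add: s_def)
 have "s ^ 3 - 1 = (s - 1) * (s * s + s + 1)" by (simp add: power3_eq_cube algebra_simps)
 then have "norm (s ^ 3 - 1) \<le> norm (s - 1) * norm (s * s + s + 1)" by (simp add: norm_mult_ineq)
 also have "\<dots> \<le> (48 * \<rho>) * 5"
 proof (intro mult_mono)
  have "norm (s * s + s + 1) \<le> norm s * norm s + norm s + norm (1::'a)"
   by (intro order_trans[OF norm_triangle_ineq] add_mono norm_mult_ineq order_refl)
  also have "\<dots> \<le> 3/2 * (3/2) + 3/2 + 1" using 2 unfolding s_def[symmetric] by (intro add_mono mult_mono) auto
  finally show "norm (s * s + s + 1) \<le> 5" by simp
 qed (use 1 rho_nonneg in \<open>auto simp: s_def\<close>)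
 finally show "norm (rsq (fq c R X x y) ^ 3 - 1) \<le> 240 * \<rho>" by (simp add: s_def)
qed

lemma fK0_diff: "norm (fK0 c R X x y - (1 / dist x y) *\<^sub>R 1) \<le> 502 * \<rho> * (1 / dist x y)"
proof -
 define s J where "s = rsq (fq c R X x y)" and "J = fJ c R X y"
 have "s * J - 1 = (s - 1) + s * (J - 1)" by (simp add: algebra_simps)
 then have "norm (s * J - 1) \<le> norm (s - 1) + norm s * norm (J - 1)"
  by (metis add_left_mono norm_mult_ineq norm_triangle_ineq order_trans)
 also have "\<dots> \<le> 48 * \<rho> + 3/2 * (6 * \<rho>)"
  using norm_rsq_fq[of x y] norm_fJ_minus_1[of y] unfolding s_def J_def by (intro add_mono mult_mono) auto
 also have "\<dots> \<le> 502 * \<rho>" using rho_nonneg by simp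
 finally have "\<bar>1 / dist x y\<bar> * norm (s * J - 1) \<le> (1 / dist x y) * (502 * \<rho>)" by (simp add: divide_right_mono)
 moreover have "fK0 c R X x y - (1 / dist x y) *\<^sub>R 1 = (1 / dist x y) *\<^sub>R (s * J - 1)"
  by (simp add: fK0_def s_def J_def scaleR_diff_right)
 ultimately show ?thesis by (simp only: norm_scaleR mult.commute)
qed

text \<open>The factors are replaced by their unmoved values one after the other. With the bounds 4
  for the cube of \<open>rsq\<close> and 2 for the Jacobian this costs
  \<open>16 + 480 + 6 = 502\<close> times \<open>\<rho>\<close>; \<open>fK0_diff\<close> is stated
  with the same constant.\<close>

lemma fK_diff: "norm (fK c R X k x y - ((x $ k - y $ k) / dist x y ^ 3) *\<^sub>R 1) \<le> 502 * \<rho> * (1 / dist x y ^ 2)"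
proof -
 define s J where "s = rsq (fq c R X x y) ^ 3" and "J = fJ c R X y"
 define n :: 'a where "n = fn k x y *\<^sub>R 1"
 define Z where "Z = fr c R x y *\<^sub>R X k"
 have s: "norm (s - 1) \<le> 240 * \<rho>" "norm s \<le> 4"
 proof -
  show *: "norm (s - 1) \<le> 240 * \<rho>" using norm_rsq_fq(3)[of x y] by (simp add: s_def)
  have "norm s \<le> norm (s - 1) + norm (1::'a)" using norm_triangle_ineq[of "s - 1" 1] by simp
  then show "norm s \<le> 4" using * rho by simp
 qed
 have J: "norm (J - 1) \<le> 6 * \<rho>" "norm J \<le> 2"
 proof -
  show *: "norm (J - 1) \<le> 6 * \<rho>" using norm_fJ_minus_1[of y] by (simp add: J_def)
  have "norm J \<le> norm (J - 1) + norm (1::'a)" using norm_triangle_ineq[of "J - 1" 1] by simp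
  then show "norm J \<le> 2" using * rho by simp
 qed
 have n: "norm n \<le> 1" using abs_fn_le[of k x y] by (simp add: n_def)
 have Z: "norm Z \<le> 2 * \<rho>" using abs_fr_le[OF R, of c x y] X[of k] by (simp add: Z_def mult_mono)
 have "(n + Z) * s * J - n = Z * s * J + n * (s - 1) * J + n * (J - 1)" by (simp add: algebra_simps)
 also have "norm \<dots> \<le> norm Z * norm s * norm J + norm n * norm (s - 1) * norm J + norm n * norm (J - 1)"
  by (intro order_trans[OF norm_triangle_ineq] add_mono order_trans[OF norm_mult_ineq] mult_right_mono norm_mult_ineq) auto
 also have "\<dots> \<le> (2 * \<rho>) * 4 * 2 + 1 * (240 * \<rho>) * 2 + 1 * (6 * \<rho>)"
  using s J n Z rho_nonneg by (intro add_mono mult_mono) auto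
 also have "\<dots> \<le> 502 * \<rho>" using rho_nonneg by simp
 finally have "\<bar>1 / dist x y ^ 2\<bar> * norm ((n + Z) * s * J - n) \<le> (1 / dist x y ^ 2) * (502 * \<rho>)" by (simp add: divide_right_mono)
 moreover have "fK c R X k x y - ((x $ k - y $ k) / dist x y ^ 3) *\<^sub>R 1 = (1 / dist x y ^ 2) *\<^sub>R ((n + Z) * s * J - n)"
  by (simp add: fK_def s_def J_def n_def Z_def fn_def scaleR_diff_right power_numeral_reduce)
 ultimately show ?thesis by (simp only: norm_scaleR mult.commute)
qed

text \<open>Since \<open>\<rho> \<le> 1/100\<close>, the factor is at most
  \<open>502 / 100 + 1\<close>, which is below 7.\<close>

lemma fK0_bound: "norm (fK0 c R X x y) \<le> 7 * (1 / dist x y)"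
proof -
 have "norm (fK0 c R X x y) \<le> norm (fK0 c R X x y - (1 / dist x y) *\<^sub>R 1) + norm ((1 / dist x y) *\<^sub>R (1::'a))"
  using norm_triangle_ineq[of "fK0 c R X x y - (1 / dist x y) *\<^sub>R 1" "(1 / dist x y) *\<^sub>R 1"] by simp
 also have "\<dots> \<le> 502 * \<rho> * (1 / dist x y) + 1 * (1 / dist x y)" by (intro add_mono fK0_diff) simp
 also have "\<dots> = (502 * \<rho> + 1) * (1 / dist x y)" by (simp only: distrib_right)
 also have "\<dots> \<le> 7 * (1 / dist x y)" using rho by (intro mult_right_mono) auto
 finally show ?thesis .
qed

lemma fK_bound: "norm (fK c R X k x y) \<le> 7 * (1 / dist x y ^ 2)"
proof -
 have "\<bar>(x $ k - y $ k) / dist x y ^ 3\<bar> = \<bar>fn k x y\<bar> * (1 / dist x y ^ 2)"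
  by (simp add: fn_def power_numeral_reduce)
 also have "\<dots> \<le> 1 * (1 / dist x y ^ 2)" using abs_fn_le by (intro mult_right_mono) auto
 finally have n: "\<bar>(x $ k - y $ k) / dist x y ^ 3\<bar> \<le> 1 * (1 / dist x y ^ 2)" .
 have "norm (fK c R X k x y) \<le> norm (fK c R X k x y - ((x $ k - y $ k) / dist x y ^ 3) *\<^sub>R 1) + norm (((x $ k - y $ k) / dist x y ^ 3) *\<^sub>R (1::'a))"
  using norm_triangle_ineq[of "fK c R X k x y - ((x $ k - y $ k) / dist x y ^ 3) *\<^sub>R 1" "((x $ k - y $ k) / dist x y ^ 3) *\<^sub>R 1"] by simp
 also have "\<dots> \<le> 502 * \<rho> * (1 / dist x y ^ 2) + 1 * (1 / dist x y ^ 2)" using n by (intro add_mono fK_diff) simp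
 also have "\<dots> = (502 * \<rho> + 1) * (1 / dist x y ^ 2)" by (simp only: distrib_right)
 also have "\<dots> \<le> 7 * (1 / dist x y ^ 2)" using rho by (intro mult_right_mono) auto
 finally show ?thesis .
qed

end

context
 fixes c t :: "real^3" and R :: real
 assumes R: "R > 0" and t: "norm t \<le> 1/100"
begin

lemma flow_distance:
 assumes "x \<noteq> y"
 shows "dist (tent_flow c R t x) (tent_flow c R t y) = dist x y * sqrt (1 + fq c R (\<lambda>j. t $ j) x y)"
  and "\<bar>fq c R (\<lambda>j. t $ j) x y\<bar> < 1"
proof -
 define d where "d = dist x y"
 have d: "d > 0" using assms by (simp add: d_def)
 have tj: "norm (t $ j) \<le> 1/100" for j using component_le_norm_cart[of t j] t by simp
 show q: "\<bar>fq c R (\<lambda>j. t $ j) x y\<bar> < 1"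
  using norm_fq[OF R, of "\<lambda>j. t $ j" "1/100" c x y] tj by simp
 define r where "r = fr c R x y"
 have sr: "tent c R x - tent c R y = r * d" using d by (simp add: r_def fr_def d_def)
 have e: "tent_flow c R t x - tent_flow c R t y = (x - y) + (r * d) *\<^sub>R t"
  unfolding sr[symmetric] by (simp add: tent_flow_def scaleR_diff_left)
 have "fq c R (\<lambda>j. t $ j) x y = 2 * r * ((x - y) \<bullet> t) / d + r\<^sup>2 * (t \<bullet> t)"
  unfolding fq_def r_def[symmetric]
  by (simp add: fn_def inner_vec_def d_def[symmetric] sum.distrib sum_distrib_left sum_divide_distrib mult_ac)
 then have "d\<^sup>2 * (1 + fq c R (\<lambda>j. t $ j) x y) = d\<^sup>2 + 2 * (r * d) * ((x - y) \<bullet> t) + (r * d)\<^sup>2 * (t \<bullet> t)"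
  using d by (simp add: power2_eq_square field_simps)
 also have "\<dots> = ((x - y) + (r * d) *\<^sub>R t) \<bullet> ((x - y) + (r * d) *\<^sub>R t)"
 proof -
  define a where "a = x - y"
  have "d\<^sup>2 = a \<bullet> a" by (simp add: d_def a_def dist_norm power2_norm_eq_inner)
  then show ?thesis unfolding a_def[symmetric]
   by (simp add: inner_add_left inner_add_right inner_commute[of t a] power2_eq_square distrib_left mult_ac)
 qed
 finally have "dist (tent_flow c R t x) (tent_flow c R t y) = sqrt (d\<^sup>2 * (1 + fq c R (\<lambda>j. t $ j) x y))"
  unfolding dist_norm e by (simp add: norm_eq_sqrt_inner)
 then show "dist (tent_flow c R t x) (tent_flow c R t y) = dist x y * sqrt (1 + fq c R (\<lambda>j. t $ j) x y)"
  using d by (simp add: real_sqrt_mult d_def)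
qed

lemma fJ_real: "fJ c R (\<lambda>j. t $ j) y = tent_jac c R t y"
 by (simp add: fJ_def tent_jac_def inner_vec_def)

lemma fK0_real: "fK0 c R (\<lambda>j. t $ j) x y = tent_jac c R t y * (1 / dist (tent_flow c R t x) (tent_flow c R t y))"
proof (cases "x = y")
 case False
 have "rsq (fq c R (\<lambda>j. t $ j) x y) = 1 / sqrt (1 + fq c R (\<lambda>j. t $ j) x y)"
  using flow_distance(2)[OF False] by (intro rsq_real_sqrt)
 then show ?thesis by (simp add: fK0_def fJ_real flow_distance(1)[OF False])
qed (simp add: fK0_def)

lemma fK_real: "fK c R (\<lambda>j. t $ j) k x y = tent_jac c R t y * ((tent_flow c R t x $ k - tent_flow c R t y $ k) / dist (tent_flow c R t x) (tent_flow c R t y) ^ 3)"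
proof (cases "x = y")
 case False
 define s where "s = sqrt (1 + fq c R (\<lambda>j. t $ j) x y)"
 define d where "d = dist x y"
 have d: "d > 0" using False by (simp add: d_def)
 have r: "rsq (fq c R (\<lambda>j. t $ j) x y) = 1 / s"
  unfolding s_def using flow_distance(2)[OF False] by (intro rsq_real_sqrt)
 have "tent_flow c R t x $ k - tent_flow c R t y $ k = d * (fn k x y + fr c R x y * t $ k)"
  using d by (simp add: tent_flow_def fn_def fr_def d_def[symmetric] field_simps)
 then show ?thesis
  using d unfolding fK_def r fJ_real flow_distance(1)[OF False] s_def[symmetric] d_def[symmetric]
  by (simp add: power_mult_distrib power_divide power_numeral_reduce mult_ac)
qed (simp add: fK_def)

end

text \<open>Evaluation at \<open>\<tau>\<close> is a homomorphism sending
  \<open>\<rho> *\<^sub>R mX j\<close> to \<open>\<rho> * \<tau> $ j\<close>. It therefore carries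
  the kernels built from indeterminates to those of the flow with parameter
  \<open>\<rho> *\<^sub>R \<tau>\<close>.\<close>

lemma msub_fK:
 fixes \<tau> :: "real^3"
 assumes R: "R > 0" and tau: "norm \<tau> \<le> 1" and rho: "0 \<le> \<rho>" "\<rho> \<le> 1/100"
 shows "msub \<tau> (fK0 c R (\<lambda>j. \<rho> *\<^sub>R mX j) x y) = fK0 c R (\<lambda>j. (\<rho> *\<^sub>R \<tau>) $ j) x y"
  and "msub \<tau> (fK c R (\<lambda>j. \<rho> *\<^sub>R mX j) k x y) = fK c R (\<lambda>j. (\<rho> *\<^sub>R \<tau>) $ j) k x y"
proof -
 note t = component_le_one[OF tau]
 note m = msub_add[OF t] msub_scaleR[OF t] msub_times[OF t] msub_one[OF t] msub_sum[OF t] msub_mX[OF t] msub_power[OF t]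
 have q: "norm (fq c R (\<lambda>j. \<rho> *\<^sub>R mX j) x y) < 1"
  using norm_fq[OF R, of "\<lambda>j. \<rho> *\<^sub>R mX j" \<rho> c x y] rho by simp
 have fq: "msub \<tau> (fq c R (\<lambda>j. \<rho> *\<^sub>R mX j) x y) = fq c R (\<lambda>j. (\<rho> *\<^sub>R \<tau>) $ j) x y"
  by (simp add: fq_def m mult_ac)
 have fJ: "msub \<tau> (fJ c R (\<lambda>j. \<rho> *\<^sub>R mX j) y) = fJ c R (\<lambda>j. (\<rho> *\<^sub>R \<tau>) $ j) y"
  by (simp add: fJ_def m mult_ac)
 have e: "(\<lambda>j. (\<rho> *\<^sub>R \<tau>) $ j) = (\<lambda>j. \<rho> * \<tau> $ j)" by simp
 show "msub \<tau> (fK0 c R (\<lambda>j. \<rho> *\<^sub>R mX j) x y) = fK0 c R (\<lambda>j. (\<rho> *\<^sub>R \<tau>) $ j) x y"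
  by (simp only: fK0_def m msub_rsq[OF tau q] fq fJ)
 show "msub \<tau> (fK c R (\<lambda>j. \<rho> *\<^sub>R mX j) k x y) = fK c R (\<lambda>j. (\<rho> *\<^sub>R \<tau>) $ j) k x y"
  by (simp only: fK_def m msub_rsq[OF tau q] fq fJ) (simp only: real_scaleR_def mult_1_right vector_scaleR_component e)
qed

subsection \<open>Transport of the cubic operators along algebra homomorphisms\<close>

text \<open>The two instances are the inclusion of the reals as constants and the evaluations
  \<open>msub \<tau>\<close>.\<close>

locale algebra_hom =
 fixes h :: "'a::{comm_ring_1,real_normed_algebra_1,banach,second_countable_topology}
  \<Rightarrow> 'b::{comm_ring_1,real_normed_algebra_1,banach,second_countable_topology}"
 assumes hom_linear: "bounded_linear h" and hom_mult: "h (x * y) = h x * h y" and hom_norm: "norm (h x) \<le> norm x"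
begin

definition hom_vec :: "'a^'i::finite \<Rightarrow> 'b^'i"
 where "hom_vec b = (\<chi> i. h (b $ i))"

lemmas hom_simps = linear_add[OF bounded_linear.linear[OF hom_linear]] linear_scale[OF bounded_linear.linear[OF hom_linear]]
 linear_sum[OF bounded_linear.linear[OF hom_linear]] hom_mult

lemma norm_hom_vec: "norm (hom_vec b) \<le> norm b"
 unfolding norm_vec_def hom_vec_def by (rule L2_set_mono) (auto intro: hom_norm)

lemma hom_vec_linear: "bounded_linear hom_vec"
 by (rule bounded_linear_intro[of _ 1]) (auto simp: hom_vec_def vec_eq_iff hom_simps intro: norm_hom_vec[unfolded hom_vec_def])

lemma hom_measurable [measurable]: "h \<in> borel_fun" "hom_vec \<in> borel_fun"
 by (intro borel_measurable_continuous_onI linear_continuous_on hom_linear hom_vec_linear)+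

lemma hom_cubic1: "h (cubic1 \<kappa> a b) = cubic1 (h \<kappa>) (h a) (hom_vec b)"
 by (simp add: cubic1_def hom_simps hom_vec_def)

lemma hom_cubic2: "hom_vec (cubic2 bm \<kappa> a b) = cubic2 bm (\<lambda>k. h (\<kappa> k)) (h a) (hom_vec b)"
 by (simp add: cubic2_def hom_simps hom_vec_def vec_eq_iff)

lemma cubic_hom:
 assumes "cubic K0 K C"
 shows "cubic (\<lambda>x y. h (K0 x y)) (\<lambda>k x y. h (K k x y)) C"
proof -
 interpret cubic K0 K _ C by fact
 show ?thesis
  by unfold_locales (use C_pos in \<open>auto intro: order_trans[OF hom_norm K0_le] order_trans[OF hom_norm K_le] simp del: mult_1_right times_divide_eq_right\<close>)
qed

text \<open>The homomorphism commutes with the cubic polynomials, and as a bounded linear map with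
  the integral wherever the integrands are integrable, that is, almost everywhere.\<close>

lemma T_hom:
 assumes c: "cubic K0 K C" and M: "pair_le M (\<lambda>x. norm (U x)) (\<lambda>x. norm (V x))" "M > 0"
  and UV: "U \<in> borel_fun" "V \<in> borel_fun"
 shows "AE x in lborel. cubic.T1 (\<lambda>x y. h (K0 x y)) (\<lambda>x. h (U x)) (\<lambda>x. hom_vec (V x)) x = h (cubic.T1 K0 U V x)
  \<and> cubic.T2 (\<lambda>k x y. h (K k x y)) bm (\<lambda>x. h (U x)) (\<lambda>x. hom_vec (V x)) x = hom_vec (cubic.T2 K bm U V x)"
proof -
 interpret A: cubic K0 K bm C by fact
 interpret B: cubic "\<lambda>x y. h (K0 x y)" "\<lambda>k x y. h (K k x y)" bm C by (rule cubic_hom[OF c])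
 show ?thesis
  using A.T_integrable[OF M UV]
 proof eventually_elim
  case (elim x)
  show ?case
   unfolding A.T1_def B.T1_def A.T2_def B.T2_def
   using integral_bounded_linear[OF hom_linear conjunct1[OF elim]] integral_bounded_linear[OF hom_vec_linear conjunct2[OF elim]]
   by (simp add: A.N1_def B.N1_def A.N2_def B.N2_def hom_cubic1 hom_cubic2)
 qed
qed

end

lemma (in cubic) picard_iterates:
 assumes "small \<epsilon>" "B \<in> sets borel" "U0 \<in> borel_fun" "V0 \<in> borel_fun"
  "pair_le M (\<lambda>x. norm (U0 x)) (\<lambda>x. norm (V0 x))" "M > 0" "pair_le \<epsilon> (on B U0) (on B V0)"
  "pair_le \<epsilon> (on B (\<lambda>x. T1 U0 V0 x - U0 x)) (on B (\<lambda>x. T2 U0 V0 x - V0 x))"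
 obtains W W' where "\<And>n. W n \<in> borel_fun" "\<And>n. W' n \<in> borel_fun"
  "\<And>n x. x \<notin> B \<Longrightarrow> W n x = U0 x \<and> W' n x = V0 x"
  "\<And>n x. x \<in> B \<Longrightarrow> W (Suc n) x = T1 (W n) (W' n) x \<and> W' (Suc n) x = T2 (W n) (W' n) x"
  "\<And>n. pair_le (3 * \<epsilon>) (on B (W n)) (on B (W' n))"
  "\<And>n. pair_le (M + 3 * \<epsilon>) (\<lambda>x. norm (W n x)) (\<lambda>x. norm (W' n x))"
  "AE x in lborel. convergent (\<lambda>n. W n x) \<and> convergent (\<lambda>n. W' n x)"
 by (rule that[OF UU_meas[OF assms] _ _ picard_small[OF assms] picard_global[OF assms] picard_convergent[OF assms]])
   (simp_all add: UU_off[OF assms] UU_Suc[OF assms])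

lemma (in cubic) ex_small: "\<exists>\<epsilon>. small \<epsilon>"
proof -
 define d where "d = D * (pair_const * 36)"
 have d: "d > 0" using D_pos pair_const_pos by (simp add: d_def)
 define e where "e = min 1 (1 / (2 * d))"
 have e: "e > 0" "e \<le> 1" "e \<le> 1 / (2 * d)" using d by (auto simp: e_def)
 have "e\<^sup>2 \<le> e * 1" unfolding power2_eq_square using e by (intro mult_left_mono) auto
 then have "d * e\<^sup>2 \<le> d * (1 / (2 * d))" using e d by (intro mult_left_mono) auto
 also have "\<dots> = 1/2" using d by simp
 finally have "small e" using e by (simp add: small_def d_def power_mult_distrib mult_ac)
 then show ?thesis ..
qed

text \<open>The constant is taken as large as the one in \<open>cubic_flow\<close>:
  \<open>small\<close> depends only on it and on \<open>bm\<close>, so it is the same condition for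
  the unmoved, the moved and the algebra-valued kernels.\<close>

lemma cubic_const:
 assumes "c0 > 0"
 shows "cubic (\<lambda>x y. c0 / dist x y) (\<lambda>k x y. (x $ k - y $ k) / dist x y ^ 3) (7 * max c0 1)"
proof
 fix x y :: "real^3" and k :: 3
 have "c0 * (1 / dist x y) \<le> 7 * max c0 1 * (1 / dist x y)" using assms by (intro mult_right_mono) auto
 then show "norm (c0 / dist x y) \<le> 7 * max c0 1 * (1 / dist x y)" using assms by simp
 have "\<bar>(x $ k - y $ k) / dist x y ^ 3\<bar> = \<bar>fn k x y\<bar> * (1 / dist x y ^ 2)"
  by (simp add: fn_def power_numeral_reduce)
 also have "\<dots> \<le> 7 * max c0 1 * (1 / dist x y ^ 2)" using abs_fn_le[of k x y] by (intro mult_right_mono) auto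
 finally show "norm ((x $ k - y $ k) / dist x y ^ 3) \<le> 7 * max c0 1 * (1 / (dist x y)\<^sup>2)" by simp
qed (use assms in \<open>auto intro!: borel_measurable_divide borel_measurable_diff borel_measurable_power borel_measurable_dist borel_measurable_const\<close>)

context
 fixes c :: "real^3" and R \<rho> c0 :: real and X :: "3 \<Rightarrow> 'a::{comm_ring_1,real_normed_algebra_1,banach,second_countable_topology}"
 assumes R: "R > 0" and X: "\<And>j. norm (X j) \<le> \<rho>" and rho: "\<rho> \<le> 1/100" and c0: "c0 > 0"
begin

lemma cubic_flow: "cubic (\<lambda>x y. c0 *\<^sub>R fK0 c R X x y) (fK c R X) (7 * max c0 1)"
proof
 note [measurable] = fK_measurable[of c R X]
 show "(\<lambda>p. c0 *\<^sub>R fK0 c R X (fst p) (snd p)) \<in> borel_measurable (borel \<Otimes>\<^sub>M borel)"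
  "(\<lambda>p. fK c R X k (fst p) (snd p)) \<in> borel_measurable (borel \<Otimes>\<^sub>M borel)" for k
  by measurable
 show "norm (c0 *\<^sub>R fK0 c R X x y) \<le> 7 * max c0 1 * (1 / dist x y)" for x y
 proof -
  have "c0 * norm (fK0 c R X x y) \<le> max c0 1 * (7 * (1 / dist x y))"
   using c0 fK0_bound[OF R, of X \<rho>, OF X rho] by (intro mult_mono) auto
  then show ?thesis using c0 by (simp add: mult_ac)
 qed
 show "norm (fK c R X k x y) \<le> 7 * max c0 1 * (1 / (dist x y)\<^sup>2)" for k x y
 proof -
  have "7 * (1 / (dist x y)\<^sup>2) \<le> 7 * max c0 1 * (1 / (dist x y)\<^sup>2)" by (intro mult_right_mono) auto
  then show ?thesis using fK_bound[OF R, of X \<rho>, OF X rho, of c k x y] by linarith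
 qed
qed auto

text \<open>The difference of moved and unmoved kernels is again an admissible kernel, with a
  constant proportional to \<open>\<rho>\<close>. Applying \<open>T_bound\<close> to it controls the
  first Picard step.\<close>

lemma cubic_flow_diff:
 assumes "\<rho> > 0"
 shows "cubic (\<lambda>x y. c0 *\<^sub>R fK0 c R X x y - (c0 / dist x y) *\<^sub>R 1)
  (\<lambda>k x y. fK c R X k x y - ((x $ k - y $ k) / dist x y ^ 3) *\<^sub>R 1) (502 * \<rho> * max c0 1)"
proof
 note [measurable] = fK_measurable[of c R X]
 show "(\<lambda>p. c0 *\<^sub>R fK0 c R X (fst p) (snd p) - (c0 / dist (fst p) (snd p)) *\<^sub>R 1) \<in> borel_measurable (borel \<Otimes>\<^sub>M borel)"
  "(\<lambda>p. fK c R X k (fst p) (snd p) - ((fst p $ k - snd p $ k) / dist (fst p) (snd p) ^ 3) *\<^sub>R 1) \<in> borel_measurable (borel \<Otimes>\<^sub>M borel)" for k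
  by measurable
 show "norm (c0 *\<^sub>R fK0 c R X x y - (c0 / dist x y) *\<^sub>R 1) \<le> 502 * \<rho> * max c0 1 * (1 / dist x y)" for x y
 proof -
  have "c0 * norm (fK0 c R X x y - (1 / dist x y) *\<^sub>R 1) \<le> max c0 1 * (502 * \<rho> * (1 / dist x y))"
   using c0 fK0_diff[OF R, of X \<rho>, OF X rho] assms by (intro mult_mono) auto
  moreover have "c0 *\<^sub>R fK0 c R X x y - (c0 / dist x y) *\<^sub>R 1 = c0 *\<^sub>R (fK0 c R X x y - (1 / dist x y) *\<^sub>R 1)"
   by (simp add: scaleR_diff_right)
  ultimately show ?thesis using c0 by (simp only: norm_scaleR abs_of_pos mult_ac)
 qed
 show "norm (fK c R X k x y - ((x $ k - y $ k) / dist x y ^ 3) *\<^sub>R 1) \<le> 502 * \<rho> * max c0 1 * (1 / (dist x y)\<^sup>2)" for k x y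
 proof -
  have "502 * \<rho> * (1 / (dist x y)\<^sup>2) \<le> 502 * \<rho> * max c0 1 * (1 / (dist x y)\<^sup>2)"
   using assms by (intro mult_right_mono) auto
  then show ?thesis using fK_diff[OF R, of X \<rho>, OF X rho, of c k x y] by linarith
 qed
qed (use assms in auto)

end

text \<open>Off the centre, the indicators of the shrinking balls are eventually 0, so dominated
  convergence applies with majorant \<open>f\<close>.\<close>

lemma nn_integral_small_balls:
 fixes f :: "real^3 \<Rightarrow> ennreal"
 assumes [measurable]: "f \<in> borel_fun" and f: "(\<integral>\<^sup>+x. f x \<partial>lborel) < \<infinity>" and d: "d > 0"
 shows "\<forall>\<^sub>F n in sequentially. (\<integral>\<^sup>+x. indicator (ball c (1 / real (Suc n))) x * f x \<partial>lborel) < d"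
proof -
 have "(\<lambda>n. \<integral>\<^sup>+x. indicator (ball c (1 / real (Suc n))) x * f x \<partial>lborel) \<longlonglongrightarrow> (\<integral>\<^sup>+(x::real^3). 0 \<partial>lborel)"
 proof (rule nn_integral_dominated_convergence[where w = f])
  have "AE x in lborel. x \<noteq> c" by (rule AE_lborel_singleton)
  then show "AE x in lborel. (\<lambda>n. indicator (ball c (1 / real (Suc n))) x * f x) \<longlonglongrightarrow> 0"
  proof eventually_elim
   case (elim x)
   then obtain m where m: "1 / real (Suc m) < dist c x"
    using reals_Archimedean[of "dist c x"] by (auto simp: inverse_eq_divide)
   have "1 / real (Suc n) \<le> 1 / real (Suc m)" if "m \<le> n" for n
    using that by (intro divide_left_mono) auto
   then have "\<forall>\<^sub>F n in sequentially. indicator (ball c (1 / real (Suc n))) x * f x = 0"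
    unfolding eventually_sequentially using m by (intro exI[of _ m]) (force simp: indicator_def)
   then show ?case by (rule tendsto_eventually)
  qed
 qed (use f in \<open>auto simp: indicator_def\<close>)
 then show ?thesis using d by (intro order_tendstoD) auto
qed

lemma pair_le_small_ball:
 assumes "pair_le M p q" and e: "e > 0"
 shows "\<exists>R>0. pair_le e (\<lambda>x. indicator (ball c R) x * p x) (\<lambda>x. indicator (ball c R) x * q x)"
proof -
 have [measurable]: "p \<in> borel_fun" "q \<in> borel_fun"
  and fin: "(\<integral>\<^sup>+x. ennreal (p x ^ 6) \<partial>lborel) < \<infinity>" "(\<integral>\<^sup>+x. ennreal (q x ^ 3) \<partial>lborel) < \<infinity>"
  using assms(1) by (auto simp: pair_le_def intro: le_less_trans)
 have "\<forall>\<^sub>F n in sequentially. (\<integral>\<^sup>+x. indicator (ball c (1 / real (Suc n))) x * ennreal (p x ^ 6) \<partial>lborel) < ennreal (e ^ 6)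
   \<and> (\<integral>\<^sup>+x. indicator (ball c (1 / real (Suc n))) x * ennreal (q x ^ 3) \<partial>lborel) < ennreal (e ^ 3)"
  using e by (intro eventually_conj nn_integral_small_balls fin) auto
 then obtain n where n: "(\<integral>\<^sup>+x. indicator (ball c (1 / real (Suc n))) x * ennreal (p x ^ 6) \<partial>lborel) < ennreal (e ^ 6)"
   "(\<integral>\<^sup>+x. indicator (ball c (1 / real (Suc n))) x * ennreal (q x ^ 3) \<partial>lborel) < ennreal (e ^ 3)"
  using eventually_happens'[OF sequentially_bot] by blast
 define R where "R = 1 / real (Suc n)"
 have eq: "ennreal ((indicator (ball c R) x * t) ^ Suc m) = indicator (ball c R) x * ennreal (t ^ Suc m)" for x t m
  by (simp add: indicator_def)
 have "pair_le e (\<lambda>x. indicator (ball c R) x * p x) (\<lambda>x. indicator (ball c R) x * q x)"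
  using assms(1) n eq[of _ _ 5] eq[of _ _ 2] unfolding pair_le_def R_def[symmetric] by auto
 moreover have "R > 0" by (simp add: R_def)
 ultimately show ?thesis by blast
qed

text \<open>The Jacobian is at least \<open>1/2\<close>, so the integral of an \<open>m\<close>-th
  power at most doubles, and \<open>2 \<le> 3 ^ m\<close>. The factor 3 matches the size
  \<open>3 * \<epsilon>\<close> that \<open>iterates_tendsto_fixed_point\<close> allows for the
  fixed point.\<close>

lemma pair_le_tent_flow:
 assumes R: "R > 0" and t: "norm t \<le> 1/4" and pq: "pair_le \<eta> p q" and eta: "\<eta> \<ge> 0"
 shows "pair_le (3 * \<eta>) (\<lambda>x. p (tent_flow c R t x)) (\<lambda>x. q (tent_flow c R t x))"
proof -
 have [measurable]: "p \<in> borel_fun" "q \<in> borel_fun"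
  using pq by (auto simp: pair_le_def)
 have key: "(\<integral>\<^sup>+x. ennreal (f (tent_flow c R t x) ^ m) \<partial>lborel) \<le> ennreal ((3 * \<eta>) ^ m)"
  if [measurable]: "f \<in> borel_fun" and f: "(\<integral>\<^sup>+x. ennreal (f x ^ m) \<partial>lborel) \<le> ennreal (\<eta> ^ m)" and m: "m > 0" for f m
 proof -
  have "(\<integral>\<^sup>+x. ennreal (f (tent_flow c R t x) ^ m) \<partial>lborel)
    \<le> (\<integral>\<^sup>+x. 2 * (ennreal (f (tent_flow c R t x) ^ m) * ennreal (tent_jac c R t x)) \<partial>lborel)"
  proof (rule nn_integral_mono)
   fix x
   have "1 \<le> ennreal (2 * tent_jac c R t x)" using tent_jac_bounds(1)[OF R t, of c x] by simp
   then have "ennreal (f (tent_flow c R t x) ^ m) * 1 \<le> ennreal (f (tent_flow c R t x) ^ m) * ennreal (2 * tent_jac c R t x)"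
    by (rule mult_left_mono) simp
   then show "ennreal (f (tent_flow c R t x) ^ m) \<le> 2 * (ennreal (f (tent_flow c R t x) ^ m) * ennreal (tent_jac c R t x))"
    using tent_jac_bounds(1)[OF R t, of c x] by (simp add: ennreal_mult mult_ac)
  qed
  also have "\<dots> = 2 * (\<integral>\<^sup>+x. ennreal (f x ^ m) \<partial>lborel)"
   by (subst nn_integral_cmult) (auto simp: nn_integral_tent_flow[OF R t, of "\<lambda>x. ennreal (f x ^ m)"])
  also have "\<dots> \<le> ennreal 2 * ennreal (\<eta> ^ m)" by (intro mult_mono f) auto
  also have "\<dots> = ennreal (2 * \<eta> ^ m)" using eta by (simp add: ennreal_mult)
  also have "\<dots> \<le> ennreal ((3 * \<eta>) ^ m)"
  proof (rule ennreal_leI)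
   have "(2::real) \<le> 3 ^ m" using self_le_power[of "3::real" m] m by simp
   then show "2 * \<eta> ^ m \<le> (3 * \<eta>) ^ m" using eta by (simp add: power_mult_distrib mult_right_mono)
  qed
  finally show ?thesis .
 qed
 show ?thesis using pq key[of p 6] key[of q 3] unfolding pair_le_def by simp
qed

subsection \<open>From almost all flow parameters to a power series\<close>

lemma AE_lborel_rescale:
 fixes P :: "real^3 \<Rightarrow> bool"
 assumes P: "AE y in lborel. P y" and r: "r > 0"
 shows "AE y in lborel. P ((y - a) /\<^sub>R r)"
proof -
 obtain A where A: "A \<in> null_sets lborel" "{y. \<not> P y} \<subseteq> A"
  using P by (auto elim!: AE_E simp: null_sets_def)
 then have [measurable]: "A \<in> sets borel" by auto
 have "(\<integral>\<^sup>+y. indicator A ((y - a) /\<^sub>R r) \<partial>lborel) = ennreal (r ^ 3) * (\<integral>\<^sup>+y. indicator A y \<partial>lborel)"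
  using nn_integral_lborel_affine[of "\<lambda>y. indicator A ((y - a) /\<^sub>R r)" r a] r by simp
 also have "\<dots> = 0" using A by auto
 finally have "AE y in lborel. indicator A ((y - a) /\<^sub>R r) = (0::ennreal)"
  by (subst (asm) nn_integral_0_iff_AE) auto
 then show ?thesis by eventually_elim (use A in \<open>auto simp: indicator_def split: if_splits\<close>)
qed

lemma AE_ball_witness:
 fixes c :: "real^3"
 assumes "AE x in lborel. P x" "d > 0"
 obtains x where "x \<in> ball c d" "P x"
proof (rule ccontr)
 assume "\<not> thesis"
 then have "AE x in lborel. x \<notin> ball c d" using assms(1) that by (auto elim!: eventually_mono)
 then have "emeasure lborel (ball c d) = 0" by (subst (asm) AE_iff_measurable[where N="ball c d"]) auto
 then have "negligible (ball c d)" by (simp add: negligible_iff_null_sets null_sets_def)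
 then show False using open_not_negligible[of "ball c d"] assms(2) by simp
qed

text \<open>Joint measurability in the parameter and the point, as a limit of Taylor polynomials;
  the exchange of exceptional sets in \<open>AE_flow_commute\<close> depends on it. The value 0 off
  the open unit ball makes the limit exist everywhere.\<close>

lemma msub_measurable:
 fixes L :: "real^3 \<Rightarrow> mps"
 assumes [measurable]: "L \<in> borel_fun"
 shows "(\<lambda>p. if norm (fst p :: real^3) < 1 then msub (fst p) (L (snd p)) else 0) \<in> borel_measurable (borel \<Otimes>\<^sub>M borel)"
proof (rule borel_measurable_LIMSEQ_real)
 let ?F = "\<lambda>M (p :: (real^3) \<times> (real^3)). if norm (fst p) < 1 then \<Sum>\<alpha> | mi_order \<alpha> \<le> M. coef (L (snd p)) \<alpha> * mi_power (fst p) \<alpha> else 0"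
 show "(\<lambda>M. ?F M p) \<longlonglongrightarrow> (if norm (fst p) < 1 then msub (fst p) (L (snd p)) else 0)" for p
 proof (cases "norm (fst p) < 1")
  case True
  have "(\<lambda>M. (\<Sum>\<alpha> | mi_order \<alpha> \<le> M. coef (L (snd p)) \<alpha> * mi_power (fst p) \<alpha>)) \<longlonglongrightarrow> msub (fst p) (L (snd p))"
  proof (rule LIM_zero_cancel, rule Lim_null_comparison)
   show "\<forall>\<^sub>F M in sequentially. norm ((\<Sum>\<alpha> | mi_order \<alpha> \<le> M. coef (L (snd p)) \<alpha> * mi_power (fst p) \<alpha>) - msub (fst p) (L (snd p))) \<le> norm (L (snd p)) * norm (fst p) ^ Suc M"
    using msub_taylor[of "fst p" "L (snd p)"] True by (intro always_eventually allI) (simp add: abs_minus_commute)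
   show "(\<lambda>M. norm (L (snd p)) * norm (fst p) ^ Suc M) \<longlonglongrightarrow> 0"
    using True by (intro tendsto_mult_right_zero LIMSEQ_Suc LIMSEQ_power_zero) simp
  qed
  then show ?thesis using True by simp
 qed simp
 have [measurable]: "(\<lambda>x. coef (L x) \<alpha>) \<in> borel_fun" for \<alpha>
  by (rule measurable_compose[OF assms borel_measurable_continuous_onI[OF linear_continuous_on[OF bounded_linear_coef]]])
 have [measurable]: "(\<lambda>x. mi_power x \<alpha>) \<in> borel_fun" for \<alpha>
  unfolding mi_power_def by measurable
 show "?F M \<in> borel_measurable (borel \<Otimes>\<^sub>M borel)" for M
  by measurable
qed

text \<open>For fixed \<open>x\<close> the moved point runs through the ball of radius
  \<open>r\<close> around \<open>x\<close> as \<open>\<tau>\<close> runs through the unit ball, so a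
  series in \<open>\<tau>\<close> is a series of \<open>f\<close> around \<open>x\<close>. As
  \<open>x\<close> is merely some good point near \<open>c\<close>, the series is recentred at
  \<open>c\<close> at the cost of half the radius.\<close>

lemma has_mps_of_flow:
 fixes f :: "real^3 \<Rightarrow> real"
 assumes ae: "AE \<tau> in lborel. norm \<tau> < 1 \<longrightarrow> msub \<tau> d = f (tent_flow c R (\<rho> *\<^sub>R \<tau>) x)"
  and r: "r = tent c R x * \<rho>" "r > 0" and x: "dist x c \<le> r / 2"
 shows "\<exists>d. AE y in lborel. norm (y - c) < r / 2 \<longrightarrow> f y = msub ((y - c) /\<^sub>R (r / 2)) d"
proof -
 define F where "F y = msub ((y - x) /\<^sub>R r) d" for y
 have "has_mps F x r d" using r by (simp add: has_mps_def F_def)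
 from has_mps_shift[OF this, of "c - x"] obtain e where e: "has_mps F c (r / 2) e"
  using x by (auto simp: dist_norm norm_minus_commute)
 have "AE y in lborel. norm ((y - x) /\<^sub>R r) < 1 \<longrightarrow> msub ((y - x) /\<^sub>R r) d = f (tent_flow c R (\<rho> *\<^sub>R ((y - x) /\<^sub>R r)) x)"
  by (rule AE_lborel_rescale[OF ae r(2)])
 then have "AE y in lborel. norm (y - c) < r / 2 \<longrightarrow> f y = msub ((y - c) /\<^sub>R (r / 2)) e"
 proof eventually_elim
  case (elim y)
  show ?case
  proof
   assume y: "norm (y - c) < r / 2"
   have "norm (y - x) < r" using y x norm_triangle_ineq[of "y - c" "c - x"] by (simp add: dist_norm norm_minus_commute)
   then have "norm ((y - x) /\<^sub>R r) < 1" using r(2) by (simp add: divide_less_eq_1_pos divide_inverse[symmetric] mult.commute[of "inverse r"] del: scaleR_diff_right)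
   then have "F y = f (tent_flow c R (\<rho> *\<^sub>R ((y - x) /\<^sub>R r)) x)" using elim by (simp add: F_def)
   also have "tent_flow c R (\<rho> *\<^sub>R ((y - x) /\<^sub>R r)) x = x + (tent c R x * \<rho> / r) *\<^sub>R (y - x)"
    by (simp add: tent_flow_def divide_inverse mult_ac)
   also have "tent c R x * \<rho> / r = 1" unfolding r(1)[symmetric] using r(2) by simp
   finally have "f y = F (c + (y - c))" by simp
   then show "f y = msub ((y - c) /\<^sub>R (r / 2)) e" using y conjunct2[OF e[unfolded has_mps_def], rule_format, of "y - c"] by simp
  qed
 qed
 then show ?thesis by blast
qed

text \<open>Before the exchange the null set of points depends on \<open>\<tau>\<close>. Afterwards
  a single point has a series that is correct for almost every parameter.\<close>

lemma AE_flow_commute: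
 fixes f :: "real^3 \<Rightarrow> real"
 assumes [measurable]: "L \<in> borel_fun" "f \<in> borel_fun"
  and ae: "\<And>\<tau>. norm \<tau> < 1 \<Longrightarrow> AE x in lborel. msub \<tau> (L x) = f (tent_flow c R (\<rho> *\<^sub>R \<tau>) x)"
 shows "AE x in lborel. AE \<tau> in lborel. norm \<tau> < 1 \<longrightarrow> msub \<tau> (L x) = f (tent_flow c R (\<rho> *\<^sub>R \<tau>) x)"
proof -
 note [measurable] = msub_measurable[of L]
 let ?P = "\<lambda>\<tau> x. norm \<tau> < 1 \<longrightarrow> (if norm \<tau> < 1 then msub \<tau> (L x) else 0) = f (x + tent c R x *\<^sub>R (\<rho> *\<^sub>R \<tau>))"
 have "(AE \<tau> in lborel. AE x in lborel. ?P \<tau> x) = (AE x in lborel. AE \<tau> in lborel. ?P \<tau> x)"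
 proof (rule lborel_pair.AE_commute)
  have "{p \<in> space (borel \<Otimes>\<^sub>M borel). ?P (fst p) (snd p)} \<in> sets ((borel :: (real^3) measure) \<Otimes>\<^sub>M (borel :: (real^3) measure))"
   by measurable
  then show "{p \<in> space (lborel \<Otimes>\<^sub>M lborel). ?P (fst p) (snd p)} \<in> sets ((lborel :: (real^3) measure) \<Otimes>\<^sub>M (lborel :: (real^3) measure))"
   by (simp add: space_pair_measure)
 qed
 moreover have "AE \<tau> in lborel. AE x in lborel. ?P \<tau> x"
 proof (rule AE_I2)
  fix \<tau> :: "real^3"
  show "AE x in lborel. ?P \<tau> x"
  proof (cases "norm \<tau> < 1")
   case True
   show ?thesis using ae[OF True] by eventually_elim (simp add: tent_flow_def)
  qed simp
 qed
 ultimately show ?thesis by (simp add: tent_flow_def cong: imp_cong)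
qed

subsection \<open>Local power series for solutions of the cubic system\<close>

lemma algebra_hom_scaleR_one:
 "algebra_hom (\<lambda>r::real. r *\<^sub>R (1::'a::{comm_ring_1,real_normed_algebra_1,banach,second_countable_topology}))"
 by (rule algebra_hom.intro) (auto intro: bounded_linear_scaleR_left)

lemma algebra_hom_msub:
 assumes "norm (\<tau>::real^3) \<le> 1"
 shows "algebra_hom (msub \<tau> :: mps \<Rightarrow> real)"
proof -
 note t = component_le_one[OF assms]
 show ?thesis by (rule algebra_hom.intro) (use bounded_linear_msub[OF t] msub_times[OF t] norm_msub_le[OF t] in auto)
qed

locale cubic_system =
 fixes u :: "real^3 \<Rightarrow> real" and w :: "real^3 \<Rightarrow> real^'i::finite" and bm :: "3 \<Rightarrow> 'i \<Rightarrow> 'i \<Rightarrow> real" and c0 M :: real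
 assumes u_meas [measurable]: "u \<in> borel_fun" and w_meas [measurable]: "w \<in> borel_fun"
  and c0: "c0 > 0" and M: "M > 0" and uw: "pair_le M (\<lambda>x. norm (u x)) (\<lambda>x. norm (w x))"
  and eq1: "AE x in lborel. u x = cubic.T1 (\<lambda>x y. c0 / dist x y) u w x"
  and eq2: "AE x in lborel. w x = cubic.T2 (\<lambda>k x y. (x $ k - y $ k) / dist x y ^ 3) bm u w x"
begin

text \<open>Evaluate the integral equations at the moved point and substitute the flow in the
  integral: the kernel between moved points times the Jacobian is \<open>fK0\<close> or
  \<open>fK\<close>.\<close>

lemma flow_fixed_point:
 assumes R: "R > 0" and t: "norm t \<le> 1/100"
 shows "AE x in lborel. u (tent_flow c R t x) = cubic.T1 (\<lambda>x y. c0 *\<^sub>R fK0 c R (\<lambda>j. t $ j) x y) (\<lambda>x. u (tent_flow c R t x)) (\<lambda>x. w (tent_flow c R t x)) x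
  \<and> w (tent_flow c R t x) = cubic.T2 (fK c R (\<lambda>j. t $ j)) bm (\<lambda>x. u (tent_flow c R t x)) (\<lambda>x. w (tent_flow c R t x)) x"
proof -
 let ?F = "tent_flow c R t"
 have tj: "norm (t $ j) \<le> 1/100" for j using component_le_norm_cart[of t j] t by simp
 have t4: "norm t \<le> 1/4" using t by simp
 interpret A: cubic "\<lambda>x y. c0 *\<^sub>R fK0 c R (\<lambda>j. t $ j) x y" "fK c R (\<lambda>j. t $ j)" bm "7 * max c0 1"
  using cubic_flow[OF R, of "\<lambda>j. t $ j" "1/100" c0 c] tj c0 by simp
 interpret S: cubic "\<lambda>x y. c0 / dist x y" "\<lambda>k x y. (x $ k - y $ k) / dist x y ^ 3" bm "7 * max c0 1"
  by (rule cubic_const[OF c0])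
 have 1: "A.T1 (\<lambda>x. u (?F x)) (\<lambda>x. w (?F x)) x = S.T1 u w (?F x)" for x
 proof -
  have "A.N1 x y (u (?F y)) (w (?F y)) = tent_jac c R t y *\<^sub>R S.N1 (?F x) (?F y) (u (?F y)) (w (?F y))" for y
   by (simp only: A.N1_def S.N1_def) (simp add: fK0_real[OF R t] cubic1_def)
  then show ?thesis
   unfolding A.T1_def S.T1_def by (simp only: integral_tent_flow[OF R t4 S.N_meas_snd(1)[OF u_meas w_meas]])
 qed
 have 2: "A.T2 (\<lambda>x. u (?F x)) (\<lambda>x. w (?F x)) x = S.T2 u w (?F x)" for x
 proof -
  have "A.N2 x y (u (?F y)) (w (?F y)) = tent_jac c R t y *\<^sub>R S.N2 (?F x) (?F y) (u (?F y)) (w (?F y))" for y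
   by (simp only: A.N2_def S.N2_def) (simp add: fK_real[OF R t] cubic2_def vec_eq_iff sum_distrib_left mult.assoc)
  then show ?thesis
   unfolding A.T2_def S.T2_def by (simp only: integral_tent_flow[OF R t4 S.N_meas_snd(2)[OF u_meas w_meas]])
 qed
 have "AE x in lborel. u x = S.T1 u w x \<and> w x = S.T2 u w x" using eq1 eq2 by eventually_elim simp
 from AE_tent_flow[OF R t4 this, of c] show ?thesis by (simp only: 1 2)
qed

text \<open>The solution, viewed as a family of constants, satisfies the system with unmoved kernels
  almost everywhere. Its residual in the moved system is therefore the operator of the difference
  kernels, of order \<open>\<rho>\<close>.\<close>

lemma first_iterate:
 fixes X :: "3 \<Rightarrow> 'a::{comm_ring_1,real_normed_algebra_1,banach,second_countable_topology}"
 assumes R: "R > 0" and X: "\<And>j. norm (X j) \<le> \<rho>" and rho: "0 < \<rho>" "\<rho> \<le> 1/100"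
 defines "U \<equiv> \<lambda>x. u x *\<^sub>R (1::'a)" and "V \<equiv> \<lambda>x. algebra_hom.hom_vec (\<lambda>r. r *\<^sub>R (1::'a)) (w x)"
 shows "pair_le (502 * \<rho> * max c0 1 * bm_const bm * (pair_const * M\<^sup>2 * M))
   (\<lambda>x. norm (cubic.T1 (\<lambda>x y. c0 *\<^sub>R fK0 c R X x y) U V x - U x)) (\<lambda>x. norm (cubic.T2 (fK c R X) bm U V x - V x))"
proof -
 interpret E: algebra_hom "\<lambda>r::real. r *\<^sub>R (1::'a)" by (rule algebra_hom_scaleR_one)
 note cf = cubic_flow[OF R, of X \<rho>, OF X rho(2) c0] cubic_flow_diff[OF R, of X \<rho>, OF X rho(2) c0 rho(1)]
 interpret A: cubic "\<lambda>x y. c0 *\<^sub>R fK0 c R X x y" "fK c R X" bm "7 * max c0 1" by (rule cf)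
 interpret F: cubic "\<lambda>x y. c0 *\<^sub>R fK0 c R X x y - (c0 / dist x y) *\<^sub>R 1"
  "\<lambda>k x y. fK c R X k x y - ((x $ k - y $ k) / dist x y ^ 3) *\<^sub>R 1" bm "502 * \<rho> * max c0 1" by (rule cf)
 interpret S: cubic "\<lambda>x y. (c0 / dist x y) *\<^sub>R (1::'a)" "\<lambda>k x y. ((x $ k - y $ k) / dist x y ^ 3) *\<^sub>R (1::'a)" bm "7 * max c0 1"
  by (rule E.cubic_hom[OF cubic_const[OF c0]])
 have UVm [measurable]: "U \<in> borel_fun" "V \<in> borel_fun" unfolding U_def V_def by measurable
 have UV: "pair_le M (\<lambda>x. norm (U x)) (\<lambda>x. norm (V x))"
  by (rule pair_le_mono[OF uw]) (use M E.norm_hom_vec in \<open>auto simp: U_def V_def\<close>)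
 have diff: "A.N1 x y a b - S.N1 x y a b = F.N1 x y a b" "A.N2 x y a b - S.N2 x y a b = F.N2 x y a b" for x y a and b :: "'a^'i"
  by (simp_all add: A.N1_def S.N1_def F.N1_def cubic1_def left_diff_distrib scaleR_diff_right
    A.N2_def S.N2_def F.N2_def cubic2_def vec_eq_iff flip: sum_subtractf)
 have b: "pair_le (502 * \<rho> * max c0 1 * bm_const bm * (pair_const * M\<^sup>2 * M)) (\<lambda>x. norm (F.T1 U V x)) (\<lambda>x. norm (F.T2 U V x))"
  using F.T_bound[OF UV M] unfolding F.D_def by simp
 have b0: "0 \<le> 502 * \<rho> * max c0 1 * bm_const bm * (pair_const * M\<^sup>2 * M)"
  using rho M pair_const_pos bm_const_ge_1[of bm] by (intro mult_nonneg_nonneg) auto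
 have ae: "AE x in lborel. A.T1 U V x - U x = F.T1 U V x \<and> A.T2 U V x - V x = F.T2 U V x"
  using eq1 eq2 E.T_hom[OF cubic_const[OF c0] uw M u_meas w_meas, of bm] A.T_integrable[OF UV M UVm] S.T_integrable[OF UV M UVm]
 proof eventually_elim
  case (elim x)
  have "U x = S.T1 U V x" "V x = S.T2 U V x" using elim by (simp_all add: U_def V_def)
  then show ?case
   using elim by (simp add: A.T1_def S.T1_def F.T1_def A.T2_def S.T2_def F.T2_def flip: diff Bochner_Integration.integral_diff)
 qed
 show ?thesis
  by (rule pair_le_mono_AE[OF b b0 order_refl]) (use ae in \<open>auto elim: eventually_mono\<close>)
qed

text \<open>The Picard iterates in the power series algebra, evaluated at a parameter \<open>\<tau>\<close>, are the Picard iterates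
 of the real system moved by the flow with parameter \<open>\<rho> \<tau>\<close>; those converge to the moved solution.\<close>

lemma flow_series:
 obtains R \<rho> :: real and L :: "real^3 \<Rightarrow> mps" and L' :: "real^3 \<Rightarrow> mps^'i"
 where "R > 0" "\<rho> > 0" "L \<in> borel_fun" "L' \<in> borel_fun"
  "\<And>\<tau>. norm \<tau> < 1 \<Longrightarrow> AE x in lborel. msub \<tau> (L x) = u (tent_flow c R (\<rho> *\<^sub>R \<tau>) x)
    \<and> (\<forall>i. msub \<tau> (L' x $ i) = w (tent_flow c R (\<rho> *\<^sub>R \<tau>) x) $ i)"
proof -
 define C where "C = 7 * max c0 1"
 interpret S: cubic "\<lambda>x y. c0 / dist x y" "\<lambda>k x y. (x $ k - y $ k) / dist x y ^ 3" bm C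
  unfolding C_def by (rule cubic_const[OF c0])
 obtain \<epsilon> where e: "S.small \<epsilon>" using S.ex_small by blast
 have e0: "\<epsilon> > 0" using e by (simp add: S.small_def)
 obtain R where R: "R > 0" and uwR: "pair_le \<epsilon> (\<lambda>x. indicator (ball c R) x * norm (u x)) (\<lambda>x. indicator (ball c R) x * norm (w x))"
  using pair_le_small_ball[OF uw e0] by blast
 define k where "k = 502 * max c0 1 * bm_const bm * (pair_const * M\<^sup>2 * M)"
 have k: "k > 0" using c0 M pair_const_pos bm_const_ge_1[of bm] by (auto simp: k_def)
 \<comment> \<open>\<open>1/100\<close> is the range in which the kernel bounds hold.
   \<open>k\<close> is the constant of \<open>first_iterate\<close> without \<open>\<rho>\<close>,
   so \<open>\<epsilon> / k\<close> makes the first Picard step at most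
   \<open>\<epsilon>\<close>.\<close>
 define \<rho> where "\<rho> = min (1/100) (\<epsilon> / k)"
 have rho: "0 < \<rho>" "\<rho> \<le> 1/100" "\<rho> \<le> \<epsilon> / k"
  unfolding \<rho>_def by (use e0 k in simp) (rule min.cobounded1 min.cobounded2)+
 define X where "X j = \<rho> *\<^sub>R (mX j :: mps)" for j :: 3
 have X: "norm (X j) \<le> \<rho>" for j using rho(1) by (simp add: X_def)
 interpret A: cubic "\<lambda>x y. c0 *\<^sub>R fK0 c R X x y" "fK c R X" bm C
  unfolding C_def by (rule cubic_flow[OF R, of X \<rho>, OF X rho(2) c0])
 interpret E: algebra_hom "\<lambda>r::real. r *\<^sub>R (1::mps)" by (rule algebra_hom_scaleR_one)
 define U where "U x = u x *\<^sub>R (1::mps)" for x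
 define V where "V x = (E.hom_vec (w x) :: mps^'i)" for x
 have [measurable]: "U \<in> borel_fun" "V \<in> borel_fun"
  unfolding U_def[abs_def] V_def[abs_def] by measurable
 have V: "norm (V x) \<le> norm (w x)" for x unfolding V_def by (rule E.norm_hom_vec)
 have UV: "pair_le M (\<lambda>x. norm (U x)) (\<lambda>x. norm (V x))"
  by (rule pair_le_mono[OF uw]) (use M V in \<open>auto simp: U_def\<close>)
 have UVR: "pair_le \<epsilon> (A.on (ball c R) U) (A.on (ball c R) V)"
  by (rule pair_le_mono[OF uwR]) (use e0 V in \<open>auto simp: A.on_def U_def intro: mult_left_mono\<close>)
 have first: "pair_le \<epsilon> (A.on (ball c R) (\<lambda>x. A.T1 U V x - U x)) (A.on (ball c R) (\<lambda>x. A.T2 U V x - V x))"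
 proof (rule pair_le_mono[OF first_iterate[OF R, of X \<rho> c, OF X rho(1,2), folded U_def[abs_def] V_def[abs_def]]])
  show "502 * \<rho> * max c0 1 * bm_const bm * (pair_const * M\<^sup>2 * M) \<le> \<epsilon>"
   using rho(3) k by (simp add: pos_le_divide_eq k_def mult_ac)
  show "0 \<le> 502 * \<rho> * max c0 1 * bm_const bm * (pair_const * M\<^sup>2 * M)"
   using rho M pair_const_pos bm_const_ge_1[of bm] by (intro mult_nonneg_nonneg) auto
 qed (auto simp: A.on_def indicator_def U_def V_def)
 obtain W W' where W [measurable]: "\<And>n. W n \<in> borel_fun" "\<And>n. W' n \<in> borel_fun"
  and off: "\<And>n x. x \<notin> ball c R \<Longrightarrow> W n x = U x \<and> W' n x = V x"
  and step: "\<And>n x. x \<in> ball c R \<Longrightarrow> W (Suc n) x = A.T1 (W n) (W' n) x \<and> W' (Suc n) x = A.T2 (W n) (W' n) x"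
  and sW: "\<And>n. pair_le (3 * \<epsilon>) (A.on (ball c R) (W n)) (A.on (ball c R) (W' n))"
  and gW: "\<And>n. pair_le (M + 3 * \<epsilon>) (\<lambda>x. norm (W n x)) (\<lambda>x. norm (W' n x))"
  and conv: "AE x in lborel. convergent (\<lambda>n. W n x) \<and> convergent (\<lambda>n. W' n x)"
  by (rule A.picard_iterates[OF e ball_borel _ _ UV M UVR first]) auto
 have Me: "M + 3 * \<epsilon> > 0" using M e0 by simp
 define L where "L x = lim (\<lambda>n. W n x)" for x
 define L' where "L' x = lim (\<lambda>n. W' n x)" for x
 have L [measurable]: "L \<in> borel_fun" "L' \<in> borel_fun"
  unfolding L_def[abs_def] L'_def[abs_def] by (auto intro: borel_measurable_lim_metric)
 have "AE x in lborel. msub \<tau> (L x) = u (tent_flow c R (\<rho> *\<^sub>R \<tau>) x)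
    \<and> (\<forall>i. msub \<tau> (L' x $ i) = w (tent_flow c R (\<rho> *\<^sub>R \<tau>) x) $ i)" if tau: "norm \<tau> < 1" for \<tau> :: "real^3"
 proof -
  define t where "t = \<rho> *\<^sub>R \<tau>"
  have "\<rho> * norm \<tau> \<le> 1/100 * 1" using rho tau by (intro mult_mono) auto
  then have t: "norm t \<le> 1/100" "norm t \<le> 1/4" using rho(1) by (auto simp: t_def)
  let ?F = "tent_flow c R t"
  have tau1: "norm \<tau> \<le> 1" using tau by simp
  interpret H: algebra_hom "msub \<tau> :: mps \<Rightarrow> real" by (rule algebra_hom_msub[OF tau1])
  have ker: "(\<lambda>x y. msub \<tau> (c0 *\<^sub>R fK0 c R X x y)) = (\<lambda>x y. c0 *\<^sub>R fK0 c R (\<lambda>j. t $ j) x y)"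
   "(\<lambda>k x y. msub \<tau> (fK c R X k x y)) = fK c R (\<lambda>j. t $ j)"
   unfolding X_def t_def using msub_fK[OF R tau1 less_imp_le[OF rho(1)] rho(2)]
   by (simp_all add: fun_eq_iff msub_scaleR[OF component_le_one[OF tau1]])
  interpret B: cubic "\<lambda>x y. c0 *\<^sub>R fK0 c R (\<lambda>j. t $ j) x y" "fK c R (\<lambda>j. t $ j)" bm C
   using H.cubic_hom[OF A.cubic_axioms] unfolding ker .
  have u0: "msub \<tau> (U x) = u x" "H.hom_vec (V x) = w x" for x
   by (simp_all add: U_def V_def E.hom_vec_def H.hom_vec_def vec_eq_iff msub_scaleR[OF component_le_one[OF tau1]] msub_one[OF component_le_one[OF tau1]])
  \<comment> \<open>The common global bound \<open>3 * M + 3 * \<epsilon>\<close> covers the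
    evaluated iterates, of size \<open>M + 3 * \<epsilon>\<close>, and the moved solution, of size
    \<open>3 * M\<close>.\<close>
  have "AE x in lborel. (\<lambda>n. msub \<tau> (W n x)) \<longlonglongrightarrow> u (?F x) \<and> (\<lambda>n. H.hom_vec (W' n x)) \<longlonglongrightarrow> w (?F x)"
  proof (rule B.iterates_tendsto_fixed_point[OF e ball_borel, where M = "3 * M + 3 * \<epsilon>"])
   fix n
   show "pair_le (3 * \<epsilon>) (B.on (ball c R) (\<lambda>x. msub \<tau> (W n x))) (B.on (ball c R) (\<lambda>x. H.hom_vec (W' n x)))"
    by (rule pair_le_mono[OF sW[of n]]) (use e0 H.hom_norm H.norm_hom_vec in \<open>auto simp: B.on_def A.on_def intro: mult_left_mono\<close>)
   show "pair_le (3 * M + 3 * \<epsilon>) (\<lambda>x. norm (msub \<tau> (W n x))) (\<lambda>x. norm (H.hom_vec (W' n x)))"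
    by (rule pair_le_mono[OF gW[of n]]) (use e0 M H.hom_norm H.norm_hom_vec in auto)
   show "AE x in lborel. x \<in> ball c R \<longrightarrow> msub \<tau> (W (Suc n) x) = B.T1 (\<lambda>x. msub \<tau> (W n x)) (\<lambda>x. H.hom_vec (W' n x)) x
     \<and> H.hom_vec (W' (Suc n) x) = B.T2 (\<lambda>x. msub \<tau> (W n x)) (\<lambda>x. H.hom_vec (W' n x)) x"
    using H.T_hom[OF A.cubic_axioms gW[of n] Me W(1)[of n] W(2)[of n], of bm] unfolding ker by eventually_elim (simp add: step)
  next
   fix n x assume "x \<notin> ball c R"
   then show "msub \<tau> (W n x) = u (?F x) \<and> H.hom_vec (W' n x) = w (?F x)"
    using off[of x n] by (simp add: u0 tent_flow_off[OF R t(2)])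
  next
   have eq: "(\<lambda>x. indicator (ball c R) (?F x) * norm (u (?F x))) = B.on (ball c R) (\<lambda>x. u (?F x))"
    "(\<lambda>x. indicator (ball c R) (?F x) * norm (w (?F x))) = B.on (ball c R) (\<lambda>x. w (?F x))"
    unfolding B.on_def indicator_def tent_flow_ball_iff[OF R t(2)] by (rule refl)+
   show "pair_le (3 * \<epsilon>) (B.on (ball c R) (\<lambda>x. u (?F x))) (B.on (ball c R) (\<lambda>x. w (?F x)))"
    using pair_le_tent_flow[OF R t(2) uwR, of c] e0 unfolding eq by simp
   show "pair_le (3 * M + 3 * \<epsilon>) (\<lambda>x. norm (u (?F x))) (\<lambda>x. norm (w (?F x)))"
    by (rule pair_le_mono[OF pair_le_tent_flow[OF R t(2) uw, of c]]) (use M e0 in auto)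
   show "AE x in lborel. x \<in> ball c R \<longrightarrow> u (?F x) = B.T1 (\<lambda>x. u (?F x)) (\<lambda>x. w (?F x)) x
     \<and> w (?F x) = B.T2 (\<lambda>x. u (?F x)) (\<lambda>x. w (?F x)) x"
    using flow_fixed_point[OF R t(1), of c] by eventually_elim simp
  qed (use M e0 in auto)
  then show ?thesis
   using conv
  proof eventually_elim
   case (elim x)
   have lim: "(\<lambda>n. W n x) \<longlonglongrightarrow> L x" "(\<lambda>n. W' n x) \<longlonglongrightarrow> L' x"
    using elim by (auto simp: L_def L'_def convergent_LIMSEQ_iff)
   have "(\<lambda>n. msub \<tau> (W n x)) \<longlonglongrightarrow> msub \<tau> (L x)" by (rule bounded_linear.tendsto[OF H.hom_linear lim(1)])
   moreover have "(\<lambda>n. H.hom_vec (W' n x)) \<longlonglongrightarrow> H.hom_vec (L' x)" by (rule bounded_linear.tendsto[OF H.hom_vec_linear lim(2)])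
   ultimately have "msub \<tau> (L x) = u (?F x)" "H.hom_vec (L' x) = w (?F x)"
    using elim by (auto intro: LIMSEQ_unique)
   then show ?case by (simp add: t_def H.hom_vec_def vec_eq_iff)
  qed
 qed
 then show thesis using that[OF R rho(1) L] by blast
qed

theorem local_series:
 obtains r where "r > 0" "\<exists>d. AE y in lborel. norm (y - c) < r \<longrightarrow> u y = msub ((y - c) /\<^sub>R r) d"
  "\<And>i. \<exists>d. AE y in lborel. norm (y - c) < r \<longrightarrow> w y $ i = msub ((y - c) /\<^sub>R r) d"
proof -
 obtain R \<rho> :: real and L :: "real^3 \<Rightarrow> mps" and L' :: "real^3 \<Rightarrow> mps^'i"
  where R: "R > 0" "\<rho> > 0" and [measurable]: "L \<in> borel_fun" "L' \<in> borel_fun"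
  and ser: "\<And>\<tau>. norm \<tau> < 1 \<Longrightarrow> AE x in lborel. msub \<tau> (L x) = u (tent_flow c R (\<rho> *\<^sub>R \<tau>) x)
    \<and> (\<forall>i. msub \<tau> (L' x $ i) = w (tent_flow c R (\<rho> *\<^sub>R \<tau>) x) $ i)"
  by (rule flow_series[of c]) (rule that)
 have "AE x in lborel. AE \<tau> in lborel. norm \<tau> < 1 \<longrightarrow> msub \<tau> (L x) = u (tent_flow c R (\<rho> *\<^sub>R \<tau>) x)"
  by (rule AE_flow_commute) (use ser in \<open>auto elim: eventually_mono\<close>)
 moreover have "AE x in lborel. msub \<tau> (L' x $ i) = w (tent_flow c R (\<rho> *\<^sub>R \<tau>) x) $ i" if "norm \<tau> < 1" for \<tau> i
  using ser[OF that] by eventually_elim simp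
 then have "AE x in lborel. \<forall>i. AE \<tau> in lborel. norm \<tau> < 1 \<longrightarrow> msub \<tau> (L' x $ i) = w (tent_flow c R (\<rho> *\<^sub>R \<tau>) x) $ i"
  unfolding AE_all_countable
  by (intro allI AE_flow_commute) auto
 ultimately have ae: "AE x in lborel. (AE \<tau> in lborel. norm \<tau> < 1 \<longrightarrow> msub \<tau> (L x) = u (tent_flow c R (\<rho> *\<^sub>R \<tau>) x))
   \<and> (\<forall>i. AE \<tau> in lborel. norm \<tau> < 1 \<longrightarrow> msub \<tau> (L' x $ i) = w (tent_flow c R (\<rho> *\<^sub>R \<tau>) x) $ i)"
  by (rule eventually_elim2) blast
 \<comment> \<open>Within \<open>R / 2\<close> of \<open>c\<close> the tent is at least
   \<open>R / 2\<close>, so the radius \<open>r\<close> around the point to be chosen is at least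
   \<open>R * \<rho> / 2\<close>; the second bound then puts that point within \<open>r / 2\<close>
   of \<open>c\<close>.\<close>
 define \<delta> where "\<delta> = min (R / 2) (R * \<rho> / 4)"
 have d: "\<delta> > 0" "\<delta> \<le> R / 2" "\<delta> \<le> R * \<rho> / 4" using R by (auto simp: \<delta>_def)
 obtain x where x: "x \<in> ball c \<delta>" and
  x1: "AE \<tau> in lborel. norm \<tau> < 1 \<longrightarrow> msub \<tau> (L x) = u (tent_flow c R (\<rho> *\<^sub>R \<tau>) x)" and
  x2: "\<And>i. AE \<tau> in lborel. norm \<tau> < 1 \<longrightarrow> msub \<tau> (L' x $ i) = w (tent_flow c R (\<rho> *\<^sub>R \<tau>) x) $ i"
  using AE_ball_witness[OF ae d(1), of c] by blast
 define r where "r = tent c R x * \<rho>"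
 have nx: "norm (x - c) \<le> R / 2" using x d by (simp add: dist_norm norm_minus_commute)
 have "R / 2 \<le> tent c R x"
 proof -
  have "(norm (x - c))\<^sup>2 \<le> (R / 2)\<^sup>2" by (rule power_mono[OF nx]) simp
  then have "(norm (x - c))\<^sup>2 \<le> R * R / 4" by (simp only: power_divide power2_eq_square[of R]) simp
  moreover have "0 \<le> R * R" by simp
  moreover have "R / 2 * R = R * R / 2" by simp
  ultimately have "R / 2 * R \<le> R\<^sup>2 - (norm (x - c))\<^sup>2" unfolding power2_eq_square[of R] by linarith
  then have "R / 2 \<le> (R\<^sup>2 - (norm (x - c))\<^sup>2) / R" using R(1) by (simp only: pos_le_divide_eq)
  then show ?thesis unfolding tent_def by (rule max.coboundedI2)
 qed
 then have "R / 2 * \<rho> \<le> r" unfolding r_def using R(2) by (intro mult_right_mono) auto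
 then have r: "r > 0" "\<delta> \<le> r / 2" using d R mult_pos_pos[OF R] by auto
 then have xr: "dist x c \<le> r / 2" using x by (simp add: dist_commute)
 show thesis
  by (rule that[of "r / 2"])
    (use r has_mps_of_flow[OF x1 r_def r(1) xr] has_mps_of_flow[OF x2 r_def r(1) xr] in auto)
qed

end

subsection \<open>Gluing local power series\<close>

lemma isCont_AE_eq:
 fixes F G :: "real^3 \<Rightarrow> 'b::real_normed_vector"
 assumes "isCont F y" "isCont G y" and e: "e > 0" and ae: "AE x in lborel. dist x y < e \<longrightarrow> F x = G x"
 shows "F y = G y"
proof (rule ccontr)
 assume "F y \<noteq> G y"
 moreover have "isCont (\<lambda>x. F x - G x) y" using assms by (intro continuous_intros)
 ultimately have "\<exists>d>0. \<forall>x. dist x y < d \<longrightarrow> F x - G x \<noteq> 0"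
  using continuous_at_avoid[of y "\<lambda>x. F x - G x" 0] by (auto simp: dist_commute)
 then obtain d where d: "d > 0" "\<And>x. dist x y < d \<Longrightarrow> F x - G x \<noteq> 0" by blast
 obtain x where "x \<in> ball y (min d e)" "dist x y < e \<longrightarrow> F x = G x"
  using AE_ball_witness[OF ae, of "min d e" y] d(1) e by auto
 then show False using d(2)[of x] by (auto simp: dist_commute)
qed

lemma glue_local_series:
 fixes f :: "real^3 \<Rightarrow> real"
 assumes loc: "\<And>c. \<exists>r>0. \<exists>d. AE y in lborel. norm (y - c) < r \<longrightarrow> f y = msub ((y - c) /\<^sub>R r) d"
 obtains g where "\<And>x. analytic_pt g x" "AE x in lborel. f x = g x"
proof -
 obtain r d where r: "\<And>c. r c > 0" and d: "\<And>c. AE y in lborel. norm (y - c) < r c \<longrightarrow> f y = msub ((y - c) /\<^sub>R r c) (d c)"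
 proof -
  have "\<forall>c. \<exists>p. fst p > 0 \<and> (AE y in lborel. norm (y - c) < fst p \<longrightarrow> f y = msub ((y - c) /\<^sub>R fst p) (snd p))"
  proof
   fix c
   obtain r d where "r > 0" "AE y in lborel. norm (y - c) < r \<longrightarrow> f y = msub ((y - c) /\<^sub>R r) d"
    using loc[of c] by blast
   then show "\<exists>p. fst p > 0 \<and> (AE y in lborel. norm (y - c) < fst p \<longrightarrow> f y = msub ((y - c) /\<^sub>R fst p) (snd p))"
    by (intro exI[of _ "(r, d)"]) simp
  qed
  from choice[OF this] obtain p where "\<forall>c. fst (p c) > 0 \<and> (AE y in lborel. norm (y - c) < fst (p c) \<longrightarrow> f y = msub ((y - c) /\<^sub>R fst (p c)) (snd (p c)))" ..
  then show thesis by (intro that[of "\<lambda>c. fst (p c)" "\<lambda>c. snd (p c)"]) blast+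
 qed
 define F where "F c y = msub ((y - c) /\<^sub>R r c) (d c)" for c y
 have mps: "has_mps (F c) c (r c) (d c)" for c using r by (simp add: has_mps_def F_def)
 have cont: "isCont (F c) y" if y: "norm (y - c) \<le> r c / 2" for c y
 proof -
  have "analytic_pt (F c) (c + (y - c))" unfolding analytic_pt_def using has_mps_shift[OF mps y] by blast
  then have "F c differentiable (at y)" by (intro analytic_pt_differentiable) simp
  then show ?thesis by (rule differentiable_imp_continuous_within)
 qed
 \<comment> \<open>Each point takes the value of the series centred at it. Overlapping series agree
   near a common point because both are continuous there and equal to \<open>f\<close> almost
   everywhere.\<close>
 define g where "g y = F y y" for y
 have gF: "g y = F c y" if y: "norm (y - c) < r c / 2" for c y
  unfolding g_def
 proof (rule isCont_AE_eq[where F = "F y" and G = "F c"])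
  show "isCont (F y) y" "isCont (F c) y" using cont[of y y] cont[of y c] y r[of y] by auto
  show "min (r y) (r c / 2) > 0" using r by simp
  show "AE x in lborel. dist x y < min (r y) (r c / 2) \<longrightarrow> F y x = F c x"
   using d[of y] d[of c]
  proof eventually_elim
   case (elim x)
   show ?case
   proof
    assume x: "dist x y < min (r y) (r c / 2)"
    then have "norm (x - c) < r c" using y norm_triangle_ineq[of "x - y" "y - c"] by (simp add: dist_norm)
    then show "F y x = F c x" using elim x by (simp add: F_def dist_norm)
   qed
  qed
 qed
 have "analytic_pt g c" for c
 proof -
  \<comment> \<open>Recentring by 0 halves the radius. Doing so twice leads to
    \<open>r c / 4\<close>, well inside the range \<open>r c / 2\<close> in which \<open>g\<close>
    equals \<open>F c\<close>.\<close>
  obtain e where e: "has_mps (F c) (c + 0) (r c / 2) e" using has_mps_shift[OF mps[of c], of 0] r[of c] by auto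
  obtain e' where e': "has_mps (F c) (c + 0) (r c / 4) e'" using has_mps_shift[OF e, of 0] r[of c] by auto
  have "has_mps g c (r c / 4) e'"
   unfolding has_mps_def
  proof (intro conjI allI impI)
   fix h :: "real^3" assume h: "norm h \<le> r c / 4"
   have "g (c + h) = F c (c + h)" using h r[of c] by (intro gF) simp
   then show "g (c + h) = msub (h /\<^sub>R (r c / 4)) e'" using e' h by (simp only: has_mps_def) simp
  qed (use r in simp)
  then show ?thesis by (auto simp: analytic_pt_def)
 qed
 moreover have "AE x in lborel. f x = g x"
 proof -
  \<comment> \<open>There is one exceptional null set for each centre; a countable subcover keeps
    their union null.\<close>
  obtain \<F> where \<F>: "\<F> \<subseteq> (\<lambda>c. ball c (r c / 2)) ` UNIV" "countable \<F>" "\<Union>\<F> = (\<Union>c. ball c (r c / 2))"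
   using Lindelof[of "range (\<lambda>c. ball c (r c / 2))"] by (metis (mono_tags, lifting) imageE open_ball)
  then obtain I where I: "countable I" "\<F> = (\<lambda>c. ball c (r c / 2)) ` I"
   using countable_subset_image[of \<F> "\<lambda>c. ball c (r c / 2)" UNIV] by auto
  have cover: "\<exists>c\<in>I. norm (x - c) < r c / 2" for x
  proof -
   have "x \<in> \<Union>\<F>" unfolding \<F>(3) using r[of x] by (intro UN_I[of x]) auto
   then show ?thesis unfolding I(2) by (auto simp: dist_norm norm_minus_commute)
  qed
  have "AE x in lborel. \<forall>c\<in>I. norm (x - c) < r c / 2 \<longrightarrow> f x = g x"
  proof (rule AE_ball_countable'[OF _ I(1)])
   fix c
   show "AE x in lborel. norm (x - c) < r c / 2 \<longrightarrow> f x = g x"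
    using d[of c]
   proof eventually_elim
    case (elim x)
    then show ?case using gF[of x c] r[of c] by (auto simp: F_def)
   qed
  qed
  then show ?thesis by eventually_elim (use cover in blast)
 qed
 ultimately show thesis by (rule that)
qed

lemma C_k_sum_scaleR:
 fixes f :: "'i \<Rightarrow> real^3 \<Rightarrow> real" and e :: "'i \<Rightarrow> 'b::real_normed_vector"
 assumes "\<And>i. i \<in> I \<Longrightarrow> C_k k (f i)"
 shows "C_k k (\<lambda>x. \<Sum>i\<in>I. f i x *\<^sub>R e i)"
 using assms
proof (induction k arbitrary: f)
 case 0
 then show ?case by (auto intro!: continuous_intros)
next
 case (Suc k)
 have D: "((\<lambda>x. \<Sum>i\<in>I. f i x *\<^sub>R e i) has_derivative (\<lambda>h. \<Sum>i\<in>I. frechet_derivative (f i) (at x) h *\<^sub>R e i)) (at x)" for x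
  using Suc.prems by (intro has_derivative_sum has_derivative_scaleR_left) (simp flip: frechet_derivative_works)
 have "partial_deriv j (\<lambda>x. \<Sum>i\<in>I. f i x *\<^sub>R e i) = (\<lambda>x. \<Sum>i\<in>I. partial_deriv j (f i) x *\<^sub>R e i)" for j
  unfolding partial_deriv_def[abs_def] frechet_derivative_at[OF D, symmetric] ..
 moreover have "(\<lambda>x. \<Sum>i\<in>I. f i x *\<^sub>R e i) differentiable (at x)" for x
  unfolding differentiable_def using D by blast
 ultimately show ?case using Suc.prems by (simp add: Suc.IH)
qed

subsection \<open>The integral equations in real coordinates\<close>

definition realc :: "complex^4 \<Rightarrow> real^(4 \<times> bool)"
 where "realc v = (\<chi> p. if snd p then Im (v $ fst p) else Re (v $ fst p))"

definition unreal :: "real^(4 \<times> bool) \<Rightarrow> complex^4"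
 where "unreal b = (\<chi> r. Complex (b $ (r, False)) (b $ (r, True)))"

lemma unreal_realc [simp]: "unreal (realc v) = v" and realc_unreal [simp]: "realc (unreal b) = b"
 by (simp_all add: unreal_def realc_def vec_eq_iff split: if_splits)

lemma sum_realc_squares: "(\<Sum>i\<in>UNIV. realc v $ i * realc v $ i) = (norm v)\<^sup>2"
proof -
 have "(\<Sum>i\<in>UNIV. realc v $ i * realc v $ i) = (\<Sum>r\<in>UNIV. \<Sum>b\<in>UNIV. realc v $ (r, b) * realc v $ (r, b))"
  unfolding sum.cartesian_product UNIV_Times_UNIV by (simp add: case_prod_beta')
 also have "\<dots> = (\<Sum>r\<in>UNIV. (norm (v $ r))\<^sup>2)"
  by (simp add: realc_def UNIV_bool cmod_power2 add.commute flip: power2_eq_square)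
 finally show ?thesis by (simp add: norm_vec_def L2_set_def sum_nonneg)
qed

lemma norm_realc [simp]: "norm (realc v) = norm v"
proof -
 have "(norm (realc v))\<^sup>2 = (norm v)\<^sup>2"
  unfolding sum_realc_squares[symmetric] power2_norm_eq_inner inner_vec_def by simp
 then show ?thesis by (simp add: power2_eq_iff_nonneg)
qed

lemma realc_linear: "bounded_linear realc"
 by (rule bounded_linear_intro[of _ 1]) (auto simp: realc_def vec_eq_iff simp flip: norm_realc)

lemma unreal_linear: "bounded_linear unreal"
proof (rule bounded_linear_intro[of _ 1])
 show "norm (unreal b) \<le> norm b * 1" for b using norm_realc[of "unreal b"] by simp
qed (auto simp: unreal_def vec_eq_iff complex_eq_iff)

text \<open>Matrix of a real-linear map in these coordinates, used to express multiplication by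
  \<open>\<i>\<close> times a Dirac matrix through the real entries \<open>bm\<close>.\<close>

lemma realc_of_linear:
 assumes "bounded_linear g"
 shows "realc (g v) $ i = (\<Sum>j\<in>UNIV. realc (g (unreal (axis j 1))) $ i * realc v $ j)"
proof -
 have l: "linear (\<lambda>b. realc (g (unreal b)))"
  by (rule bounded_linear.linear[OF bounded_linear_compose[OF realc_linear bounded_linear_compose[OF assms unreal_linear]]])
 have "realc v = (\<Sum>j\<in>UNIV. (realc v $ j) *\<^sub>R axis j 1)"
  using basis_expansion[of "realc v"] by (simp only: scalar_mult_eq_scaleR)
 then have "realc (g (unreal (realc v))) = realc (g (unreal (\<Sum>j\<in>UNIV. (realc v $ j) *\<^sub>R axis j 1)))"
  by (rule arg_cong)
 also have "\<dots> = (\<Sum>j\<in>UNIV. (realc v $ j) *\<^sub>R realc (g (unreal (axis j 1))))"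
  by (simp only: linear_sum[OF l] linear_scale[OF l])
 finally show ?thesis by (simp add: mult.commute)
qed

lemma bounded_linear_dirac_term: "bounded_linear (\<lambda>v. \<i> *s (A *v v) :: complex^4)"
 by (rule bounded_linear_compose[OF bounded_linear_smult bounded_linear_mat_mul])

lemma dirac_part_sum: "dirac_part \<alpha> z v = (\<Sum>k\<in>UNIV. (z $ k) *\<^sub>R (\<i> *s (\<alpha> k *v v)))"
proof -
 have "\<i> *s (\<alpha> k *v ((z $ k) *\<^sub>R v)) = (z $ k) *\<^sub>R (\<i> *s (\<alpha> k *v v))" for k
  using linear_scale[OF bounded_linear.linear[OF bounded_linear_dirac_term[of "\<alpha> k"]]] by simp
 then show ?thesis
  by (simp only: dirac_part_def linear_sum[OF bounded_linear.linear[OF bounded_linear_smult]])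
qed

context integral_solution
begin

text \<open>The real matrix of \<open>\<i> *s (\<alpha> k *v v)\<close>, divided by
  \<open>kappa\<close>. Absorbing this factor leaves the plain kernel
  \<open>z $ k / norm z ^ 3\<close>.\<close>

definition real_coeff :: "3 \<Rightarrow> 4 \<times> bool \<Rightarrow> 4 \<times> bool \<Rightarrow> real"
 where "real_coeff k i j = (1 / kappa) * realc (\<i> *s (\<alpha> k *v unreal (axis j 1))) $ i"

lemma cubic1_real: "cubic1 (1 / (6 * kappa) / d) (u y) (realc (\<psi> y)) = 1 / (6 * kappa) * (rhs1 y / d)"
 by (simp add: cubic1_def sum_realc_squares rhs1_def)

lemma cubic2_real:
 "cubic2 real_coeff (\<lambda>k. z $ k / d) (u y) (realc (\<psi> y)) = realc ((1 / kappa) *\<^sub>R (1 / d) *\<^sub>R dirac_part \<alpha> z (rhs2 y))"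
proof -
 have "realc ((1 / kappa) *\<^sub>R (1 / d) *\<^sub>R dirac_part \<alpha> z (rhs2 y)) $ i
   = (\<Sum>k\<in>UNIV. (1 / kappa) * ((1 / d) * (z $ k * realc (\<i> *s (\<alpha> k *v rhs2 y)) $ i)))" for i
  unfolding dirac_part_sum linear_sum[OF bounded_linear.linear[OF realc_linear]] linear_scale[OF bounded_linear.linear[OF realc_linear]]
  by (simp add: sum_distrib_left)
 moreover have "realc (\<i> *s (\<alpha> k *v rhs2 y)) $ i
   = (\<Sum>j\<in>UNIV. realc (\<i> *s (\<alpha> k *v unreal (axis j 1))) $ i * ((u y * u y) * realc (\<psi> y) $ j))" for k i
  by (subst realc_of_linear[OF bounded_linear_dirac_term])
    (simp add: rhs2_def linear_scale[OF bounded_linear.linear[OF realc_linear]] power2_eq_square)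
 ultimately show ?thesis
  by (simp add: vec_eq_iff cubic2_def real_coeff_def sum_distrib_left mult_ac)
qed

lemma cubic_system: "\<exists>M. cubic_system u (\<lambda>x. realc (\<psi> x)) real_coeff (1 / (6 * kappa)) M"
proof -
 define a b where "a = enn2real (\<integral>\<^sup>+x. ennreal (\<bar>u x\<bar> ^ 6) \<partial>lborel)" and "b = enn2real (\<integral>\<^sup>+x. ennreal (norm (\<psi> x) ^ 3) \<partial>lborel)"
 have ab: "(\<integral>\<^sup>+x. ennreal (\<bar>u x\<bar> ^ 6) \<partial>lborel) = ennreal a" "(\<integral>\<^sup>+x. ennreal (norm (\<psi> x) ^ 3) \<partial>lborel) = ennreal b" "a \<ge> 0" "b \<ge> 0"
  using u_int psi_int by (simp_all add: a_def b_def less_top)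
 \<comment> \<open>Because \<open>M \<ge> 1\<close>, one has \<open>a \<le> M \<le> M ^ 6\<close>
   and \<open>b \<le> M \<le> M ^ 3\<close>, which bounds both norms without taking roots.\<close>
 define M where "M = 1 + a + b"
 have M: "M \<ge> 1" "a \<le> M" "b \<le> M" using ab by (auto simp: M_def)
 have pw: "M \<le> M ^ 6" "M \<le> M ^ 3" using M(1) by (auto intro: self_le_power)
 have [measurable]: "(\<lambda>x. realc (\<psi> x)) \<in> borel_fun"
  by (rule measurable_compose[OF psi_meas borel_measurable_continuous_onI[OF linear_continuous_on[OF realc_linear]]])
 have kp: "kappa > 0" by (rule kappa_pos)
 interpret S: cubic "\<lambda>x y. 1 / (6 * kappa) / dist x y" "\<lambda>k x y. (x $ k - y $ k) / dist x y ^ 3" real_coeff "7 * max (1 / (6 * kappa)) 1"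
  by (rule cubic_const) (use kp in simp)
 have "cubic_system u (\<lambda>x. realc (\<psi> x)) real_coeff (1 / (6 * kappa)) M"
 proof
  show "pair_le M (\<lambda>x. norm (u x)) (\<lambda>x. norm (realc (\<psi> x)))"
   using ab M pw by (auto simp: pair_le_def intro!: ennreal_leI)
  show "AE x in lborel. u x = S.T1 u (\<lambda>x. realc (\<psi> x)) x"
   using int_eq1 by (simp only: S.T1_def S.N1_def cubic1_real integral_mult_right_zero)
  have "S.T2 u (\<lambda>x. realc (\<psi> x)) x = realc ((1 / kappa) *\<^sub>R (\<integral>y. (1 / dist x y ^ 3) *\<^sub>R dirac_part \<alpha> (x - y) (rhs2 y) \<partial>lborel))" for x
  proof -
   have "S.T2 u (\<lambda>x. realc (\<psi> x)) x = (\<integral>y. realc ((1 / kappa) *\<^sub>R (1 / dist x y ^ 3) *\<^sub>R dirac_part \<alpha> (x - y) (rhs2 y)) \<partial>lborel)"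
    unfolding S.T2_def S.N2_def cubic2_real[symmetric] by simp
   also have "\<dots> = realc (\<integral>y. (1 / kappa) *\<^sub>R (1 / dist x y ^ 3) *\<^sub>R dirac_part \<alpha> (x - y) (rhs2 y) \<partial>lborel)"
    by (rule integral_bounded_linear'[OF realc_linear unreal_linear]) simp
   finally show ?thesis unfolding Bochner_Integration.integral_scaleR_right .
  qed
  then show "AE x in lborel. realc (\<psi> x) = S.T2 u (\<lambda>x. realc (\<psi> x)) x"
   using int_eq2 by (auto elim: eventually_mono)
 qed (use kp M in auto)
 then show ?thesis ..
qed

theorem analytic_representative:
 obtains u' \<psi>' where "\<And>x. analytic_pt u' x" "\<And>i x. analytic_pt (\<lambda>x. realc (\<psi>' x) $ i) x"
  "AE x in lborel. u x = u' x" "AE x in lborel. \<psi> x = \<psi>' x"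
proof -
 obtain M where "cubic_system u (\<lambda>x. realc (\<psi> x)) real_coeff (1 / (6 * kappa)) M" using cubic_system by blast
 then interpret cubic_system u "\<lambda>x. realc (\<psi> x)" real_coeff "1 / (6 * kappa)" M .
 have 1: "\<exists>r>0. \<exists>d. AE y in lborel. norm (y - c) < r \<longrightarrow> u y = msub ((y - c) /\<^sub>R r) d" for c
  by (rule local_series[of c]) blast
 have 2: "\<exists>r>0. \<exists>d. AE y in lborel. norm (y - c) < r \<longrightarrow> realc (\<psi> y) $ i = msub ((y - c) /\<^sub>R r) d" for c i
  by (rule local_series[of c]) blast
 obtain u' where u': "\<And>x. analytic_pt u' x" "AE x in lborel. u x = u' x"
  by (rule glue_local_series[OF 1]) blast
 have "\<forall>i. \<exists>g. (\<forall>x. analytic_pt g x) \<and> (AE x in lborel. realc (\<psi> x) $ i = g x)"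
  using glue_local_series[OF 2] by metis
 then obtain g where g: "\<And>i x. analytic_pt (g i) x" "\<And>i. AE x in lborel. realc (\<psi> x) $ i = g i x" by metis
 define \<psi>' where "\<psi>' x = unreal (\<chi> i. g i x)" for x
 have "AE x in lborel. \<forall>i. realc (\<psi> x) $ i = g i x" unfolding AE_all_countable using g(2) by blast
 then have ae: "AE x in lborel. \<psi> x = \<psi>' x"
 proof eventually_elim
  case (elim x)
  then have "realc (\<psi> x) = (\<chi> i. g i x)" by (simp add: vec_eq_iff)
  then show ?case unfolding \<psi>'_def by (metis unreal_realc)
 qed
 show thesis by (rule that[OF u'(1) _ u'(2) ae]) (simp add: \<psi>'_def g(1))
qed

end

lemma smooth_of_analytic_components:
 assumes "\<And>i x. analytic_pt (\<lambda>x. realc (f x) $ i) x"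
 shows "smooth f"
proof -
 have "f x = (\<Sum>i\<in>UNIV. (realc (f x) $ i) *\<^sub>R unreal (axis i 1))" for x
 proof -
  have "realc (f x) = (\<Sum>i\<in>UNIV. (realc (f x) $ i) *\<^sub>R axis i 1)"
   using basis_expansion[of "realc (f x)"] by (simp only: scalar_mult_eq_scaleR)
  then have "unreal (realc (f x)) = unreal (\<Sum>i\<in>UNIV. (realc (f x) $ i) *\<^sub>R axis i 1)" by (rule arg_cong)
  also have "\<dots> = (\<Sum>i\<in>UNIV. (realc (f x) $ i) *\<^sub>R unreal (axis i 1))"
   by (simp only: linear_sum[OF bounded_linear.linear[OF unreal_linear]] linear_scale[OF bounded_linear.linear[OF unreal_linear]])
  finally have "unreal (realc (f x)) = (\<Sum>i\<in>UNIV. (realc (f x) $ i) *\<^sub>R unreal (axis i 1))" .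
  then show ?thesis by simp
 qed
 then have "f = (\<lambda>x. \<Sum>i\<in>UNIV. (realc (f x) $ i) *\<^sub>R unreal (axis i 1))" by blast
 moreover have "smooth (\<lambda>x. \<Sum>i\<in>UNIV. (realc (f x) $ i) *\<^sub>R unreal (axis i 1))"
  using analytic_smooth[OF assms] unfolding smooth_def by (auto intro!: C_k_sum_scaleR)
 ultimately show ?thesis by simp
qed

section \<open>The Kelvin transform\<close>

definition inversion :: "real^3 \<Rightarrow> real^3"
 where "inversion x = (1 / (norm x)\<^sup>2) *\<^sub>R x"

lemma inversion_zero [simp]: "inversion 0 = 0" and inversion_eq_0 [simp]: "inversion x = 0 \<longleftrightarrow> x = 0"
 by (simp_all add: inversion_def)

lemma norm_inversion [simp]: "norm (inversion x) = 1 / norm x"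
 by (simp add: inversion_def power2_eq_square)

lemma inversion_inversion [simp]: "inversion (inversion x) = x"
 unfolding inversion_def[of "inversion x"] norm_inversion by (simp add: inversion_def power_divide)

lemma inversion_measurable [measurable]: "inversion \<in> borel_fun"
 unfolding inversion_def[abs_def] by measurable

lemma dist_inversion:
 assumes "x \<noteq> 0" "y \<noteq> 0"
 shows "dist (inversion x) (inversion y) = dist x y / (norm x * norm y)"
proof (rule power2_eq_imp_eq)
 have e: "(norm (a - b))\<^sup>2 = (norm a)\<^sup>2 + (norm b)\<^sup>2 - 2 * (a \<bullet> b)" for a b :: "real^3"
  by (simp add: power2_norm_eq_inner inner_diff_left inner_diff_right inner_commute)
 have "inversion x \<bullet> inversion y = (x \<bullet> y) / ((norm x)\<^sup>2 * (norm y)\<^sup>2)" by (simp add: inversion_def)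
 then show "(dist (inversion x) (inversion y))\<^sup>2 = (dist x y / (norm x * norm y))\<^sup>2"
  unfolding dist_norm e power_divide power_mult_distrib norm_inversion using assms
  by (simp add: field_simps)
qed auto

lemma inversion_has_derivative:
 assumes "x \<noteq> 0"
 shows "(inversion has_derivative (\<lambda>h. (1 / (norm x)\<^sup>2) *\<^sub>R (h + (x \<bullet> h) *\<^sub>R ((- 2 / (norm x)\<^sup>2) *\<^sub>R x)))) (at x)"
proof -
 have "inversion = (\<lambda>x. inverse (x \<bullet> x) *\<^sub>R x)" by (simp add: fun_eq_iff inversion_def power2_norm_eq_inner divide_inverse)
 moreover have "((\<lambda>x. inverse (x \<bullet> x) *\<^sub>R x) has_derivative
   (\<lambda>h. inverse (x \<bullet> x) *\<^sub>R h + (- (inverse (x \<bullet> x) * (x \<bullet> h + h \<bullet> x) * inverse (x \<bullet> x))) *\<^sub>R x)) (at x)"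
  using assms by (auto intro!: derivative_eq_intros)
 moreover have "(\<lambda>h. inverse (x \<bullet> x) *\<^sub>R h + (- (inverse (x \<bullet> x) * (x \<bullet> h + h \<bullet> x) * inverse (x \<bullet> x))) *\<^sub>R x)
   = (\<lambda>h. (1 / (norm x)\<^sup>2) *\<^sub>R (h + (x \<bullet> h) *\<^sub>R ((- 2 / (norm x)\<^sup>2) *\<^sub>R x)))"
  by (simp add: fun_eq_iff power2_norm_eq_inner divide_inverse scaleR_add_right scaleR_diff_right inner_commute mult_ac)
 ultimately show ?thesis by simp
qed

text \<open>The derivative is \<open>1 / (norm x)^2\<close> times the reflection in the plane
  orthogonal to \<open>x\<close>, whose determinant is \<open>- 1\<close>.\<close>

lemma det_inversion:
 assumes "x \<noteq> 0"
 shows "\<bar>det (matrix (\<lambda>h::real^3. (1 / (norm x)\<^sup>2) *\<^sub>R (h + (x \<bullet> h) *\<^sub>R ((- 2 / (norm x)\<^sup>2) *\<^sub>R x))))\<bar> = 1 / norm x ^ 6"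
proof -
 define s where "s = 1 / (norm x)\<^sup>2"
 define g where "g h = h + (x \<bullet> h) *\<^sub>R ((- 2 / (norm x)\<^sup>2) *\<^sub>R x)" for h
 have "matrix (\<lambda>h. s *\<^sub>R g h) = (\<chi> i. s *s (matrix g $ i))"
  by (simp add: matrix_def vec_eq_iff)
 then have "det (matrix (\<lambda>h. s *\<^sub>R g h)) = s ^ 3 * det (matrix g)"
  using det_rows_mul[of "\<lambda>i. s" "\<lambda>i. matrix g $ i"] by simp
 also have "det (matrix g) = -1"
  unfolding g_def[abs_def] det_rank_one using assms by (simp add: power2_norm_eq_inner)
 finally have "det (matrix (\<lambda>h. s *\<^sub>R g h)) = s ^ 3 * -1" .
 moreover have "s ^ 3 = 1 / norm x ^ 6" by (simp add: s_def power_divide flip: power_mult)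
 ultimately show ?thesis unfolding s_def[symmetric] g_def[symmetric] by simp
qed

lemma substitution_inversion: "substitution inversion (\<lambda>y. 1 / norm y ^ 6)"
proof
 show "AE y in lborel. 0 < 1 / norm (y::real^3) ^ 6"
  using AE_lborel_singleton[of "0::real^3"] by eventually_elim simp
 fix g :: "real^3 \<Rightarrow> ennreal" assume [measurable]: "g \<in> borel_fun"
 have "(\<integral>\<^sup>+y. g (inversion y) * (ennreal (1 / norm y ^ 6) * indicator (- {0}) y) \<partial>lborel) = (\<integral>\<^sup>+y. g y * indicator (- {0}) y \<partial>lborel)"
 proof (rule nn_integral_change_of_variables)
  show "(inversion has_derivative (\<lambda>h. (1 / (norm y)\<^sup>2) *\<^sub>R (h + (y \<bullet> h) *\<^sub>R ((- 2 / (norm y)\<^sup>2) *\<^sub>R y)))) (at y)"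
   if "y \<in> - {0}" for y
   using that by (intro inversion_has_derivative) simp
  show "inj_on inversion (- {0})" by (metis inj_on_def inversion_inversion)
  show "inversion ` (- {0}) = - {0}"
  proof (intro subset_antisym subsetI)
   fix y :: "real^3" assume "y \<in> - {0}"
   then have "inversion y \<in> - {0}" by simp
   then show "y \<in> inversion ` (- {0})" using image_eqI[of y inversion "inversion y"] by simp
  qed auto
  show "1 / norm y ^ 6 = \<bar>det (matrix (\<lambda>h. (1 / (norm y)\<^sup>2) *\<^sub>R (h + (y \<bullet> h) *\<^sub>R ((- 2 / (norm y)\<^sup>2) *\<^sub>R y))))\<bar>"
   if "y \<in> - {0}" for y :: "real^3"
   using det_inversion[of y] that by simp
 qed auto
 moreover have "(\<integral>\<^sup>+y. g (inversion y) * (ennreal (1 / norm y ^ 6) * indicator (- {0}) y) \<partial>lborel) = (\<integral>\<^sup>+y. g (inversion y) * ennreal (1 / norm y ^ 6) \<partial>lborel)"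
  by (intro nn_integral_cong) (auto simp: indicator_def)
 moreover have "(\<integral>\<^sup>+y. g y * indicator (- {0}) y \<partial>lborel) = (\<integral>\<^sup>+y. g y \<partial>lborel)"
  by (intro nn_integral_cong_AE eventually_mono[OF AE_lborel_singleton[of "0::real^3"]]) (auto simp: indicator_def)
 ultimately show "(\<integral>\<^sup>+y. g (inversion y) * ennreal (1 / norm y ^ 6) \<partial>lborel) = (\<integral>\<^sup>+y. g y \<partial>lborel)" by simp
qed measurable

interpretation inv: substitution inversion "\<lambda>y. 1 / norm y ^ 6"
 by (rule substitution_inversion)

subsection \<open>Clifford multiplication\<close>

lemma inner_hermitian:
 fixes A :: "complex^'n^'n::finite"
 assumes "hermitian A"
 shows "(A *v v) \<bullet> w = v \<bullet> (A *v w)"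
proof -
 have ip: "a \<bullet> b = Re (a * cnj b)" for a b :: complex by (simp add: inner_complex_def)
 have "(A *v v) \<bullet> w = Re (\<Sum>i\<in>UNIV. \<Sum>j\<in>UNIV. A $ i $ j * v $ j * cnj (w $ i))"
  by (simp add: inner_vec_def ip matrix_vector_mult_def sum_distrib_right)
 also have "(\<Sum>i\<in>UNIV. \<Sum>j\<in>UNIV. A $ i $ j * v $ j * cnj (w $ i)) = (\<Sum>j\<in>UNIV. \<Sum>i\<in>UNIV. A $ i $ j * v $ j * cnj (w $ i))"
  by (rule sum.swap)
 also have "\<dots> = (\<Sum>j\<in>UNIV. v $ j * cnj (\<Sum>i\<in>UNIV. A $ j $ i * w $ i))"
 proof (intro sum.cong refl)
  fix j
  have "cnj (A $ j $ i) = A $ i $ j" for i using assms unfolding hermitian_def by metis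
  then show "(\<Sum>i\<in>UNIV. A $ i $ j * v $ j * cnj (w $ i)) = v $ j * cnj (\<Sum>i\<in>UNIV. A $ j $ i * w $ i)"
   by (simp add: sum_distrib_left mult_ac)
 qed
 also have "Re \<dots> = v \<bullet> (A *v w)" by (simp add: inner_vec_def ip matrix_vector_mult_def)
 finally show ?thesis .
qed

locale clifford_algebra =
 fixes \<alpha> :: "3 \<Rightarrow> complex^4^4" and \<beta> :: "complex^4^4"
 assumes clifford: "clifford \<alpha>" and hermitian: "hermitian (\<alpha> k)" "hermitian \<beta>"
  and beta_square: "\<beta> ** \<beta> = mat 1" and anticommute: "\<beta> ** \<alpha> k = - (\<alpha> k ** \<beta>)"
begin

definition mul :: "real^3 \<Rightarrow> complex^4 \<Rightarrow> complex^4"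
 where "mul x v = (\<Sum>k\<in>UNIV. (x $ k) *\<^sub>R (\<alpha> k *v v))"

definition Uop :: "real^3 \<Rightarrow> complex^4 \<Rightarrow> complex^4"
 where "Uop x v = (1 / norm x) *\<^sub>R (\<i> *s (\<beta> *v mul x v))"

lemma mul_linear: "linear (mul x)" "linear (\<lambda>x. mul x v)"
 by (rule linearI; simp add: mul_def matrix_vector_right_distrib mat_mul_scaleR sum.distrib scaleR_sum_right scaleR_add_right scaleR_add_left mult_ac)+

lemma mul_i: "mul x (\<i> *s v) = \<i> *s mul x v"
 unfolding mul_def linear_sum[OF bounded_linear.linear[OF bounded_linear_smult]] mat_mul_smult
  linear_scale[OF bounded_linear.linear[OF bounded_linear_smult]] ..

lemma mul_mul: "mul x (mul x v) = (norm x)\<^sup>2 *\<^sub>R v"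
proof -
 have "mul x (mul x v) = (\<Sum>k\<in>UNIV. \<alpha> k *v (\<Sum>j\<in>UNIV. \<alpha> j *v ((x $ k * x $ j) *\<^sub>R v)))"
  unfolding mul_def by (simp add: mat_mul_sum mat_mul_scaleR scaleR_sum_right)
 also have "\<dots> = (\<Sum>j\<in>UNIV. (x $ j * x $ j) *\<^sub>R v)"
  by (rule clifford_symmetric_sum[OF clifford]) (simp add: mult.commute)
 also have "\<dots> = (norm x)\<^sup>2 *\<^sub>R v" by (simp add: power2_norm_eq_inner inner_vec_def scaleR_sum_left)
 finally show ?thesis .
qed

lemma beta_mul: "\<beta> *v mul x v = - mul x (\<beta> *v v)"
proof -
 have "\<beta> *v (\<alpha> k *v v) = - (\<alpha> k *v (\<beta> *v v))" for k
  unfolding matrix_vector_mul_assoc anticommute by (simp add: matrix_vector_mult_def vec_eq_iff sum_negf)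
 then show ?thesis by (simp add: mul_def mat_mul_sum mat_mul_scaleR sum_negf)
qed

lemma beta_beta: "\<beta> *v (\<beta> *v v) = v"
 by (simp add: matrix_vector_mul_assoc beta_square)

lemma inner_mul: "mul x v \<bullet> w = v \<bullet> mul x w"
 by (simp add: mul_def inner_sum_left inner_sum_right inner_hermitian[OF hermitian(1)])

lemma norm_mul: "norm (mul x v) = norm x * norm v"
proof (rule power2_eq_imp_eq)
 show "(norm (mul x v))\<^sup>2 = (norm x * norm v)\<^sup>2"
  by (simp add: power2_norm_eq_inner[of "mul x v"] inner_mul mul_mul power_mult_distrib power2_norm_eq_inner[of v])
qed auto

lemma norm_beta: "norm (\<beta> *v v) = norm v"
proof (rule power2_eq_imp_eq)
 show "(norm (\<beta> *v v))\<^sup>2 = (norm v)\<^sup>2"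
  by (simp add: power2_norm_eq_inner inner_hermitian[OF hermitian(2)] beta_beta)
qed auto

lemma norm_Uop: "x \<noteq> 0 \<Longrightarrow> norm (Uop x v) = norm v"
proof -
 have ni: "norm (\<i> *s v) = norm v" for v :: "complex^4" by (simp add: norm_vec_def norm_mult)
 show "x \<noteq> 0 \<Longrightarrow> norm (Uop x v) = norm v" by (simp add: Uop_def ni norm_beta norm_mul)
qed

lemma Uop_linear: "bounded_linear (Uop x)"
 unfolding linear_conv_bounded_linear[symmetric] Uop_def
 by (rule linearI) (simp_all add: linear_add[OF mul_linear(1)] linear_scale[OF mul_linear(1)] matrix_vector_right_distrib
   mat_mul_scaleR scaleR_add_right vec.scale_right_distrib linear_scale[OF bounded_linear.linear[OF bounded_linear_smult]])

lemma i_i: "\<i> *s (\<i> *s v) = - (v :: complex^4)"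
 by (simp add: vec_eq_iff)

text \<open>\<open>\<beta>\<close> anticommutes with Clifford multiplication by \<open>x\<close>;
  the resulting sign cancels that of \<open>\<i>\<close> squared, and what is left is the square of
  \<open>x\<close>. Hence the Kelvin transform of spinors is an involution.\<close>

lemma Uop_Uop:
 assumes "x \<noteq> 0"
 shows "Uop x (Uop x v) = v"
proof -
 have "Uop x (Uop x v) = (1 / norm x) *\<^sub>R ((1 / norm x) *\<^sub>R (\<i> *s (\<beta> *v mul x (\<i> *s (\<beta> *v mul x v)))))"
  unfolding Uop_def linear_scale[OF mul_linear(1)] mat_mul_scaleR linear_scale[OF bounded_linear.linear[OF bounded_linear_smult]] ..
 also have "\<i> *s (\<beta> *v mul x (\<i> *s (\<beta> *v mul x v))) = (norm x)\<^sup>2 *\<^sub>R v"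
  unfolding mul_i mat_mul_smult i_i beta_mul[of x "\<beta> *v mul x v"] beta_beta mul_mul by simp
 finally show ?thesis using assms by (simp add: power2_eq_square)
qed

lemma Uop_scaleR: "c > 0 \<Longrightarrow> Uop (c *\<^sub>R x) v = Uop x v"
 by (simp add: Uop_def linear_scale[OF mul_linear(2)] mat_mul_scaleR linear_scale[OF bounded_linear.linear[OF bounded_linear_smult]])

lemma Uop_inversion: "Uop (inversion x) v = Uop x v"
 by (cases "x = 0") (simp_all add: inversion_def Uop_scaleR)

lemma dirac_part_mul: "dirac_part \<alpha> z v = \<i> *s mul z v"
 unfolding dirac_part_def mul_def mat_mul_scaleR ..

text \<open>Covariance of the Dirac kernel. Its core is the identity
  \<open>x (x/|x|^2 - y/|y|^2) y = y - x\<close> in the Clifford algebra; the two factors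
  \<open>\<beta>\<close> meet and cancel.\<close>

lemma dirac_part_inversion:
 assumes "x \<noteq> 0" "y \<noteq> 0"
 shows "Uop x (dirac_part \<alpha> (inversion x - inversion y) (Uop y v)) = (1 / (norm x * norm y)) *\<^sub>R dirac_part \<alpha> (x - y) v"
proof -
 have m: "mul x (mul (inversion x - inversion y) (mul y v)) = mul y v - mul x v"
  using assms by (simp add: linear_diff[OF mul_linear(2)] linear_diff[OF mul_linear(1)] inversion_def
    linear_scale[OF mul_linear(2)] linear_scale[OF mul_linear(1)] mul_mul)
 have bm: "\<beta> *v mul x (mul z (\<beta> *v w)) = mul x (mul z w)" for z w
  by (simp add: beta_mul beta_beta linear_neg[OF mul_linear(1)])
 have "Uop x (dirac_part \<alpha> (inversion x - inversion y) (Uop y v))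
   = (1 / norm x) *\<^sub>R ((1 / norm y) *\<^sub>R (\<i> *s (\<i> *s (\<i> *s mul x (mul (inversion x - inversion y) (mul y v))))))"
  unfolding Uop_def dirac_part_mul linear_scale[OF mul_linear(1)] mul_i mat_mul_smult mat_mul_scaleR bm
   linear_scale[OF bounded_linear.linear[OF bounded_linear_smult]] ..
 also have "\<dots> = (1 / (norm x * norm y)) *\<^sub>R (\<i> *s (mul x v - mul y v))"
  unfolding m i_i by (simp add: vec.scale_right_diff_distrib flip: scaleR_minus_right)
 finally show ?thesis by (simp add: dirac_part_mul linear_diff[OF mul_linear(2)])
qed

lemma Uop_measurable [measurable]:
 assumes [measurable]: "f \<in> borel_fun"
 shows "(\<lambda>x. Uop x (f x)) \<in> borel_fun"
proof -
 note [measurable] = borel_measurable_continuous_onI[OF linear_continuous_on[OF bounded_linear_mat_mul]]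
 have "(\<lambda>x. A *v f x) \<in> borel_fun" for A :: "complex^4^4"
  by (rule measurable_compose[OF assms]) measurable
 then have [measurable]: "(\<lambda>x. mul x (f x)) \<in> borel_fun" unfolding mul_def by measurable
 have "(\<lambda>x. \<i> *s (\<beta> *v mul x (f x))) \<in> borel_fun"
  by (rule measurable_compose[of "\<lambda>x. mul x (f x)" _ borel "\<lambda>v. \<i> *s (\<beta> *v v)"])
    (use bounded_linear_dirac_term[of \<beta>] in \<open>auto intro!: borel_measurable_continuous_onI linear_continuous_on\<close>)
 then show ?thesis unfolding Uop_def by measurable
qed

end

subsection \<open>Invariance of the integral equations\<close>

locale kelvin = integral_solution u \<psi> \<alpha> + clifford_algebra \<alpha> \<beta>
 for u :: "real^3 \<Rightarrow> real" and \<psi> :: "real^3 \<Rightarrow> complex^4" and \<alpha> \<beta>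
begin

text \<open>The weights, 1 here and 2 in \<open>kpsi\<close>, are those for which the sixth power of
  \<open>ku\<close> and the third power of \<open>kpsi\<close> both acquire exactly the Jacobian
  \<open>1 / norm y ^ 6\<close>.\<close>

definition ku :: "real^3 \<Rightarrow> real"
 where "ku y = u (inversion y) / norm y"

definition kpsi :: "real^3 \<Rightarrow> complex^4"
 where "kpsi y = (1 / (norm y)\<^sup>2) *\<^sub>R Uop y (\<psi> (inversion y))"

lemma norm_kpsi: "norm (kpsi y) = norm (\<psi> (inversion y)) / (norm y)\<^sup>2"
 by (cases "y = 0") (simp_all add: kpsi_def norm_Uop)

sublocale K: critical_pair ku kpsi
proof
 show "ku \<in> borel_fun" "kpsi \<in> borel_fun"
  unfolding ku_def[abs_def] kpsi_def[abs_def] by measurable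
 have "(\<integral>\<^sup>+x. ennreal (\<bar>ku x\<bar> ^ 6) \<partial>lborel) = (\<integral>\<^sup>+x. ennreal (\<bar>u (inversion x)\<bar> ^ 6) * ennreal (1 / norm x ^ 6) \<partial>lborel)"
  by (intro nn_integral_cong) (simp add: ku_def power_divide flip: ennreal_mult)
 also have "\<dots> = (\<integral>\<^sup>+x. ennreal (\<bar>u x\<bar> ^ 6) \<partial>lborel)" by (rule inv.nn_integral_subst) measurable
 finally show "(\<integral>\<^sup>+x. ennreal (\<bar>ku x\<bar> ^ 6) \<partial>lborel) < \<infinity>" using u_int by simp
 have "(\<integral>\<^sup>+x. ennreal (norm (kpsi x) ^ 3) \<partial>lborel) = (\<integral>\<^sup>+x. ennreal (norm (\<psi> (inversion x)) ^ 3) * ennreal (1 / norm x ^ 6) \<partial>lborel)"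
  by (intro nn_integral_cong) (simp add: norm_kpsi power_divide flip: ennreal_mult power_mult)
 also have "\<dots> = (\<integral>\<^sup>+x. ennreal (norm (\<psi> x) ^ 3) \<partial>lborel)" by (rule inv.nn_integral_subst) measurable
 finally show "(\<integral>\<^sup>+x. ennreal (norm (kpsi x) ^ 3) \<partial>lborel) < \<infinity>" using psi_int by simp
qed

text \<open>The right-hand side scales with \<open>norm y ^ 5\<close> and the distance supplies one
  further power, which together cancel the Jacobian. The factor \<open>norm x\<close> that remains
  is the weight on the left of the integral equation.\<close>

lemma kelvin_rhs1:
 assumes x: "x \<noteq> 0"
 shows "(1 / norm y ^ 6) *\<^sub>R (rhs1 (inversion y) / dist (inversion x) (inversion y)) = norm x * (K.rhs1 y / dist x y)"
proof (cases "y = 0")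
 case False
 have "K.rhs1 y = rhs1 (inversion y) / norm y ^ 5"
  by (simp add: K.rhs1_def rhs1_def norm_kpsi ku_def power_divide power_numeral_reduce)
 then show ?thesis
  using False x by (cases "x = y") (simp_all add: dist_inversion power_numeral_reduce)
qed (simp add: K.rhs1_def ku_def)

lemma kelvin_rhs2:
 assumes x: "x \<noteq> 0"
 shows "Uop x ((1 / norm y ^ 6) *\<^sub>R ((1 / dist (inversion x) (inversion y) ^ 3) *\<^sub>R dirac_part \<alpha> (inversion x - inversion y) (rhs2 (inversion y))))
  = (norm x)\<^sup>2 *\<^sub>R ((1 / dist x y ^ 3) *\<^sub>R dirac_part \<alpha> (x - y) (K.rhs2 y))"
proof (cases "y = 0 \<or> x = y")
 case False
 then have y: "y \<noteq> 0" and d: "dist x y \<noteq> 0" by auto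
 have "K.rhs2 y = (1 / norm y ^ 4) *\<^sub>R Uop y (rhs2 (inversion y))"
  by (simp add: K.rhs2_def rhs2_def kpsi_def ku_def linear_scale[OF bounded_linear.linear[OF Uop_linear]] power_divide power_numeral_reduce)
 then have r: "rhs2 (inversion y) = norm y ^ 4 *\<^sub>R Uop y (K.rhs2 y)"
  using y by (simp add: linear_scale[OF bounded_linear.linear[OF Uop_linear]] Uop_Uop)
 have "Uop x ((1 / norm y ^ 6) *\<^sub>R ((1 / dist (inversion x) (inversion y) ^ 3) *\<^sub>R dirac_part \<alpha> (inversion x - inversion y) (rhs2 (inversion y))))
  = (1 / norm y ^ 6 * (1 / dist (inversion x) (inversion y) ^ 3) * norm y ^ 4 * (1 / (norm x * norm y))) *\<^sub>R dirac_part \<alpha> (x - y) (K.rhs2 y)"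
  unfolding r dirac_part_scaleR linear_scale[OF bounded_linear.linear[OF Uop_linear]] dirac_part_inversion[OF x y]
  by (simp only: scaleR_scaleR mult.assoc)
 also have "1 / norm y ^ 6 * (1 / dist (inversion x) (inversion y) ^ 3) * norm y ^ 4 * (1 / (norm x * norm y)) = (norm x)\<^sup>2 * (1 / dist x y ^ 3)"
  unfolding dist_inversion[OF x y] using x y d by (simp add: field_simps power_numeral_reduce)
 finally show ?thesis by simp
next
 case True
 then show ?thesis by (auto simp: K.rhs2_def ku_def Uop_def dirac_part_mul linear_0[OF mul_linear(1)] linear_0[OF mul_linear(2)])
qed

lemma kelvin_solution: "integral_solution ku kpsi \<alpha>"
proof
 have nz: "AE x in lborel. x \<noteq> (0::real^3)" by (rule AE_lborel_singleton)
 show "AE x in lborel. ku x = 1 / (6 * kappa) * (\<integral>y. K.rhs1 y / dist x y \<partial>lborel)"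
  using inv.AE_subst[OF int_eq1] nz
 proof eventually_elim
  case (elim x)
  have "(\<integral>z. rhs1 z / dist (inversion x) z \<partial>lborel) = (\<integral>y. (1 / norm y ^ 6) *\<^sub>R (rhs1 (inversion y) / dist (inversion x) (inversion y)) \<partial>lborel)"
   by (rule inv.integral_subst[symmetric]) measurable
  also have "\<dots> = norm x * (\<integral>y. K.rhs1 y / dist x y \<partial>lborel)"
   unfolding kelvin_rhs1[OF elim(2)] by (rule integral_mult_right_zero)
  finally show ?case using elim by (simp add: ku_def)
 qed
 show "AE x in lborel. kpsi x = (1 / kappa) *\<^sub>R (\<integral>y. (1 / dist x y ^ 3) *\<^sub>R dirac_part \<alpha> (x - y) (K.rhs2 y) \<partial>lborel)"
  using inv.AE_subst[OF int_eq2] nz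
 proof eventually_elim
  case (elim x)
  let ?g = "\<lambda>z. (1 / dist (inversion x) z ^ 3) *\<^sub>R dirac_part \<alpha> (inversion x - z) (rhs2 z)"
  have [measurable]: "(\<lambda>z. dirac_part \<alpha> (inversion x - z) (rhs2 z)) \<in> borel_fun"
  proof -
   have "(\<lambda>z. \<i> *s (\<alpha> k *v rhs2 z)) \<in> borel_fun" for k
    by (rule measurable_compose[OF rhs_meas(2)])
      (use bounded_linear_dirac_term[of "\<alpha> k"] in \<open>auto intro!: borel_measurable_continuous_onI linear_continuous_on\<close>)
   note [measurable] = this
   show ?thesis unfolding dirac_part_sum by measurable
  qed
  have "Uop x (\<integral>z. ?g z \<partial>lborel) = Uop x (\<integral>y. (1 / norm y ^ 6) *\<^sub>R ?g (inversion y) \<partial>lborel)"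
   by (subst inv.integral_subst) simp_all
  \<comment> \<open>\<open>Uop x\<close> is its own inverse, so it may be moved through the integral
    whether or not the integrand is integrable.\<close>
  also have "\<dots> = (\<integral>y. Uop x ((1 / norm y ^ 6) *\<^sub>R ?g (inversion y)) \<partial>lborel)"
   by (rule integral_bounded_linear'[OF Uop_linear[of x] Uop_linear[of x], symmetric]) (simp add: Uop_Uop[OF elim(2)])
  also have "\<dots> = (norm x)\<^sup>2 *\<^sub>R (\<integral>y. (1 / dist x y ^ 3) *\<^sub>R dirac_part \<alpha> (x - y) (K.rhs2 y) \<partial>lborel)"
   unfolding kelvin_rhs2[OF elim(2)] by (rule integral_scaleR_right)
  finally have "Uop x (\<integral>z. ?g z \<partial>lborel) = (norm x)\<^sup>2 *\<^sub>R (\<integral>y. (1 / dist x y ^ 3) *\<^sub>R dirac_part \<alpha> (x - y) (K.rhs2 y) \<partial>lborel)" .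
  then show ?case
   using elim(2) unfolding kpsi_def elim(1) linear_scale[OF bounded_linear.linear[OF Uop_linear]]
   by simp
 qed
qed

end

text \<open>Both right-hand sides contain both components as factors, so if either component
  vanishes, so do both right-hand sides, and the integral equations give zero for the pair.\<close>

lemma (in integral_solution) trivial_iff:
 assumes "(AE x in lborel. u x = 0) \<or> (AE x in lborel. \<psi> x = 0)"
 shows "AE x in lborel. u x = 0 \<and> \<psi> x = 0"
proof -
 have "AE x in lborel. rhs1 x = 0" "AE x in lborel. rhs2 x = 0"
  using assms by (auto simp: rhs1_def rhs2_def elim: eventually_mono)
 then have "AE y in lborel. rhs1 y / dist x y = 0" "AE y in lborel. (1 / dist x y ^ 3) *\<^sub>R dirac_part \<alpha> (x - y) (rhs2 y) = 0" for x
  by (eventually_elim, simp add: linear_0[OF bounded_linear.linear[OF dirac_part_linear]])+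
 note z = this[THEN integral_eq_zero_AE]
 show ?thesis using int_eq1 int_eq2 by eventually_elim (simp add: z)
qed

subsection \<open>Taylor expansions of analytic functions\<close>

lemma analytic_continuous:
 assumes "\<And>x. analytic_pt f x"
 shows "continuous_on S f"
 using analytic_pt_differentiable[OF assms] by (intro continuous_at_imp_continuous_on ballI differentiable_imp_continuous_within)

text \<open>The remainder is bounded on the whole unit ball and not only near 0, because inversion
  maps the required range \<open>norm x \<ge> 1\<close> onto the punctured unit ball.\<close>

definition taylor :: "(real^3 \<Rightarrow> 'b::real_normed_vector) \<Rightarrow> (nat^3 \<Rightarrow> 'b) \<Rightarrow> bool"
 where "taylor f z \<longleftrightarrow> (\<forall>M. \<exists>C. \<forall>y. norm y \<le> 1 \<longrightarrow>
  norm (f y - (\<Sum>\<alpha> | mi_order \<alpha> \<le> M. mi_power y \<alpha> *\<^sub>R z \<alpha>)) \<le> C * norm y ^ Suc M)"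

lemma analytic_taylor:
 assumes an: "\<And>x. analytic_pt f x"
 obtains z where "taylor f z" "(\<And>\<alpha>. z \<alpha> = 0) \<Longrightarrow> f = (\<lambda>_. 0)"
proof -
 obtain r c where rc: "has_mps f 0 r c" using an[of 0] by (auto simp: analytic_pt_def)
 then have r: "r > 0" and fs: "\<And>y. norm y \<le> r \<Longrightarrow> f y = msub (y /\<^sub>R r) c" by (auto simp: has_mps_def)
 \<comment> \<open>This undoes the rescaling of the variable by \<open>r\<close> in
   \<open>has_mps\<close>.\<close>
 define z where "z \<alpha> = coef c \<alpha> / r ^ mi_order \<alpha>" for \<alpha>
 have "\<exists>C. \<forall>y. norm y \<le> 1 \<longrightarrow> norm (f y - (\<Sum>\<alpha> | mi_order \<alpha> \<le> M. mi_power y \<alpha> *\<^sub>R z \<alpha>)) \<le> C * norm y ^ Suc M" for M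
 proof -
  define g where "g y = f y - (\<Sum>\<alpha> | mi_order \<alpha> \<le> M. mi_power y \<alpha> *\<^sub>R z \<alpha>)" for y
  \<comment> \<open>The series controls the remainder only for \<open>norm y \<le> r\<close>. For
    larger \<open>y\<close> in the unit ball, \<open>(norm y / r) ^ Suc M\<close> is at least 1, and
    a bound by compactness suffices.\<close>
  have "continuous_on (cball 0 1) g"
   unfolding g_def mi_power_def by (intro continuous_intros analytic_continuous an)
  then have "bounded (g ` cball 0 1)" by (intro compact_imp_bounded compact_continuous_image) auto
  then obtain B where B: "B > 0" "\<And>y. norm y \<le> 1 \<Longrightarrow> norm (g y) \<le> B" by (auto simp: bounded_pos)
  have "norm (g y) \<le> max (norm c) B / r ^ Suc M * norm y ^ Suc M" if y: "norm y \<le> 1" for y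
  proof (cases "norm y \<le> r")
   case True
   have n: "norm (y /\<^sub>R r) = norm y / r" using r by (simp add: divide_inverse mult.commute)
   have "(\<Sum>\<alpha> | mi_order \<alpha> \<le> M. coef c \<alpha> * mi_power (y /\<^sub>R r) \<alpha>) = (\<Sum>\<alpha> | mi_order \<alpha> \<le> M. mi_power y \<alpha> *\<^sub>R z \<alpha>)"
    by (intro sum.cong refl) (simp add: mi_power_scaleR z_def power_inverse divide_inverse mult_ac)
   then have "norm (g y) \<le> norm c * norm (y /\<^sub>R r) ^ Suc M"
    using msub_taylor[of "y /\<^sub>R r" c M] True r fs[OF True] unfolding n by (simp add: g_def)
   also have "\<dots> \<le> max (norm c) B * (norm y / r) ^ Suc M" unfolding n using r by (intro mult_right_mono) auto
   finally show ?thesis by (simp add: power_divide)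
  next
   case False
   then have "1 \<le> (norm y / r) ^ Suc M" using r by (intro one_le_power) simp
   then have "B * 1 \<le> max (norm c) B * (norm y / r) ^ Suc M" using B(1) by (intro mult_mono) auto
   then show ?thesis using B(2)[OF y] by (simp add: power_divide)
  qed
  then show ?thesis unfolding g_def by blast
 qed
 then have "taylor f z" by (simp only: taylor_def) blast
 moreover have "f = (\<lambda>_. 0)" if "\<And>\<alpha>. z \<alpha> = 0"
 proof
  have "coef c \<alpha> = 0" for \<alpha> using that[of \<alpha>] r by (simp add: z_def)
  then show "f x = 0" for x by (rule analytic_unique_continuation[OF an rc])
 qed
 ultimately show thesis by (rule that)
qed

lemma norm_realc_le_sum: "norm v \<le> (\<Sum>i\<in>UNIV. \<bar>realc v $ i\<bar>)"
 using norm_le_l1_cart[of "realc v"] by simp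

lemma analytic_taylor_spinor:
 assumes an: "\<And>i x. analytic_pt (\<lambda>x. realc (f x) $ i) x"
 obtains z where "taylor f z" "(\<And>\<alpha>. z \<alpha> = 0) \<Longrightarrow> f = (\<lambda>_. 0)"
proof -
 have "\<forall>i. \<exists>z. taylor (\<lambda>y. realc (f y) $ i) z \<and> ((\<forall>\<alpha>. z \<alpha> = 0) \<longrightarrow> (\<lambda>y. realc (f y) $ i) = (\<lambda>_. 0))"
 proof
  fix i
  show "\<exists>z. taylor (\<lambda>y. realc (f y) $ i) z \<and> ((\<forall>\<alpha>. z \<alpha> = 0) \<longrightarrow> (\<lambda>y. realc (f y) $ i) = (\<lambda>_. 0))"
   by (rule analytic_taylor[OF an[of i]]) blast
 qed
 from choice[OF this] obtain z where z: "\<And>i. taylor (\<lambda>y. realc (f y) $ i) (z i)"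
  and z0: "\<And>i. \<forall>\<alpha>. z i \<alpha> = 0 \<Longrightarrow> (\<lambda>y. realc (f y) $ i) = (\<lambda>_. 0)" by blast
 define \<zeta> where "\<zeta> \<alpha> = unreal (\<chi> i. z i \<alpha>)" for \<alpha>
 note rl = linear_sum[OF bounded_linear.linear[OF realc_linear]] linear_scale[OF bounded_linear.linear[OF realc_linear]]
  linear_diff[OF bounded_linear.linear[OF realc_linear]]
 have "taylor f \<zeta>"
  unfolding taylor_def
 proof
  fix M
  let ?S = "\<lambda>i y. norm (realc (f y) $ i - (\<Sum>\<alpha> | mi_order \<alpha> \<le> M. mi_power y \<alpha> *\<^sub>R z i \<alpha>))"
  have "\<forall>i. \<exists>C. \<forall>y. norm y \<le> 1 \<longrightarrow> ?S i y \<le> C * norm y ^ Suc M" using z unfolding taylor_def by blast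
  from choice[OF this] obtain C where C: "\<And>i y. norm y \<le> 1 \<Longrightarrow> ?S i y \<le> C i * norm y ^ Suc M" by blast
  have "norm (f y - (\<Sum>\<alpha> | mi_order \<alpha> \<le> M. mi_power y \<alpha> *\<^sub>R \<zeta> \<alpha>)) \<le> (\<Sum>i\<in>UNIV. C i) * norm y ^ Suc M" if y: "norm y \<le> 1" for y
  proof -
   have "norm (f y - (\<Sum>\<alpha> | mi_order \<alpha> \<le> M. mi_power y \<alpha> *\<^sub>R \<zeta> \<alpha>)) \<le> (\<Sum>i\<in>UNIV. ?S i y)"
    by (rule order_trans[OF norm_realc_le_sum]) (simp add: rl \<zeta>_def)
   also have "\<dots> \<le> (\<Sum>i\<in>UNIV. C i * norm y ^ Suc M)" by (intro sum_mono C y)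
   finally show ?thesis by (simp only: sum_distrib_right)
  qed
  then show "\<exists>C. \<forall>y. norm y \<le> 1 \<longrightarrow> norm (f y - (\<Sum>\<alpha> | mi_order \<alpha> \<le> M. mi_power y \<alpha> *\<^sub>R \<zeta> \<alpha>)) \<le> C * norm y ^ Suc M" by blast
 qed
 moreover have "f = (\<lambda>_. 0)" if zero: "\<And>\<alpha>. \<zeta> \<alpha> = 0"
 proof
  fix y
  have "(\<chi> i. z i \<alpha>) = 0" for \<alpha>
   using arg_cong[OF zero[of \<alpha>], of realc] linear_0[OF bounded_linear.linear[OF realc_linear]] by (simp add: \<zeta>_def)
  then have "z i \<alpha> = 0" for i \<alpha> by (metis vec_lambda_beta zero_index)
  then have "realc (f y) $ i = 0" for i using fun_cong[OF z0[of i], of y] by blast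
  then have "realc (f y) = 0" unfolding vec_eq_iff zero_index by blast
  then show "f y = 0" using norm_realc[of "f y"] by simp
 qed
 ultimately show thesis by (rule that)
qed

subsection \<open>Expansions at infinity\<close>

lemma mi_power_inversion: "mi_power (inversion x) \<alpha> = mi_power x \<alpha> / norm x ^ (2 * mi_order \<alpha>)"
 unfolding inversion_def mi_power_scaleR by (simp add: power_divide power_mult)

text \<open>Applied with \<open>k = 1\<close> and the identity for \<open>u\<close>, and with
  \<open>k = 2\<close> and \<open>Uop\<close> for \<open>\<psi>\<close>. As \<open>L x\<close> is an
  isometry it preserves the remainder, and the exponent adds \<open>k\<close> from the weight to
  \<open>Suc M\<close> from the Taylor bound.\<close>

lemma taylor_at_infinity:
 fixes f w :: "real^3 \<Rightarrow> 'b::real_normed_vector" and L :: "real^3 \<Rightarrow> 'b \<Rightarrow> 'b"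
 assumes f: "taylor f z" and L: "\<And>x. linear (L x)" "\<And>x b. x \<noteq> 0 \<Longrightarrow> norm (L x b) = norm b"
  and w: "\<And>x. x \<noteq> 0 \<Longrightarrow> w x = (1 / norm x ^ k) *\<^sub>R L x (f (inversion x))"
 shows "\<exists>C. \<forall>x. norm x \<ge> 1 \<longrightarrow> norm (w x - (1 / norm x ^ k) *\<^sub>R L x (\<Sum>\<alpha> | mi_order \<alpha> \<le> M. (mi_power x \<alpha> / norm x ^ (2 * mi_order \<alpha>)) *\<^sub>R z \<alpha>))
  \<le> C * norm x powi (- int (Suc k) - int M)"
proof -
 obtain C where C: "\<And>y. norm y \<le> 1 \<Longrightarrow> norm (f y - (\<Sum>\<alpha> | mi_order \<alpha> \<le> M. mi_power y \<alpha> *\<^sub>R z \<alpha>)) \<le> C * norm y ^ Suc M"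
  using f unfolding taylor_def by blast
 have "norm (w x - (1 / norm x ^ k) *\<^sub>R L x (\<Sum>\<alpha> | mi_order \<alpha> \<le> M. (mi_power x \<alpha> / norm x ^ (2 * mi_order \<alpha>)) *\<^sub>R z \<alpha>))
  \<le> C * norm x powi (- int (Suc k) - int M)" if x: "norm x \<ge> 1" for x
 proof -
  let ?y = "inversion x"
  have x0: "x \<noteq> 0" using x by auto
  then have n: "norm ?y \<le> 1" using x by (simp add: divide_le_eq_1)
  have "norm (w x - (1 / norm x ^ k) *\<^sub>R L x (\<Sum>\<alpha> | mi_order \<alpha> \<le> M. (mi_power x \<alpha> / norm x ^ (2 * mi_order \<alpha>)) *\<^sub>R z \<alpha>))
   = norm ((1 / norm x ^ k) *\<^sub>R L x (f ?y - (\<Sum>\<alpha> | mi_order \<alpha> \<le> M. mi_power ?y \<alpha> *\<^sub>R z \<alpha>)))"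
   unfolding w[OF x0] mi_power_inversion linear_diff[OF L(1)] scaleR_diff_right ..
  also have "\<dots> = (1 / norm x ^ k) * norm (f ?y - (\<Sum>\<alpha> | mi_order \<alpha> \<le> M. mi_power ?y \<alpha> *\<^sub>R z \<alpha>))"
   unfolding norm_scaleR L(2)[OF x0] by simp
  also have "\<dots> \<le> (1 / norm x ^ k) * (C * norm ?y ^ Suc M)" by (intro mult_left_mono C n) simp
  also have "\<dots> = C * (1 / norm x ^ (Suc k + M))" by (simp add: power_divide power_add mult_ac)
  also have "1 / norm x ^ (Suc k + M) = norm x powi (- int (Suc k + M))" unfolding power_int_minus by (simp only: power_int_of_nat inverse_eq_divide)
  finally show ?thesis by (simp add: algebra_simps)
 qed
 then show ?thesis by blast
qed

context kelvin
begin

lemma isCont_inversion: "x \<noteq> 0 \<Longrightarrow> isCont inversion x"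
 using has_derivative_continuous[OF inversion_has_derivative] by simp

text \<open>Transforming twice returns the original pair, at first almost everywhere. Away from 0
  both sides are continuous, so the identity holds at every such point.\<close>

lemma kelvin_back:
 assumes "\<And>x. analytic_pt u' x" "\<And>i x. analytic_pt (\<lambda>x. realc (\<psi>' x) $ i) x" "AE x in lborel. u x = u' x" "AE x in lborel. \<psi> x = \<psi>' x"
  and "\<And>x. analytic_pt v x" "\<And>i x. analytic_pt (\<lambda>x. realc (\<xi> x) $ i) x" "AE x in lborel. ku x = v x" "AE x in lborel. kpsi x = \<xi> x"
  and x: "x \<noteq> 0"
 shows "u' x = (1 / norm x) * v (inversion x)" and "\<psi>' x = (1 / (norm x)\<^sup>2) *\<^sub>R Uop x (\<xi> (inversion x))"
proof -
 have cont: "isCont u' y" "isCont v y" for y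
  using assms(1,5) by (auto intro!: differentiable_imp_continuous_within analytic_pt_differentiable)
 have "C_k 0 \<psi>'" "C_k 0 \<xi>"
  using smooth_of_analytic_components[of \<psi>'] smooth_of_analytic_components[of \<xi>] assms(2,6) unfolding smooth_def by blast+
 then have conts: "isCont \<psi>' y" "isCont \<xi> y" for y by (auto simp: continuous_on_eq_continuous_at)
 have nz: "AE x in lborel. x \<noteq> (0::real^3)" by (rule AE_lborel_singleton)
 show "u' x = (1 / norm x) * v (inversion x)"
 proof (rule isCont_AE_eq[where F = u' and G = "\<lambda>x. (1 / norm x) * v (inversion x)"])
  show "isCont (\<lambda>x. (1 / norm x) * v (inversion x)) x"
   using x by (intro continuous_intros isCont_o2[OF isCont_inversion cont(2)]) auto
  show "AE x in lborel. dist x y < 1 \<longrightarrow> u' x = (1 / norm x) * v (inversion x)" for y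
   using inv.AE_subst[OF assms(7)] assms(3) nz
  proof eventually_elim
   case (elim x)
   have "v (inversion x) = u' x * norm x" using elim by (simp add: ku_def)
   then show ?case using elim by simp
  qed
 qed (use cont in auto)
 have bl: "bounded_linear (\<lambda>w. \<i> *s (\<beta> *v w) :: complex^4)" "bounded_linear (\<lambda>w. \<alpha> k *v w)" for k
  by (rule bounded_linear_dirac_term bounded_linear_mat_mul)+
 show "\<psi>' x = (1 / (norm x)\<^sup>2) *\<^sub>R Uop x (\<xi> (inversion x))"
 proof (rule isCont_AE_eq[where F = \<psi>' and G = "\<lambda>x. (1 / (norm x)\<^sup>2) *\<^sub>R Uop x (\<xi> (inversion x))"])
  have "isCont (\<lambda>x. \<xi> (inversion x)) x" by (rule isCont_o2[OF isCont_inversion[OF x] conts(2)])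
  then have "isCont (\<lambda>x. mul x (\<xi> (inversion x))) x"
   unfolding mul_def by (intro continuous_intros bounded_linear.isCont[OF bl(2)])
  then show "isCont (\<lambda>x. (1 / (norm x)\<^sup>2) *\<^sub>R Uop x (\<xi> (inversion x))) x"
   unfolding Uop_def using x by (intro continuous_intros bounded_linear.isCont[OF bl(1)]) auto
  show "AE x in lborel. dist x y < 1 \<longrightarrow> \<psi>' x = (1 / (norm x)\<^sup>2) *\<^sub>R Uop x (\<xi> (inversion x))" for y
   using inv.AE_subst[OF assms(8)] assms(4) nz
  proof eventually_elim
   case (elim x)
   have "\<xi> (inversion x) = (norm x)\<^sup>2 *\<^sub>R Uop x (\<psi>' x)"
    using elim by (simp add: kpsi_def Uop_inversion power_divide)
   then show ?case using elim(3) by (simp add: linear_scale[OF bounded_linear.linear[OF Uop_linear]] Uop_Uop)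
  qed
 qed (use conts in auto)
qed

theorem expansion_at_infinity:
 obtains u' \<psi>' v \<xi> z \<zeta> where "AE x in lborel. u x = u' x" "AE x in lborel. \<psi> x = \<psi>' x" "smooth u'" "smooth \<psi>'"
  "taylor v z" "taylor \<xi> \<zeta>" "\<And>x. x \<noteq> 0 \<Longrightarrow> u' x = (1 / norm x) * v (inversion x)"
  "\<And>x. x \<noteq> 0 \<Longrightarrow> \<psi>' x = (1 / (norm x)\<^sup>2) *\<^sub>R Uop x (\<xi> (inversion x))"
  "\<not> (AE x in lborel. u x = 0 \<and> \<psi> x = 0) \<Longrightarrow> (\<exists>\<alpha>. z \<alpha> \<noteq> 0) \<and> (\<exists>\<alpha>. \<zeta> \<alpha> \<noteq> 0)"
proof -
 interpret KS: integral_solution ku kpsi \<alpha> by (rule kelvin_solution)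
 obtain u' \<psi>' where u': "\<And>x. analytic_pt u' x" "\<And>i x. analytic_pt (\<lambda>x. realc (\<psi>' x) $ i) x"
  "AE x in lborel. u x = u' x" "AE x in lborel. \<psi> x = \<psi>' x" by (rule analytic_representative) blast
 obtain v \<xi> where v: "\<And>x. analytic_pt v x" "\<And>i x. analytic_pt (\<lambda>x. realc (\<xi> x) $ i) x"
  "AE x in lborel. ku x = v x" "AE x in lborel. kpsi x = \<xi> x" by (rule KS.analytic_representative) blast
 note kb = kelvin_back[OF u' v]
 obtain z where z: "taylor v z" and z0: "(\<And>\<alpha>. z \<alpha> = 0) \<Longrightarrow> v = (\<lambda>_. 0)" by (rule analytic_taylor[OF v(1)]) blast
 obtain \<zeta> where zeta: "taylor \<xi> \<zeta>" and zeta0: "(\<And>\<alpha>. \<zeta> \<alpha> = 0) \<Longrightarrow> \<xi> = (\<lambda>_. 0)" by (rule analytic_taylor_spinor[OF v(2)]) blast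
 have "(\<exists>\<alpha>. z \<alpha> \<noteq> 0) \<and> (\<exists>\<alpha>. \<zeta> \<alpha> \<noteq> 0)" if nt: "\<not> (AE x in lborel. u x = 0 \<and> \<psi> x = 0)"
 proof (intro conjI; rule ccontr)
  assume "\<not> (\<exists>\<alpha>. z \<alpha> \<noteq> 0)"
  then have "v = (\<lambda>_. 0)" using z0 by blast
  then have v0: "v y = 0" for y by simp
  have "AE x in lborel. x \<noteq> 0 \<longrightarrow> u x = 0"
   using u'(3) by eventually_elim (auto simp: kb(1) v0)
  moreover have "AE x in lborel. x \<noteq> (0::real^3)" by (rule AE_lborel_singleton)
  ultimately have "AE x in lborel. u x = 0" by eventually_elim simp
  then show False using trivial_iff nt by blast
 next
  assume "\<not> (\<exists>\<alpha>. \<zeta> \<alpha> \<noteq> 0)"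
  then have "\<xi> = (\<lambda>_. 0)" using zeta0 by blast
  then have xi0: "\<xi> y = 0" for y by simp
  have "AE x in lborel. x \<noteq> 0 \<longrightarrow> \<psi> x = 0"
   using u'(4) by eventually_elim (auto simp: kb(2) xi0 linear_0[OF bounded_linear.linear[OF Uop_linear]])
  moreover have "AE x in lborel. x \<noteq> (0::real^3)" by (rule AE_lborel_singleton)
  ultimately have "AE x in lborel. \<psi> x = 0" by eventually_elim simp
  then show False using trivial_iff nt by blast
 qed
 then show thesis
  using that[OF u'(3,4) analytic_smooth[OF u'(1)] smooth_of_analytic_components[OF u'(2)] z zeta kb] by blast
qed

end

section \<open>Distributional solutions\<close>

text \<open>The solution is given as Lebesgue measurable, whereas all integral operators above act
  on Borel functions with respect to \<open>lborel\<close>. Passing to Borel representatives changes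
  neither the integrals nor the equations.\<close>

lemma lebesgue_borel_representative:
 fixes f :: "real^3 \<Rightarrow> real"
 assumes "f \<in> borel_measurable lebesgue"
 obtains g where "g \<in> borel_fun" "AE x in lborel. f x = g x"
 using completion_ex_borel_measurable_real[OF assms] by auto

lemma lebesgue_borel_representative_spinor:
 fixes f :: "real^3 \<Rightarrow> complex^4"
 assumes f: "f \<in> borel_measurable lebesgue"
 obtains g where "g \<in> borel_fun" "AE x in lborel. f x = g x"
proof -
 have rm: "realc \<in> borel_fun" "unreal \<in> borel_fun"
  by (intro borel_measurable_continuous_onI linear_continuous_on realc_linear unreal_linear)+
 have "(\<lambda>x. realc (f x) $ i) \<in> borel_measurable lebesgue" for i
  using measurable_compose[OF f rm(1)] by (rule borel_measurable_vec_nth)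
 then have "\<forall>i. \<exists>g. g \<in> borel_fun \<and> (AE x in lborel. realc (f x) $ i = g x)"
  by (metis lebesgue_borel_representative)
 from choice[OF this] obtain g where g: "\<And>i. g i \<in> borel_fun" "\<And>i. AE x in lborel. realc (f x) $ i = g i x" by blast
 have "(\<lambda>x. \<chi> i. g i x) \<in> borel_fun" by (intro borel_measurable_vec_lambda g)
 then have "(\<lambda>x. unreal (\<chi> i. g i x)) \<in> borel_fun" by (rule measurable_compose[OF _ rm(2)])
 moreover have "AE x in lborel. \<forall>i. realc (f x) $ i = g i x" unfolding AE_all_countable using g(2) by blast
 then have "AE x in lborel. f x = unreal (\<chi> i. g i x)"
 proof eventually_elim
  case (elim x)
  then have "realc (f x) = (\<chi> i. g i x)" by (simp add: vec_eq_iff)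
  then show ?case by (metis unreal_realc)
 qed
 ultimately show thesis by (rule that)
qed

lemma integral_lebesgue_cong:
 fixes f g :: "real^3 \<Rightarrow> 'b::{banach,second_countable_topology}"
 assumes f: "f \<in> borel_measurable lebesgue" and g: "g \<in> borel_fun" and ae: "AE x in lborel. f x = g x"
 shows "(\<integral>x. f x \<partial>lebesgue) = (\<integral>x. g x \<partial>lborel)"
proof -
 have g': "g \<in> borel_measurable lborel" using g by simp
 have "(\<integral>x. f x \<partial>lebesgue) = (\<integral>x. g x \<partial>lebesgue)"
  using f measurable_completion[OF g'] ae by (intro integral_cong_AE) (auto simp: AE_completion_iff)
 then show ?thesis by (simp only: integral_completion[OF g'])
qed

lemma in_Lp_finite:
 fixes f g :: "real^3 \<Rightarrow> 'b::euclidean_space"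
 assumes f: "in_Lp p f" and g: "g \<in> borel_fun" and ae: "AE x in lborel. f x = g x"
 shows "(\<integral>\<^sup>+x. ennreal (norm (g x) ^ p) \<partial>lborel) < \<infinity>"
proof -
 have [measurable]: "g \<in> borel_fun" by (rule g)
 have gm: "(\<lambda>x. norm (g x) ^ p) \<in> borel_measurable lborel" by measurable
 have "integrable lebesgue (\<lambda>x. norm (f x) ^ p)" "(\<lambda>x. norm (f x) ^ p) \<in> borel_measurable lebesgue"
  using f by (auto simp: in_Lp_def)
 then have "integrable lebesgue (\<lambda>x. norm (g x) ^ p)"
  using measurable_completion[OF gm] ae
  by (subst integrable_cong_AE[where g = "\<lambda>x. norm (f x) ^ p"]) (auto simp: AE_completion_iff)
 then have "integrable lborel (\<lambda>x. norm (g x) ^ p)" by (simp only: integrable_completion[OF gm])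
 then show ?thesis by (simp add: integrable_iff_bounded)
qed

lemma test_function_derivs:
 assumes "test_function (\<phi> :: real^3 \<Rightarrow> real)"
 shows "\<phi> \<in> borel_fun" "partial_deriv j \<phi> \<in> borel_fun" "partial_deriv i (partial_deriv j \<phi>) \<in> borel_fun"
proof -
 have c: "C_k 0 \<phi>" "C_k (Suc 0) \<phi>" "C_k (Suc (Suc 0)) \<phi>" using assms unfolding test_function_def smooth_def by blast+
 then have "continuous_on UNIV \<phi>" "continuous_on UNIV (partial_deriv j \<phi>)" "continuous_on UNIV (partial_deriv i (partial_deriv j \<phi>))" by auto
 then show "\<phi> \<in> borel_fun" "partial_deriv j \<phi> \<in> borel_fun" "partial_deriv i (partial_deriv j \<phi>) \<in> borel_fun"
  by (auto intro: borel_measurable_continuous_onI)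
qed

lemma regular_distr_cong:
 fixes f g :: "real^3 \<Rightarrow> 'b::euclidean_space"
 assumes f: "f \<in> borel_measurable lebesgue" and g: "g \<in> borel_fun" and ae: "AE x in lborel. f x = g x"
  and h: "h \<in> borel_fun"
 shows "regular_distr f h = (\<integral>x. h x *\<^sub>R g x \<partial>lborel)"
proof -
 have "h \<in> borel_measurable lborel" using h by simp
 note [measurable] = f g h measurable_completion[OF this]
 show ?thesis
  unfolding regular_distr_def
  by (rule integral_lebesgue_cong) (use ae in \<open>auto elim: eventually_mono\<close>)
qed

lemma vector_4:
 "(vector [a, b, c, d] :: 'a::zero^4) $ 1 = a" "(vector [a, b, c, d] :: 'a^4) $ 2 = b"
 "(vector [a, b, c, d] :: 'a^4) $ 3 = c" "(vector [a, b, c, d] :: 'a^4) $ 4 = d"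
 unfolding vector_def by simp_all

lemmas off_diag_simps = off_diag_blocks_def vector_4 matrix_matrix_mult_def matrix_vector_mult_def vec_eq_iff forall_4 sum_4 mat_def

text \<open>With this \<open>\<beta>\<close>, which anticommutes with the Dirac matrices, \<open>U(x) = (\<i>/|x|) \<beta> (\<alpha> \<cdot> x)\<close>.\<close>

definition beta_matrix :: "complex^4^4"
 where "beta_matrix = vector [vector [-1, 0, 0, 0], vector [0, -1, 0, 0], vector [0, 0, 1, 0], vector [0, 0, 0, 1]]"

context
 fixes \<sigma> :: "3 \<Rightarrow> complex^2^2"
 assumes \<sigma>: "pauli_system \<sigma>"
begin

lemma clifford_dirac_alpha: "clifford (dirac_alpha \<sigma>)"
proof -
 have "(\<sigma> j ** \<sigma> k + \<sigma> k ** \<sigma> j) $ a $ b = mat (if j = k then 2 else 0) $ a $ b" for j k a b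
  using \<sigma> by (simp add: pauli_system_def)
 then have "\<sigma> j $ a $ 1 * \<sigma> k $ 1 $ b + \<sigma> j $ a $ 2 * \<sigma> k $ 2 $ b + (\<sigma> k $ a $ 1 * \<sigma> j $ 1 $ b + \<sigma> k $ a $ 2 * \<sigma> j $ 2 $ b)
   = (if a = b then if j = k then 2 else 0 else 0)" for j k a b
  by (simp add: matrix_matrix_mult_def sum_2 mat_def)
 from this[of _ 1 _ 1] this[of _ 1 _ 2] this[of _ 2 _ 1] this[of _ 2 _ 2] show ?thesis
  unfolding clifford_def dirac_alpha_def by (simp add: off_diag_simps)
qed

lemma clifford_algebra_dirac: "clifford_algebra (dirac_alpha \<sigma>) beta_matrix"
proof
 show "clifford (dirac_alpha \<sigma>)" by (rule clifford_dirac_alpha)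
 have "\<sigma> k $ a $ b = cnj (\<sigma> k $ b $ a)" for k a b
  using \<sigma> unfolding pauli_system_def hermitian_def by blast
 from this[of _ 1 1] this[of _ 1 2] this[of _ 2 1] this[of _ 2 2]
 show "hermitian (dirac_alpha \<sigma> k)" for k
  unfolding hermitian_def dirac_alpha_def by (auto simp: off_diag_simps)
 show "hermitian beta_matrix" unfolding hermitian_def beta_matrix_def by (simp add: off_diag_simps)
 show "beta_matrix ** beta_matrix = mat 1" unfolding beta_matrix_def by (simp add: off_diag_simps)
 show "beta_matrix ** dirac_alpha \<sigma> k = - (dirac_alpha \<sigma> k ** beta_matrix)" for k
  unfolding beta_matrix_def dirac_alpha_def by (simp add: off_diag_simps)
qed

text \<open>Links the explicit block matrix of the statement with the Clifford form used for the
  Kelvin transform; it is checked entry by entry.\<close>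

lemma U_matrix_Uop: "U_matrix \<sigma> x *v w = clifford_algebra.Uop (dirac_alpha \<sigma>) beta_matrix x w"
proof -
 interpret clifford_algebra "dirac_alpha \<sigma>" beta_matrix by (rule clifford_algebra_dirac)
 show ?thesis
  unfolding Uop_def mul_def unfolding U_matrix_def Let_def dot_sigma_def beta_matrix_def dirac_alpha_def
  by (simp add: off_diag_simps sum_3) (simp add: scaleR_conv_of_real algebra_simps divide_inverse)
qed

end

theorem theorem1p2:
  fixes \<sigma> :: "3 \<Rightarrow> complex^2^2"
    and u :: "real^3 \<Rightarrow> real"
    and \<psi> :: "real^3 \<Rightarrow> complex^4"
  assumes "pauli_system \<sigma>"
    and "in_Lp 6 u" and "in_Lp 3 \<psi>"
    and "distributional_solution \<sigma> u \<psi>"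
  shows "\<exists>u' \<psi>'.
    (AE x in lebesgue. u x = u' x) \<and> (AE x in lebesgue. \<psi> x = \<psi>' x) \<and>
    smooth u' \<and> smooth \<psi>' \<and>
    (\<exists>(z :: nat^3 \<Rightarrow> real) (\<zeta> :: nat^3 \<Rightarrow> complex^4).
      (\<forall>M::nat. \<exists>C::real. \<forall>x. norm x \<ge> 1 \<longrightarrow>
        \<bar>u' x - inverse (norm x) *
           (\<Sum>\<alpha> | mi_order \<alpha> \<le> M. mi_power x \<alpha> / norm x ^ (2 * mi_order \<alpha>) * z \<alpha>)\<bar>
          \<le> C * norm x powi (- 2 - int M)) \<and>
      (\<forall>M::nat. \<exists>C::real. \<forall>x. norm x \<ge> 1 \<longrightarrow>
        norm (\<psi>' x - (norm x powi (- 2)) *\<^sub>R (U_matrix \<sigma> x *v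
           (\<Sum>\<alpha> | mi_order \<alpha> \<le> M. (mi_power x \<alpha> / norm x ^ (2 * mi_order \<alpha>)) *\<^sub>R \<zeta> \<alpha>)))
          \<le> C * norm x powi (- 3 - int M)) \<and>
      (\<not> (AE x in lebesgue. u x = 0 \<and> \<psi> x = 0) \<longrightarrow>
        (\<exists>\<alpha>. z \<alpha> \<noteq> 0) \<and> (\<exists>\<alpha>. \<zeta> \<alpha> \<noteq> 0)))"
proof -
 have um [measurable]: "u \<in> borel_measurable lebesgue" and psim [measurable]: "\<psi> \<in> borel_measurable lebesgue"
  using assms(2,3) by (auto simp: in_Lp_def)
 obtain u0 where u0: "u0 \<in> borel_fun" "AE x in lborel. u x = u0 x"
  by (rule lebesgue_borel_representative[OF um])
 obtain \<psi>0 where psi0: "\<psi>0 \<in> borel_fun" "AE x in lborel. \<psi> x = \<psi>0 x"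
  by (rule lebesgue_borel_representative_spinor[OF psim])
 interpret critical_pair u0 \<psi>0
  using u0 psi0 in_Lp_finite[OF assms(2) u0] in_Lp_finite[OF assms(3) psi0] by unfold_locales simp_all
 have rhs: "(\<lambda>x. (norm (\<psi> x))\<^sup>2 * u x) \<in> borel_measurable lebesgue" "(\<lambda>x. \<bar>u x\<bar>\<^sup>2 *\<^sub>R \<psi> x) \<in> borel_measurable lebesgue"
  "AE x in lborel. (norm (\<psi> x))\<^sup>2 * u x = rhs1 x" "AE x in lborel. \<bar>u x\<bar>\<^sup>2 *\<^sub>R \<psi> x = rhs2 x"
 proof -
  show "AE x in lborel. (norm (\<psi> x))\<^sup>2 * u x = rhs1 x" "AE x in lborel. \<bar>u x\<bar>\<^sup>2 *\<^sub>R \<psi> x = rhs2 x"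
   using u0(2) psi0(2) by (eventually_elim, simp add: rhs1_def rhs2_def)+
 qed measurable
 interpret clifford_algebra "dirac_alpha \<sigma>" beta_matrix by (rule clifford_algebra_dirac[OF assms(1)])
 interpret weak_solution u0 \<psi>0 "dirac_alpha \<sigma>"
 proof
  show "clifford (dirac_alpha \<sigma>)" by (rule clifford)
  fix \<phi> :: "real^3 \<Rightarrow> real" assume \<phi>: "test_function \<phi>"
  note m = test_function_derivs[OF \<phi>]
  have sol: "- c3 * distr_laplacian (regular_distr u) \<phi> = regular_distr (\<lambda>x. (norm (\<psi> x))\<^sup>2 * u x) \<phi>"
   "distr_dirac \<sigma> (regular_distr \<psi>) \<phi> = regular_distr (\<lambda>x. \<bar>u x\<bar>\<^sup>2 *\<^sub>R \<psi> x) \<phi>"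
   using assms(4) \<phi> unfolding distributional_solution_def by blast+
  show "- 6 * (\<Sum>j\<in>UNIV. \<integral>x. partial_deriv j (partial_deriv j \<phi>) x *\<^sub>R u0 x \<partial>lborel) = (\<integral>x. \<phi> x *\<^sub>R rhs1 x \<partial>lborel)"
   using sol(1) unfolding c3_def distr_laplacian_def distr_deriv_def
    regular_distr_cong[OF um u0 m(3)] regular_distr_cong[OF rhs(1) rhs_meas(1) rhs(3) m(1)] by simp
  have neg: "A *v (- w) = - (A *v (w::complex^4))" for A :: "complex^4^4" and w
   by (simp add: matrix_vector_mult_def vec_eq_iff sum_negf)
  show "\<i> *s (\<Sum>j\<in>UNIV. dirac_alpha \<sigma> j *v (\<integral>x. partial_deriv j \<phi> x *\<^sub>R \<psi>0 x \<partial>lborel)) = (\<integral>x. \<phi> x *\<^sub>R rhs2 x \<partial>lborel)"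
   using sol(2) unfolding distr_dirac_def distr_deriv_def neg sum_negf
    regular_distr_cong[OF psim psi0 m(2)] regular_distr_cong[OF rhs(2) rhs_meas(2) rhs(4) m(1)] by (simp add: vec_eq_iff)
 qed
 interpret kelvin u0 \<psi>0 "dirac_alpha \<sigma>" beta_matrix ..
 obtain u' \<psi>' v \<xi> z \<zeta> where x: "AE x in lborel. u0 x = u' x" "AE x in lborel. \<psi>0 x = \<psi>' x" "smooth u'" "smooth \<psi>'"
  and v: "taylor v z" "\<And>x. x \<noteq> 0 \<Longrightarrow> u' x = (1 / norm x) * v (inversion x)"
  and xi: "taylor \<xi> \<zeta>" "\<And>x. x \<noteq> 0 \<Longrightarrow> \<psi>' x = (1 / (norm x)\<^sup>2) *\<^sub>R Uop x (\<xi> (inversion x))"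
  and nt: "\<not> (AE x in lborel. u0 x = 0 \<and> \<psi>0 x = 0) \<Longrightarrow> (\<exists>\<alpha>. z \<alpha> \<noteq> 0) \<and> (\<exists>\<alpha>. \<zeta> \<alpha> \<noteq> 0)"
  by (rule expansion_at_infinity) blast
 have pw: "t powi (- 2) = 1 / t\<^sup>2" for t :: real by (simp add: power_int_minus inverse_eq_divide)
 have e1: "\<exists>C. \<forall>x. norm x \<ge> 1 \<longrightarrow> \<bar>u' x - inverse (norm x) * (\<Sum>\<alpha> | mi_order \<alpha> \<le> M. mi_power x \<alpha> / norm x ^ (2 * mi_order \<alpha>) * z \<alpha>)\<bar>
   \<le> C * norm x powi (- 2 - int M)" for M
  using taylor_at_infinity[OF v(1), of "\<lambda>_ b. b" u' 1 M] v(2) by (simp add: inverse_eq_divide linear_id[unfolded id_def])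
 have e2: "\<exists>C. \<forall>x. norm x \<ge> 1 \<longrightarrow> norm (\<psi>' x - (norm x powi (- 2)) *\<^sub>R (U_matrix \<sigma> x *v
    (\<Sum>\<alpha> | mi_order \<alpha> \<le> M. (mi_power x \<alpha> / norm x ^ (2 * mi_order \<alpha>)) *\<^sub>R \<zeta> \<alpha>))) \<le> C * norm x powi (- 3 - int M)" for M
  using taylor_at_infinity[OF xi(1) bounded_linear.linear[OF Uop_linear] norm_Uop xi(2), of M] unfolding U_matrix_Uop[OF assms(1)] pw by simp
 have "AE x in lebesgue. u x = u' x" "AE x in lebesgue. \<psi> x = \<psi>' x"
  unfolding AE_completion_iff using u0(2) psi0(2) x(1,2) by (eventually_elim, simp)+
 moreover have "(\<exists>\<alpha>. z \<alpha> \<noteq> 0) \<and> (\<exists>\<alpha>. \<zeta> \<alpha> \<noteq> 0)" if "\<not> (AE x in lebesgue. u x = 0 \<and> \<psi> x = 0)"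
 proof (rule nt, rule notI)
  assume "AE x in lborel. u0 x = 0 \<and> \<psi>0 x = 0"
  then have "AE x in lborel. u x = 0 \<and> \<psi> x = 0" using u0(2) psi0(2) by eventually_elim simp
  then show False using that by (simp add: AE_completion_iff)
 qed
 ultimately show ?thesis
  using x(3,4) e1 e2
  by (intro exI[of _ u'] exI[of _ \<psi>'] conjI exI[of _ z] exI[of _ \<zeta>] allI impI) blast+
qed

end
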